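(* Let $\mathfrak{X}$ be a countable set, $\beta>0$, and let $H$ and $H_N$ ($N=1,2,\dots$) be self-adjoint operators on $\ell^2(\mathfrak{X})$ such that $\varphi_{H_N,\beta}$ is stochastically positive with respect to $\mathfrak{D}(\mathfrak{X})$ for all $N\ge1$, and $H_N\to H$ in the strong resolvent sense as $N\to\infty$. Let $(X^{(N)}_t)_{t\in[-\beta/2,\beta/2]}$ be the stochastic process on $\mathcal{C}(\mathfrak{X})$ associated with $\varphi_{H_N,\beta}$. Then $\varphi_{H,\beta}$ is stochastically positive with respect to $\mathfrak{D}(\mathfrak{X})$. Let $(X_t)_{t\in[-\beta/2,\beta/2]}$ be the associated stochastic process on $\mathcal{C}(\mathfrak{X})$. Then, for any $n\ge1$ and $t_1\le\cdots\le t_n$ in $[-\beta/2,\beta/2]$, the distribution of $(X^{(N)}_{t_1},\dots,X^{(N)}_{t_n})$ converges weakly to the distribution of $(X_{t_1},\dots,X_{t_n})$ as $N\to\infty$. Moreover, for any $n\geq 1$, $x_1,\dots,x_n\in\mathfrak{X}$ and $-\beta/2\le t_1\le\cdots\le t_n\le\beta/2$, $$\mathbb{P}[(X_{t_1})_{x_1}=1,\dots,(X_{t_n})_{x_n}=1]=\det[R_{H,\beta}(x_i,t_i;x_j,t_j)]_{i,j=1}^n,$$ where $$R_{H,\beta}(x,t;y,s)=\begin{cases}\langle e^{-(\beta-s+t)H}(1+e^{-\beta H})^{-1}\delta_x,\delta_y\rangle & t\le s,\\ -\langle e^{-(t-s)H}(1+e^{-\beta H})^{-1}\delta_x,\delta_y\rangle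 & t>s.\end{cases}$$
   Context: Strong resolvent convergence means $(\lambda-H_N)^{-1}\to(\lambda-H)^{-1}$ strongly for every $\lambda\in\mathbb{C}\setminus\mathbb{R}$. Inner products are complex linear in the left argument. $\mathfrak{X}$ is a countable discrete set and $\mathcal{C}(\mathfrak{X})=\{0,1\}^{\mathfrak{X}}$ with the product topology. $\mathfrak{A}(\mathfrak{X})$ is the CAR algebra over $\ell^2(\mathfrak{X})$: the universal unital $C^*$-algebra generated by $a(h)$, $h\in\ell^2(\mathfrak{X})$, such that $h\mapsto a^*(h):=a(h)^*$ is linear, $a(h)a(k)+a(k)a(h)=0$ and $a^*(h)a(k)+a(k)a^*(h)=\langle h,k\rangle 1$. With $(\delta_x)_{x\in\mathfrak{X}}$ the canonical basis, $a_x:=a(\delta_x)$ and $\rho_x:=a_x^*a_x$; $\mathfrak{D}(\mathfrak{X})$ is the commutative unital $C^*$-subalgebra generated by $\{\rho_x\}_{x\in\mathfrak{X}}$, identified with $C(\mathcal{C}(\mathfrak{X}))$ so that $\rho_x$ is the indicator function of $\{\omega:\omega_x=1\}$; $\mathfrak{D}(\mathfrak{X})_+$ is its set of nonnegative elements. For a bounded operator $0\le K\le 1$ on $\ell^2(\mathfrak{X})$, $\varphi_K$ is the unique state with $\varphi_K(a^*(h_n)\cdots a^*(h_1)a(k_1)\cdots a(k_m))=\delta_{n,m}\det[\langle Kh_i,k_j\rangle]_{i,j=1}^n$. For a self-adjoint operator $G$ on $\ell^2(\mathfrak{X})$ put $K_{G,\beta}:=e^{-\beta G}(1+e^{-\beta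 G})^{-1}$, $\varphi_{G,\beta}:=\varphi_{K_{G,\beta}}$, and let $\alpha^G$ be the flow $\alpha^G_t(a(h))=a(e^{\mathrm{i}tG}h)$; $\varphi_{G,\beta}$ is an $\alpha^G$-KMS state at $\beta$. $A$ is entire analytic for $\alpha^G$ if $t\mapsto\alpha^G_t(A)$ extends to an entire function $z\mapsto\alpha^G_z(A)$; such elements are norm dense. For $-\beta/2\le t_1\le\cdots\le t_n\le\beta/2$, $(A_1,\dots,A_n)\mapsto\mathcal{S}_{A_1,\dots,A_n}(t_1,\dots,t_n)$ (depending on $G$) is the unique multilinear form bounded by $\|A_1\|\cdots\|A_n\|$ with $\mathcal{S}_{A_1,\dots,A_n}(t_1,\dots,t_n)=\varphi_{G,\beta}(\alpha^G_{\mathrm{i}t_1}(A_1)\cdots\alpha^G_{\mathrm{i}t_n}(A_n))$ for entire analytic $A_i$. $\varphi_{G,\beta}$ is stochastically positive with respect to $\mathfrak{D}(\mathfrak{X})$ if $\mathcal{S}_{A_1,\dots,A_n}(t_1,\dots,t_n)\ge0$ for all $n$, all such $(t_i)$ and all $A_i\in\mathfrak{D}(\mathfrak{X})_+$; the associated stochastic process is then the $\mathcal{C}(\mathfrak{X})$-valued process (unique up to finite-dimensional distributions) with $\mathbb{E}[f_1(X_{t_1})\cdots f_n(X_{t_n})]=\mathcal{S}_{f_1,\dots,f_n}(t_1,\dots,t_n)$ for all $f_i\in C(\mathcal{C}(\mathfrak{X}))$. $(X_t)_x$ is the $x$-coordinate of $X_t$.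
   Formalization: The determinant formula is stated for pairwise distinct space-time points (x_i,t_i); with a repeated point it fails, e.g. H=0, n=2, (x_1,t_1)=(x_2,t_2): the probability is 1/2 but the matrix has two equal rows, so its determinant is 0. *)

theory Defs
  imports
    "HOL-Probability.Probability"
    "HOL-Algebra.Ring"
    "Jordan_Normal_Form.Determinant"
begin

section \<open>Complex Banach spaces and unital C*-algebras\<close>

class scaleC =
  fixes scaleC :: "complex \<Rightarrow> 'a \<Rightarrow> 'a"  (infixr \<open>*\<^sub>C\<close> 75)

class complex_banach = banach + scaleC +
  assumes scaleC_add_right: "c *\<^sub>C (x + y) = c *\<^sub>C x + c *\<^sub>C y"
    and scaleC_add_left: "(c + d) *\<^sub>C x = c *\<^sub>C x + d *\<^sub>C x"
    and scaleC_scaleC: "c *\<^sub>C d *\<^sub>C x = (c * d) *\<^sub>C x"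
    and scaleC_of_real: "complex_of_real r *\<^sub>C x = r *\<^sub>R x"
    and norm_scaleC: "norm (c *\<^sub>C x) = cmod c * norm x"

text \<open>Through \<^class>\<open>real_normed_algebra_1\<close>, algebras in this class are nonzero.\<close>

class cstar_algebra = complex_banach + real_normed_algebra_1 +
  fixes adj :: "'a \<Rightarrow> 'a"
  assumes scaleC_mult_left: "(c *\<^sub>C x) * y = c *\<^sub>C (x * y)"
    and scaleC_mult_right: "x * (c *\<^sub>C y) = c *\<^sub>C (x * y)"
    and adj_adj: "adj (adj x) = x"
    and adj_add: "adj (x + y) = adj x + adj y"
    and adj_scaleC: "adj (c *\<^sub>C x) = cnj c *\<^sub>C adj x"
    and adj_mult: "adj (x * y) = adj y * adj x"
    and cstar_identity: "norm (adj x * x) = (norm x)\<^sup>2"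

definition cstar_generated :: "'a::cstar_algebra set \<Rightarrow> 'a set" where
  "cstar_generated S = \<Inter>{B. S \<subseteq> B \<and> 1 \<in> B \<and> closed B
     \<and> (\<forall>x\<in>B. \<forall>y\<in>B. x + y \<in> B \<and> x * y \<in> B)
     \<and> (\<forall>c. \<forall>x\<in>B. c *\<^sub>C x \<in> B) \<and> (\<forall>x\<in>B. adj x \<in> B)}"

definition positive_part :: "'a::cstar_algebra set \<Rightarrow> 'a set" where
  "positive_part D = {adj B * B | B. B \<in> D}"

definition is_star_automorphism :: "('a::cstar_algebra \<Rightarrow> 'a) \<Rightarrow> bool" where
  "is_star_automorphism \<pi> \<longleftrightarrow> bij \<pi> \<and>
     (\<forall>x y. \<pi> (x + y) = \<pi> x + \<pi> y) \<and> (\<forall>c x. \<pi> (c *\<^sub>C x) = c *\<^sub>C \<pi> x) \<and>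
     (\<forall>x y. \<pi> (x * y) = \<pi> x * \<pi> y) \<and> (\<forall>x. \<pi> (adj x) = adj (\<pi> x))"

definition is_state :: "('a::cstar_algebra \<Rightarrow> complex) \<Rightarrow> bool" where
  "is_state \<phi> \<longleftrightarrow> (\<forall>x y. \<phi> (x + y) = \<phi> x + \<phi> y) \<and> (\<forall>c x. \<phi> (c *\<^sub>C x) = c * \<phi> x) \<and>
     (\<forall>x. \<phi> (adj x * x) \<in> \<real>\<^sub>\<ge>\<^sub>0) \<and> \<phi> 1 = 1"

text \<open>
  C*-algebras as records. They are needed only because a universal property quantifies over
  C*-algebras inside a formula, where a type class constraint cannot be quantified. The zero
  algebra is allowed here.
\<close>

record 'a cstar = "'a Ring.ring" +
  cs_scale :: "complex \<Rightarrow> 'a \<Rightarrow> 'a"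
  cs_star :: "'a \<Rightarrow> 'a"
  cs_norm :: "'a \<Rightarrow> real"

locale cstar_structure = Ring.ring B for B :: "'a cstar" (structure) +
  assumes cs_scale_closed: "x \<in> carrier B \<Longrightarrow> cs_scale B c x \<in> carrier B"
    and cs_scale_add: "\<lbrakk>x \<in> carrier B; y \<in> carrier B\<rbrakk>
          \<Longrightarrow> cs_scale B c (x \<oplus> y) = cs_scale B c x \<oplus> cs_scale B c y"
    and cs_add_scale: "x \<in> carrier B \<Longrightarrow> cs_scale B (c + d) x = cs_scale B c x \<oplus> cs_scale B d x"
    and cs_scale_scale: "x \<in> carrier B \<Longrightarrow> cs_scale B c (cs_scale B d x) = cs_scale B (c * d) x"
    and cs_scale_one: "x \<in> carrier B \<Longrightarrow> cs_scale B 1 x = x"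
    and cs_scale_mult: "\<lbrakk>x \<in> carrier B; y \<in> carrier B\<rbrakk>
          \<Longrightarrow> cs_scale B c x \<otimes> y = cs_scale B c (x \<otimes> y)"
    and cs_mult_scale: "\<lbrakk>x \<in> carrier B; y \<in> carrier B\<rbrakk>
          \<Longrightarrow> x \<otimes> cs_scale B c y = cs_scale B c (x \<otimes> y)"
    and cs_star_closed: "x \<in> carrier B \<Longrightarrow> cs_star B x \<in> carrier B"
    and cs_star_star: "x \<in> carrier B \<Longrightarrow> cs_star B (cs_star B x) = x"
    and cs_star_add: "\<lbrakk>x \<in> carrier B; y \<in> carrier B\<rbrakk>
          \<Longrightarrow> cs_star B (x \<oplus> y) = cs_star B x \<oplus> cs_star B y"
    and cs_star_scale: "x \<in> carrier B
          \<Longrightarrow> cs_star B (cs_scale B c x) = cs_scale B (cnj c) (cs_star B x)"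
    and cs_star_mult: "\<lbrakk>x \<in> carrier B; y \<in> carrier B\<rbrakk>
          \<Longrightarrow> cs_star B (x \<otimes> y) = cs_star B y \<otimes> cs_star B x"
    and cs_norm_eq_0: "x \<in> carrier B \<Longrightarrow> cs_norm B x = 0 \<longleftrightarrow> x = \<zero>"
    and cs_norm_add: "\<lbrakk>x \<in> carrier B; y \<in> carrier B\<rbrakk>
          \<Longrightarrow> cs_norm B (x \<oplus> y) \<le> cs_norm B x + cs_norm B y"
    and cs_norm_scale: "x \<in> carrier B \<Longrightarrow> cs_norm B (cs_scale B c x) = cmod c * cs_norm B x"
    and cs_norm_mult: "\<lbrakk>x \<in> carrier B; y \<in> carrier B\<rbrakk>
          \<Longrightarrow> cs_norm B (x \<otimes> y) \<le> cs_norm B x * cs_norm B y"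
    and cs_cstar: "x \<in> carrier B \<Longrightarrow> cs_norm B (cs_star B x \<otimes> x) = (cs_norm B x)\<^sup>2"
    and cs_complete: "\<lbrakk>range s \<subseteq> carrier B;
          \<forall>e>0. \<exists>k. \<forall>m\<ge>k. \<forall>n\<ge>k. cs_norm B (s m \<ominus> s n) < e\<rbrakk>
          \<Longrightarrow> \<exists>l\<in>carrier B. (\<lambda>n. cs_norm B (s n \<ominus> l)) \<longlonglongrightarrow> 0"


section \<open>The Hilbert space of square summable functions\<close>

definition square_summable :: "('x \<Rightarrow> complex) \<Rightarrow> bool" where
  "square_summable f \<longleftrightarrow> (\<lambda>x. (cmod (f x))\<^sup>2) summable_on UNIV"

lemma square_summable_zero: "square_summable (\<lambda>_. 0)"
  by (simp add: square_summable_def)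

lemma square_summable_scale:
  assumes "square_summable f" shows "square_summable (\<lambda>x. c * f x)"
  using summable_on_cmult_right[of "\<lambda>x. (cmod (f x))\<^sup>2" UNIV "(cmod c)\<^sup>2"] assms
  by (simp add: square_summable_def norm_mult power_mult_distrib)

lemma square_summable_add:
  assumes "square_summable f" "square_summable g"
  shows "square_summable (\<lambda>x. f x + g x)"
proof -
  have b: "(cmod (f x + g x))\<^sup>2 \<le> 2 * (cmod (f x))\<^sup>2 + 2 * (cmod (g x))\<^sup>2" for x
  proof -
    have "(cmod (f x + g x))\<^sup>2 \<le> (cmod (f x) + cmod (g x))\<^sup>2"
      by (intro power_mono norm_triangle_ineq) auto
    also have "\<dots> \<le> 2 * (cmod (f x))\<^sup>2 + 2 * (cmod (g x))\<^sup>2"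
      using sum_squares_bound[of "cmod (f x)" "cmod (g x)"] by (simp add: power2_sum)
    finally show ?thesis .
  qed
  have "(\<lambda>x. 2 * (cmod (f x))\<^sup>2 + 2 * (cmod (g x))\<^sup>2) summable_on UNIV"
    using assms by (intro summable_on_add summable_on_cmult_right) (simp_all add: square_summable_def)
  then show ?thesis
    unfolding square_summable_def by (rule summable_on_comparison_test) (use b in auto)
qed

lemma square_summable_prod:
  assumes "square_summable f" "square_summable g"
  shows "(\<lambda>x. f x * cnj (g x)) summable_on UNIV"
proof -
  have "(\<lambda>x. (cmod (f x))\<^sup>2 + (cmod (g x))\<^sup>2) summable_on UNIV"
    using assms by (intro summable_on_add) (simp_all add: square_summable_def)
  then have "(\<lambda>x. cmod (f x * cnj (g x))) summable_on UNIV"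
  proof (rule summable_on_comparison_test)
    fix x
    have "2 * (cmod (f x) * cmod (g x)) \<le> (cmod (f x))\<^sup>2 + (cmod (g x))\<^sup>2"
      using sum_squares_bound[of "cmod (f x)" "cmod (g x)"] by simp
    moreover have "0 \<le> cmod (f x) * cmod (g x)" by simp
    ultimately show "cmod (f x * cnj (g x)) \<le> (cmod (f x))\<^sup>2 + (cmod (g x))\<^sup>2"
      unfolding norm_mult complex_mod_cnj by linarith
  qed simp
  then show ?thesis by (rule abs_summable_summable)
qed

typedef 'x ell2 = "{f :: 'x \<Rightarrow> complex. square_summable f}"
  using square_summable_zero by auto

setup_lifting type_definition_ell2

lift_definition delta :: "'x \<Rightarrow> 'x ell2" is "\<lambda>x y. if y = x then 1 else 0"
proof -
  fix x :: 'x
  have "(\<lambda>y. (cmod (if y = x then 1 else 0))\<^sup>2) summable_on {x}" by simp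
  then show "square_summable (\<lambda>y. if y = x then 1 else 0 :: complex)"
    unfolding square_summable_def
    by (rule summable_on_cong_neutral[THEN iffD1, rotated -1]) auto
qed

text \<open>Linear in the left argument.\<close>

lift_definition cinner :: "'x ell2 \<Rightarrow> 'x ell2 \<Rightarrow> complex" is
  "\<lambda>f g. \<Sum>\<^sub>\<infinity>x. f x * cnj (g x)" .

instantiation ell2 :: (type) scaleC
begin
lift_definition scaleC_ell2 :: "complex \<Rightarrow> 'a ell2 \<Rightarrow> 'a ell2" is "\<lambda>c f x. c * f x"
  by (rule square_summable_scale)
instance ..
end

instantiation ell2 :: (type) real_vector
begin
lift_definition zero_ell2 :: "'a ell2" is "\<lambda>_. 0" by (rule square_summable_zero)
lift_definition plus_ell2 :: "'a ell2 \<Rightarrow> 'a ell2 \<Rightarrow> 'a ell2" is "\<lambda>f g x. f x + g x"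
  by (rule square_summable_add)
lift_definition uminus_ell2 :: "'a ell2 \<Rightarrow> 'a ell2" is "\<lambda>f x. - f x"
  by (simp add: square_summable_def)
lift_definition minus_ell2 :: "'a ell2 \<Rightarrow> 'a ell2 \<Rightarrow> 'a ell2" is "\<lambda>f g x. f x - g x"
  using square_summable_add[OF _ square_summable_scale[where c = "-1"]] by auto
lift_definition scaleR_ell2 :: "real \<Rightarrow> 'a ell2 \<Rightarrow> 'a ell2" is "\<lambda>r f x. complex_of_real r * f x"
  by (rule square_summable_scale)
instance
  by standard (transfer; auto simp: algebra_simps)+
end

lemma cinner_add_left: "cinner (u + v) w = cinner u w + cinner v w"
  by transfer (simp add: distrib_right infsum_add square_summable_prod)

lemma cinner_scaleC_left: "cinner (c *\<^sub>C u) w = c * cinner u w"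
  by transfer (simp add: mult.assoc infsum_cmult_right square_summable_prod)

lemma cinner_commute: "cinner u v = cnj (cinner v u)"
  by transfer (simp add: mult.commute flip: infsum_cnj)

lemma scaleR_scaleC_ell2: "r *\<^sub>R u = complex_of_real r *\<^sub>C (u :: 'x ell2)"
  by transfer simp

lemma cinner_self:
  "cinner u u = complex_of_real (\<Sum>\<^sub>\<infinity>x. (cmod (Rep_ell2 u x))\<^sup>2)"
proof -
  have "(\<lambda>x. (cmod (Rep_ell2 u x))\<^sup>2) summable_on UNIV"
    using Rep_ell2[of u] by (simp add: square_summable_def)
  then have "((\<lambda>x. complex_of_real ((cmod (Rep_ell2 u x))\<^sup>2)) has_sum
      complex_of_real (\<Sum>\<^sub>\<infinity>x. (cmod (Rep_ell2 u x))\<^sup>2)) UNIV"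
    by (intro has_sum_of_real has_sum_infsum)
  then show ?thesis
    unfolding cinner.rep_eq complex_norm_square[symmetric] by (rule infsumI)
qed

instantiation ell2 :: (type) real_inner
begin
definition inner_ell2 :: "'a ell2 \<Rightarrow> 'a ell2 \<Rightarrow> real" where
  "inner_ell2 u v = Re (cinner u v)"
definition norm_ell2 :: "'a ell2 \<Rightarrow> real" where
  "norm_ell2 u = sqrt (Re (cinner u u))"
definition dist_ell2 :: "'a ell2 \<Rightarrow> 'a ell2 \<Rightarrow> real" where
  "dist_ell2 u v = norm (u - v)"
definition sgn_ell2 :: "'a ell2 \<Rightarrow> 'a ell2" where
  "sgn_ell2 u = u /\<^sub>R norm u"
definition uniformity_ell2 :: "('a ell2 \<times> 'a ell2) filter" where
  "uniformity_ell2 = (INF e\<in>{0<..}. principal {(x, y). dist x y < e})"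
definition open_ell2 :: "'a ell2 set \<Rightarrow> bool" where
  "open_ell2 U \<longleftrightarrow> (\<forall>x\<in>U. \<forall>\<^sub>F (x', y) in uniformity. x' = x \<longrightarrow> y \<in> U)"
instance
proof
  fix x y z :: "'a ell2" and r :: real
  show "inner x y = inner y x"
    unfolding inner_ell2_def by (subst cinner_commute) simp
  show "inner (x + y) z = inner x z + inner y z"
    by (simp add: inner_ell2_def cinner_add_left)
  show "inner (r *\<^sub>R x) y = r * inner x y"
    by (simp add: inner_ell2_def scaleR_scaleC_ell2 cinner_scaleC_left)
  show "0 \<le> inner x x"
    by (simp add: inner_ell2_def cinner_self infsum_nonneg)
  show "inner x x = 0 \<longleftrightarrow> x = 0"
  proof
    assume "inner x x = 0"
    then have "(\<Sum>\<^sub>\<infinity>y. (cmod (Rep_ell2 x y))\<^sup>2) = 0"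
      by (simp add: inner_ell2_def cinner_self)
    moreover have "(\<lambda>y. (cmod (Rep_ell2 x y))\<^sup>2) summable_on UNIV"
      using Rep_ell2[of x] by (simp add: square_summable_def)
    ultimately have "(cmod (Rep_ell2 x y))\<^sup>2 = 0" for y
      by (intro nonneg_infsum_le_0D[where A = UNIV]) auto
    then show "x = 0"
      by (simp add: Rep_ell2_inject[symmetric] zero_ell2.rep_eq fun_eq_iff)
  next
    assume "x = 0" then show "inner x x = 0"
      by (simp add: inner_ell2_def cinner_self zero_ell2.rep_eq)
  qed
qed (simp_all add: inner_ell2_def norm_ell2_def dist_ell2_def sgn_ell2_def
       uniformity_ell2_def open_ell2_def)
end

lemma norm_ell2_square: "(norm u)\<^sup>2 = (\<Sum>\<^sub>\<infinity>x. (cmod (Rep_ell2 u x))\<^sup>2)"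
  by (simp add: norm_ell2_def cinner_self infsum_nonneg)

lemma finite_sum_le_norm_ell2:
  assumes "finite F" shows "(\<Sum>x\<in>F. (cmod (Rep_ell2 u x))\<^sup>2) \<le> (norm u)\<^sup>2"
  unfolding norm_ell2_square using Rep_ell2[of u] assms
  by (intro finite_sum_le_infsum) (auto simp: square_summable_def)

lemma norm_scaleC_ell2: "norm (c *\<^sub>C u) = cmod c * norm (u :: 'x ell2)"
proof -
  have "(norm (c *\<^sub>C u))\<^sup>2 = (\<Sum>\<^sub>\<infinity>x. (cmod c)\<^sup>2 * (cmod (Rep_ell2 u x))\<^sup>2)"
    by (simp add: norm_ell2_square scaleC_ell2.rep_eq norm_mult power_mult_distrib)
  also have "\<dots> = (cmod c)\<^sup>2 * (norm u)\<^sup>2"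
    unfolding norm_ell2_square by (rule infsum_cmult_right')
  finally show ?thesis
    by (simp flip: power_mult_distrib)
qed

lemma square_summable_bounded_sums:
  assumes "\<And>F. finite F \<Longrightarrow> (\<Sum>x\<in>F. (cmod (f x))\<^sup>2) \<le> B"
  shows "square_summable f" and "(\<Sum>\<^sub>\<infinity>x. (cmod (f x))\<^sup>2) \<le> B"
proof -
  show "square_summable f"
    unfolding square_summable_def
    by (rule nonneg_bdd_above_summable_on) (use assms in \<open>auto intro!: bdd_aboveI2\<close>)
  then show "(\<Sum>\<^sub>\<infinity>x. (cmod (f x))\<^sup>2) \<le> B"
    unfolding square_summable_def by (rule infsum_le_finite_sums) (rule assms)
qed

instantiation ell2 :: (type) complex_banach
begin
instance
proof
  fix s :: "nat \<Rightarrow> 'a ell2" assume s: "Cauchy s"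
  have coord: "cmod (Rep_ell2 u x) \<le> norm u" for u :: "'a ell2" and x
    by (rule power2_le_imp_le) (use finite_sum_le_norm_ell2[of "{x}" u] in simp_all)
  have "Cauchy (\<lambda>n. Rep_ell2 (s n) x)" for x
  proof (rule metric_CauchyI)
    fix e :: real assume "0 < e"
    then obtain k where k: "\<forall>m\<ge>k. \<forall>n\<ge>k. dist (s m) (s n) < e"
      using metric_CauchyD[OF s \<open>0 < e\<close>] by blast
    have le: "dist (Rep_ell2 (s m) x) (Rep_ell2 (s n) x) \<le> dist (s m) (s n)" for m n
      using coord[of "s m - s n" x] by (simp add: dist_norm minus_ell2.rep_eq)
    show "\<exists>k. \<forall>m\<ge>k. \<forall>n\<ge>k. dist (Rep_ell2 (s m) x) (Rep_ell2 (s n) x) < e"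
      using k by (intro exI[of _ k] allI impI le_less_trans[OF le]) simp
  qed
  then have "convergent (\<lambda>n. Rep_ell2 (s n) x)" for x
    by (rule Cauchy_convergent)
  then have "\<exists>l. (\<lambda>n. Rep_ell2 (s n) x) \<longlonglongrightarrow> l" for x
    by (simp add: convergent_def)
  then obtain g where g: "\<And>x. (\<lambda>n. Rep_ell2 (s n) x) \<longlonglongrightarrow> g x"
    by metis
  have tail: "\<exists>k. \<forall>m\<ge>k. \<forall>F. finite F \<longrightarrow> (\<Sum>x\<in>F. (cmod (Rep_ell2 (s m) x - g x))\<^sup>2) \<le> e\<^sup>2"
    if e: "0 < e" for e :: real
  proof -
    obtain k where k: "\<forall>m\<ge>k. \<forall>n\<ge>k. dist (s m) (s n) < e"
      using metric_CauchyD[OF s e] by blast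
    have "(\<Sum>x\<in>F. (cmod (Rep_ell2 (s m) x - g x))\<^sup>2) \<le> e\<^sup>2" if "m \<ge> k" "finite F" for m F
    proof (rule tendsto_upperbound)
      show "(\<lambda>n. \<Sum>x\<in>F. (cmod (Rep_ell2 (s m) x - Rep_ell2 (s n) x))\<^sup>2)
              \<longlonglongrightarrow> (\<Sum>x\<in>F. (cmod (Rep_ell2 (s m) x - g x))\<^sup>2)"
        by (intro tendsto_sum tendsto_power tendsto_norm tendsto_diff tendsto_const g)
      show "\<forall>\<^sub>F n in sequentially. (\<Sum>x\<in>F. (cmod (Rep_ell2 (s m) x - Rep_ell2 (s n) x))\<^sup>2) \<le> e\<^sup>2"
        using eventually_ge_at_top[of k]
      proof eventually_elim
        case (elim n)
        have "(\<Sum>x\<in>F. (cmod (Rep_ell2 (s m) x - Rep_ell2 (s n) x))\<^sup>2) \<le> (norm (s m - s n))\<^sup>2"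
          using finite_sum_le_norm_ell2[OF that(2), of "s m - s n"] by (simp add: minus_ell2.rep_eq)
        also have "\<dots> \<le> e\<^sup>2"
          using k[rule_format, OF that(1) elim] unfolding dist_norm by (intro power_mono) simp_all
        finally show ?case .
      qed
    qed simp
    then show ?thesis by blast
  qed
  have "0 < (1 :: real)" by simp
  from tail[OF this] obtain k
    where k: "\<forall>m\<ge>k. \<forall>F. finite F \<longrightarrow> (\<Sum>x\<in>F. (cmod (Rep_ell2 (s m) x - g x))\<^sup>2) \<le> 1\<^sup>2"
    by blast
  have "square_summable (\<lambda>x. Rep_ell2 (s k) x - g x)"
    by (rule square_summable_bounded_sums(1)[where B = "1\<^sup>2"]) (simp only: k[rule_format, OF order_refl])
  from square_summable_add[OF _ square_summable_scale[OF this, of "-1"], of "Rep_ell2 (s k)"]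
  have gs: "square_summable g"
    using Rep_ell2[of "s k"] by simp
  have "s \<longlonglongrightarrow> Abs_ell2 g"
  proof (rule metric_LIMSEQ_I)
    fix e :: real assume "0 < e"
    then obtain k where k: "\<forall>m\<ge>k. \<forall>F. finite F \<longrightarrow>
        (\<Sum>x\<in>F. (cmod (Rep_ell2 (s m) x - g x))\<^sup>2) \<le> (e / 2)\<^sup>2"
      using tail[OF half_gt_zero[OF \<open>0 < e\<close>]] by blast
    have "dist (s m) (Abs_ell2 g) < e" if "m \<ge> k" for m
    proof -
      have "(\<Sum>\<^sub>\<infinity>x. (cmod (Rep_ell2 (s m) x - g x))\<^sup>2) \<le> (e / 2)\<^sup>2"
        by (rule square_summable_bounded_sums(2)) (simp only: k[rule_format, OF that])
      then have "(norm (s m - Abs_ell2 g))\<^sup>2 \<le> (e / 2)\<^sup>2"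
        using gs by (simp only: norm_ell2_square minus_ell2.rep_eq Abs_ell2_inverse mem_Collect_eq)
      then have "norm (s m - Abs_ell2 g) \<le> e / 2"
        by (rule power2_le_imp_le) (use \<open>0 < e\<close> in simp)
      then show ?thesis using \<open>0 < e\<close> unfolding dist_norm by linarith
    qed
    then show "\<exists>k. \<forall>m\<ge>k. dist (s m) (Abs_ell2 g) < e" by blast
  qed
  then show "convergent s" by (auto simp: convergent_def)
next
  fix c d :: complex and x y :: "'a ell2" and r :: real
  show "c *\<^sub>C (x + y) = c *\<^sub>C x + c *\<^sub>C y" by transfer (simp add: distrib_left)
  show "(c + d) *\<^sub>C x = c *\<^sub>C x + d *\<^sub>C x" by transfer (simp add: distrib_right)
  show "c *\<^sub>C d *\<^sub>C x = (c * d) *\<^sub>C x" by transfer (simp add: mult.assoc)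
  show "complex_of_real r *\<^sub>C x = r *\<^sub>R x" by (simp add: scaleR_scaleC_ell2)
  show "norm (c *\<^sub>C x) = cmod c * norm x" by (rule norm_scaleC_ell2)
qed
end


section \<open>Self-adjoint operators and their functional calculus\<close>

text \<open>A (possibly unbounded) operator is given by its graph.\<close>

type_synonym 'x ell2_op = "('x ell2 \<times> 'x ell2) set"

definition linear_op :: "'x ell2_op \<Rightarrow> bool" where
  "linear_op G \<longleftrightarrow> single_valued G \<and> (0, 0) \<in> G \<and>
     (\<forall>(u, v)\<in>G. \<forall>(u', v')\<in>G. (u + u', v + v') \<in> G) \<and>
     (\<forall>c. \<forall>(u, v)\<in>G. (c *\<^sub>C u, c *\<^sub>C v) \<in> G)"

definition adjoint_op :: "'x ell2_op \<Rightarrow> 'x ell2_op" where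
  "adjoint_op G = {(v, w). \<forall>(u, Gu)\<in>G. cinner Gu v = cinner u w}"

definition self_adjoint :: "'x ell2_op \<Rightarrow> bool" where
  "self_adjoint G \<longleftrightarrow> linear_op G \<and> closure (Domain G) = UNIV \<and> adjoint_op G = G"

definition op_apply :: "'x ell2_op \<Rightarrow> 'x ell2 \<Rightarrow> 'x ell2" where
  "op_apply G u = (THE v. (u, v) \<in> G)"

definition resolvent :: "'x ell2_op \<Rightarrow> complex \<Rightarrow> 'x ell2 \<Rightarrow> 'x ell2" where
  "resolvent G l u = (THE v. (v, l *\<^sub>C v - u) \<in> G)"

definition strong_resolvent_conv :: "(nat \<Rightarrow> 'x ell2_op) \<Rightarrow> 'x ell2_op \<Rightarrow> bool" where
  "strong_resolvent_conv GN G \<longleftrightarrow>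
     (\<forall>l. Im l \<noteq> 0 \<longrightarrow> (\<forall>u. (\<lambda>N. resolvent (GN N) l u) \<longlonglongrightarrow> resolvent G l u))"

definition is_pvm :: "(real set \<Rightarrow> 'x ell2 \<Rightarrow> 'x ell2) \<Rightarrow> bool" where
  "is_pvm E \<longleftrightarrow>
     (\<forall>S\<in>sets borel.
        (\<forall>u v. E S (u + v) = E S u + E S v) \<and> (\<forall>c u. E S (c *\<^sub>C u) = c *\<^sub>C E S u) \<and>
        (\<forall>u. E S (E S u) = E S u) \<and> (\<forall>u v. cinner (E S u) v = cinner u (E S v))) \<and>
     E UNIV = id \<and>
     (\<forall>A. range A \<subseteq> sets borel \<and> disjoint_family A \<longrightarrow>
        (\<forall>u. (\<lambda>i. E (A i) u) sums E (\<Union>i::nat. A i) u))"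

definition spectral_dist :: "(real set \<Rightarrow> 'x ell2 \<Rightarrow> 'x ell2) \<Rightarrow> 'x ell2 \<Rightarrow> real measure" where
  "spectral_dist E u = measure_of UNIV (sets borel) (\<lambda>S. ennreal (Re (cinner (E S u) u)))"

text \<open>
  The normal operator \<open>\<integral> f dE\<close> with its natural domain, for Borel \<open>f\<close>. By polarization the right
  hand side below is the integral of \<open>f\<close> against the complex measure \<open>S \<mapsto> \<langle>E S u, w\<rangle>\<close>.
\<close>

definition spectral_integral ::
    "(real set \<Rightarrow> 'x ell2 \<Rightarrow> 'x ell2) \<Rightarrow> (real \<Rightarrow> complex) \<Rightarrow> 'x ell2_op" where
  "spectral_integral E f =
     (let D = {u. integrable (spectral_dist E u) (\<lambda>x. (cmod (f x))\<^sup>2)} in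
      {(u, v). u \<in> D \<and> (\<forall>w\<in>D. cinner v w =
         (\<Sum>k<4. \<i> ^ k * (LINT x|spectral_dist E (u + \<i> ^ k *\<^sub>C w). f x)) / 4)})"

text \<open>The choice is immaterial: the spectral measure is unique on Borel sets.\<close>

definition spectral_measure :: "'x ell2_op \<Rightarrow> real set \<Rightarrow> 'x ell2 \<Rightarrow> 'x ell2" where
  "spectral_measure G = (SOME E. is_pvm E \<and> spectral_integral E complex_of_real = G)"

text \<open>\<open>f(G)\<close>, used only for bounded continuous \<open>f\<close>, where it is everywhere defined.\<close>

definition fun_calc :: "'x ell2_op \<Rightarrow> (real \<Rightarrow> complex) \<Rightarrow> 'x ell2 \<Rightarrow> 'x ell2" where
  "fun_calc G f = op_apply (spectral_integral (spectral_measure G) f)"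


section \<open>The CAR algebra, quasi-free states and flows\<close>

definition car_relations :: "('x ell2 \<Rightarrow> 'a::cstar_algebra) \<Rightarrow> bool" where
  "car_relations a \<longleftrightarrow>
     (\<forall>h k. adj (a (h + k)) = adj (a h) + adj (a k)) \<and>
     (\<forall>c h. adj (a (c *\<^sub>C h)) = c *\<^sub>C adj (a h)) \<and>
     (\<forall>h k. a h * a k + a k * a h = 0) \<and>
     (\<forall>h k. adj (a h) * a k + a k * adj (a h) = cinner h k *\<^sub>C 1)"

definition car_relations_in :: "'a cstar \<Rightarrow> ('x ell2 \<Rightarrow> 'a) \<Rightarrow> bool" where
  "car_relations_in B b \<longleftrightarrow>
     (\<forall>h. b h \<in> carrier B) \<and>
     (\<forall>h k. cs_star B (b (h + k)) = cs_star B (b h) \<oplus>\<^bsub>B\<^esub> cs_star B (b k)) \<and>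
     (\<forall>c h. cs_star B (b (c *\<^sub>C h)) = cs_scale B c (cs_star B (b h))) \<and>
     (\<forall>h k. b h \<otimes>\<^bsub>B\<^esub> b k \<oplus>\<^bsub>B\<^esub> b k \<otimes>\<^bsub>B\<^esub> b h = \<zero>\<^bsub>B\<^esub>) \<and>
     (\<forall>h k. cs_star B (b h) \<otimes>\<^bsub>B\<^esub> b k \<oplus>\<^bsub>B\<^esub> b k \<otimes>\<^bsub>B\<^esub> cs_star B (b h)
        = cs_scale B (cinner h k) \<one>\<^bsub>B\<^esub>)"

definition star_hom_into :: "'b cstar \<Rightarrow> ('a::cstar_algebra \<Rightarrow> 'b) \<Rightarrow> bool" where
  "star_hom_into B \<pi> \<longleftrightarrow>
     (\<forall>x. \<pi> x \<in> carrier B) \<and> \<pi> 1 = \<one>\<^bsub>B\<^esub> \<and>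
     (\<forall>x y. \<pi> (x + y) = \<pi> x \<oplus>\<^bsub>B\<^esub> \<pi> y) \<and> (\<forall>x y. \<pi> (x * y) = \<pi> x \<otimes>\<^bsub>B\<^esub> \<pi> y) \<and>
     (\<forall>c x. \<pi> (c *\<^sub>C x) = cs_scale B c (\<pi> x)) \<and> (\<forall>x. \<pi> (adj x) = cs_star B (\<pi> x))"

text \<open>
  The type \<open>'a\<close> together with \<open>a\<close> is the universal unital C*-algebra generated by the CAR. The
  target algebras \<open>B\<close> are all C*-algebras with carrier in \<open>'a\<close>. For countable \<open>'x\<close> this
  loses nothing: it is enough to consider targets generated by the \<open>b h\<close>; these are separable,
  hence have at most continuum many elements, and \<open>'a\<close> has at least that many.
\<close>

definition is_car_algebra :: "('x ell2 \<Rightarrow> 'a::cstar_algebra) \<Rightarrow> bool" where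
  "is_car_algebra a \<longleftrightarrow> car_relations a \<and> cstar_generated (range a) = UNIV \<and>
     (\<forall>(B :: 'a cstar) b. cstar_structure B \<and> car_relations_in B b \<longrightarrow>
        (\<exists>\<pi>. star_hom_into B \<pi> \<and> (\<forall>h. \<pi> (a h) = b h)))"

definition occupation :: "('x ell2 \<Rightarrow> 'a::cstar_algebra) \<Rightarrow> 'x \<Rightarrow> 'a" where
  "occupation a x = adj (a (delta x)) * a (delta x)"

definition diag_algebra :: "('x ell2 \<Rightarrow> 'a::cstar_algebra) \<Rightarrow> 'a set" where
  "diag_algebra a = cstar_generated (range (occupation a))"

text \<open>
  The configuration space \<open>{0,1}\<^sup>X\<close> is \<^typ>\<open>'x \<Rightarrow> bool\<close> with its product topology, \<open>True\<close> standing
  for 1. The following is the identification of continuous functions on it with the diagonal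
  algebra; only its values on continuous functions matter, and these are determined.
\<close>

definition is_diag_identification ::
    "('x ell2 \<Rightarrow> 'a::cstar_algebra) \<Rightarrow> ((('x \<Rightarrow> bool) \<Rightarrow> complex) \<Rightarrow> 'a) \<Rightarrow> bool" where
  "is_diag_identification a J \<longleftrightarrow>
     (let C = {f. continuous_on UNIV f} in
      bij_betw J C (diag_algebra a) \<and> J (\<lambda>_. 1) = 1 \<and>
      (\<forall>f\<in>C. \<forall>g\<in>C. J (\<lambda>\<omega>. f \<omega> + g \<omega>) = J f + J g \<and> J (\<lambda>\<omega>. f \<omega> * g \<omega>) = J f * J g) \<and>
      (\<forall>c. \<forall>f\<in>C. J (\<lambda>\<omega>. c * f \<omega>) = c *\<^sub>C J f) \<and>
      (\<forall>f\<in>C. J (\<lambda>\<omega>. cnj (f \<omega>)) = adj (J f)) \<and>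
      (\<forall>x. J (indicator {\<omega>. \<omega> x}) = occupation a x))"

definition diag_of_fun ::
    "('x ell2 \<Rightarrow> 'a::cstar_algebra) \<Rightarrow> (('x \<Rightarrow> bool) \<Rightarrow> complex) \<Rightarrow> 'a" where
  "diag_of_fun a = (SOME J. is_diag_identification a J)"

text \<open>\<open>hs\<close> is \<open>h\<^sub>1, \<dots>, h\<^sub>n\<close> and \<open>ks\<close> is \<open>k\<^sub>1, \<dots>, k\<^sub>m\<close>; the creators appear in reverse order.\<close>

definition is_quasifree :: "('x ell2 \<Rightarrow> 'a::cstar_algebra) \<Rightarrow> ('x ell2 \<Rightarrow> 'x ell2) \<Rightarrow>
    ('a \<Rightarrow> complex) \<Rightarrow> bool" where
  "is_quasifree a K \<phi> \<longleftrightarrow> is_state \<phi> \<and>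
     (\<forall>hs ks. \<phi> (prod_list (rev (map (\<lambda>h. adj (a h)) hs)) * prod_list (map a ks)) =
        (if length hs = length ks
         then Determinant.det (Matrix.mat (length hs) (length hs)
                (\<lambda>(i, j). cinner (K (hs ! i)) (ks ! j)))
         else 0))"

definition quasifree_state ::
    "('x ell2 \<Rightarrow> 'a::cstar_algebra) \<Rightarrow> ('x ell2 \<Rightarrow> 'x ell2) \<Rightarrow> 'a \<Rightarrow> complex" where
  "quasifree_state a K = (THE \<phi>. is_quasifree a K \<phi>)"

text \<open>\<open>K\<^sub>G\<^sub>,\<^sub>\<beta> = e\<^sup>-\<^sup>\<beta>\<^sup>G (1 + e\<^sup>-\<^sup>\<beta>\<^sup>G)\<^sup>-\<^sup>1\<close>\<close>

definition fermi_op :: "'x ell2_op \<Rightarrow> real \<Rightarrow> 'x ell2 \<Rightarrow> 'x ell2" where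
  "fermi_op G \<beta> = fun_calc G (\<lambda>x. complex_of_real (exp (- \<beta> * x) * inverse (1 + exp (- \<beta> * x))))"

definition gibbs_state ::
    "('x ell2 \<Rightarrow> 'a::cstar_algebra) \<Rightarrow> 'x ell2_op \<Rightarrow> real \<Rightarrow> 'a \<Rightarrow> complex" where
  "gibbs_state a G \<beta> = quasifree_state a (fermi_op G \<beta>)"

definition quasifree_flow ::
    "('x ell2 \<Rightarrow> 'a::cstar_algebra) \<Rightarrow> 'x ell2_op \<Rightarrow> real \<Rightarrow> 'a \<Rightarrow> 'a" where
  "quasifree_flow a G t = (THE \<pi>. is_star_automorphism \<pi> \<and>
     (\<forall>h. \<pi> (a h) = a (fun_calc G (\<lambda>x. exp (\<i> * complex_of_real (t * x))) h)))"


section \<open>Time-ordered forms, stochastic positivity and the associated process\<close>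

definition entire_fun :: "(complex \<Rightarrow> 'a::complex_banach) \<Rightarrow> bool" where
  "entire_fun F \<longleftrightarrow> (\<forall>z. \<exists>D. ((\<lambda>w. inverse (w - z) *\<^sub>C (F w - F z)) \<longlongrightarrow> D) (at z))"

text \<open>\<open>A\<close> is entire analytic for \<open>\<alpha>\<close>, with \<open>F z = \<alpha>\<^sub>z(A)\<close>.\<close>

definition entire_extension ::
    "(real \<Rightarrow> 'a \<Rightarrow> 'a) \<Rightarrow> 'a::complex_banach \<Rightarrow> (complex \<Rightarrow> 'a) \<Rightarrow> bool" where
  "entire_extension \<alpha> A F \<longleftrightarrow> entire_fun F \<and> (\<forall>t. F (complex_of_real t) = \<alpha> t A)"

definition ordered_times :: "real \<Rightarrow> real list \<Rightarrow> bool" where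
  "ordered_times \<beta> ts \<longleftrightarrow> sorted ts \<and> set ts \<subseteq> {- \<beta> / 2 .. \<beta> / 2}"

text \<open>An \<open>n\<close>-linear form takes a list of \<open>n = length ts\<close> arguments.\<close>

definition is_time_ordered_form :: "('a::cstar_algebra \<Rightarrow> complex) \<Rightarrow> (real \<Rightarrow> 'a \<Rightarrow> 'a) \<Rightarrow>
    real list \<Rightarrow> ('a list \<Rightarrow> complex) \<Rightarrow> bool" where
  "is_time_ordered_form \<phi> \<alpha> ts S \<longleftrightarrow> (\<forall>As. length As = length ts \<longrightarrow>
     (\<forall>i<length ts. \<forall>B C. S (As[i := B + C]) = S (As[i := B]) + S (As[i := C])) \<and>
     (\<forall>i<length ts. \<forall>c B. S (As[i := c *\<^sub>C B]) = c * S (As[i := B])) \<and>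
     cmod (S As) \<le> prod_list (map norm As) \<and>
     (\<forall>Fs. length Fs = length ts \<and> (\<forall>i<length ts. entire_extension \<alpha> (As ! i) (Fs ! i)) \<longrightarrow>
        S As = \<phi> (prod_list (map2 (\<lambda>F t. F (\<i> * complex_of_real t)) Fs ts))))"

text \<open>The form is unique on lists of length \<open>length ts\<close>, the only ones it is applied to.\<close>

definition time_ordered_form :: "('a::cstar_algebra \<Rightarrow> complex) \<Rightarrow> (real \<Rightarrow> 'a \<Rightarrow> 'a) \<Rightarrow>
    real list \<Rightarrow> 'a list \<Rightarrow> complex" where
  "time_ordered_form \<phi> \<alpha> ts = (SOME S. is_time_ordered_form \<phi> \<alpha> ts S)"

text \<open>
  The first conjunct below says that the form is well defined. It holds for every KMS state and
  is there so that positivity cannot be a statement about an unspecified object.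
\<close>

definition stochastically_positive :: "('a::cstar_algebra \<Rightarrow> complex) \<Rightarrow> (real \<Rightarrow> 'a \<Rightarrow> 'a) \<Rightarrow>
    real \<Rightarrow> 'a set \<Rightarrow> bool" where
  "stochastically_positive \<phi> \<alpha> \<beta> D \<longleftrightarrow> (\<forall>ts. ordered_times \<beta> ts \<longrightarrow>
     is_time_ordered_form \<phi> \<alpha> ts (time_ordered_form \<phi> \<alpha> ts) \<and>
     (\<forall>As. length As = length ts \<and> set As \<subseteq> positive_part D \<longrightarrow>
        time_ordered_form \<phi> \<alpha> ts As \<in> \<real>\<^sub>\<ge>\<^sub>0))"

text \<open>Only the times in \<open>[-\<beta>/2, \<beta>/2]\<close> matter.\<close>

definition associated_process :: "('x ell2 \<Rightarrow> 'a::cstar_algebra) \<Rightarrow> 'x ell2_op \<Rightarrow> real \<Rightarrow>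
    'w measure \<Rightarrow> (real \<Rightarrow> 'w \<Rightarrow> 'x \<Rightarrow> bool) \<Rightarrow> bool" where
  "associated_process a G \<beta> M X \<longleftrightarrow> prob_space M \<and>
     (\<forall>t\<in>{- \<beta> / 2 .. \<beta> / 2}. X t \<in> borel_measurable M) \<and>
     (\<forall>ts fs. ordered_times \<beta> ts \<and> length fs = length ts \<and>
        (\<forall>f\<in>set fs. continuous_on UNIV f) \<longrightarrow>
        (LINT \<omega>|M. (\<Prod>i<length ts. (fs ! i) (X (ts ! i) \<omega>))) =
        time_ordered_form (gibbs_state a G \<beta>) (quasifree_flow a G) ts (map (diag_of_fun a) fs))"

definition joint_law ::
    "'w measure \<Rightarrow> (real \<Rightarrow> 'w \<Rightarrow> 'x \<Rightarrow> bool) \<Rightarrow> real list \<Rightarrow> (nat \<Rightarrow> 'x \<Rightarrow> bool) measure" where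
  "joint_law M X ts = distr M (Pi\<^sub>M {..<length ts} (\<lambda>_. borel)) (\<lambda>\<omega>. \<lambda>i\<in>{..<length ts}. X (ts ! i) \<omega>)"

definition weakly_converges :: "'s topology \<Rightarrow> (nat \<Rightarrow> 's measure) \<Rightarrow> 's measure \<Rightarrow> bool" where
  "weakly_converges T \<mu>N \<mu> \<longleftrightarrow>
     (\<forall>f :: 's \<Rightarrow> real. continuous_map T euclidean f \<and> bounded (f ` topspace T) \<longrightarrow>
        (\<lambda>N. LINT s|\<mu>N N. f s) \<longlonglongrightarrow> (LINT s|\<mu>. f s))"

abbreviation config_power :: "nat \<Rightarrow> (nat \<Rightarrow> 'x \<Rightarrow> bool) topology" where
  "config_power n \<equiv> product_topology (\<lambda>_. euclidean) {..<n}"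

definition R_kernel :: "'x ell2_op \<Rightarrow> real \<Rightarrow> 'x \<Rightarrow> real \<Rightarrow> 'x \<Rightarrow> real \<Rightarrow> complex" where
  "R_kernel H \<beta> x t y s =
     (if t \<le> s
      then cinner (fun_calc H (\<lambda>l. complex_of_real
             (exp (- (\<beta> - s + t) * l) * inverse (1 + exp (- \<beta> * l)))) (delta x)) (delta y)
      else - cinner (fun_calc H (\<lambda>l. complex_of_real
             (exp (- (t - s) * l) * inverse (1 + exp (- \<beta> * l)))) (delta x)) (delta y))"

end

theory Submission
  imports Defs "HOL-Complex_Analysis.Complex_Analysis" "HOL-Real_Asymp.Real_Asymp"
begin

text \<open>
  Wick's theorem gives the time-ordered form of the Gibbs state of \<open>G\<close> on words in creators and
  annihilators as a determinant whose entries are matrix elements of bounded continuous functions of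
  \<open>G\<close>, since at most the factor \<open>exp (- \<beta> G)\<close> is split between the two letters of an entry. Strong
  resolvent convergence makes these entries converge. Words span a dense subspace and the forms of
  \<open>H\<^sub>N\<close> are bounded by the product of the norms, so they converge on all of the algebra to a bounded
  multilinear form. By the three lines theorem in each time variable this limit has the prescribed
  values on entire analytic elements, so it is the form of \<open>H\<close>. Positivity passes to the limit, the
  forms evaluated at occupation numbers are the stated determinants, and Kolmogorov's extension
  theorem turns the limits of the cylinder probabilities into the process.

  The algebra and the states are only given axiomatically. The functional calculus rests on a
  spectral theorem, obtained from the Cayley transform and Herglotz' theorem; the quasi-free states
  are limits of states with finitely many eigenvalues of \<open>K\<close>.
\<close>

section \<open>Complex Banach spaces and square summable functions\<close>

text \<open>Existence of the time-ordered form of \<open>H\<close> is part of what has to be proved,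
  so it cannot serve to identify the limit: the limit functional itself must satisfy the definition
  on every tuple of entire analytic elements. This is the delicate point. Such an element is
  approximated by combinations of spectrally cut words, but only in norm, hence uniformly in real
  time, with no direct control at complex times. What rescues the argument is that the limit
  functional is bounded by the product of the norms, which supplies a second estimate on the line
  whose imaginary part is the prescribed time; the two lines together control the strip.

  The order of the times and the length \<beta> of the interval enter mainly through
  \<open>ker_bound\<close>: for ordered times every matrix element that Wick's theorem produces
  comes from a function of modulus at most 1, although the exponentials of \<open>G\<close> alone
  are unbounded.

  Norm bounds and positivity in the algebra are reduced to explicit square roots given by the
  binomial series, see \<open>commuting_squares_bound\<close>.\<close>

abbreviation (input) cor :: "real => complex" where "cor \<equiv> of_real"

lemma scaleC_one [simp]: "1 *\<^sub>C (x :: 'a::complex_banach) = x"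
 using scaleC_of_real[of 1 x] by simp

lemma bounded_bilinear_scaleC: "bounded_bilinear (scaleC :: complex => 'a::complex_banach => 'a)"
proof
 fix a b :: complex and x y :: 'a and r :: real
 show "(r *\<^sub>R a) *\<^sub>C x = r *\<^sub>R (a *\<^sub>C x)"
  by (simp add: scaleC_scaleC scaleR_conv_of_real flip: scaleC_of_real)
 show "a *\<^sub>C (r *\<^sub>R x) = r *\<^sub>R (a *\<^sub>C x)"
  by (simp add: scaleC_scaleC mult.commute flip: scaleC_of_real)
 show "\<exists>K. \<forall>a (b::'a). norm (a *\<^sub>C b) \<le> norm a * norm b * K"
  by (intro exI[of _ 1]) (simp add: norm_scaleC)
qed (simp_all add: scaleC_add_left scaleC_add_right)

interpretation scaleC: bounded_bilinear "scaleC :: complex => 'a::complex_banach => 'a"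
 by (rule bounded_bilinear_scaleC)

declare scaleC.zero_left [simp] scaleC.zero_right [simp]

lemma scaleC_minus_one: "(- 1) *\<^sub>C (x :: 'a::complex_banach) = - x"
 by (simp add: scaleC.minus_left)

lemma scaleC_eq_0 [simp]: "c *\<^sub>C (x :: 'a::complex_banach) = 0 \<longleftrightarrow> c = 0 \<or> x = 0"
 using norm_scaleC[of c x] by (metis mult_eq_0_iff norm_eq_zero)

text \<open>The usual three-term estimate. Closeness is asked only eventually, because on a fixed
  vector a spectral cutoff of the N-th operator is good only for large N.\<close>

lemma tendsto_approx:
 fixes s :: "nat => 'b::metric_space"
 assumes "!!e. e > 0 ==> \<exists>s' l'. s' \<longlonglongrightarrow> l' \<and> (\<forall>\<^sub>F n in sequentially. dist (s n) (s' n) \<le> e) \<and> dist l l' \<le> e"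
 shows "s \<longlonglongrightarrow> l"
proof (rule tendstoI)
 fix r :: real assume r: "r > 0"
 then obtain s' l' where s': "s' \<longlonglongrightarrow> l'" "\<forall>\<^sub>F n in sequentially. dist (s n) (s' n) \<le> r / 3" "dist l l' \<le> r / 3"
  using assms[of "r / 3"] by auto
 have "\<forall>\<^sub>F n in sequentially. dist (s' n) l' < r / 3" using tendstoD[OF s'(1), of "r / 3"] r by simp
 with s'(2) show "\<forall>\<^sub>F n in sequentially. dist (s n) l < r"
 proof eventually_elim
  case (elim n)
  have "dist (s n) l \<le> dist (s n) (s' n) + dist (s' n) l" by (rule dist_triangle)
  also have "dist (s' n) l \<le> dist (s' n) l' + dist l l'" by (rule dist_triangle2)
  finally show ?case using elim s'(3) by linarith
 qed
qed

section \<open>Complex subspaces and spans\<close>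

definition csubspace :: "'a::complex_banach set => bool" where
 "csubspace S \<longleftrightarrow> 0 \<in> S \<and> (\<forall>x\<in>S. \<forall>y\<in>S. x + y \<in> S) \<and> (\<forall>c. \<forall>x\<in>S. c *\<^sub>C x \<in> S)"

lemma csubspaceD:
 assumes "csubspace S"
 shows "0 \<in> S" "x \<in> S ==> y \<in> S ==> x + y \<in> S" "x \<in> S ==> c *\<^sub>C x \<in> S"
 using assms by (auto simp: csubspace_def)

lemma csubspace_diff: "csubspace S ==> x \<in> S ==> y \<in> S ==> x - y \<in> S"
 using csubspaceD(2)[of S x "(-1) *\<^sub>C y"] csubspaceD(3)[of S y "-1"] by (simp add: scaleC_minus_one)

lemma csubspace_sum: "csubspace S ==> (!!i. i \<in> I ==> f i \<in> S) ==> sum f I \<in> S"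
 by (induction I rule: infinite_finite_induct) (auto simp: csubspaceD)

lemma csubspace_closure:
 assumes "csubspace S" shows "csubspace (closure S)"
 unfolding csubspace_def
proof (intro conjI ballI allI)
 show "0 \<in> closure S" using csubspaceD(1)[OF assms] closure_subset by blast
next
 fix x y assume "x \<in> closure S" "y \<in> closure S"
 then obtain f g where "\<forall>n. f n \<in> S" "f \<longlonglongrightarrow> x" "\<forall>n. g n \<in> S" "g \<longlonglongrightarrow> y"
  unfolding closure_sequential by blast
 then show "x + y \<in> closure S"
  unfolding closure_sequential
  by (intro exI[of _ "%n. f n + g n"]) (auto intro: csubspaceD[OF assms] tendsto_add)
next
 fix c x assume "x \<in> closure S"
 then obtain f where "\<forall>n. f n \<in> S" "f \<longlonglongrightarrow> x"
  unfolding closure_sequential by blast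
 then show "c *\<^sub>C x \<in> closure S"
  unfolding closure_sequential
  by (intro exI[of _ "%n. c *\<^sub>C f n"]) (auto intro: csubspaceD[OF assms] scaleC.tendsto)
qed

text \<open>One scaled generator is added at a time, so rule induction carries over properties that
  hold eventually, or limits that exist, with no finite index sets to manage.\<close>

inductive_set cspan :: "'a::complex_banach set => 'a set" for S where
 cspan_zero: "0 \<in> cspan S"
| cspan_add_scale: "x \<in> cspan S ==> y \<in> S ==> x + c *\<^sub>C y \<in> cspan S"

lemma cspan_add: "x \<in> cspan S ==> y \<in> cspan S ==> x + y \<in> cspan S"
 by (rotate_tac, induction y rule: cspan.induct)
  (auto simp: add.assoc[symmetric] intro: cspan.intros)

lemma cspan_scale: "x \<in> cspan S ==> c *\<^sub>C x \<in> cspan S"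
 by (induction x rule: cspan.induct)
  (auto simp: scaleC_add_right scaleC_scaleC intro: cspan.intros)

lemma cspan_base: "x \<in> S ==> x \<in> cspan S"
 using cspan_add_scale[OF cspan_zero, of x S 1] by simp

lemma csubspace_cspan: "csubspace (cspan S)"
 by (simp add: csubspace_def cspan_zero cspan_add cspan_scale)

lemma cspan_minimal: "S \<subseteq> T ==> csubspace T ==> cspan S \<subseteq> T"
proof
 fix x assume "S \<subseteq> T" "csubspace T" "x \<in> cspan S"
 from this(3) show "x \<in> T"
  by induction (use \<open>S \<subseteq> T\<close> \<open>csubspace T\<close> in \<open>auto intro: csubspaceD\<close>)
qed

section \<open>The complex inner product: duality and orthogonality\<close>

lemma cinner_add_right: "cinner u (v + w) = cinner u v + cinner u w"
 by (metis cinner_add_left cinner_commute complex_cnj_add)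

lemma cinner_scaleC_right: "cinner u (c *\<^sub>C v) = cnj c * cinner u v"
 by (metis cinner_commute cinner_scaleC_left complex_cnj_mult)

lemma cinner_self_norm: "cinner u u = cor ((norm u)\<^sup>2)"
 by (simp add: cinner_self norm_ell2_square)

lemma norm_cinner_le: "cmod (cinner u v) \<le> norm u * norm v"
proof -
 \<comment> \<open>This phase makes \<open>cinner (c *\<^sub>C u) v\<close> real and nonnegative, so
   the Cauchy-Schwarz inequality of the real inner product applies.\<close>
 define c where "c = cnj (sgn (cinner u v))"
 have "cinner (c *\<^sub>C u) v = cor (cmod (cinner u v))"
 proof (cases "cinner u v = 0")
  case False
  have "cnj (cinner u v) * cinner u v = cor ((cmod (cinner u v))\<^sup>2)"
   by (simp add: complex_norm_square mult.commute del: of_real_power)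
  then show ?thesis
   using False by (simp add: cinner_scaleC_left c_def sgn_div_norm scaleR_conv_of_real power2_eq_square
     mult.assoc)
 qed (simp add: cinner_scaleC_left)
 then have "cmod (cinner u v) = inner (c *\<^sub>C u) v"
  by (simp add: inner_ell2_def)
 also have "\<dots> \<le> norm (c *\<^sub>C u) * norm v" by (rule norm_cauchy_schwarz)
 also have "\<dots> \<le> (1 * norm u) * norm v"
  unfolding norm_scaleC_ell2 by (intro mult_right_mono) (auto simp: c_def norm_sgn)
 finally show ?thesis by simp
qed

lemma bounded_bilinear_cinner: "bounded_bilinear (cinner :: 'x ell2 => 'x ell2 => complex)"
proof
 fix a b :: "'x ell2" and r :: real
 show "cinner (r *\<^sub>R a) b = r *\<^sub>R cinner a b"
  by (simp add: scaleR_scaleC_ell2 cinner_scaleC_left scaleR_conv_of_real)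
 show "cinner a (r *\<^sub>R b) = r *\<^sub>R cinner a b"
  by (simp add: scaleR_scaleC_ell2 cinner_scaleC_right scaleR_conv_of_real)
 show "\<exists>K. \<forall>a b :: 'x ell2. norm (cinner a b) \<le> norm a * norm b * K"
  by (intro exI[of _ 1]) (simp add: norm_cinner_le)
qed (simp_all add: cinner_add_left cinner_add_right)

interpretation cinner: bounded_bilinear "cinner :: 'x ell2 => 'x ell2 => complex"
 by (rule bounded_bilinear_cinner)

declare cinner.zero_left [simp] cinner.zero_right [simp]

lemma cinner_eqI: "(!!w. cinner u w = cinner v w) ==> u = v"
proof -
 assume "!!w. cinner u w = cinner v w"
 then have "cinner (u - v) (u - v) = 0" by (simp add: cinner.diff_left)
 then show "u = v" by (simp add: cinner_self_norm)
qed

lemma norm_add_square: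
 "(norm (u + v))\<^sup>2 = (norm u)\<^sup>2 + 2 * Re (cinner u v) + (norm (v :: 'x ell2))\<^sup>2"
 unfolding power2_norm_eq_inner by (simp add: inner_add_left inner_add_right inner_commute)
  (simp add: inner_ell2_def cinner_commute[of v u])

lemma cinner_delta_right: "cinner u (delta x) = Rep_ell2 u x"
proof -
 have "(\<Sum>\<^sub>\<infinity>y. Rep_ell2 u y * cnj (if y = x then 1 else 0)) = (\<Sum>\<^sub>\<infinity>y\<in>{x}. Rep_ell2 u y)"
  by (rule infsum_cong_neutral) auto
 then show ?thesis by (simp add: cinner.rep_eq delta.rep_eq)
qed

lemma cinner_delta: "cinner (delta x) (delta y) = (if x = y then 1 else 0)"
 by (auto simp: cinner_delta_right delta.rep_eq)

lemma norm_delta [simp]: "norm (delta x) = 1"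
 by (simp add: norm_ell2_def cinner_delta)

lemma Rep_ell2_sum: "Rep_ell2 (sum f F) x = (\<Sum>i\<in>F. Rep_ell2 (f i) x)"
 by (induction F rule: infinite_finite_induct) (auto simp: zero_ell2.rep_eq plus_ell2.rep_eq)

lemma ell2_finite_approx:
 assumes "e > 0"
 shows "\<exists>F. finite F \<and> norm (u - (\<Sum>x\<in>F. Rep_ell2 u x *\<^sub>C delta x)) < e"
proof -
 define g where "g = (%x. (cmod (Rep_ell2 u x))\<^sup>2)"
 have g: "g summable_on UNIV" using Rep_ell2[of u] by (simp add: square_summable_def g_def)
 have "(g has_sum infsum g UNIV) UNIV" using g by (rule has_sum_infsum)
 then obtain F where F: "finite F" "dist (sum g F) (infsum g UNIV) < e\<^sup>2"
  using \<open>e > 0\<close> unfolding has_sum_def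
  by (metis (no_types, lifting) eventually_finite_subsets_at_top order_refl tendstoD zero_less_power)
 define w where "w = u - (\<Sum>x\<in>F. Rep_ell2 u x *\<^sub>C delta x)"
 have r: "Rep_ell2 w x = (if x \<in> F then 0 else Rep_ell2 u x)" for x
  using F(1) by (simp add: w_def minus_ell2.rep_eq Rep_ell2_sum scaleC_ell2.rep_eq delta.rep_eq
    if_distrib sum.delta cong: if_cong)
 have "(norm w)\<^sup>2 = infsum (%x. if x \<in> F then 0 else g x) UNIV"
  unfolding norm_ell2_square r g_def by (rule infsum_cong) auto
 also have "\<dots> = infsum g (UNIV - F)"
  by (rule infsum_cong_neutral) auto
 also have "\<dots> = infsum g UNIV - infsum g F"
  by (rule infsum_Diff) (auto intro: g summable_on_finite F(1))
 also have "\<dots> < e\<^sup>2" using F by (simp add: dist_real_def)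
 finally have "norm w < e"
  using \<open>e > 0\<close> by (meson less_imp_le power2_less_imp_less)
 then show ?thesis using F(1) unfolding w_def by blast
qed

lemma ell2_delta_dense:
 assumes "csubspace S" "closed S" "!!x. delta x \<in> S"
 shows "(S :: 'x ell2 set) = UNIV"
proof -
 have "u \<in> closure S" for u
  unfolding closure_approachable
 proof (intro allI impI)
  fix e :: real assume "e > 0"
  from ell2_finite_approx[OF this, of u] obtain F
   where "norm (u - (\<Sum>x\<in>F. Rep_ell2 u x *\<^sub>C delta x)) < e" by blast
  moreover have "(\<Sum>x\<in>F. Rep_ell2 u x *\<^sub>C delta x) \<in> S"
   by (intro csubspace_sum csubspaceD(3) assms)
  ultimately show "\<exists>y\<in>S. dist y u < e" by (metis dist_commute dist_norm)
 qed
 then show ?thesis using assms(2) by auto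
qed

text \<open>With the basis \<open>delta\<close> at hand the representing vector can be written in
  coordinates. Testing \<open>l\<close> on its finite truncations bounds their norms by
  \<open>B\<close>, so it is square summable, and density of the basis does the rest.\<close>

lemma ell2_riesz:
 fixes l :: "'x ell2 => complex"
 assumes add: "!!u v. l (u + v) = l u + l v" and scale: "!!c u. l (c *\<^sub>C u) = c * l u"
  and bound: "!!u. cmod (l u) \<le> B * norm u"
 shows "\<exists>v. \<forall>u. l u = cinner u v"
proof -
 define f where "f = (%x. cnj (l (delta x)))"
 have l0: "l 0 = 0" using scale[of 0 0] by simp
 have lsum: "l (sum g F) = (\<Sum>i\<in>F. l (g i))" for g :: "'x => 'x ell2" and F
  by (induction F rule: infinite_finite_induct) (auto simp: l0 add)
 have B: "(\<Sum>x\<in>F. (cmod (f x))\<^sup>2) \<le> B\<^sup>2" if "finite F" for F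
 proof -
  define s where "s = (\<Sum>x\<in>F. (cmod (f x))\<^sup>2)"
  define w where "w = (\<Sum>x\<in>F. f x *\<^sub>C delta x)"
  have s0: "0 \<le> s" by (simp add: s_def sum_nonneg)
  have lw: "l w = cor s"
   unfolding w_def s_def lsum scale of_real_sum complex_norm_square
   by (rule sum.cong) (auto simp: f_def)
  have "cinner w w = cor s"
  proof -
   have "Rep_ell2 w x = (if x \<in> F then f x else 0)" for x
    using that by (simp add: w_def Rep_ell2_sum scaleC_ell2.rep_eq delta.rep_eq if_distrib sum.delta cong: if_cong)
   then have "cinner w w = (\<Sum>x\<in>F. cnj (f x) * (if x \<in> F then f x else 0))"
    by (subst (2) w_def) (simp add: cinner.sum_right cinner_scaleC_right cinner_delta_right)
   also have "\<dots> = cor s"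
    unfolding s_def of_real_sum complex_norm_square by (rule sum.cong) (auto simp: mult.commute)
   finally show ?thesis .
  qed
  then have nw: "(norm w)\<^sup>2 = s"
   by (metis cinner_self_norm of_real_eq_iff)
  then have "s \<le> B * sqrt s"
   using bound[of w] s0 unfolding lw
   by (metis abs_of_nonneg norm_ge_zero norm_of_real real_sqrt_unique)
  then have "sqrt s * sqrt s \<le> B * sqrt s" using s0 by simp
  show ?thesis
  proof (cases "s = 0")
   case False
   then have "sqrt s \<le> B" using \<open>sqrt s * sqrt s \<le> B * sqrt s\<close> s0
    by (metis less_eq_real_def mult_le_cancel_right_pos real_sqrt_gt_zero)
   then have "(sqrt s)\<^sup>2 \<le> B\<^sup>2" using s0 by (intro power_mono) auto
   then show ?thesis using s0 by (simp add: s_def)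
  qed (simp add: s_def)
 qed
 define v where "v = Abs_ell2 f"
 have fv: "Rep_ell2 v = f"
  unfolding v_def using square_summable_bounded_sums(1)[of f, OF B] by (simp add: Abs_ell2_inverse)
 have "{u. l u = cinner u v} = UNIV"
 proof (rule ell2_delta_dense)
  show "csubspace {u. l u = cinner u v}"
   by (simp add: csubspace_def l0 add scale cinner_add_left cinner_scaleC_left)
  have bl: "bounded_linear l"
   by (rule bounded_linear_intro[of _ B])
    (auto simp: add scale scaleR_scaleC_ell2 scaleR_conv_of_real bound mult.commute)
  show "closed {u. l u = cinner u v}"
   by (intro closed_Collect_eq linear_continuous_on bl cinner.bounded_linear_left)
  show "delta x \<in> {u. l u = cinner u v}" for x
   by (simp add: cinner_commute[of "delta x"] cinner_delta_right fv f_def)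
 qed
 then show ?thesis by blast
qed

text \<open>The projection theorem: a minimizing sequence for the distance to \<open>S\<close> is
  Cauchy by the parallelogram law, and the residual at its limit is orthogonal to
  \<open>S\<close>.\<close>

lemma ell2_orthogonal_complement:
 assumes S: "csubspace S" "closed S" and orth: "!!v. (!!u. u \<in> S ==> cinner u v = 0) ==> v = 0"
 shows "(S :: 'x ell2 set) = UNIV"
proof -
 have "w \<in> S" for w
 proof -
  have ne: "S \<noteq> {}" using csubspaceD(1)[OF S(1)] by blast
  define d where "d = infdist w S"
  have dle: "d \<le> norm (w - m)" if "m \<in> S" for m
   using infdist_le[OF that, of w] by (simp add: d_def dist_norm)
  have "\<exists>m\<in>S. norm (w - m) < d + 1 / Suc n" for n
  proof -
   have "\<exists>m\<in>S. dist w m < d + 1 / Suc n"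
   proof (rule ccontr)
    assume "\<not> ?thesis"
    then have "d + 1 / Suc n \<le> infdist w S"
     unfolding infdist_notempty[OF ne] by (intro cINF_greatest ne) (auto simp: not_less)
    then show False by (simp add: d_def)
   qed
   then show ?thesis by (simp add: dist_norm)
  qed
  then obtain m where m: "!!n. m n \<in> S" "!!n. norm (w - m n) < d + 1 / Suc n" by metis
  have d0: "0 \<le> d" by (simp add: d_def infdist_nonneg)
  have par: "(norm (m k - m l))\<^sup>2 \<le> 2 * (norm (w - m k))\<^sup>2 + 2 * (norm (w - m l))\<^sup>2 - 4 * d\<^sup>2" for k l
  proof -
   have mid: "(1/2) *\<^sub>C (m k + m l) \<in> S" by (intro csubspaceD[OF S(1)] m)
   have e: "(w - m k) + (w - m l) = 2 *\<^sub>R (w - (1/2) *\<^sub>C (m k + m l))"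
    using scaleC_of_real[of "1/2" "m k + m l"] by (simp add: algebra_simps scaleR_2)
   have "2 * d \<le> norm ((w - m k) + (w - m l))"
    unfolding e norm_scaleR using dle[OF mid] by simp
   then have "(2 * d)\<^sup>2 \<le> (norm ((w - m k) + (w - m l)))\<^sup>2"
    using d0 by (intro power_mono) auto
   moreover have "(norm (m k - m l))\<^sup>2 = 2 * (norm (w - m k))\<^sup>2 + 2 * (norm (w - m l))\<^sup>2
     - (norm ((w - m k) + (w - m l)))\<^sup>2"
    unfolding power2_norm_eq_inner by (simp add: inner_diff_left inner_diff_right inner_add_left inner_add_right inner_commute)
   ultimately show ?thesis by (simp add: power_mult_distrib)
  qed
  have lim: "(%n. (norm (w - m n))\<^sup>2) \<longlonglongrightarrow> d\<^sup>2"
  proof (rule tendsto_power, rule real_tendsto_sandwich[of "%_. d" _ _ "%n. d + 1 / Suc n"])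
   show "(%n. d + 1 / real (Suc n)) \<longlonglongrightarrow> d"
    using tendsto_add[OF tendsto_const LIMSEQ_inverse_real_of_nat, of d] by (simp add: inverse_eq_divide)
  qed (auto simp del: of_nat_Suc intro: always_eventually dle m less_imp_le)
  have "Cauchy m"
  proof (rule metric_CauchyI)
   fix e :: real assume e: "e > 0"
   then have "\<forall>\<^sub>F n in sequentially. dist ((norm (w - m n))\<^sup>2) (d\<^sup>2) < e\<^sup>2 / 4"
    by (intro tendstoD[OF lim]) simp
   then obtain K where K: "!!n. n \<ge> K ==> \<bar>(norm (w - m n))\<^sup>2 - d\<^sup>2\<bar> < e\<^sup>2 / 4"
    by (auto simp: eventually_sequentially dist_real_def)
   have "dist (m k) (m l) < e" if "k \<ge> K" "l \<ge> K" for k l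
   proof -
    have "(norm (m k - m l))\<^sup>2 < e\<^sup>2"
     using par[of k l] K[OF that(1)] K[OF that(2)] by linarith
    then show ?thesis using e by (simp add: dist_norm power_less_imp_less_base)
   qed
   then show "\<exists>M. \<forall>k\<ge>M. \<forall>l\<ge>M. dist (m k) (m l) < e" by blast
  qed
  then obtain p where p: "m \<longlonglongrightarrow> p" using Cauchy_convergent convergent_def by blast
  have pS: "p \<in> S" using S(2) m(1) p closed_sequentially by blast
  have "(norm (w - p))\<^sup>2 = d\<^sup>2"
   by (rule LIMSEQ_unique[OF _ lim]) (intro tendsto_intros p)
  then have nd: "norm (w - p) = d" using d0 by (simp add: power2_eq_iff_nonneg)
  define z where "z = w - p"
  have re: "inner z q = 0" if "q \<in> S" for q
  proof (cases "q = 0")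
   case False
   \<comment> \<open>The coefficient that makes \<open>p + t *\<^sub>R q\<close> closest to
     \<open>w\<close>; any gain would contradict minimality of \<open>p\<close>.\<close>
   define t where "t = inner z q / (norm q)\<^sup>2"
   have "p + of_real t *\<^sub>C q \<in> S" by (intro csubspaceD[OF S(1)] pS that)
   from dle[OF this] have "norm z \<le> norm (z - t *\<^sub>R q)"
    by (simp add: nd z_def scaleC_of_real algebra_simps)
   then have "(norm z)\<^sup>2 \<le> (norm (z - t *\<^sub>R q))\<^sup>2" by (intro power_mono) auto
   also have "\<dots> = (norm z)\<^sup>2 - 2 * t * inner z q + t\<^sup>2 * (norm q)\<^sup>2"
    unfolding power2_norm_eq_inner by (simp add: inner_diff_left inner_diff_right inner_commute algebra_simps power2_eq_square)
   also have "\<dots> = (norm z)\<^sup>2 - (inner z q)\<^sup>2 / (norm q)\<^sup>2"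
    using False by (simp add: t_def field_simps power2_eq_square)
   finally have "(inner z q)\<^sup>2 / (norm q)\<^sup>2 \<le> 0" by simp
   then show ?thesis using False by (simp add: divide_le_0_iff zero_less_power2 not_less)
  qed simp
  have "cinner q z = 0" if "q \<in> S" for q
  proof -
   have "Re (cinner q z) = 0" using re[OF that] by (simp add: inner_commute inner_ell2_def)
   \<comment> \<open>Real orthogonality to \<i> times \<open>q\<close> is what controls the
     imaginary part.\<close>
   moreover have "Re (cinner (\<i> *\<^sub>C q) z) = 0"
   proof -
    have "inner z (\<i> *\<^sub>C q) = 0" by (rule re[OF csubspaceD(3)[OF S(1) that]])
    then show ?thesis by (simp only: inner_commute[of z]) (simp only: inner_ell2_def)
   qed
   ultimately show ?thesis by (simp add: cinner_scaleC_left complex_eq_iff)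
  qed
  then have "z = 0" by (rule orth)
  then show "w \<in> S" using pS by (simp add: z_def)
 qed
 then show ?thesis by blast
qed

section \<open>Bounded Borel functions\<close>

definition bborel :: "(real => complex) => bool" where
 "bborel f \<longleftrightarrow> f \<in> borel_measurable borel \<and> (\<exists>B. \<forall>x. cmod (f x) \<le> B)"

lemma bborel_measurable [measurable_dest]: "bborel f ==> f \<in> borel_measurable borel"
 by (simp add: bborel_def)

lemma bborelI: "f \<in> borel_measurable borel ==> (!!x. cmod (f x) \<le> B) ==> bborel f"
 by (auto simp: bborel_def)

lemma bborelE:
 assumes "bborel f" obtains B where "B \<ge> 0" "!!x. cmod (f x) \<le> B"
 using assms by (metis bborel_def norm_ge_zero order_trans)

lemma bborel_indicator [simp]: "S \<in> sets borel ==> bborel (indicator S)"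
 by (rule bborelI[of _ 1]) (auto simp: indicator_def)

lemma bborel_const [simp]: "bborel (%_. c)"
 by (rule bborelI[of _ "cmod c"]) auto

lemma bborel_add [intro]:
 assumes f: "bborel f" and g: "bborel g" shows "bborel (%x. f x + g x)"
proof -
 obtain A B where "!!x. cmod (f x) \<le> A" "!!x. cmod (g x) \<le> B"
  using bborelE[OF f] bborelE[OF g] by metis
 then show ?thesis
  by (intro bborelI[of _ "A + B", OF borel_measurable_add] norm_triangle_le add_mono
    f[THEN bborel_measurable] g[THEN bborel_measurable])
qed

lemma bborel_mult [intro]:
 assumes f: "bborel f" and g: "bborel g" shows "bborel (%x. f x * g x)"
proof -
 obtain A B where "0 \<le> A" "!!x. cmod (f x) \<le> A" "!!x. cmod (g x) \<le> B"
  using bborelE[OF f] bborelE[OF g] by metis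
 then show ?thesis
  by (intro bborelI[of _ "A * B", OF borel_measurable_times]
    f[THEN bborel_measurable] g[THEN bborel_measurable])
   (auto simp: norm_mult intro: mult_mono)
qed

lemma bborel_cnj [intro]: "bborel f ==> bborel (%x. cnj (f x))"
 unfolding bborel_def
 using borel_measurable_continuous_on[OF continuous_on_cnj[OF continuous_on_id], of f borel] by simp

lemma bborel_diff [intro]: "bborel f ==> bborel g ==> bborel (%x. f x - g x)"
 using bborel_add[OF _ bborel_mult[OF bborel_const[of "-1"]], of f g] by simp

lemma bborel_power [intro]: "bborel f ==> bborel (%x. f x ^ n)"
 by (induction n) auto

lemma bborel_sum [intro]: "(!!i. i \<in> I ==> bborel (f i)) ==> bborel (%x. \<Sum>i\<in>I. f i x)"
 by (induction I rule: infinite_finite_induct) auto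

lemma bborel_continuous: "continuous_on UNIV f ==> (!!x. cmod (f x) \<le> B) ==> bborel f"
 by (intro bborelI borel_measurable_continuous_onI)

text \<open>A monotone class principle. Limits come with a common bound, so every property stable
  under dominated convergence passes from indicators to all bounded Borel functions.\<close>

lemma bborel_induct [consumes 1, case_names indicator add scale limit]:
 assumes f: "bborel f"
  and ind: "!!S. S \<in> sets borel ==> P (indicator S)"
  and add: "!!f g. bborel f ==> bborel g ==> P f ==> P g ==> P (%x. f x + g x)"
  and scale: "!!c f. bborel f ==> P f ==> P (%x. c * f x)"
  and lim: "!!s f B. (!!n. bborel (s n)) ==> (!!n. P (s n)) ==> (!!n x. cmod (s n x) \<le> B) ==>
    (!!x. (%n. s n x) \<longlonglongrightarrow> f x) ==> bborel f ==> P f"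
 shows "P f"
proof -
 obtain B where B: "!!x. cmod (f x) \<le> B" using bborelE[OF f] by blast
 obtain F where F: "!!i. simple_function borel (F i)" "!!x. (%i. F i x) \<longlonglongrightarrow> f x"
  "!!i x. cmod (F i x) \<le> 2 * cmod (f x)"
  using borel_measurable_implies_sequence_metric[OF bborel_measurable[OF f], of 0] by auto
 have simple: "bborel g \<and> P g" if g: "simple_function borel g" for g :: "real => complex"
 proof -
  have fin: "finite (range g)" using g by (simp add: simple_function_def)
  have sets: "g -` {y} \<in> sets borel" for y
   using simple_functionD(2)[OF g, of "{y}"] by simp
  have z: "P (%_. 0)" using scale[of "indicator {}" 0] ind[of "{}"] by simp
  have "bborel (%x. \<Sum>y\<in>Y. y * indicator (g -` {y}) x) \<and> P (%x. \<Sum>y\<in>Y. y * indicator (g -` {y}) x)"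
   if "finite Y" for Y
   using that
  proof (induction Y)
   case empty then show ?case using z by simp
  next
   case (insert y Y)
   have b: "bborel (%x. y * indicator (g -` {y}) x)" using sets by auto
   then have "P (%x. y * indicator (g -` {y}) x)" by (intro scale ind bborel_indicator sets)
   then show ?case
    using bborel_add[OF b] add[OF b] insert.IH insert.hyps by (simp only: sum.insert simp_thms)
  qed
  from this[OF fin] show ?thesis
   by (simp add: indicator_def if_distrib sum.delta fin cong: if_cong)
 qed
 show ?thesis
 \<comment> \<open>The simple functions approximating \<open>f\<close> are bounded by twice its
   modulus.\<close>
 proof (rule lim[of F "2 * B"])
  show "cmod (F n x) \<le> 2 * B" for n x using F(3)[of n x] B[of x] by linarith
 qed (use simple F f in auto)
qed

section \<open>Calculus of projection-valued measures\<close>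

lemma cinner_polarization:
 assumes "!!u v. p (u + v) = p u + p v" "!!c u. p (c *\<^sub>C u) = c *\<^sub>C p u"
  "!!u v. q (u + v) = q u + q v" "!!c u. q (c *\<^sub>C u) = c *\<^sub>C q u"
 shows "cinner (p u) (q v) = (\<Sum>k<4. \<i> ^ k * cinner (p (u + \<i> ^ k *\<^sub>C v)) (q (u + \<i> ^ k *\<^sub>C v))) / 4"
 by (simp add: eval_nat_numeral assms cinner_add_left cinner_add_right cinner_scaleC_left
   cinner_scaleC_right algebra_simps)

text \<open>Polarization bounds \<open>F v\<close> only by squared norms of the vectors
  \<open>u + \<i> ^ k *\<^sub>C v\<close>, which is not linear in \<open>v\<close>. Normalizing
  \<open>v\<close> first and using homogeneity gives a linear bound, to which the Riesz lemma
  applies.\<close>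

lemma polar_form_represented:
 assumes J: "!!w. cmod (J w) \<le> C * (norm w)\<^sup>2"
  and F: "!!v. F v = (\<Sum>k<4. \<i> ^ k * J (u + \<i> ^ k *\<^sub>C v)) / 4"
  and add: "!!v v'. F (v + v') = F v + F v'" and scale: "!!c v. F (c *\<^sub>C v) = cnj c * F v"
 shows "\<exists>t :: 'x ell2. \<forall>v. cinner t v = F v"
proof -
 have C0: "C \<ge> 0"
  using order_trans[OF norm_ge_zero J[of "delta undefined"]] by simp
 have bound: "cmod (F v) \<le> C * (norm u + 1)\<^sup>2 * norm v" for v
 proof (cases "v = 0")
  case True
  then show ?thesis using scale[of 0 0] by simp
 next
  case False
  define w where "w = cor (inverse (norm v)) *\<^sub>C v"
  have v: "v = cor (norm v) *\<^sub>C w" using False by (simp add: w_def scaleC_scaleC)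
  have nw: "norm w = 1" using False by (simp add: w_def norm_scaleC norm_inverse)
  have 1: "cmod (\<i> ^ k * J (u + \<i> ^ k *\<^sub>C w)) \<le> C * (norm u + 1)\<^sup>2" for k
  proof -
   have "norm (u + \<i> ^ k *\<^sub>C w) \<le> norm u + 1"
    using norm_triangle_ineq[of u "\<i> ^ k *\<^sub>C w"] by (simp add: norm_scaleC norm_power nw)
   then have "C * (norm (u + \<i> ^ k *\<^sub>C w))\<^sup>2 \<le> C * (norm u + 1)\<^sup>2"
    by (intro mult_left_mono power_mono C0) auto
   then show ?thesis
    using J[of "u + \<i> ^ k *\<^sub>C w"] by (simp add: norm_mult norm_power)
  qed
  have "cmod (\<Sum>k<4. \<i> ^ k * J (u + \<i> ^ k *\<^sub>C w)) \<le> (\<Sum>k<(4::nat). C * (norm u + 1)\<^sup>2)"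
   by (intro sum_norm_le 1)
  then have "cmod (F w) \<le> C * (norm u + 1)\<^sup>2"
   by (simp add: F norm_divide)
  then have "norm v * cmod (F w) \<le> norm v * (C * (norm u + 1)\<^sup>2)"
   by (intro mult_left_mono) auto
  then show ?thesis
   by (subst v) (simp add: scale norm_mult mult_ac)
 qed
 have "\<exists>t. \<forall>v. cnj (F v) = cinner v t"
  by (rule ell2_riesz[where B = "C * (norm u + 1)\<^sup>2"]) (simp_all add: add scale bound)
 then show ?thesis by (metis cinner_commute complex_cnj_cnj)
qed

text \<open>The integral of \<open>f\<close> against the complex measure sending \<open>S\<close> to
  \<open>cinner (E S u) v\<close>, in the polarized form in which \<open>spectral_integral\<close>
  is stated.\<close>

definition sform :: "(real set => 'x ell2 => 'x ell2) => (real => complex) => 'x ell2 => 'x ell2 => complex" where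
 "sform E f u v = (\<Sum>k<4. \<i> ^ k * (LINT x|spectral_dist E (u + \<i> ^ k *\<^sub>C v). f x)) / 4"

definition scalc :: "(real set => 'x ell2 => 'x ell2) => (real => complex) => 'x ell2 => 'x ell2" where
 "scalc E f = op_apply (spectral_integral E f)"

locale pvm =
 fixes E :: "real set => 'x ell2 => 'x ell2"
 assumes pvm: "is_pvm E"
begin

abbreviation "mu \<equiv> spectral_dist E"
abbreviation "T \<equiv> scalc E"

lemma E_add: "S \<in> sets borel ==> E S (u + v) = E S u + E S v"
 and E_scale: "S \<in> sets borel ==> E S (c *\<^sub>C u) = c *\<^sub>C E S u"
 and E_idem: "S \<in> sets borel ==> E S (E S u) = E S u"
 and E_sym: "S \<in> sets borel ==> cinner (E S u) v = cinner u (E S v)"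
 and E_UNIV: "E UNIV u = u"
 and E_sums: "range A \<subseteq> sets borel ==> disjoint_family A ==> (%i. E (A i) u) sums E (\<Union>i::nat. A i) u"
 using pvm unfolding is_pvm_def by (simp_all add: id_def)

lemma E_zero: "S \<in> sets borel ==> E S 0 = 0"
 using E_scale[of S 0 0] by simp

lemma E_empty: "E {} u = 0"
proof -
 have "(%i::nat. E {} u) sums E {} u"
  using E_sums[of "%_. {}" u] by (simp add: disjoint_family_on_def)
 then show ?thesis
  using sums_summable summable_LIMSEQ_zero LIMSEQ_const_iff by metis
qed

lemma E_Un:
 assumes "S \<in> sets borel" "R \<in> sets borel" "S \<inter> R = {}"
 shows "E (S \<union> R) u = E S u + E R u"
proof -
 have "(%i. E (binaryset S R i) u) sums E (\<Union>i. binaryset S R i) u"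
  using assms by (intro E_sums) (auto simp: disjoint_family_on_def binaryset_def)
 moreover have "(%i. E (binaryset S R i) u) sums (\<Sum>i<2. E (binaryset S R i) u)"
  by (rule sums_finite) (auto simp: binaryset_def E_empty)
 ultimately show ?thesis
  by (simp add: UN_binaryset_eq sums_iff eval_nat_numeral binaryset_def)
qed

lemma E_norm: "S \<in> sets borel ==> cinner (E S u) u = cor ((norm (E S u))\<^sup>2)"
 by (metis E_idem E_sym cinner_self_norm)

lemma sets_mu [simp, measurable_cong]: "sets (mu u) = sets borel"
 and space_mu [simp]: "space (mu u) = UNIV"
 by (simp_all add: spectral_dist_def sets.sigma_sets_eq[of borel, simplified])

lemma emeasure_mu:
 assumes "S \<in> sets borel"
 shows "emeasure (mu u) S = ennreal ((norm (E S u))\<^sup>2)"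
proof -
 have "emeasure (mu u) S = ennreal (Re (cinner (E S u) u))"
 proof (rule emeasure_measure_of[OF spectral_dist_def])
  show "sets borel \<subseteq> Pow (UNIV :: real set)" by simp
  show "S \<in> sets (mu u)" using assms by simp
  show "positive (sets (mu u)) (%S. ennreal (Re (cinner (E S u) u)))"
   by (simp add: positive_def E_empty)
  show "countably_additive (sets (mu u)) (%S. ennreal (Re (cinner (E S u) u)))"
  proof (rule countably_additiveI)
   fix A :: "nat => real set"
   assume A: "range A \<subseteq> sets (mu u)" "disjoint_family A" "\<Union> (range A) \<in> sets (mu u)"
   have "(%i. Re (cinner (E (A i) u) u)) sums Re (cinner (E (\<Union> (range A)) u) u)"
    by (intro bounded_linear.sums[OF bounded_linear_Re]
      bounded_linear.sums[OF cinner.bounded_linear_left] E_sums) (use A in auto)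
   then show "(\<Sum>i. ennreal (Re (cinner (E (A i) u) u))) = ennreal (Re (cinner (E (\<Union> (range A)) u) u))"
    by (intro suminf_ennreal_eq) (use A in \<open>auto simp: E_norm range_subsetD\<close>)
  qed
 qed
 then show ?thesis using assms by (simp add: E_norm)
qed

lemma finite_measure_mu: "finite_measure (mu u)"
 by (rule finite_measureI) (simp add: emeasure_mu)

lemma measure_mu: "S \<in> sets borel ==> measure (mu u) S = (norm (E S u))\<^sup>2"
 by (simp add: measure_def emeasure_mu)

lemma integrable_mu:
 assumes f: "bborel f" shows "integrable (mu u) f"
proof -
 interpret finite_measure "mu u" by (rule finite_measure_mu)
 obtain B where "!!x. cmod (f x) \<le> B" using bborelE[OF f] by blast
 then show ?thesis
  by (intro integrable_const_bound[of _ B]) (use f in \<open>auto dest: bborel_measurable\<close>)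
qed

lemma integral_mu_indicator:
 assumes "S \<in> sets borel"
 shows "(LINT x|mu u. indicator S x) = cor ((norm (E S u))\<^sup>2)"
proof -
 have "(LINT x|mu u. indicator S x :: complex) = (LINT x|mu u. cor (indicator S x))"
  by (intro Bochner_Integration.integral_cong refl) (simp add: indicator_def)
 also have "\<dots> = cor (measure (mu u) S)"
  using assms by (simp only: integral_complex_of_real) simp
 finally show ?thesis using assms by (simp add: measure_mu)
qed

lemma tendsto_mu:
 assumes "!!n. bborel (s n)" "!!n x. cmod (s n x) \<le> B" "!!x. (%n. s n x) \<longlonglongrightarrow> f x" "bborel f"
 shows "(%n. LINT x|mu u. s n x) \<longlonglongrightarrow> (LINT x|mu u. f x)"
proof (rule integral_dominated_convergence)
 interpret finite_measure "mu u" by (rule finite_measure_mu)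
 show "integrable (mu u) (%_. B)" by simp
qed (use assms in \<open>auto dest: bborel_measurable\<close>)

lemma sform_add: "bborel f ==> bborel g ==> sform E (%x. f x + g x) u v = sform E f u v + sform E g u v"
 by (simp add: sform_def integrable_mu distrib_left sum.distrib add_divide_distrib del: sum.lessThan_Suc)

lemma sform_scale: "bborel f ==> sform E (%x. c * f x) u v = c * sform E f u v"
 by (simp add: sform_def integrable_mu sum_distrib_left mult.left_commute)

lemma sform_limit:
 assumes "!!n. bborel (s n)" "!!n x. cmod (s n x) \<le> B" "!!x. (%n. s n x) \<longlonglongrightarrow> f x" "bborel f"
 shows "(%n. sform E (s n) u v) \<longlonglongrightarrow> sform E f u v"
 unfolding sform_def by (intro tendsto_intros tendsto_mu[OF assms]) simp

lemma sform_indicator: "S \<in> sets borel ==> sform E (indicator S) u v = cinner (E S u) v"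
 by (simp only: sform_def integral_mu_indicator E_norm[symmetric])
  (rule cinner_polarization[of "E S" "%v. v", symmetric], simp_all only: E_add E_scale)

text \<open>The polarized expression hides sesquilinearity. On an indicator it is
  \<open>cinner (E S u) v\<close>, where linearity is clear, and \<open>bborel_induct\<close> does
  the rest; the next lemmas follow the same pattern.\<close>

lemma sform_add_left: "bborel f ==> sform E f (u + u') v = sform E f u v + sform E f u' v"
proof (induction rule: bborel_induct)
 case (limit s f B)
 show ?case
  by (rule LIMSEQ_unique[OF sform_limit[OF limit(1-4)]])
   (simp only: limit(5), intro tendsto_intros sform_limit[OF limit(1-4)])
qed (simp_all add: sform_indicator sform_add sform_scale E_add cinner_add_left algebra_simps)

lemma sform_scale_left: "bborel f ==> sform E f (c *\<^sub>C u) v = c * sform E f u v"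
proof (induction rule: bborel_induct)
 case (limit s f B)
 show ?case
  by (rule LIMSEQ_unique[OF sform_limit[OF limit(1-4)]])
   (simp only: limit(5), intro tendsto_intros sform_limit[OF limit(1-4)])
qed (simp_all add: sform_indicator sform_add sform_scale E_scale cinner_scaleC_left algebra_simps)

lemma sform_add_right: "bborel f ==> sform E f u (v + v') = sform E f u v + sform E f u v'"
proof (induction rule: bborel_induct)
 case (limit s f B)
 show ?case
  by (rule LIMSEQ_unique[OF sform_limit[OF limit(1-4)]])
   (simp only: limit(5), intro tendsto_intros sform_limit[OF limit(1-4)])
qed (simp_all add: sform_indicator sform_add sform_scale cinner_add_right algebra_simps)

lemma sform_scale_right: "bborel f ==> sform E f u (c *\<^sub>C v) = cnj c * sform E f u v"
proof (induction rule: bborel_induct)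
 case (limit s f B)
 show ?case
  by (rule LIMSEQ_unique[OF sform_limit[OF limit(1-4)]])
   (simp only: limit(5), intro tendsto_intros sform_limit[OF limit(1-4)])
qed (simp_all add: sform_indicator sform_add sform_scale cinner_scaleC_right algebra_simps)

lemma integral_mu_bound:
 assumes "bborel f" "!!x. cmod (f x) \<le> B"
 shows "cmod (LINT x|mu u. f x) \<le> B * (norm u)\<^sup>2"
proof -
 interpret finite_measure "mu u" by (rule finite_measure_mu)
 have "cmod (LINT x|mu u. f x) \<le> (LINT x|mu u. cmod (f x))" by (rule integral_norm_bound)
 also have "\<dots> \<le> (LINT x|mu u. B)"
  by (intro integral_mono integrable_norm integrable_mu) (use assms in auto)
 also have "\<dots> = B * (norm u)\<^sup>2"
  using measure_mu[of UNIV u] by (simp add: E_UNIV)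
 finally show ?thesis .
qed

lemma domain_bborel:
 assumes f: "bborel f" shows "integrable (mu u) (%x. (cmod (f x))\<^sup>2)"
proof -
 have "bborel (%x. f x * cnj (f x))" by (intro bborel_mult bborel_cnj f)
 from integrable_Re[OF integrable_mu[OF this], of u] show ?thesis
  by (simp add: complex_norm_square[symmetric] flip: of_real_power)
qed

text \<open>For bounded \<open>f\<close> the domain in \<open>spectral_integral\<close> is the whole
  space, so the vector representing the form is the only candidate for the value, and the
  description in \<open>op_apply\<close> finds it.\<close>

lemma cinner_T:
 assumes f: "bborel f" shows "cinner (T f u) v = sform E f u v"
proof -
 obtain B where B: "!!x. cmod (f x) \<le> B" using bborelE[OF f] by blast
 obtain t where t: "!!v. cinner t v = sform E f u v"
  using polar_form_represented[where F = "sform E f u", OF integral_mu_bound[OF f B] sform_def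
    sform_add_right[OF f] sform_scale_right[OF f]] by blast
 have mem: "(u, y) \<in> spectral_integral E f \<longleftrightarrow> (\<forall>w. cinner y w = sform E f u w)" for y
  by (simp add: spectral_integral_def sform_def domain_bborel[OF f])
 have "T f u = t"
  unfolding scalc_def op_apply_def
  by (rule the_equality) (auto simp: mem t intro: cinner_eqI)
 then show ?thesis by (simp add: t)
qed

lemma T_eqI: "bborel f ==> (!!w. sform E f u w = cinner v w) ==> T f u = v"
 by (rule cinner_eqI) (simp add: cinner_T)

lemma T_indicator: "S \<in> sets borel ==> T (indicator S) = E S"
 by (intro ext T_eqI) (simp_all add: sform_indicator)

lemma T_one: "T (%_. 1) u = u"
 using T_indicator[of UNIV] by (simp add: E_UNIV indicator_def[abs_def])

lemma T_add: "bborel f ==> T f (u + v) = T f u + T f v"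
 by (intro T_eqI) (simp_all add: sform_add_left cinner_T cinner_add_left)

lemma T_scale: "bborel f ==> T f (c *\<^sub>C u) = c *\<^sub>C T f u"
 by (intro T_eqI) (simp_all add: sform_scale_left cinner_T cinner_scaleC_left)

lemma T_add_fun: "bborel f ==> bborel g ==> T (%x. f x + g x) u = T f u + T g u"
 by (intro T_eqI) (auto simp: sform_add cinner_T cinner_add_left)

lemma T_scale_fun: "bborel f ==> T (%x. c * f x) u = c *\<^sub>C T f u"
 by (intro T_eqI) (auto simp: sform_scale cinner_T cinner_scaleC_left)

lemma T_diff_fun: "bborel f ==> bborel g ==> T (%x. f x - g x) u = T f u - T g u"
 using T_add_fun[of f "%x. -1 * g x" u] T_scale_fun[of g "-1" u] bborel_mult[of "%_. -1" g]
 by (simp add: scaleC_minus_one)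

lemma T_weak_limit:
 assumes "!!n. bborel (s n)" "!!n x. cmod (s n x) \<le> B" "!!x. (%n. s n x) \<longlonglongrightarrow> f x" "bborel f"
 shows "(%n. cinner (T (s n) u) v) \<longlonglongrightarrow> cinner (T f u) v"
 using sform_limit[OF assms] by (simp add: cinner_T assms)

lemma T_cnj: "bborel f ==> cinner (T f u) v = cinner u (T (%x. cnj (f x)) v)"
proof (induction rule: bborel_induct)
 case (indicator S)
 have "(%x. cnj (indicator S x)) = (indicator S :: real => complex)" by (auto simp: indicator_def)
 then show ?case using indicator by (simp add: T_indicator E_sym)
next
 case (limit s f B)
 have "(%n. cnj (cinner (T (%x. cnj (s n x)) v) u)) \<longlonglongrightarrow> cnj (cinner (T (%x. cnj (f x)) v) u)"
  by (intro tendsto_intros T_weak_limit[of _ B]) (use limit in auto)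
 then have "(%n. cinner (T (s n) u) v) \<longlonglongrightarrow> cinner u (T (%x. cnj (f x)) v)"
  by (simp add: limit(5) flip: cinner_commute)
 then show ?case
  by (rule LIMSEQ_unique[OF T_weak_limit[OF limit(1-4)]])
qed (simp_all add: T_add_fun T_scale_fun bborel_cnj cinner_add_left cinner_add_right
  cinner_scaleC_left cinner_scaleC_right)

text \<open>\<open>E (S \<union> R)\<close> is the sum of the two and is idempotent, so
  \<open>E S\<close> and \<open>E R\<close> anticommute. Multiplying this relation by
  \<open>E S\<close> on the left and on the right shows that the two products are equal as well,
  hence zero.\<close>

lemma E_disjoint:
 assumes S: "S \<in> sets borel" and R: "R \<in> sets borel" and "S \<inter> R = {}"
 shows "E S (E R u) = 0"
proof -
 have *: "E S (E R v) + E R (E S v) = 0" for v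
 proof -
  have "E (S \<union> R) (E (S \<union> R) v) = E (S \<union> R) v" using S R by (intro E_idem) auto
  then show ?thesis using assms by (simp add: E_Un E_add E_idem algebra_simps)
 qed
 have "E R (E S u) = - E S (E R (E S u))"
  using *[of "E S u"] S by (simp add: E_idem eq_neg_iff_add_eq_0 add.commute)
 moreover have "E S (E R u) = - E S (E R (E S u))"
  using arg_cong[OF *[of u], of "E S"] S by (simp add: E_idem E_add E_zero eq_neg_iff_add_eq_0)
 ultimately have "E S (E R u) + E S (E R u) = 0" using *[of u] by simp
 then have "2 *\<^sub>R E S (E R u) = 0" by (simp only: scaleR_2)
 then show ?thesis by simp
qed

lemma E_Int:
 assumes S: "S \<in> sets borel" and R: "R \<in> sets borel"
 shows "E S (E R u) = E (S \<inter> R) u"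
proof -
 have m: "S \<inter> R \<in> sets borel" "S - R \<in> sets borel" "R - S \<in> sets borel" using S R by auto
 have "S \<inter> R \<union> (S - R) = S" "S \<inter> R \<union> (R - S) = R" by auto
 then have e: "E S v = E (S \<inter> R) v + E (S - R) v" "E R v = E (S \<inter> R) v + E (R - S) v" for v
  using E_Un[of "S \<inter> R" "S - R" v] E_Un[of "S \<inter> R" "R - S" v] m by auto
 have "E S (E R u) = E (S \<inter> R) (E (S \<inter> R) u) + E (S \<inter> R) (E (R - S) u) + (E (S - R) (E (S \<inter> R) u) + E (S - R) (E (R - S) u))"
  by (simp only: e E_add[OF m(1)] E_add[OF m(2)] add_ac)
 moreover have "E (S \<inter> R) (E (R - S) u) = 0" "E (S - R) (E (S \<inter> R) u) = 0" "E (S - R) (E (R - S) u) = 0"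
  by (intro E_disjoint m; blast)+
 ultimately show ?thesis by (simp add: E_idem m)
qed

text \<open>First \<open>g\<close> is an indicator and \<open>f\<close> varies, then
  \<open>g\<close> varies. In the second induction \<open>T f\<close> is moved to the other side of
  the inner product as \<open>T\<close> of the conjugate function, so weak limits suffice.\<close>

lemma T_mult: "bborel f ==> bborel g ==> T (%x. f x * g x) u = T f (T g u)"
proof -
 have 1: "T (%x. f x * indicator R x) v = T f (E R v)" if "bborel f" and R: "R \<in> sets borel" for f R v
  using that(1)
 proof (induction rule: bborel_induct)
  case (indicator S)
  have "(%x. indicator S x * indicator R x) = (indicator (S \<inter> R) :: real => complex)"
   by (auto simp: indicator_def)
  then show ?case using indicator R by (simp add: T_indicator E_Int)
 next
  case (limit s f B)
  show ?case
  proof (rule cinner_eqI)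
   fix w
   have "cmod (s n x * indicator R x) \<le> B" for n x
    using limit(2)[of n x] order_trans[OF norm_ge_zero limit(2)[of n x]]
    by (auto simp: indicator_def)
   then have "(%n. cinner (T (%x. s n x * indicator R x) v) w) \<longlonglongrightarrow> cinner (T (%x. f x * indicator R x) v) w"
    using limit R by (intro T_weak_limit[of _ B]) (auto intro!: tendsto_intros bborel_mult)
   then show "cinner (T (%x. f x * indicator R x) v) w = cinner (T f (E R v)) w"
    unfolding limit(5) by (rule LIMSEQ_unique[OF _ T_weak_limit[OF limit(1-4)]])
  qed
 qed (simp_all add: distrib_right mult.assoc T_add_fun T_scale_fun bborel_mult R)
 assume f: "bborel f" and "bborel g"
 from this(2) show ?thesis
 proof (induction rule: bborel_induct)
  case (indicator R) then show ?case using 1[OF f] by (simp add: T_indicator)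
 next
  case (limit s g B)
  obtain A where A: "0 \<le> A" "!!x. cmod (f x) \<le> A" using bborelE[OF f] by blast
  show ?case
  proof (rule cinner_eqI)
   fix w
   have "(%n. cinner (T (%x. f x * s n x) u) w) \<longlonglongrightarrow> cinner (T (%x. f x * g x) u) w"
    using limit f A by (intro T_weak_limit[of _ "A * B"])
     (auto intro!: tendsto_intros bborel_mult mult_mono simp: norm_mult)
   moreover have "(%n. cinner (T (s n) u) (T (%x. cnj (f x)) w)) \<longlonglongrightarrow> cinner (T g u) (T (%x. cnj (f x)) w)"
    by (rule T_weak_limit[OF limit(1-4)])
   ultimately show "cinner (T (%x. f x * g x) u) w = cinner (T f (T g u)) w"
    by (simp add: limit(5) T_cnj[OF f] LIMSEQ_unique)
  qed
 qed (simp_all add: distrib_left mult.left_commute T_add_fun T_scale_fun bborel_mult f T_add T_scale)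
qed

lemma T_diag: "bborel f ==> cinner (T f u) u = (LINT x|mu u. f x)"
proof (induction rule: bborel_induct)
 case (indicator S) then show ?case by (simp only: T_indicator E_norm integral_mu_indicator)
next
 case (limit s f B)
 show ?case
  using LIMSEQ_unique[OF T_weak_limit[OF limit(1-4), of u u]] tendsto_mu[OF limit(1-4), of u]
  by (simp add: limit(5))
qed (simp_all add: T_add_fun T_scale_fun cinner_add_left cinner_scaleC_left integrable_mu)

lemma norm_T_square:
 assumes f: "bborel f" shows "(norm (T f u))\<^sup>2 = (LINT x|mu u. (cmod (f x))\<^sup>2)"
proof -
 have "cor ((norm (T f u))\<^sup>2) = cinner u (T (%x. cnj (f x)) (T f u))"
  by (simp only: cinner_self_norm[symmetric] T_cnj[OF f])
 also have "\<dots> = cinner u (T (%x. f x * cnj (f x)) u)"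
  by (subst T_mult[symmetric, OF bborel_cnj[OF f] f]) (simp add: mult.commute)
 also have "\<dots> = cinner (T (%x. f x * cnj (f x)) u) u"
  by (subst T_cnj[OF bborel_mult[OF f bborel_cnj[OF f]]]) (simp add: mult.commute)
 also have "\<dots> = (LINT x|mu u. cor ((cmod (f x))\<^sup>2))"
  unfolding complex_norm_square by (intro T_diag bborel_mult bborel_cnj f)
 finally show ?thesis by (metis integral_complex_of_real of_real_eq_iff)
qed

lemma norm_T_le:
 assumes f: "bborel f" and B: "!!x. cmod (f x) \<le> B"
 shows "norm (T f u) \<le> B * norm u"
proof -
 have B0: "0 \<le> B" using B[of 0] norm_ge_zero order_trans by blast
 have b: "bborel (%x. cor ((cmod (f x))\<^sup>2))"
  unfolding complex_norm_square by (intro bborel_mult bborel_cnj f)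
 have "(norm (T f u))\<^sup>2 = cmod (LINT x|mu u. cor ((cmod (f x))\<^sup>2))"
  by (simp add: norm_T_square[OF f] flip: of_real_power)
 also have "\<dots> \<le> B\<^sup>2 * (norm u)\<^sup>2"
  by (rule integral_mu_bound[OF b]) (use B B0 in \<open>auto intro!: power_mono simp: norm_power\<close>)
 finally have "(norm (T f u))\<^sup>2 \<le> (B * norm u)\<^sup>2" by (simp only: power_mult_distrib)
 then show ?thesis using B0 by (rule power2_le_imp_le[OF _ mult_nonneg_nonneg]) simp
qed

lemma T_bounded_linear: "bborel f ==> bounded_linear (T f)"
proof -
 assume f: "bborel f"
 then obtain B where "!!x. cmod (f x) \<le> B" by (rule bborelE) (rule that)
 then have "norm (T f u) \<le> norm u * B" for u
  using norm_T_le[OF f, of B u] by (simp add: mult.commute)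
 then show ?thesis
  using T_add[OF f] T_scale[OF f, of "cor _"] unfolding scaleC_of_real
  by (intro bounded_linear_intro[where K = B])
qed

text \<open>The convergence is strong, not merely weak, because \<open>norm_T_square\<close> writes
  the squared norm of the difference as an integral to which dominated convergence applies.\<close>

lemma T_strong_limit:
 assumes s: "!!n. bborel (s n)" "!!n x. cmod (s n x) \<le> B" "!!x. (%n. s n x) \<longlonglongrightarrow> f x" "bborel f"
 shows "(%n. T (s n) u) \<longlonglongrightarrow> T f u"
proof -
 obtain A where "0 \<le> A" and A: "!!x. cmod (f x) \<le> A" by (rule bborelE[OF s(4)]) (rule that)
 have "(%n. LINT x|mu u. (cmod (s n x - f x))\<^sup>2) \<longlonglongrightarrow> (LINT x|mu u. 0)"
 proof (rule integral_dominated_convergence)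
  interpret finite_measure "mu u" by (rule finite_measure_mu)
  show "integrable (mu u) (%_. (B + A)\<^sup>2)" by simp
  show "(%x. (cmod (s n x - f x))\<^sup>2) \<in> borel_measurable (mu u)" for n
   using s(1)[of n] s(4) by (auto dest!: bborel_measurable)
  show "AE x in mu u. (%n. (cmod (s n x - f x))\<^sup>2) \<longlonglongrightarrow> 0"
  proof (rule AE_I2)
   fix x
   have "(%n. (cmod (s n x - f x))\<^sup>2) \<longlonglongrightarrow> (cmod (f x - f x))\<^sup>2"
    by (intro tendsto_intros s(3))
   then show "(%n. (cmod (s n x - f x))\<^sup>2) \<longlonglongrightarrow> 0" by simp
  qed
  show "AE x in mu u. norm ((cmod (s n x - f x))\<^sup>2) \<le> (B + A)\<^sup>2" for n
  proof (rule AE_I2)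
   fix x
   have "cmod (s n x - f x) \<le> B + A"
    using norm_triangle_ineq4[of "s n x" "f x"] s(2)[of n x] A[of x] by linarith
   then show "norm ((cmod (s n x - f x))\<^sup>2) \<le> (B + A)\<^sup>2" by (auto intro: power_mono)
  qed
 qed simp
 then have "(%n. (norm (T (s n) u - T f u))\<^sup>2) \<longlonglongrightarrow> 0"
  using s by (simp add: norm_T_square[symmetric] bborel_diff T_diff_fun[symmetric])
 then have "(%n. sqrt ((norm (T (s n) u - T f u))\<^sup>2)) \<longlonglongrightarrow> sqrt 0"
  by (rule tendsto_real_sqrt)
 then have "(%n. norm (T (s n) u - T f u)) \<longlonglongrightarrow> 0"
  by (simp only: real_sqrt_abs abs_norm_cancel real_sqrt_zero)
 then show ?thesis
  by (rule LIM_zero_cancel[OF tendsto_norm_zero_cancel])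
qed

end

section \<open>The Cayley transform and trigonometric polynomials\<close>

definition cay :: "real => complex" where
 "cay x = (cor x - \<i>) / (cor x + \<i>)"

text \<open>Stereographic projection of the unit circle from the point 1, with orientation reversed;
  the point 1 corresponds to infinity on the line.\<close>

definition cay_inv :: "complex => real" where
 "cay_inv z = - Im z / (1 - Re z)"

lemma real_plus_ii_nz [simp]: "cor x + \<i> \<noteq> 0" "cor x - \<i> \<noteq> 0"
 by (auto simp: complex_eq_iff)

lemma norm_cay [simp]: "cmod (cay x) = 1"
proof -
 have "cmod (cor x - \<i>) = cmod (cor x + \<i>)"
  by (simp add: cmod_def)
 then show ?thesis by (simp add: cay_def norm_divide)
qed

lemma cay_cnj [simp]: "cay x * cnj (cay x) = 1"
 by (simp add: complex_norm_square[symmetric])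

lemma cay_alt: "cay x = Complex ((x\<^sup>2 - 1) / (x\<^sup>2 + 1)) (- 2 * x / (x\<^sup>2 + 1))"
proof -
 define s where "s = x\<^sup>2 + 1"
 have nz: "s \<noteq> 0" unfolding s_def by (smt (verit) zero_le_power2)
 have sq: "x\<^sup>2 = s - 1" "x * x = s - 1" by (simp_all add: s_def power2_eq_square)
 have "(s - 2) / s * x + 2 * x / s = x" "(s - 2) / s - 2 * (x * x) / s = - 1"
  unfolding sq using nz by (simp_all add: field_simps)
 then have "Complex ((s - 2) / s) (- 2 * x / s) * (cor x + \<i>) = cor x - \<i>"
  by (simp add: complex_eq_iff mult.assoc)
 then show ?thesis by (simp add: cay_def divide_eq_eq sq(1))
qed

lemma cay_inv_cay: "cay_inv (cay x) = x"
proof -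
 have nz: "x\<^sup>2 + 1 \<noteq> 0" by (smt (verit) zero_le_power2)
 have "1 - (x\<^sup>2 - 1) / (x\<^sup>2 + 1) = 2 / (x\<^sup>2 + 1)" using nz by (simp add: field_simps)
 then show ?thesis using nz by (simp add: cay_inv_def cay_alt)
qed

lemma cay_neq_1: "cay x \<noteq> 1"
 by (simp add: cay_def)

lemma cay_cay_inv:
 assumes "cmod z = 1" "z \<noteq> 1" shows "cay (cay_inv z) = z"
proof -
 have sq: "(Re z)\<^sup>2 + (Im z)\<^sup>2 = 1" using assms(1) by (metis cmod_power2 one_power2)
 have r: "1 - Re z \<noteq> 0"
 proof
  assume "1 - Re z = 0"
  then have "Re z = 1" "Im z = 0" using sq by auto
  then show False using assms(2) by (simp add: complex_eq_iff)
 qed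
 have im: "(Im z)\<^sup>2 = (1 - Re z) * (1 + Re z)" using sq by (simp add: algebra_simps power2_eq_square)
 have s: "(cay_inv z)\<^sup>2 = (1 + Re z) / (1 - Re z)"
  unfolding cay_inv_def power_divide power2_minus im using r by (simp add: power2_eq_square)
 have p: "(cay_inv z)\<^sup>2 + 1 = 2 / (1 - Re z)" "(cay_inv z)\<^sup>2 - 1 = 2 * Re z / (1 - Re z)"
  unfolding s using r by (simp_all add: field_simps)
 show ?thesis
  unfolding cay_alt p using r by (simp add: complex_eq_iff cay_inv_def)
qed

lemma continuous_cay: "continuous_on UNIV cay"
 unfolding cay_def by (intro continuous_intros) auto

lemma bborel_cay [simp]: "bborel cay"
 by (rule bborel_continuous[OF continuous_cay, of 1]) simp

text \<open>Trigonometric polynomials read on the line. Powers of \<open>cay\<close> and of its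
  conjugate stand for the positive and the negative frequencies.\<close>

inductive trig :: "(real => complex) => bool" where
 trig_base: "trig (%x. cay x ^ a * cnj (cay x) ^ b)"
| trig_add: "trig f ==> trig g ==> trig (%x. f x + g x)"
| trig_scale: "trig f ==> trig (%x. c * f x)"

lemma bborel_trig: "trig f ==> bborel f"
 by (induction rule: trig.induct) (auto intro!: bborel_mult bborel_power bborel_cnj)

lemma trig_const: "trig (%_. c)"
 using trig_scale[OF trig_base[of 0 0], of c] by simp

lemma trig_mult:
 assumes "trig f" "trig g" shows "trig (%x. f x * g x)"
proof -
 have base: "trig (%x. cay x ^ a * cnj (cay x) ^ b * g x)" if "trig g" for a b g
  using that
 proof (induction g)
  case (trig_base a' b')
  show ?case
   using trig.trig_base[of "a + a'" "b + b'"] by (simp add: power_add mult_ac)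
 next
  case (trig_add f g)
  show ?case using trig.trig_add[OF trig_add(3,4)] by (simp add: distrib_left)
 next
  case (trig_scale f c)
  show ?case using trig.trig_scale[OF trig_scale(2), of c] by (simp add: mult_ac)
 qed
 from assms(1) show ?thesis
 proof induction
  case (trig_base a b)
  show ?case by (rule base[OF assms(2)])
 next
  case (trig_add f f')
  show ?case using trig.trig_add[OF trig_add(3,4)] by (simp add: distrib_right)
 next
  case (trig_scale f c)
  show ?case using trig.trig_scale[OF trig_scale(2), of c] by (simp add: mult.assoc)
 qed
qed

lemma trig_real_polynomial:
 "real_polynomial_function p ==> trig (%x. cor (p (cay x)))"
proof (induction rule: real_polynomial_function.induct)
 case (linear f)
 have f: "f z = Re z * f 1 + Im z * f \<i>" for z
 proof -
  interpret bounded_linear f by (rule linear)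
  have "f z = f (Re z *\<^sub>R 1 + Im z *\<^sub>R \<i>)"
   by (rule arg_cong[of _ _ f]) (simp add: complex_eq_iff)
  then show ?thesis by (simp only: add scaleR) simp
 qed
 have c: "trig cay" "trig (%x. cnj (cay x))" using trig_base[of 1 0] trig_base[of 0 1] by simp_all
 have "trig (%x. ((f 1 - \<i> * f \<i>) / 2) * cay x + ((f 1 + \<i> * f \<i>) / 2) * cnj (cay x))"
  by (intro trig_add trig_scale c)
 moreover have "((f 1 - \<i> * f \<i>) / 2) * cay x + ((f 1 + \<i> * f \<i>) / 2) * cnj (cay x)
   = cor (f (cay x))" for x
  by (subst f) (simp add: complex_eq_iff field_simps)
 ultimately show ?case by simp
qed (simp_all add: trig_const trig_add trig_mult)

text \<open>A function vanishing outside a bounded interval becomes continuous on the circle when it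
  is given the value 0 at 1, the image of infinity, and Stone-Weierstrass applies there.\<close>

lemma trig_approx:
 fixes g :: "real => real"
 assumes g: "continuous_on UNIV g" and supp: "!!x. \<bar>x\<bar> > R ==> g x = 0" and e: "e > 0"
 shows "\<exists>p. trig p \<and> (\<forall>x. cmod (cor (g x) - p x) < e)"
proof -
 define h where "h z = (if z = 1 then 0 else g (cay_inv z))" for z
 define S where "S = sphere (0::complex) 1"
 have "continuous (at z within S) h" if z: "z \<in> S" for z
 proof (cases "z = 1")
  case True
  have "\<forall>\<^sub>F w in at 1 within S. h w = 0"
  proof -
   \<comment> \<open>The real part of \<open>cay R\<close>: points of the circle with larger real
     part come from outside the support.\<close>
   define r where "r = (R\<^sup>2 - 1) / (R\<^sup>2 + 1)"
   have R: "R\<^sup>2 + 1 > 0" by (smt (verit) zero_le_power2)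
   have "((%w. Re w) \<longlongrightarrow> Re 1) (at 1 within S)" by (intro tendsto_intros)
   moreover have "r < Re 1" using R by (simp add: r_def)
   ultimately have "\<forall>\<^sub>F w in at 1 within S. r < Re w" by (rule order_tendstoD)
   moreover have "\<forall>\<^sub>F w in at 1 within S. w \<in> S \<and> w \<noteq> 1"
    by (auto simp: eventually_at_filter)
   ultimately show ?thesis
   proof eventually_elim
    case (elim w)
    define y where "y = cay_inv w"
    have "w = cay y" using elim by (simp add: y_def cay_cay_inv S_def)
    then have "r < (y\<^sup>2 - 1) / (y\<^sup>2 + 1)" using elim by (simp add: cay_alt)
    moreover have "y\<^sup>2 + 1 > 0" by (smt (verit) zero_le_power2)
    ultimately have "R\<^sup>2 < y\<^sup>2" using R by (simp add: r_def field_simps)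
    then have "\<bar>R\<bar> < \<bar>y\<bar>" using abs_le_square_iff linorder_not_le by blast
    then have "g y = 0" by (intro supp) auto
    then show "h w = 0" by (simp add: h_def y_def)
   qed
  qed
  then have "(h \<longlongrightarrow> 0) (at 1 within S)" by (rule tendsto_eventually)
  then show ?thesis unfolding True continuous_within by (simp add: h_def)
 next
  case False
  have "cmod z = 1" using z by (simp add: S_def)
  then have "1 - Re z \<noteq> 0"
   using False by (metis complex_eq_iff cmod_power2 one_power2 add_cancel_right_right diff_eq_eq
     add_0 one_complex.sel power_eq_0_iff)
  then have "isCont cay_inv z"
   unfolding cay_inv_def by (intro continuous_intros) auto
  moreover have "isCont g (cay_inv z)" using g by (simp add: continuous_on_eq_continuous_at)
  ultimately have "isCont (%w. g (cay_inv w)) z" by (rule isCont_o2)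
  then have c: "continuous (at z within S) (%w. g (cay_inv w))"
   by (rule continuous_at_imp_continuous_at_within)
  show ?thesis
  proof (rule continuous_transform_within[OF c])
   show "0 < dist z 1" using False by simp
   show "g (cay_inv w) = h w" if "w \<in> S" "dist w z < dist z 1" for w
    using that False by (auto simp: h_def dist_commute)
  qed (use z in auto)
 qed
 then have "continuous_on S h" by (simp add: continuous_on_eq_continuous_within)
 moreover have "compact S" by (simp add: S_def)
 ultimately obtain p where p: "real_polynomial_function p" "!!z. z \<in> S ==> \<bar>h z - p z\<bar> < e"
  using Stone_Weierstrass_real_polynomial_function e by metis
 have "cmod (cor (g x) - cor (p (cay x))) < e" for x
 proof -
  have "\<bar>h (cay x) - p (cay x)\<bar> < e" by (rule p(2)) (simp add: S_def)
  then show ?thesis by (simp add: h_def cay_neq_1 cay_inv_cay flip: of_real_diff)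
 qed
 then show ?thesis using trig_real_polynomial[OF p(1)] by blast
qed

lemma borel_eq_intervals: "(borel :: real measure) = sigma UNIV (range (%(a, b). {a<..<b}))"
 unfolding borel_eq_box box_real ..

text \<open>The uniqueness principle behind all identities for the measures below: an identity that
  is linear in \<open>f\<close> and stable under bounded pointwise limits has to be checked only on
  monomials in \<open>cay\<close> and its conjugate. It spreads from there to continuous functions
  of bounded support, to open intervals, by the pi-lambda theorem to Borel sets, and finally to
  bounded Borel functions.\<close>

lemma bborel_functional_zero:
 fixes L :: "(real => complex) => complex"
 assumes add: "!!f g. bborel f ==> bborel g ==> L (%x. f x + g x) = L f + L g"
  and scale: "!!c f. bborel f ==> L (%x. c * f x) = c * L f"
  and lim: "!!s f B. (!!n. bborel (s n)) ==> (!!n x. cmod (s n x) \<le> B) ==>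
    (!!x. (%n. s n x) \<longlonglongrightarrow> f x) ==> bborel f ==> (%n. L (s n)) \<longlonglongrightarrow> L f"
  and zero: "!!a b. L (%x. cay x ^ a * cnj (cay x) ^ b) = 0"
  and f: "bborel f"
 shows "L f = 0"
proof -
 have limz: "L h = 0" if "!!n. bborel (s n)" "!!n x. cmod (s n x) \<le> B"
  "!!x. (%n. s n x) \<longlonglongrightarrow> h x" "bborel h" "!!n. L (s n) = 0" for s h B
  using lim[OF that(1-4)] by (simp add: that(5) LIMSEQ_const_iff)
 have trig: "L p = 0" if "trig p" for p
  using that by induction (simp_all add: zero add scale bborel_trig)
 have cont: "L (%x. cor (g x)) = 0"
  if g: "continuous_on UNIV g" and supp: "!!x. \<bar>x\<bar> > R ==> g x = 0" and bd: "!!x. \<bar>g x\<bar> \<le> 1" for g R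
 proof -
  have "\<exists>p. trig p \<and> (\<forall>x. cmod (cor (g x) - p x) < 1 / real (Suc n))" for n
   by (rule trig_approx[OF g supp]) auto
  then obtain p where p: "!!n. trig (p n)" "!!n x. cmod (cor (g x) - p n x) < 1 / real (Suc n)"
   by metis
  show ?thesis
  proof (rule limz[of p 2])
   show "cmod (p n x) \<le> 2" for n x
   proof -
    have "1 / real (Suc n) \<le> 1" by simp
    then have "cmod (cor (g x) - p n x) \<le> 1" using p(2)[of x n] by linarith
    moreover have "cmod (cor (g x)) \<le> 1" using bd[of x] by simp
    ultimately show ?thesis
     using norm_triangle_sub[of "p n x" "cor (g x)"] by (simp add: norm_minus_commute)
   qed
   show "(%n. p n x) \<longlonglongrightarrow> cor (g x)" for x
   proof (rule metric_LIMSEQ_I)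
    fix r :: real assume "0 < r"
    then obtain N where N: "1 / real (Suc N) < r" using nat_approx_posE by blast
    have "dist (p n x) (cor (g x)) < r" if "n \<ge> N" for n
    proof -
     have "1 / real (Suc n) \<le> 1 / real (Suc N)" using that by (simp add: field_simps)
     then show ?thesis using p(2)[of x n] N by (simp add: dist_norm norm_minus_commute)
    qed
    then show "\<exists>no. \<forall>n\<ge>no. dist (p n x) (cor (g x)) < r" by blast
   qed
   show "bborel (%x. cor (g x))"
    by (rule bborel_continuous[of _ 1]) (use bd g in \<open>auto intro!: continuous_on_of_real\<close>)
  qed (auto simp: p bborel_trig trig)
 qed
 have int: "L (indicator {a<..<b}) = 0" for a b :: real
 \<comment> \<open>Trapezoids of slope \<open>n\<close> and height at most 1 increase to the
   indicator of the open interval.\<close>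
 proof (rule limz[where s = "%n x. cor (min 1 (real n * max 0 (min (x - a) (b - x))))" and B = 1])
  fix n :: nat
  have c: "continuous_on UNIV (%x. min 1 (real n * max 0 (min (x - a) (b - x))))"
   by (intro continuous_intros)
  have bd: "\<bar>min 1 (real n * max 0 (min (x - a) (b - x)))\<bar> \<le> 1" for x
  proof -
   have "0 \<le> real n * max 0 (min (x - a) (b - x))" by simp
   then show ?thesis by (simp only: abs_le_iff) linarith
  qed
  show "cmod (cor (min 1 (real n * max 0 (min (x - a) (b - x))))) \<le> 1" for x
   using bd[of x] by simp
  show "bborel (%x. cor (min 1 (real n * max 0 (min (x - a) (b - x)))))"
   by (rule bborel_continuous[of _ 1]) (use bd c in \<open>auto intro!: continuous_on_of_real\<close>)
  show "L (%x. cor (min 1 (real n * max 0 (min (x - a) (b - x))))) = 0"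
  proof (rule cont[OF c _ bd])
   fix x assume "\<bar>a\<bar> + \<bar>b\<bar> < \<bar>x\<bar>"
   then have "max 0 (min (x - a) (b - x)) = 0" by (auto simp: min_def max_def)
   then show "min 1 (real n * max 0 (min (x - a) (b - x))) = 0" by simp
  qed
 next
  fix x :: real
  show "(%n. cor (min 1 (real n * max 0 (min (x - a) (b - x))))) \<longlonglongrightarrow> indicator {a<..<b} x"
  proof (cases "x \<in> {a<..<b}")
   case True
   define d where "d = min (x - a) (b - x)"
   have d: "d > 0" using True by (simp add: d_def)
   obtain N :: nat where N: "1 / d < real N" using reals_Archimedean2 by blast
   have "min 1 (real n * max 0 d) = 1" if "n \<ge> N" for n
   proof -
    have "1 / d \<le> real n" using N that by linarith
    then show ?thesis using d by (simp add: field_simps max_def)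
   qed
   then have "\<forall>\<^sub>F n in sequentially. cor (min 1 (real n * max 0 d)) = 1"
    unfolding eventually_sequentially by (intro exI[of _ N]) simp
   then show ?thesis using True by (simp add: tendsto_eventually d_def)
  next
   case False
   then have "max 0 (min (x - a) (b - x)) = 0" by (auto simp: max_def min_def)
   then show ?thesis using False by (simp only: ) simp
  qed
 qed simp
 have ind: "L (indicator S) = 0" if S: "S \<in> sets borel" for S
 proof -
  have gen: "S \<in> sigma_sets UNIV (range (%(a, b). {a<..<b::real}))"
   using S unfolding borel_eq_intervals by (simp add: sets_measure_of)
  have bor: "A \<in> sets borel" if "A \<in> sigma_sets UNIV (range (%(a, b). {a<..<b::real}))" for A
   using that unfolding borel_eq_intervals by (simp add: sets_measure_of)
  show ?thesis
  proof (rule sigma_sets_induct_disjoint[OF _ _ gen])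
   show "Int_stable (range (%(a, b). {a<..<b::real}))"
   proof (rule Int_stableI, clarify)
    fix a b a' b' :: real
    have "{a<..<b} \<inter> {a'<..<b'} = {max a a'<..<min b b'}" by auto
    then show "{a<..<b} \<inter> {a'<..<b'} \<in> range (%(a, b). {a<..<b})" by auto
   qed
   show "L (indicator A) = 0" if "A \<in> range (%(a, b). {a<..<b::real})" for A
    using that int by auto
   show "L (indicator {}) = 0" using int[of 0 0] by simp
  next
   fix A assume A: "A \<in> sigma_sets UNIV (range (%(a, b). {a<..<b::real}))" "L (indicator A) = 0"
   have "(indicator (UNIV - A) :: real => complex) = (%x. 1 + (-1) * indicator A x)"
    by (auto simp: indicator_def)
   moreover have "L (%x. 1 + (-1) * indicator A x) = 0"
    using add[OF bborel_const[of 1] bborel_mult[OF bborel_const[of "-1"] bborel_indicator[OF bor[OF A(1)]]]]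
     scale[OF bborel_indicator[OF bor[OF A(1)]], of "-1"] zero[of 0 0] A(2) by simp
   ultimately show "L (indicator (UNIV - A)) = 0" by simp
  next
   fix A :: "nat => real set"
   assume A: "disjoint_family A" "range A \<subseteq> sigma_sets UNIV (range (%(a, b). {a<..<b::real}))"
    "!!i. L (indicator (A i)) = 0"
   have Ab: "A i \<in> sets borel" for i using A(2) by (intro bor) auto
   have e: "(\<Sum>i<n. indicator (A i) x) = (indicator (\<Union>i<n. A i) x :: complex)" for n x
    using A(1) by (subst indicator_UN_disjoint) (auto simp: disjoint_family_on_def)
   have bs: "bborel (%x. \<Sum>i<n. indicator (A i) x)" for n
    by (intro bborel_sum bborel_indicator Ab)
   show "L (indicator (\<Union>i. A i)) = 0"
   proof (rule limz[where s = "%n x. \<Sum>i<n. indicator (A i) x" and B = 1])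
    show "cmod (\<Sum>i<n. indicator (A i) x) \<le> 1" for n x
     unfolding e by (simp add: indicator_def)
    show "(%n. \<Sum>i<n. indicator (A i) x) \<longlonglongrightarrow> (indicator (\<Union>i. A i) x :: complex)" for x
     unfolding e by (rule LIMSEQ_indicator_UN)
    show "L (%x. \<Sum>i<n. indicator (A i) x) = 0" for n
    proof (induction n)
     case 0 then show ?case using int[of 0 0] by (simp add: indicator_def[abs_def])
    next
     case (Suc n) then show ?case using add[OF bs[of n] bborel_indicator[OF Ab[of n]]] A(3) by simp
    qed
    show "bborel (indicator (\<Union>i. A i))" using Ab by (intro bborel_indicator) auto
   qed (rule bs)
  qed auto
 qed
 from f show ?thesis
 proof (induction rule: bborel_induct)
  case (limit s f B)
  show ?case by (rule limz[OF limit])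
 qed (simp_all add: ind add scale)
qed

section \<open>Spectral measures of an isometry\<close>

locale ell2_isometry =
 fixes U :: "'x ell2 => 'x ell2"
 assumes U_add: "U (u + v) = U u + U v" and U_scale: "U (c *\<^sub>C u) = c *\<^sub>C U u"
  and U_norm: "norm (U u) = norm u"
begin

lemma U_cinner: "cinner (U u) (U v) = cinner u v"
proof -
 have "cinner (U w) (U w) = cinner w w" for w by (simp add: cinner_self_norm U_norm)
 then show ?thesis
  using cinner_polarization[of U U, OF U_add U_scale U_add U_scale, of u v]
   cinner_polarization[of "%u. u" "%u. u" u v]
  by (metis (no_types, lifting) sum.cong)
qed

lemma Um_add: "(U ^^ m) (u + v) = (U ^^ m) u + (U ^^ m) v"
 and Um_scale: "(U ^^ m) (c *\<^sub>C u) = c *\<^sub>C (U ^^ m) u"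
 and Um_norm: "norm ((U ^^ m) u) = norm u"
 and Um_cinner: "cinner ((U ^^ m) u) ((U ^^ m) v) = cinner u v"
 by (induction m) (simp_all add: U_add U_scale U_norm U_cinner)

lemma Um_zero: "(U ^^ m) 0 = 0"
 using Um_scale[of m 0 0] by simp

lemma Um_diff: "(U ^^ m) (u - v) = (U ^^ m) u - (U ^^ m) v"
 using Um_add[of m u "(-1) *\<^sub>C v"] Um_scale[of m "-1" v] by (simp add: scaleC_minus_one)

lemma Um_sum: "(U ^^ m) (sum f I) = (\<Sum>i\<in>I. (U ^^ m) (f i))"
 by (induction I rule: infinite_finite_induct) (simp_all add: Um_zero Um_add)

text \<open>The discrete Fourier transform of the orbit of \<open>u\<close>, without normalization,
  at the \<open>n\<close>-th root of unity with index \<open>j\<close>.\<close>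

definition fourier_vec :: "'x ell2 => nat => nat => 'x ell2" where
 "fourier_vec u n j = (\<Sum>k<n. cnj (cis (2 * pi * real j / real n)) ^ k *\<^sub>C (U ^^ k) u)"

lemma roots_orthogonal:
 assumes "k < n" "l < n"
 shows "(\<Sum>j<n. cnj (cis (2 * pi * real j / real n)) ^ k * cis (2 * pi * real j / real n) ^ l)
   = (if k = l then of_nat n else 0)"
proof -
 define w where "w = (%j. cis (2 * pi * real j / real n))"
 have n: "n > 0" using assms by simp
 have w: "inj_on w {..<n}" "!!j. j < n ==> w j ^ n = 1"
  using Complex.bij_betw_roots_unity[OF n] unfolding w_def bij_betw_def by auto
 have wpow: "w j ^ l = w l ^ j" for j l
  unfolding w_def Complex.DeMoivre by (rule arg_cong[of _ _ cis]) simp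
 have cw: "cnj (w j) * w j = 1" for j by (simp add: w_def cis_cnj cis_mult)
 define q where "q = cnj (w k) * w l"
 have "(\<Sum>j<n. cnj (w j) ^ k * w j ^ l) = (\<Sum>j<n. q ^ j)"
  by (simp add: wpow q_def power_mult_distrib flip: complex_cnj_power)
 also have "\<dots> = (if k = l then of_nat n else 0)"
 proof (cases "k = l")
  case True then show ?thesis by (simp add: q_def cw)
 next
  case False
  have "q \<noteq> 1"
  proof
   assume "q = 1"
   then have "w k * (cnj (w k) * w l) = w k" by (simp add: q_def)
   moreover have "w k * (cnj (w k) * w l) = (cnj (w k) * w k) * w l" by (simp only: mult_ac)
   ultimately have "w l = w k" by (simp only: cw mult_1)
   then show False using w(1) assms False by (auto simp: inj_on_def)
  qed
  moreover have "q ^ n = 1"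
   using w(2)[OF assms(1)] w(2)[OF assms(2)] by (simp add: q_def power_mult_distrib flip: complex_cnj_power)
  ultimately show ?thesis using False by (simp add: geometric_sum)
 qed
 finally show ?thesis by (simp only: w_def)
qed

text \<open>Orthogonality of the roots of unity keeps the diagonal terms with weight
  \<open>n\<close>, and these \<open>n\<close> terms are equal because \<open>U\<close> is
  isometric; hence the square.\<close>

lemma fourier_parseval:
 "(\<Sum>j<n. cinner ((U ^^ m) (fourier_vec u n j)) (fourier_vec u n j)) = of_nat (n\<^sup>2) * cinner ((U ^^ m) u) u"
proof -
 let ?w = "%j. cis (2 * pi * real j / real n)"
 have "(\<Sum>j<n. cinner ((U ^^ m) (fourier_vec u n j)) (fourier_vec u n j)) =
  (\<Sum>j<n. \<Sum>k<n. \<Sum>l<n. (cnj (?w j) ^ k * ?w j ^ l) * cinner ((U ^^ m) ((U ^^ k) u)) ((U ^^ l) u))"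
  unfolding fourier_vec_def Um_sum Um_scale cinner.sum_left
  unfolding cinner.sum_right cinner_scaleC_left cinner_scaleC_right
  by (simp only: complex_cnj_power complex_cnj_cnj mult_ac)
 also have "\<dots> = (\<Sum>k<n. \<Sum>l<n. \<Sum>j<n. (cnj (?w j) ^ k * ?w j ^ l) * cinner ((U ^^ m) ((U ^^ k) u)) ((U ^^ l) u))"
  by (subst sum.swap) (intro sum.cong refl sum.swap)
 also have "\<dots> = (\<Sum>k<n. \<Sum>l<n. (if k = l then of_nat n else 0) * cinner ((U ^^ m) ((U ^^ k) u)) ((U ^^ l) u))"
  by (intro sum.cong refl) (simp add: roots_orthogonal flip: sum_distrib_right)
 also have "\<dots> = (\<Sum>k<n. of_nat n * cinner ((U ^^ m) ((U ^^ k) u)) ((U ^^ k) u))"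
  by (intro sum.cong refl) (simp add: if_distrib[of "%x. x * _"] cong: if_cong)
 also have "\<dots> = (\<Sum>k<n. of_nat n * cinner ((U ^^ m) u) u)"
 proof (intro sum.cong refl arg_cong2[of _ _ _ _ "(*)"])
  fix k
  have "(U ^^ m) ((U ^^ k) u) = (U ^^ k) ((U ^^ m) u)"
   by (metis add.commute comp_apply funpow_add)
  then show "cinner ((U ^^ m) ((U ^^ k) u)) ((U ^^ k) u) = cinner ((U ^^ m) u) u"
   by (simp add: Um_cinner)
 qed
 finally show ?thesis by (simp add: power2_eq_square)
qed

text \<open>Each Fourier vector is almost an eigenvector: applying \<open>U\<close> shifts the sum,
  and only the end terms \<open>u\<close> and \<open>(U ^^ n) u\<close> fail to cancel. Each of the
  \<open>m\<close> applications costs at most 2.\<close>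

lemma fourier_shift:
 assumes n: "n > 0" and u: "norm u = 1" and j: "j < n"
 shows "norm ((U ^^ m) (fourier_vec u n j) - cis (2 * pi * real j / real n) ^ m *\<^sub>C fourier_vec u n j) \<le> 2 * real m"
proof -
 define w where "w = cis (2 * pi * real j / real n)"
 define D where "D = fourier_vec u n j"
 have cw: "w * cnj w = 1" by (simp add: w_def cis_cnj cis_mult)
 have "w ^ n = 1" using Complex.bij_betw_roots_unity[OF n] j unfolding w_def bij_betw_def by auto
 then have wn: "cnj w ^ n = 1" by (simp flip: complex_cnj_power)
 have "cnj w *\<^sub>C U D = (\<Sum>k<n. cnj w ^ Suc k *\<^sub>C (U ^^ Suc k) u)"
  using Um_sum[of 1 "%k. cnj w ^ k *\<^sub>C (U ^^ k) u" "{..<n}"]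
  by (simp add: D_def fourier_vec_def U_scale scaleC.sum_right scaleC_scaleC flip: w_def)
 also have "\<dots> = (\<Sum>k<Suc n. cnj w ^ k *\<^sub>C (U ^^ k) u) - u"
  by (subst sum.lessThan_Suc_shift) simp
 also have "\<dots> = D + (U ^^ n) u - u" by (simp add: D_def fourier_vec_def wn flip: w_def)
 finally have "w *\<^sub>C cnj w *\<^sub>C U D = w *\<^sub>C (D + ((U ^^ n) u - u))" by (simp only: add_diff_eq)
 then have "U D - w *\<^sub>C D = w *\<^sub>C ((U ^^ n) u - u)"
  by (simp add: scaleC_scaleC cw scaleC_add_right)
 then have "norm (U D - w *\<^sub>C D) = norm ((U ^^ n) u - u)"
  by (simp add: norm_scaleC w_def)
 also have "\<dots> \<le> 2" using norm_triangle_ineq4[of "(U ^^ n) u" u] by (simp add: Um_norm u)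
 finally have 1: "norm (U D - w *\<^sub>C D) \<le> 2" .
 have "norm ((U ^^ m) D - w ^ m *\<^sub>C D) \<le> 2 * real m"
 proof (induction m)
  case (Suc m)
  have "(U ^^ Suc m) D - w ^ Suc m *\<^sub>C D = (U ^^ m) (U D - w *\<^sub>C D) + w *\<^sub>C ((U ^^ m) D - w ^ m *\<^sub>C D)"
   by (simp add: Um_diff Um_scale funpow_swap1 scaleC.diff_right scaleC_scaleC)
  also have "norm \<dots> \<le> 2 + 2 * real m"
   by (intro norm_triangle_le add_mono) (use 1 Suc.IH in \<open>simp_all add: Um_norm norm_scaleC w_def\<close>)
  finally show ?case by simp
 qed simp
 then show ?thesis by (simp only: w_def D_def)
qed

lemma fourier_norm_sum: "norm u = 1 ==> (\<Sum>j<n. (norm (fourier_vec u n j))\<^sup>2) = real (n\<^sup>2)"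
proof -
 assume "norm u = 1"
 then have "cor (\<Sum>j<n. (norm (fourier_vec u n j))\<^sup>2) = cor (real (n\<^sup>2))"
  using fourier_parseval[where m = 0 and u = u and n = n]
  by (simp only: funpow_0 cinner_self_norm of_real_sum) simp
 then show ?thesis by (simp only: of_real_eq_iff)
qed

lemma fourier_moment:
 assumes n: "n > 0" and u: "norm u = 1"
 shows "cmod ((\<Sum>j<n. cor ((norm (fourier_vec u n j))\<^sup>2 / real (n\<^sup>2)) * cis (2 * pi * real j / real n) ^ m)
   - cinner ((U ^^ m) u) u) \<le> 2 * real m / sqrt n"
proof -
 let ?D = "fourier_vec u n" and ?w = "%j. cis (2 * pi * real j / real n)"
 have n2: "real (n\<^sup>2) > 0" using n by simp
 have "(\<Sum>j<n. cor ((norm (?D j))\<^sup>2 / real (n\<^sup>2)) * ?w j ^ m) - cinner ((U ^^ m) u) u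
   = (\<Sum>j<n. cinner (?w j ^ m *\<^sub>C ?D j) (?D j)) / of_nat (n\<^sup>2) - cinner ((U ^^ m) u) u"
  by (simp add: cinner_scaleC_left cinner_self_norm sum_divide_distrib mult.commute)
 also have "\<dots> = (\<Sum>j<n. cinner (?w j ^ m *\<^sub>C ?D j - (U ^^ m) (?D j)) (?D j)) / of_nat (n\<^sup>2)"
  using n by (simp add: cinner.diff_left sum_subtractf fourier_parseval diff_divide_distrib)
 finally have "cmod ((\<Sum>j<n. cor ((norm (?D j))\<^sup>2 / real (n\<^sup>2)) * ?w j ^ m) - cinner ((U ^^ m) u) u)
   = cmod (\<Sum>j<n. cinner (?w j ^ m *\<^sub>C ?D j - (U ^^ m) (?D j)) (?D j)) / real (n\<^sup>2)"
  by (simp add: norm_divide norm_power)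
 also have "\<dots> \<le> (\<Sum>j<n. 2 * real m * norm (?D j)) / real (n\<^sup>2)"
 proof (intro divide_right_mono sum_norm_le)
  fix j assume "j \<in> {..<n}"
  then have "norm (?w j ^ m *\<^sub>C ?D j - (U ^^ m) (?D j)) \<le> 2 * real m"
   using fourier_shift[OF n u, of j m] by (simp add: norm_minus_commute)
  then show "cmod (cinner (?w j ^ m *\<^sub>C ?D j - (U ^^ m) (?D j)) (?D j)) \<le> 2 * real m * norm (?D j)"
   by (intro order_trans[OF norm_cinner_le] mult_right_mono) auto
 qed simp
 also have "\<dots> = 2 * real m * (\<Sum>j<n. norm (?D j)) / real (n\<^sup>2)"
  by (simp add: sum_distrib_left)
 also have "\<dots> \<le> 2 * real m * (n * sqrt n) / real (n\<^sup>2)"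
 proof (intro divide_right_mono mult_left_mono)
  define r where "r = sqrt n"
  have r: "r > 0" "r * r = n" using n by (simp_all add: r_def)
  \<comment> \<open>The arithmetic-geometric mean inequality, weighted by the square root of
    \<open>n\<close>, which is the root mean square of the norms by Parseval.\<close>
  have "(\<Sum>j<n. norm (?D j)) \<le> (\<Sum>j<n. (r + (norm (?D j))\<^sup>2 / r) / 2)"
  proof (intro sum_mono)
   fix j
   have "0 \<le> (r - norm (?D j))\<^sup>2" by simp
   then have "2 * (norm (?D j) * r) \<le> r * r + (norm (?D j))\<^sup>2"
    by (simp add: power2_eq_square algebra_simps)
   then show "norm (?D j) \<le> (r + (norm (?D j))\<^sup>2 / r) / 2"
    using r(1) by (simp add: field_simps)
  qed
  also have "\<dots> = (n * r + real (n\<^sup>2) / r) / 2"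
   by (simp add: sum.distrib sum_divide_distrib[symmetric] fourier_norm_sum[OF u])
  also have "\<dots> = n * r" using r by (simp add: field_simps power2_eq_square flip: r(2))
  finally show "(\<Sum>j<n. norm (?D j)) \<le> n * sqrt n" by (simp add: r_def)
 qed auto
 also have "\<dots> = 2 * real m / sqrt n"
 proof -
  have "real n = sqrt n * sqrt n" by simp
  then have "n * sqrt n / real (n\<^sup>2) = 1 / sqrt n"
   using n by (simp add: power2_eq_square field_simps)
  then show ?thesis by (metis mult.assoc mult_1_right times_divide_eq_right)
 qed
 finally show ?thesis .
qed

text \<open>
 The approximating measures sit on the \<open>n\<close>-th roots of unity, weighted by the squared norms of the
 discrete Fourier coefficients of \<open>u, U u, \<dots>\<close>, so positivity is immediate.
\<close>

lemma herglotz: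
 assumes u: "norm u = 1"
 shows "\<exists>\<nu>. real_distribution \<nu> \<and> (\<forall>m. (LINT t|\<nu>. cis t ^ m) = cinner ((U ^^ m) u) u)"
proof -
 define W where "W n j = (norm (fourier_vec u n j))\<^sup>2 / real (n\<^sup>2)" for n j
 define P where "P n = point_measure {..<Suc n} (W (Suc n))" for n
 define A where "A n j = 2 * pi * real j / real (Suc n)" for n j
 define M where "M n = distr (P n) borel (A n)" for n
 have W0: "0 \<le> W n j" for n j by (simp add: W_def)
 have Wsum: "(\<Sum>j<Suc n. W (Suc n) j) = 1" for n
  using fourier_norm_sum[OF u, of "Suc n"] unfolding W_def sum_divide_distrib[symmetric] by simp
 have meas[measurable]: "A n \<in> borel_measurable (P n)" for n
  by (simp add: P_def measurable_def sets_point_measure space_point_measure)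
 have pP: "prob_space (P n)" for n
  by (rule prob_spaceI)
   (simp only: P_def space_point_measure emeasure_point_measure_finite[OF finite_lessThan subset_refl]
    sum_ennreal[OF W0] Wsum ennreal_1)
 have rd: "real_distribution (M n)" for n
  unfolding M_def real_distribution_def real_distribution_axioms_def
  using prob_space.prob_space_distr[OF pP meas] by simp
 have int: "(LINT t|M n. cis t ^ m) = (\<Sum>j<Suc n. cor (W (Suc n) j) * cis (2 * pi * real j / real (Suc n)) ^ m)" for n m
 proof -
  have c: "(%t. cis t ^ m) \<in> borel_measurable borel"
   by (intro borel_measurable_continuous_onI continuous_intros)
  show ?thesis
   unfolding M_def integral_distr[OF meas c]
   unfolding P_def by (subst lebesgue_integral_point_measure_finite)
    (simp_all only: finite_lessThan W0 A_def scaleR_conv_of_real)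
 qed
 have mom: "(%n. LINT t|M n. cis t ^ m) \<longlonglongrightarrow> cinner ((U ^^ m) u) u" for m
 proof (rule LIM_zero_cancel, rule Lim_null_comparison)
  show "\<forall>\<^sub>F n in sequentially. cmod ((LINT t|M n. cis t ^ m) - cinner ((U ^^ m) u) u) \<le> 2 * real m / sqrt (Suc n)"
   unfolding int W_def by (intro always_eventually allI fourier_moment u) simp
  show "(%n. 2 * real m / sqrt (real (Suc n))) \<longlonglongrightarrow> 0"
   by real_asymp
 qed
 have "tight M"
  unfolding tight_def
 proof (intro conjI allI impI rd)
  fix e :: real assume e: "0 < e"
  \<comment> \<open>Any fixed interval containing the angles from 0 to \<open>2 * pi\<close>
    witnesses tightness.\<close>
  have "measure (M n) {-1<..9} = 1" for n
  proof -
   have "2 * pi * real j / real (Suc n) \<in> {-1<..9}" if "j < Suc n" for j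
   proof -
    have "real j / real (Suc n) \<le> 1" "0 \<le> real j / real (Suc n)" using that by (auto simp: divide_simps)
    then have "2 * pi * (real j / real (Suc n)) \<le> 2 * pi * 1" by (intro mult_left_mono) auto
    moreover have "0 \<le> 2 * pi * (real j / real (Suc n))" by simp
    ultimately have "0 \<le> 2 * pi * real j / real (Suc n)" "2 * pi * real j / real (Suc n) \<le> 2 * pi"
     by (simp_all only: times_divide_eq_right mult_1_right)
    then show ?thesis using pi_less_4 unfolding greaterThanAtMost_iff by linarith
   qed
   then have e: "A n -` {-1<..9} \<inter> space (P n) = space (P n)"
    by (auto simp: P_def A_def space_point_measure)
   have "measure (M n) {-1<..9} = measure (P n) (space (P n))"
    unfolding M_def by (subst measure_distr) (simp_all add: e)
   then show ?thesis using prob_space.prob_space[OF pP] by simp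
  qed
  then show "\<exists>a b. a < b \<and> (\<forall>n. 1 - e < measure (M n) {a<..b})"
   using e by (intro exI[of _ "-1"] exI[of _ 9]) auto
 qed
 then obtain r \<nu> where r: "strict_mono r" and \<nu>: "real_distribution \<nu>" "weak_conv_m (M \<circ> r) \<nu>"
  using tight_imp_convergent_subsubsequence[of M "%n. n"] by (auto simp: strict_mono_def comp_def)
 have "(LINT t|\<nu>. cis t ^ m) = cinner ((U ^^ m) u) u" for m
 proof (rule LIMSEQ_unique)
  show "(%n. LINT t|(M \<circ> r) n. cis t ^ m) \<longlonglongrightarrow> (LINT t|\<nu>. cis t ^ m)"
  proof (rule weak_conv_imp_integral_bdd_continuous_conv[where B = 1])
   show "real_distribution ((M \<circ> r) n)" for n using rd by simp
   have "continuous_on UNIV (%t. cis t ^ m)" by (intro continuous_intros)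
   then show "isCont (%t. cis t ^ m) x" for x by (simp add: continuous_on_eq_continuous_at)
  qed (use \<nu> in \<open>simp_all add: norm_power comp_def\<close>)
  show "(%n. LINT t|(M \<circ> r) n. cis t ^ m) \<longlonglongrightarrow> cinner ((U ^^ m) u) u"
   using LIMSEQ_subseq_LIMSEQ[OF mom r] by (simp add: comp_def)
 qed
 then show ?thesis using \<nu>(1) by blast
qed

end

text \<open>Density of the range of \<open>1 - U\<close> excludes the eigenvalue 1. Since 1 is the
  image of infinity under \<open>cay\<close>, this is what allows measures on the circle to be moved
  to the line.\<close>

locale ell2_unitary = ell2_isometry +
 assumes U_surj: "\<exists>v. U v = u" and U_dense: "closure (range (%w. w - U w)) = UNIV"
begin

definition "U_mean n v = inverse (of_nat n :: complex) *\<^sub>C (\<Sum>k<n. (U ^^ k) v)"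

lemma norm_U_mean: "norm (U_mean n v) \<le> norm v"
proof (cases "n = 0")
 case False
 have "norm (\<Sum>k<n. (U ^^ k) v) \<le> (\<Sum>k<n. norm v)" by (intro sum_norm_le) (simp add: Um_norm)
 then have "inverse (real n) * norm (\<Sum>k<n. (U ^^ k) v) \<le> inverse (real n) * (real n * norm v)"
  by (intro mult_left_mono) simp_all
 also have "\<dots> = norm v" using False by simp
 finally show ?thesis by (simp add: U_mean_def norm_scaleC norm_inverse)
qed (simp add: U_mean_def)

text \<open>The mean ergodic theorem: the sums telescope on vectors \<open>w - U w\<close>, these
  are dense, and the means are contractions.\<close>

lemma U_mean_tendsto: "(%n. U_mean n v) \<longlonglongrightarrow> 0"
proof (rule metric_LIMSEQ_I)
 fix e :: real assume e: "0 < e"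
 have "v \<in> closure (range (%w. w - U w))" using U_dense by simp
 then obtain w where w: "dist (w - U w) v < e / 2"
  unfolding closure_approachable using half_gt_zero[OF e] by blast
 have diff: "U_mean n v = U_mean n (w - U w) + U_mean n (v - (w - U w))" for n
  by (simp add: U_mean_def Um_diff sum_subtractf scaleC.diff_right)
 have tele: "(\<Sum>k<n. (U ^^ k) (w - U w)) = w - (U ^^ n) w" for n
  by (induction n) (simp_all add: Um_diff funpow_swap1)
 have n1: "norm (U_mean n (w - U w)) \<le> 2 * norm w / real n" for n
 proof -
  have "norm (w - (U ^^ n) w) \<le> 2 * norm w"
   using norm_triangle_ineq4[of w "(U ^^ n) w"] by (simp add: Um_norm)
  then show ?thesis
   unfolding U_mean_def tele norm_scaleC norm_inverse norm_of_nat divide_inverse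
   by (subst mult.commute) (rule mult_right_mono, simp_all)
 qed
 obtain N :: nat where N: "2 * norm w / (e / 2) < real N" using reals_Archimedean2 by blast
 have "dist (U_mean n v) 0 < e" if "n \<ge> Suc N" for n
 proof -
  have "2 * norm w / (e / 2) < real n" using N that by linarith
  then have "2 * norm w / real n < e / 2" using e that by (simp add: field_simps)
  moreover have "norm (U_mean n (v - (w - U w))) < e / 2"
   using norm_U_mean[of n "v - (w - U w)"] w by (simp add: dist_norm norm_minus_commute)
  ultimately show ?thesis
   using n1[of n] norm_triangle_ineq[of "U_mean n (w - U w)" "U_mean n (v - (w - U w))"]
   unfolding diff[of n] by simp
 qed
 then show "\<exists>no. \<forall>n\<ge>no. dist (U_mean n v) 0 < e" by blast
qed

text \<open>The Cesaro means of the powers of \<open>cis t\<close> tend to the indicator of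
  \<open>cis t = 1\<close>, while their integrals tend to 0 by the ergodic theorem. So the Herglotz
  measure has no mass at 1, and its image under \<open>cay_inv\<close> loses nothing.\<close>

lemma spectral_prob_exists:
 "\<exists>\<mu>. prob_space \<mu> \<and> sets \<mu> = sets borel \<and>
  (\<forall>m. cor ((norm u)\<^sup>2) * (LINT x|\<mu>. cay x ^ m) = cinner ((U ^^ m) u) u)"
proof (cases "u = 0")
 case True
 then show ?thesis
  by (intro exI[of _ "return borel (0::real)"]) (simp add: prob_space_return Um_zero)
next
 case False
 define v where "v = cor (inverse (norm u)) *\<^sub>C u"
 have nv: "norm v = 1" using False by (simp add: v_def norm_scaleC norm_inverse)
 obtain \<nu> where \<nu>: "real_distribution \<nu>" and mom: "!!m. (LINT t|\<nu>. cis t ^ m) = cinner ((U ^^ m) v) v"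
  using herglotz[OF nv] by blast
 interpret real_distribution \<nu> by (rule \<nu>)
 have cis_meas[measurable]: "cis \<in> borel_measurable borel"
  by (intro borel_measurable_continuous_onI continuous_intros)
 define Z where "Z = {t. cis t = 1}"
 have Z: "Z \<in> sets borel"
 proof -
  have "cis -` {1} \<inter> space borel \<in> sets borel" by (rule measurable_sets[OF cis_meas]) simp
  then show ?thesis by (simp add: Z_def vimage_def)
 qed
 have "(%n. LINT t|\<nu>. inverse (of_nat n) * (\<Sum>k<n. cis t ^ k)) \<longlonglongrightarrow> (LINT t|\<nu>. indicator Z t)"
 proof (rule integral_dominated_convergence[where w = "%_. 1"])
  show "AE t in \<nu>. (%n. inverse (of_nat n) * (\<Sum>k<n. cis t ^ k)) \<longlonglongrightarrow> indicator Z t"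
  proof (rule AE_I2)
   fix t
   show "(%n. inverse (of_nat n) * (\<Sum>k<n. cis t ^ k)) \<longlonglongrightarrow> indicator Z t"
   proof (cases "cis t = 1")
    case True
    then have "\<forall>\<^sub>F n in sequentially. inverse (of_nat n) * (\<Sum>k<n. cis t ^ k) = 1"
     unfolding eventually_sequentially by (intro exI[of _ 1]) simp
    then show ?thesis using True by (simp add: tendsto_eventually Z_def)
   next
    case False
    have "(%n. inverse (of_nat n) * (\<Sum>k<n. cis t ^ k)) \<longlonglongrightarrow> 0"
    proof (rule Lim_null_comparison)
     show "\<forall>\<^sub>F n in sequentially. cmod (inverse (of_nat n) * (\<Sum>k<n. cis t ^ k)) \<le> inverse (real n) * (2 / cmod (cis t - 1))"
     proof (intro always_eventually allI)
      fix n
      have "cmod (cis t ^ n - 1) \<le> 2"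
       using norm_triangle_ineq4[of "cis t ^ n" 1] by (simp add: norm_power)
      then show "cmod (inverse (of_nat n) * (\<Sum>k<n. cis t ^ k)) \<le> inverse (real n) * (2 / cmod (cis t - 1))"
       unfolding geometric_sum[OF False] norm_mult norm_inverse norm_divide norm_of_nat
       by (intro mult_left_mono divide_right_mono) auto
     qed
     show "(%n. inverse (real n) * (2 / cmod (cis t - 1))) \<longlonglongrightarrow> 0"
      by (rule tendsto_mult_left_zero[OF lim_inverse_n])
    qed
    then show ?thesis using False by (simp add: Z_def)
   qed
  qed
  show "AE t in \<nu>. norm (inverse (of_nat n) * (\<Sum>k<n. cis t ^ k)) \<le> 1" for n
  proof (rule AE_I2)
   fix t
   have "cmod (\<Sum>k<n. cis t ^ k) \<le> (\<Sum>k<n. 1)" by (intro sum_norm_le) (simp add: norm_power)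
   then show "norm (inverse (of_nat n) * (\<Sum>k<n. cis t ^ k)) \<le> 1"
    by (cases "n = 0") (simp_all add: norm_mult norm_inverse norm_divide field_simps)
  qed
  show "(indicator Z :: real => complex) \<in> borel_measurable \<nu>" using Z by simp
 qed simp_all
 moreover have "(LINT t|\<nu>. inverse (of_nat n) * (\<Sum>k<n. cis t ^ k)) = cinner (U_mean n v) v" for n
 proof -
  have "integrable \<nu> (%t. cis t ^ k)" for k
   by (rule integrable_const_bound[of _ 1]) (auto simp: norm_power)
  then show ?thesis
   by (simp add: mom U_mean_def cinner_scaleC_left cinner.sum_left)
 qed
 moreover have "(%n. cinner (U_mean n v) v) \<longlonglongrightarrow> 0"
  using cinner.tendsto[OF U_mean_tendsto tendsto_const, of v v] by simp
 ultimately have "(LINT t|\<nu>. indicator Z t :: complex) = 0"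
  using LIMSEQ_unique by auto
 moreover have "(LINT t|\<nu>. indicator Z t :: complex) = cor (prob Z)"
 proof -
  have "(LINT t|\<nu>. indicator Z t :: complex) = (LINT t|\<nu>. cor (indicator Z t))"
   by (intro Bochner_Integration.integral_cong refl) (simp add: indicator_def)
  then show ?thesis using Z by (simp only: integral_complex_of_real) simp
 qed
 ultimately have "prob Z = 0" by simp
 then have AE: "AE t in \<nu>. cis t \<noteq> 1"
  using Z by (intro AE_I[of _ _ Z]) (auto simp: Z_def emeasure_eq_measure)
 have g: "(%t. cay_inv (cis t)) \<in> borel_measurable \<nu>"
  unfolding cay_inv_def by measurable
 define \<mu> where "\<mu> = distr \<nu> borel (%t. cay_inv (cis t))"
 have int: "(LINT x|\<mu>. cay x ^ m) = cinner ((U ^^ m) v) v" for m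
 proof -
  have "(LINT x|\<mu>. cay x ^ m) = (LINT t|\<nu>. cay (cay_inv (cis t)) ^ m)"
   unfolding \<mu>_def by (rule integral_distr[OF g]) (intro borel_measurable_power bborel_measurable bborel_cay)
  also have "\<dots> = (LINT t|\<nu>. cis t ^ m)"
  proof (rule integral_cong_AE)
   show "(%t. cay (cay_inv (cis t)) ^ m) \<in> borel_measurable \<nu>"
    using measurable_compose[OF g bborel_measurable[OF bborel_cay]] by (rule borel_measurable_power)
   show "AE t in \<nu>. cay (cay_inv (cis t)) ^ m = cis t ^ m"
    using AE by eventually_elim (simp add: cay_cay_inv)
  qed simp
  finally show ?thesis by (simp add: mom)
 qed
 have u: "u = cor (norm u) *\<^sub>C v" using False by (simp add: v_def scaleC_scaleC)
 have "cor ((norm u)\<^sup>2) * cinner ((U ^^ m) v) v = cinner ((U ^^ m) u) u" for m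
 proof -
  have "cor ((norm u)\<^sup>2) * cinner ((U ^^ m) v) v =
    cinner ((U ^^ m) (cor (norm u) *\<^sub>C v)) (cor (norm u) *\<^sub>C v)"
   by (simp add: Um_scale cinner_scaleC_left cinner_scaleC_right power2_eq_square)
  then show ?thesis by (simp only: u[symmetric])
 qed
 then show ?thesis
  using int prob_space_distr[OF g] by (intro exI[of _ \<mu>]) (simp add: \<mu>_def)
qed

text \<open>A probability measure even at \<open>u = 0\<close>; the weight
  \<open>(norm u)\<^sup>2\<close> is kept outside, in \<open>I\<close>.\<close>

definition "spr u = (SOME \<mu>. prob_space \<mu> \<and> sets \<mu> = sets borel \<and>
  (\<forall>m. cor ((norm u)\<^sup>2) * (LINT x|\<mu>. cay x ^ m) = cinner ((U ^^ m) u) u))"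

lemma spr: "prob_space (spr u)" "sets (spr u) = sets borel"
 "cor ((norm u)\<^sup>2) * (LINT x|spr u. cay x ^ m) = cinner ((U ^^ m) u) u"
 using someI_ex[OF spectral_prob_exists[of u]] unfolding spr_def by auto

definition "I u f = cor ((norm u)\<^sup>2) * (LINT x|spr u. f x)"

lemma spr_integrable: "bborel f ==> integrable (spr u) f"
proof -
 interpret prob_space "spr u" by (rule spr)
 assume f: "bborel f"
 then obtain B where B: "!!x. cmod (f x) \<le> B" by (rule bborelE) (rule that)
 show ?thesis
  by (rule integrable_const_bound[of _ B])
   (use B f spr(2) in \<open>auto dest!: bborel_measurable cong: measurable_cong_sets\<close>)
qed

lemma I_add: "bborel f ==> bborel g ==> I u (%x. f x + g x) = I u f + I u g"
 by (simp add: I_def spr_integrable distrib_left)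

lemma I_scale: "bborel f ==> I u (%x. c * f x) = c * I u f"
 by (simp add: I_def spr_integrable mult_ac)

lemma I_limit:
 assumes "!!n. bborel (s n)" "!!n x. cmod (s n x) \<le> B" "!!x. (%n. s n x) \<longlonglongrightarrow> f x" "bborel f"
 shows "(%n. I u (s n)) \<longlonglongrightarrow> I u f"
 unfolding I_def
proof (intro tendsto_intros integral_dominated_convergence[where w = "%_. B"])
 interpret prob_space "spr u" by (rule spr)
 show "integrable (spr u) (%_. B)" by simp
qed (use assms spr(2)[of u] in \<open>auto dest: bborel_measurable cong: measurable_cong_sets\<close>)

lemma I_bound:
 assumes f: "bborel f" and B: "!!x. cmod (f x) \<le> B" shows "cmod (I u f) \<le> B * (norm u)\<^sup>2"
proof -
 interpret prob_space "spr u" by (rule spr)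
 have "cmod (LINT x|spr u. f x) \<le> (LINT x|spr u. cmod (f x))" by (rule integral_norm_bound)
 also have "\<dots> \<le> (LINT x|spr u. B)"
  by (intro integral_mono integrable_norm spr_integrable f) (use B in auto)
 finally have "cmod (LINT x|spr u. f x) \<le> B" by (simp add: prob_space)
 then show ?thesis
  unfolding I_def norm_mult norm_of_real by (subst mult.commute) (auto intro: mult_right_mono)
qed

lemma I_cnj: "bborel f ==> I u (%x. cnj (f x)) = cnj (I u f)"
 by (simp add: I_def)

lemma I_cay: "I u (%x. cay x ^ a * cnj (cay x) ^ b) = cinner ((U ^^ a) u) ((U ^^ b) u)"
proof -
 have red: "cay x ^ (b + d) * cnj (cay x) ^ b = cay x ^ d" for x b d
 proof -
  have "cay x ^ (b + d) * cnj (cay x) ^ b = (cay x * cnj (cay x)) ^ b * cay x ^ d"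
   by (simp add: power_add power_mult_distrib del: cay_cnj)
  then show ?thesis by simp
 qed
 have c: "cinner ((U ^^ (b + d)) u) ((U ^^ b) u) = cinner ((U ^^ d) u) u" for b d u
  by (simp add: funpow_add Um_cinner)
 have ge: "I u (%x. cay x ^ (b + d) * cnj (cay x) ^ b) = cinner ((U ^^ (b + d)) u) ((U ^^ b) u)" for b d
  unfolding red c I_def by (rule spr(3))
 show ?thesis
 proof (cases "b \<le> a")
  case True
  then show ?thesis using ge[of b "a - b"] by simp
 next
  case False
  have "bborel (%x. cay x ^ b * cnj (cay x) ^ a)" by (intro bborel_mult bborel_power bborel_cnj bborel_cay)
  from I_cnj[OF this, of u] show ?thesis
   using ge[of a "b - a"] False cinner_commute[of "(U ^^ a) u" "(U ^^ b) u"]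
   by (simp add: mult.commute)
 qed
qed

text \<open>The measures \<open>spr\<close> were chosen for each vector separately, so nothing
  relates the one at \<open>u + v\<close> to those at \<open>u\<close> and \<open>v\<close>.
  Sesquilinearity is therefore proved on monomials, where \<open>bf_cay\<close> computes the form
  from \<open>U\<close>, and extended by \<open>bborel_functional_zero\<close>.\<close>

definition "bf f u v = (\<Sum>k<4. \<i> ^ k * I (u + \<i> ^ k *\<^sub>C v) f) / 4"

lemma bf_add: "bborel f ==> bborel g ==> bf (%x. f x + g x) u v = bf f u v + bf g u v"
 by (simp add: bf_def I_add distrib_left sum.distrib add_divide_distrib)

lemma bf_scale: "bborel f ==> bf (%x. c * f x) u v = c * bf f u v"
 by (simp add: bf_def I_scale sum_distrib_left mult.left_commute)

lemma bf_limit: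
 assumes "!!n. bborel (s n)" "!!n x. cmod (s n x) \<le> B" "!!x. (%n. s n x) \<longlonglongrightarrow> f x" "bborel f"
 shows "(%n. bf (s n) u v) \<longlonglongrightarrow> bf f u v"
 unfolding bf_def by (intro tendsto_intros I_limit[OF assms]) simp

lemma bf_cay: "bf (%x. cay x ^ a * cnj (cay x) ^ b) u v = cinner ((U ^^ a) u) ((U ^^ b) v)"
 unfolding bf_def I_cay
 by (rule cinner_polarization[of "U ^^ a" "U ^^ b", symmetric]) (simp_all add: Um_add Um_scale)

lemma bf_shift:
 assumes f: "bborel f"
 shows "bf (%x. cay x ^ a * cnj (cay x) ^ b * f x) u v = bf f ((U ^^ a) u) ((U ^^ b) v)"
proof -
 have m: "bborel (%x. cay x ^ a * cnj (cay x) ^ b)"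
  by (intro bborel_mult bborel_power bborel_cnj bborel_cay)
 have "bf (%x. cay x ^ a * cnj (cay x) ^ b * f x) u v - bf f ((U ^^ a) u) ((U ^^ b) v) = 0"
 proof (rule bborel_functional_zero[OF _ _ _ _ f])
  fix s f B
  assume s: "!!n. bborel (s n)" "!!n x. cmod (s n x) \<le> B" "!!x. (%n. s n x) \<longlonglongrightarrow> f x" "bborel f"
  show "(%n. bf (%x. cay x ^ a * cnj (cay x) ^ b * s n x) u v - bf (s n) ((U ^^ a) u) ((U ^^ b) v))
   \<longlonglongrightarrow> bf (%x. cay x ^ a * cnj (cay x) ^ b * f x) u v - bf f ((U ^^ a) u) ((U ^^ b) v)"
   by (intro tendsto_diff bf_limit[OF s] bf_limit[where B = B] bborel_mult[OF m] s tendsto_intros)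
    (use s(2) in \<open>simp add: norm_mult norm_power\<close>)
 next
  fix a' b'
  have "cay x ^ a * cnj (cay x) ^ b * (cay x ^ a' * cnj (cay x) ^ b') = cay x ^ (a' + a) * cnj (cay x) ^ (b' + b)" for x
   by (simp add: power_add mult_ac)
  then show "bf (%x. cay x ^ a * cnj (cay x) ^ b * (cay x ^ a' * cnj (cay x) ^ b')) u v
    - bf (%x. cay x ^ a' * cnj (cay x) ^ b') ((U ^^ a) u) ((U ^^ b) v) = 0"
   by (simp only: bf_cay funpow_add comp_apply) simp
 next
  fix f g assume fg: "bborel f" "bborel g"
  show "bf (%x. cay x ^ a * cnj (cay x) ^ b * (f x + g x)) u v - bf (%x. f x + g x) ((U ^^ a) u) ((U ^^ b) v) =
   bf (%x. cay x ^ a * cnj (cay x) ^ b * f x) u v - bf f ((U ^^ a) u) ((U ^^ b) v) +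
   (bf (%x. cay x ^ a * cnj (cay x) ^ b * g x) u v - bf g ((U ^^ a) u) ((U ^^ b) v))"
   using bf_add[OF bborel_mult[OF m fg(1)] bborel_mult[OF m fg(2)]] bf_add[OF fg]
   by (simp add: distrib_left)
 next
  fix c f assume f: "bborel f"
  show "bf (%x. cay x ^ a * cnj (cay x) ^ b * (c * f x)) u v - bf (%x. c * f x) ((U ^^ a) u) ((U ^^ b) v) =
   c * (bf (%x. cay x ^ a * cnj (cay x) ^ b * f x) u v - bf f ((U ^^ a) u) ((U ^^ b) v))"
   using bf_scale[OF bborel_mult[OF m f], of c] bf_scale[OF f, of c]
   by (simp add: right_diff_distrib mult.left_commute)
 qed
 then show ?thesis by simp
qed

lemma bf_add_left: "bborel f ==> bf f (u + u') v = bf f u v + bf f u' v"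
proof -
 assume f: "bborel f"
 have "bf f (u + u') v - bf f u v - bf f u' v = 0"
  by (rule bborel_functional_zero[OF _ _ _ _ f])
   (auto simp: bf_add bf_scale bf_cay Um_add cinner_add_left algebra_simps intro!: tendsto_intros bf_limit)
 then show ?thesis by (simp add: algebra_simps)
qed

lemma bf_scale_left: "bborel f ==> bf f (c *\<^sub>C u) v = c * bf f u v"
proof -
 assume f: "bborel f"
 have "bf f (c *\<^sub>C u) v - c * bf f u v = 0"
  by (rule bborel_functional_zero[OF _ _ _ _ f])
   (auto simp: bf_add bf_scale bf_cay Um_scale cinner_scaleC_left algebra_simps intro!: tendsto_intros bf_limit)
 then show ?thesis by simp
qed

lemma bf_add_right: "bborel f ==> bf f u (v + v') = bf f u v + bf f u v'"
proof -
 assume f: "bborel f"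
 have "bf f u (v + v') - bf f u v - bf f u v' = 0"
  by (rule bborel_functional_zero[OF _ _ _ _ f])
   (auto simp: bf_add bf_scale bf_cay Um_add cinner_add_right algebra_simps intro!: tendsto_intros bf_limit)
 then show ?thesis by (simp add: algebra_simps)
qed

lemma bf_scale_right: "bborel f ==> bf f u (c *\<^sub>C v) = cnj c * bf f u v"
proof -
 assume f: "bborel f"
 have "bf f u (c *\<^sub>C v) - cnj c * bf f u v = 0"
  by (rule bborel_functional_zero[OF _ _ _ _ f])
   (auto simp: bf_add bf_scale bf_cay Um_scale cinner_scaleC_right algebra_simps intro!: tendsto_intros bf_limit)
 then show ?thesis by simp
qed

lemma bf_diag: "bborel f ==> bf f u u = I u f"
proof -
 assume f: "bborel f"
 have "bf f u u - I u f = 0"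
  by (rule bborel_functional_zero[OF _ _ _ _ f])
   (auto simp: bf_add bf_scale I_add I_scale bf_cay I_cay algebra_simps intro!: tendsto_intros bf_limit I_limit)
 then show ?thesis by simp
qed

lemma bf_cnj: "bborel f ==> bf (%x. cnj (f x)) v u = cnj (bf f u v)"
proof -
 assume f: "bborel f"
 have "bf f u v - cnj (bf (%x. cnj (f x)) v u) = 0"
 proof (rule bborel_functional_zero[OF _ _ _ _ f])
  show "(%n. bf (s n) u v - cnj (bf (%x. cnj (s n x)) v u)) \<longlonglongrightarrow> bf f u v - cnj (bf (%x. cnj (f x)) v u)"
   if "!!n. bborel (s n)" "!!n x. cmod (s n x) \<le> B" "!!x. (%n. s n x) \<longlonglongrightarrow> f x" "bborel f" for s f B
   by (intro tendsto_intros bf_limit[OF that] bf_limit[where B = B]) (use that in auto)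
  show "bf (%x. cay x ^ a * cnj (cay x) ^ b) u v - cnj (bf (%x. cnj (cay x ^ a * cnj (cay x) ^ b)) v u) = 0" for a b
   using bf_cay[of b a v u] cinner_commute[of "(U ^^ b) v" "(U ^^ a) u"] by (simp add: bf_cay mult.commute)
 qed (auto simp: bf_add bf_scale bborel_cnj algebra_simps)
 then show ?thesis by (simp add: algebra_simps)
qed

definition "proj S u = (SOME t. \<forall>v. cinner t v = bf (indicator S) u v)"

lemma cinner_proj: "S \<in> sets borel ==> cinner (proj S u) v = bf (indicator S) u v"
proof -
 assume S: "S \<in> sets borel"
 have "\<exists>t. \<forall>v. cinner t v = bf (indicator S) u v"
 proof (rule polar_form_represented[where J = "%w. I w (indicator S)" and C = 1 and u = u])
  show "cmod (I w (indicator S)) \<le> 1 * (norm w)\<^sup>2" for w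
   by (rule I_bound) (use S in \<open>auto simp: indicator_def\<close>)
 qed (rule bf_def bf_add_right[OF bborel_indicator[OF S]] bf_scale_right[OF bborel_indicator[OF S]])+
 then show ?thesis unfolding proj_def by (rule someI2_ex) blast
qed

lemma proj_eqI: "S \<in> sets borel ==> (!!w. bf (indicator S) u w = cinner v w) ==> proj S u = v"
 by (rule cinner_eqI) (simp add: cinner_proj)

lemma proj_add: "S \<in> sets borel ==> proj S (u + v) = proj S u + proj S v"
 by (rule proj_eqI) (simp_all add: bf_add_left cinner_add_left cinner_proj)

lemma proj_scale: "S \<in> sets borel ==> proj S (c *\<^sub>C u) = c *\<^sub>C proj S u"
 by (rule proj_eqI) (simp_all add: bf_scale_left cinner_scaleC_left cinner_proj)

lemma proj_sym: "S \<in> sets borel ==> cinner (proj S u) v = cinner u (proj S v)"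
proof -
 assume S: "S \<in> sets borel"
 have "(%x. cnj (indicator S x)) = (indicator S :: real => complex)" by (auto simp: indicator_def)
 then have "bf (indicator S) v u = cnj (bf (indicator S) u v)" using bf_cnj[of "indicator S" v u] S by simp
 then show ?thesis using cinner_commute[of u "proj S v"] S by (simp add: cinner_proj)
qed

lemma proj_U: "S \<in> sets borel ==> U (proj S u) = proj S (U u)"
proof (rule cinner_eqI)
 fix w assume S: "S \<in> sets borel"
 obtain v where v: "w = U v" using U_surj[of w] by metis
 have "bf (indicator S) u v = bf (indicator S) (U u) (U v)"
  using bf_shift[OF bborel_indicator[OF S], of 1 1 u v] by simp
 then show "cinner (U (proj S u)) w = cinner (proj S (U u)) w"
  by (simp add: v U_cinner cinner_proj S)
qed

lemma proj_Um: "S \<in> sets borel ==> (U ^^ m) (proj S u) = proj S ((U ^^ m) u)"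
 by (induction m) (simp_all add: proj_U)

text \<open>The calculus is multiplicative for one indicator factor: on a monomial both sides reduce
  to \<open>bf (indicator S)\<close> at powers of \<open>U\<close>, because the projections commute
  with \<open>U\<close>.\<close>

lemma proj_Int:
 assumes S: "S \<in> sets borel" and R: "R \<in> sets borel"
 shows "proj S (proj R u) = proj (S \<inter> R) u"
proof (rule cinner_eqI)
 fix v
 have "bf (%x. indicator S x * f x) u v - bf f u (proj S v) = 0" if f: "bborel f" for f
 proof (rule bborel_functional_zero[OF _ _ _ _ f])
  fix s f B
  assume s: "!!n. bborel (s n)" "!!n x. cmod (s n x) \<le> B" "!!x. (%n. s n x) \<longlonglongrightarrow> f x" "bborel f"
  have "0 \<le> B" using order_trans[OF norm_ge_zero s(2)] .
  then have "cmod (indicator S x * s n x) \<le> B" for n x using s(2)[of n x] by (auto simp: indicator_def)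
  then show "(%n. bf (%x. indicator S x * s n x) u v - bf (s n) u (proj S v))
   \<longlonglongrightarrow> bf (%x. indicator S x * f x) u v - bf f u (proj S v)"
   by (intro tendsto_diff bf_limit[OF s] bf_limit[where B = B] bborel_mult bborel_indicator S s tendsto_intros)
 next
  fix a b
  have "bf (%x. indicator S x * (cay x ^ a * cnj (cay x) ^ b)) u v = bf (indicator S) ((U ^^ a) u) ((U ^^ b) v)"
   using bf_shift[OF bborel_indicator[OF S], of a b u v] by (simp add: mult_ac)
  then show "bf (%x. indicator S x * (cay x ^ a * cnj (cay x) ^ b)) u v
    - bf (%x. cay x ^ a * cnj (cay x) ^ b) u (proj S v) = 0"
   using S by (simp add: bf_cay proj_Um proj_sym[symmetric] cinner_proj)
 next
  fix f g assume fg: "bborel f" "bborel g"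
  show "bf (%x. indicator S x * (f x + g x)) u v - bf (%x. f x + g x) u (proj S v) =
   bf (%x. indicator S x * f x) u v - bf f u (proj S v) +
   (bf (%x. indicator S x * g x) u v - bf g u (proj S v))"
   using bf_add[OF bborel_mult[OF bborel_indicator[OF S] fg(1)] bborel_mult[OF bborel_indicator[OF S] fg(2)]] bf_add[OF fg]
   by (simp add: distrib_left)
 next
  fix c f assume f: "bborel f"
  show "bf (%x. indicator S x * (c * f x)) u v - bf (%x. c * f x) u (proj S v) =
   c * (bf (%x. indicator S x * f x) u v - bf f u (proj S v))"
   using bf_scale[OF bborel_mult[OF bborel_indicator[OF S] f], of c] bf_scale[OF f, of c]
   by (simp add: right_diff_distrib mult.left_commute)
 qed
 from this[OF bborel_indicator[OF R]]
 have "bf (indicator (S \<inter> R)) u v = bf (indicator R) u (proj S v)"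
  by (simp add: indicator_inter_arith[symmetric])
 then show "cinner (proj S (proj R u)) v = cinner (proj (S \<inter> R) u) v"
  using S R by (simp add: cinner_proj[of "S \<inter> R"] cinner_proj[of R] proj_sym[of S])
qed

lemma is_pvm_proj: "is_pvm proj"
 unfolding is_pvm_def
proof (intro conjI ballI allI impI)
 show "proj UNIV = id"
 proof
  fix u
  have "bf (indicator UNIV) u w = cinner u w" for w
   using bf_cay[of 0 0 u w] by (simp add: indicator_def[abs_def])
  then show "proj UNIV u = id u" by (intro proj_eqI) auto
 qed
next
 fix A :: "nat => real set" and u
 assume A: "range A \<subseteq> sets borel \<and> disjoint_family A"
 have Ab: "A i \<in> sets borel" for i using A by auto
 have disj: "i \<noteq> j ==> x \<in> A i ==> x \<in> A j ==> False" for i j x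
  using A by (auto simp: disjoint_family_on_def)
 let ?V = "%n. \<Union>i. A (i + n)"
 have Vb: "?V n \<in> sets borel" for n using Ab by auto
 have split: "proj (\<Union>i. A i) u - (\<Sum>i<n. proj (A i) u) = proj (?V n) u" for n
 proof (induction n)
  case (Suc n)
  have "bf (indicator (?V n)) u w = bf (%x. indicator (A n) x + indicator (?V (Suc n)) x) u w" for w
  proof -
   have "(indicator (?V n) :: real => complex) = (%x. indicator (A n) x + indicator (?V (Suc n)) x)"
   proof
    fix x
    have 1: "x \<in> ?V n \<longleftrightarrow> x \<in> A n \<or> x \<in> ?V (Suc n)"
    proof
     assume "x \<in> ?V n"
     then obtain i where "x \<in> A (i + n)" by blast
     then show "x \<in> A n \<or> x \<in> ?V (Suc n)" by (cases i) auto
    next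
     assume "x \<in> A n \<or> x \<in> ?V (Suc n)"
     then have "x \<in> A (0 + n) \<or> (\<exists>i. x \<in> A (Suc i + n))" by auto
     then show "x \<in> ?V n" by blast
    qed
    have 2: "\<not> (x \<in> A n \<and> x \<in> ?V (Suc n))"
    proof
     assume a: "x \<in> A n \<and> x \<in> ?V (Suc n)"
     then obtain j where "x \<in> A (j + Suc n)" by blast
     then show False using disj[of n "j + Suc n" x] a by simp
    qed
    show "indicator (?V n) x = (indicator (A n) x + indicator (?V (Suc n)) x :: complex)"
     using 1 2 by (auto simp: indicator_def)
   qed
   then show ?thesis by simp
  qed
  then have "proj (?V n) u = proj (A n) u + proj (?V (Suc n)) u"
   by (intro proj_eqI Vb) (simp only: bf_add[OF bborel_indicator[OF Ab] bborel_indicator[OF Vb]]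
     cinner_add_left cinner_proj[OF Ab] cinner_proj[OF Vb])
  then show ?case using Suc by (simp add: algebra_simps)
 qed simp
 \<comment> \<open>By idempotence and symmetry the squared norm of a tail is the diagonal integral
   of its indicator, so dominated convergence makes the tails vanish.\<close>
 have n: "cor ((norm (proj (?V n) u))\<^sup>2) = I u (indicator (?V n))" for n
  using proj_sym[OF Vb[of n], of "proj (?V n) u" u]
  by (simp only: cinner_self_norm[symmetric] proj_Int[OF Vb Vb] Int_absorb cinner_proj[OF Vb]
    bf_diag[OF bborel_indicator[OF Vb]])
 have "(%n. I u (indicator (?V n))) \<longlonglongrightarrow> I u (%_. 0)"
 proof (rule I_limit[where B = 1])
  fix x
  show "(%n. indicator (?V n) x :: complex) \<longlonglongrightarrow> 0"
  proof (cases "\<exists>i. x \<in> A i")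
   case True
   then obtain i where i: "x \<in> A i" by blast
   have "x \<notin> ?V n" if "n \<ge> Suc i" for n
   proof
    assume "x \<in> ?V n"
    then obtain j where "x \<in> A (j + n)" by blast
    moreover have "i \<noteq> j + n" using that by simp
    ultimately show False using disj i by blast
   qed
   then have "\<forall>\<^sub>F n in sequentially. (indicator (?V n) x :: complex) = 0"
    unfolding eventually_sequentially by (intro exI[of _ "Suc i"]) auto
   then show ?thesis by (rule tendsto_eventually)
  qed simp
 qed (auto simp: indicator_def Vb)
 moreover have "I u (%_. 0) = 0" by (simp add: I_def)
 ultimately have "(%n. cor ((norm (proj (?V n) u))\<^sup>2)) \<longlonglongrightarrow> 0" by (simp only: n)
 then have "(%n. (norm (proj (?V n) u))\<^sup>2) \<longlonglongrightarrow> 0"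
  by (drule_tac tendsto_Re) (simp only: Re_complex_of_real zero_complex.sel)
 then have "(%n. sqrt ((norm (proj (?V n) u))\<^sup>2)) \<longlonglongrightarrow> sqrt 0" by (rule tendsto_real_sqrt)
 then have "(%n. norm (proj (?V n) u)) \<longlonglongrightarrow> 0" by (simp only: real_sqrt_abs abs_norm_cancel real_sqrt_zero)
 then have "(%n. proj (\<Union>i. A i) u - (\<Sum>i<n. proj (A i) u)) \<longlonglongrightarrow> 0"
  unfolding split by (rule tendsto_norm_zero_cancel)
 then have "(%n. proj (\<Union>i. A i) u - (proj (\<Union>i. A i) u - (\<Sum>i<n. proj (A i) u))) \<longlonglongrightarrow> proj (\<Union>i. A i) u - 0"
  by (intro tendsto_intros)
 then show "(%i. proj (A i) u) sums proj (\<Union>i. A i) u" by (simp add: sums_def)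
qed (simp_all add: proj_add proj_scale proj_sym proj_Int)

lemma spectral_measure_of_unitary: "\<exists>E. is_pvm E \<and> scalc E cay = U"
proof -
 interpret pvm proj by (rule pvm.intro[OF is_pvm_proj])
 have "sform proj f u v = bf f u v" if "bborel f" for f u v
  using that
 proof (induction rule: bborel_induct)
  case (limit s f B)
  show ?case
   using sform_limit[OF limit(1-4), of u v] bf_limit[OF limit(1-4), of u v]
   by (simp add: limit(5) LIMSEQ_unique)
 qed (simp_all add: sform_indicator cinner_proj sform_add sform_scale bf_add bf_scale)
 then have "scalc proj cay u = U u" for u
  using bf_cay[of 1 0 u] by (intro T_eqI) simp_all
 then show ?thesis using is_pvm_proj by blast
qed

end

section \<open>The spectral theorem for unbounded self-adjoint operators\<close>

definition trunc :: "nat => real => complex" where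
 "trunc m x = (if \<bar>x\<bar> \<le> real m then cor x else 0)"

lemma norm_trunc: "cmod (trunc m x) \<le> real m" "cmod (trunc m x) \<le> \<bar>x\<bar>"
 by (auto simp: trunc_def)

lemma bborel_trunc [simp]: "bborel (trunc m)"
 by (rule bborelI[OF _ norm_trunc(1)]) (unfold trunc_def[abs_def], measurable)

lemma trunc_tendsto: "(%m. trunc m x) \<longlonglongrightarrow> cor x"
proof (rule tendsto_eventually)
 obtain N :: nat where "\<bar>x\<bar> < real N" using reals_Archimedean2 by blast
 then show "\<forall>\<^sub>F m in sequentially. trunc m x = cor x"
  unfolding eventually_sequentially trunc_def by (intro exI[of _ N]) auto
qed

lemma trunc_cnj [simp]: "cnj (trunc m x) = trunc m x"
 by (simp add: trunc_def)

context pvm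
begin

abbreviation "dom_id \<equiv> {u. integrable (mu u) (%x. (cmod (cor x))\<^sup>2)}"

lemma spectral_integral_id_iff:
 "(u, v) \<in> spectral_integral E cor \<longleftrightarrow>
  u \<in> dom_id \<and> (\<forall>w\<in>dom_id. cinner v w = sform E cor u w)"
 by (auto simp: spectral_integral_def sform_def Let_def)

text \<open>Monotone convergence turns square integrability of the identity into boundedness of the
  truncated operators, a condition from which linearity of the domain can be read off.\<close>

lemma dom_id_iff: "u \<in> dom_id \<longleftrightarrow> (\<exists>C. \<forall>m. norm (T (trunc m) u) \<le> C)"
proof
 interpret finite_measure "mu u" by (rule finite_measure_mu)
 assume "u \<in> dom_id"
 then have i: "integrable (mu u) (%x. (cmod (cor x))\<^sup>2)" by simp
 define C where "C = sqrt (LINT x|mu u. (cmod (cor x))\<^sup>2)"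
 have "norm (T (trunc m) u) \<le> C" for m
 proof -
  have "(norm (T (trunc m) u))\<^sup>2 = (LINT x|mu u. (cmod (trunc m x))\<^sup>2)" by (simp add: norm_T_square)
  also have "\<dots> \<le> (LINT x|mu u. (cmod (cor x))\<^sup>2)"
   by (intro integral_mono i domain_bborel power_mono) (simp_all add: norm_trunc)
  finally show ?thesis unfolding C_def by (rule real_le_rsqrt)
 qed
 then show "\<exists>C. \<forall>m. norm (T (trunc m) u) \<le> C" by blast
next
 assume "\<exists>C. \<forall>m. norm (T (trunc m) u) \<le> C"
 then obtain C where C: "!!m. norm (T (trunc m) u) \<le> C" by blast
 let ?f = "%m x. (cmod (trunc m x))\<^sup>2"
 have int: "integrable (mu u) (?f m)" for m by (rule domain_bborel) simp
 have mono: "?f m x \<le> ?f n x" if "m \<le> n" for m n x using that by (auto simp: trunc_def)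
 have "incseq (%m. LINT x|mu u. ?f m x)"
  unfolding incseq_def by (intro allI impI integral_mono int mono)
 moreover have "(LINT x|mu u. ?f m x) \<le> C\<^sup>2" for m
  using C[of m] by (simp add: norm_T_square[symmetric] power_mono)
 ultimately obtain L where L: "(%m. LINT x|mu u. ?f m x) \<longlonglongrightarrow> L"
  using incseq_convergent by metis
 have "integrable (mu u) (%x. (cmod (cor x))\<^sup>2)"
 proof (rule integral_monotone_convergence_nonneg(1)[OF int _ _ _ L])
  show "AE x in mu u. mono (%m. ?f m x)" by (intro AE_I2 monoI mono)
  show "AE x in mu u. 0 \<le> ?f m x" for m by simp
  show "AE x in mu u. (%m. ?f m x) \<longlonglongrightarrow> (cmod (cor x))\<^sup>2"
   by (intro AE_I2 tendsto_intros trunc_tendsto)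
 qed simp
 then show "u \<in> dom_id" by simp
qed

lemma csubspace_dom_id: "csubspace dom_id"
 unfolding csubspace_def
proof (intro conjI ballI allI)
 show "0 \<in> dom_id"
  unfolding dom_id_iff using T_scale[of "trunc _" 0 0] by (intro exI[of _ 0]) simp
next
 fix u v assume "u \<in> dom_id" "v \<in> dom_id"
 then obtain A B where "!!m. norm (T (trunc m) u) \<le> A" "!!m. norm (T (trunc m) v) \<le> B"
  unfolding dom_id_iff by blast
 then show "u + v \<in> dom_id"
  unfolding dom_id_iff
  by (intro exI[of _ "A + B"]) (auto simp: T_add intro: norm_triangle_le add_mono)
next
 fix c u assume "u \<in> dom_id"
 then obtain A where "!!m. norm (T (trunc m) u) \<le> A" unfolding dom_id_iff by blast
 then show "c *\<^sub>C u \<in> dom_id"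
  unfolding dom_id_iff
  by (intro exI[of _ "cmod c * A"]) (auto simp: T_scale norm_scaleC intro: mult_left_mono)
qed

lemma sform_id_limit:
 assumes "u \<in> dom_id" "w \<in> dom_id"
 shows "(%m. cinner (T (trunc m) u) w) \<longlonglongrightarrow> sform E cor u w"
proof -
 have "(%m. LINT x|mu v. trunc m x) \<longlonglongrightarrow> (LINT x|mu v. cor x)" if v: "v \<in> dom_id" for v
 proof (rule integral_dominated_convergence[where w = "%x. 1 + (cmod (cor x))\<^sup>2"])
  interpret finite_measure "mu v" by (rule finite_measure_mu)
  show "integrable (mu v) (%x. 1 + (cmod (cor x))\<^sup>2)" using v by simp
  show "AE x in mu v. norm (trunc m x) \<le> 1 + (cmod (cor x))\<^sup>2" for m
  proof (rule AE_I2)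
   fix x :: real
   have "0 \<le> (\<bar>x\<bar> - 1)\<^sup>2 + \<bar>x\<bar>" by simp
   then have "\<bar>x\<bar> \<le> 1 + x\<^sup>2" by (simp add: power2_diff)
   then show "norm (trunc m x) \<le> 1 + (cmod (cor x))\<^sup>2"
    using norm_trunc(2)[of m x] by simp
  qed
  show "trunc m \<in> borel_measurable (mu v)" for m
   using bborel_measurable[OF bborel_trunc] by simp
 qed (auto intro: trunc_tendsto)
 then have "(%m. sform E (trunc m) u w) \<longlonglongrightarrow> sform E cor u w"
  unfolding sform_def
  by (intro tendsto_intros) (use assms csubspaceD(2,3)[OF csubspace_dom_id] in auto)
 then show ?thesis by (simp add: cinner_T)
qed

text \<open>Bounded functions \<open>r\<close> that decay like a resolvent produce pairs in the
  graph of the integral of the identity; this is how resolvents are found inside the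
  calculus.\<close>

lemma spectral_integral_id_mem:
 assumes r: "bborel r" and xr: "bborel (%x. cor x * r x)"
 shows "(T r w, T (%x. cor x * r x) w) \<in> spectral_integral E cor"
proof -
 obtain B where B: "!!x. cmod (cor x * r x) \<le> B" using bborelE[OF xr] by blast
 have bd: "cmod (trunc m x * r x) \<le> B" for m x
  using mult_right_mono[OF norm_trunc(2)[of m x] norm_ge_zero[of "r x"]] B[of x] by (simp add: norm_mult)
 have b: "bborel (%x. trunc m x * r x)" for m by (intro bborel_mult bborel_trunc r)
 have "T (trunc m) (T r w) = T (%x. trunc m x * r x) w" for m by (simp add: T_mult r)
 then have dom: "T r w \<in> dom_id"
  unfolding dom_id_iff using norm_T_le[OF b bd] by auto
 have "cinner (T (%x. cor x * r x) w) v = sform E cor (T r w) v" if "v \<in> dom_id" for v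
 proof (rule LIMSEQ_unique)
  show "(%m. cinner (T (%x. trunc m x * r x) w) v) \<longlonglongrightarrow> cinner (T (%x. cor x * r x) w) v"
   by (rule T_weak_limit[OF b bd _ xr]) (intro tendsto_intros trunc_tendsto)
  show "(%m. cinner (T (%x. trunc m x * r x) w) v) \<longlonglongrightarrow> sform E cor (T r w) v"
   using sform_id_limit[OF dom that] by (simp add: T_mult r)
 qed
 then show ?thesis unfolding spectral_integral_id_iff using dom by blast
qed

lemma spectral_integral_id_sym:
 assumes "(p, q) \<in> spectral_integral E cor" "(u, v) \<in> spectral_integral E cor"
 shows "cinner q u = cinner p v"
proof -
 have d: "p \<in> dom_id" "u \<in> dom_id" and q: "cinner q u = sform E cor p u"
  and v: "cinner v p = sform E cor u p"
  using assms unfolding spectral_integral_id_iff by blast+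
 have "(%m. cnj (cinner (T (trunc m) u) p)) \<longlonglongrightarrow> cnj (cinner v p)"
  unfolding v by (intro tendsto_intros sform_id_limit d)
 then have "(%m. cinner (T (trunc m) p) u) \<longlonglongrightarrow> cinner p v"
  by (simp add: T_cnj[of "trunc _" p] flip: cinner_commute)
 then show ?thesis
  unfolding q using sform_id_limit[OF d] LIMSEQ_unique by blast
qed

end

section \<open>Self-adjoint operators, the Cayley transform and resolvents\<close>

context
 fixes G :: "'x ell2_op" assumes sa: "self_adjoint G"
begin

lemma sa_linear: "(0, 0) \<in> G" "(u, v) \<in> G ==> (u', v') \<in> G ==> (u + u', v + v') \<in> G"
 "(u, v) \<in> G ==> (c *\<^sub>C u, c *\<^sub>C v) \<in> G" "(u, v) \<in> G ==> (u, v') \<in> G ==> v = v'"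
 using sa unfolding self_adjoint_def linear_op_def by (auto simp: single_valued_def split: prod.splits)

lemma sa_diff: "(u, v) \<in> G ==> (u', v') \<in> G ==> (u - u', v - v') \<in> G"
 using sa_linear(2)[of u v "(-1) *\<^sub>C u'" "(-1) *\<^sub>C v'"] sa_linear(3)[of u' v' "-1"]
 by (simp add: scaleC_minus_one)

lemma sa_adjoint: "(v, w) \<in> G \<longleftrightarrow> (\<forall>(u, Gu)\<in>G. cinner Gu v = cinner u w)"
proof -
 have "(v, w) \<in> G \<longleftrightarrow> (v, w) \<in> adjoint_op G" using sa by (simp add: self_adjoint_def)
 then show ?thesis by (simp add: adjoint_op_def)
qed

lemma sa_sym: "(u, v) \<in> G ==> (u', v') \<in> G ==> cinner v u' = cinner u v'"
 using sa_adjoint[of u' v'] by blast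

lemma sa_closed:
 assumes "!!n. (f n, g n) \<in> G" "f \<longlonglongrightarrow> u" "g \<longlonglongrightarrow> v" shows "(u, v) \<in> G"
 unfolding sa_adjoint
proof clarify
 fix p q assume pq: "(p, q) \<in> G"
 have "(%n. cinner q (f n)) \<longlonglongrightarrow> cinner q u" "(%n. cinner p (g n)) \<longlonglongrightarrow> cinner p v"
  by (intro cinner.tendsto tendsto_const assms)+
 then show "cinner q u = cinner p v"
  using sa_sym[OF pq assms(1)] by (simp add: LIMSEQ_unique)
qed

lemma sa_norm:
 assumes "(u, v) \<in> G" and s: "s = \<i> \<or> s = - \<i>"
 shows "(norm (v + s *\<^sub>C u))\<^sup>2 = (norm v)\<^sup>2 + (norm u)\<^sup>2"
proof -
 have "cinner v u = cnj (cinner v u)"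
  using sa_sym[OF assms(1) assms(1)] cinner_commute[of u v] by simp
 then have "Im (cinner v u) = 0" by (metis complex_cnj_cancel_iff Im_complex_of_real Reals_cnj_iff complex_is_Real_iff)
 then have "Re (cinner v (s *\<^sub>C u)) = 0" using s by (auto simp: cinner_scaleC_right)
 moreover have "norm (s *\<^sub>C u) = norm u" using s by (auto simp: norm_scaleC)
 ultimately show ?thesis by (simp add: norm_add_square)
qed

text \<open>The range is closed since \<open>sa_norm\<close> controls both components of a pair, and
  a vector orthogonal to it would be an eigenvector of \<open>G\<close> with an imaginary
  eigenvalue.\<close>

lemma sa_range:
 assumes s: "s = \<i> \<or> s = - \<i>"
 shows "\<exists>u v. (u, v) \<in> G \<and> v + s *\<^sub>C u = w"
proof -
 define R where "R = {v + s *\<^sub>C u |u v. (u, v) \<in> G}"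
 have "R = UNIV"
 proof (rule ell2_orthogonal_complement)
  show "csubspace R"
   unfolding csubspace_def
  proof (intro conjI ballI allI)
   show "0 \<in> R" using sa_linear(1) by (force simp: R_def)
  next
   fix x y assume "x \<in> R" "y \<in> R"
   then obtain u v u' v' where "(u, v) \<in> G" "(u', v') \<in> G" "x = v + s *\<^sub>C u" "y = v' + s *\<^sub>C u'"
    unfolding R_def by blast
   then show "x + y \<in> R" unfolding R_def
    by (intro CollectI exI[of _ "u + u'"] exI[of _ "v + v'"]) (simp add: sa_linear scaleC_add_right)
  next
   fix c x assume "x \<in> R"
   then obtain u v where "(u, v) \<in> G" "x = v + s *\<^sub>C u" unfolding R_def by blast
   then show "c *\<^sub>C x \<in> R" unfolding R_def
    by (intro CollectI exI[of _ "c *\<^sub>C u"] exI[of _ "c *\<^sub>C v"])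
     (simp add: sa_linear scaleC_add_right scaleC_scaleC mult.commute)
  qed
  show "closed R"
   unfolding closed_sequential_limits
  proof (intro allI impI, elim conjE)
   fix x l assume x: "\<forall>n. x n \<in> R" and l: "x \<longlonglongrightarrow> l"
   then have "\<exists>u v. (u, v) \<in> G \<and> x n = v + s *\<^sub>C u" for n unfolding R_def by blast
   then obtain u v where uv: "!!n. (u n, v n) \<in> G" "!!n. x n = v n + s *\<^sub>C u n" by metis
   have sq: "(norm (x m - x n))\<^sup>2 = (norm (v m - v n))\<^sup>2 + (norm (u m - u n))\<^sup>2" for m n
   proof -
    have "x m - x n = (v m - v n) + s *\<^sub>C (u m - u n)" by (simp add: uv(2) scaleC.diff_right)
    then show ?thesis using sa_norm[OF sa_diff[OF uv(1) uv(1)] s] by simp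
   qed
   have le: "norm (v m - v n) \<le> norm (x m - x n)" "norm (u m - u n) \<le> norm (x m - x n)" for m n
    by (rule power2_le_imp_le; simp add: sq)+
   have C: "Cauchy x" using l by (rule LIMSEQ_imp_Cauchy)
   have "Cauchy u" "Cauchy v"
    using C le unfolding Cauchy_def dist_norm by (meson le_less_trans)+
   then obtain p q where "u \<longlonglongrightarrow> p" "v \<longlonglongrightarrow> q" using Cauchy_convergent convergent_def by blast
   moreover from this have "(p, q) \<in> G" by (rule sa_closed[OF uv(1)])
   moreover have "x \<longlonglongrightarrow> q + s *\<^sub>C p"
    unfolding uv(2) using calculation by (intro tendsto_add scaleC.tendsto tendsto_const)
   ultimately show "l \<in> R" using l LIMSEQ_unique unfolding R_def by blast
  qed
  fix w assume orth: "!!x. x \<in> R ==> cinner x w = 0"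
  have "(w, s *\<^sub>C w) \<in> G"
   unfolding sa_adjoint
  proof clarify
   fix u v assume "(u, v) \<in> G"
   then have "cinner (v + s *\<^sub>C u) w = 0" by (intro orth) (auto simp: R_def)
   moreover have "cnj s = - s" using s by auto
   ultimately show "cinner v w = cinner u (s *\<^sub>C w)"
    by (simp add: cinner_add_left cinner_scaleC_left cinner_scaleC_right add_eq_0_iff)
  qed
  from sa_sym[OF this this] have "s * cinner w w = cnj s * cinner w w"
   by (simp add: cinner_scaleC_left cinner_scaleC_right)
  then have "cinner w w = 0" using s by auto
  then show "w = 0" by (simp add: cinner_self_norm)
 qed
 then have "w \<in> R" by simp
 then show ?thesis unfolding R_def by blast
qed

text \<open>The Cayley transform is \<open>U w = w - (2 * \<i>) *\<^sub>C R w\<close> with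
  \<open>R\<close> the inverse of \<open>G + \<i>\<close>. Its spectral measure reproduces
  \<open>R\<close> as the integral of \<open>1 / (x + \<i>)\<close> and \<open>Q\<close> as that of
  \<open>x / (x + \<i>)\<close>, and the pairs \<open>(R w, Q w)\<close> exhaust
  \<open>G\<close>.\<close>

theorem self_adjoint_spectral:
 "\<exists>E. is_pvm E \<and> spectral_integral E cor = G"
proof -
 have "\<forall>w. \<exists>p. p \<in> G \<and> snd p + \<i> *\<^sub>C fst p = w" using sa_range[of \<i>] by fastforce
 then obtain P where P: "!!w. P w \<in> G" "!!w. snd (P w) + \<i> *\<^sub>C fst (P w) = w" by metis
 define R where "R w = fst (P w)" for w
 define Q where "Q w = snd (P w)" for w
 have RQ: "(R w, Q w) \<in> G" "Q w + \<i> *\<^sub>C R w = w" for w using P by (simp_all add: R_def Q_def)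
 have uniq: "R w = u" "Q w = v" if "(u, v) \<in> G" "v + \<i> *\<^sub>C u = w" for u v w
 proof -
  have "(Q w - v) + \<i> *\<^sub>C (R w - u) = 0"
   using RQ(2)[of w] that(2) by (simp add: scaleC.diff_right algebra_simps)
  then have "(norm (Q w - v))\<^sup>2 + (norm (R w - u))\<^sup>2 = 0"
   using sa_norm[OF sa_diff[OF RQ(1) that(1)], of \<i> w] by simp
  then show "R w = u" "Q w = v" by (simp_all add: sum_power2_eq_zero_iff)
 qed
 define U where "U w = w - (2 * \<i>) *\<^sub>C R w" for w
 have Radd: "R (v + w) = R v + R w" for v w
  using RQ(2)[of v] RQ(2)[of w]
  by (intro uniq(1)[of _ "Q v + Q w"] sa_linear(2) RQ(1)) (simp add: scaleC_add_right algebra_simps)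
 have Rscale: "R (c *\<^sub>C v) = c *\<^sub>C R v" for c v
  using arg_cong[OF RQ(2)[of v], of "%x. c *\<^sub>C x"]
  by (intro uniq(1)[of _ "c *\<^sub>C Q v"] sa_linear(3) RQ(1)) (simp add: scaleC_add_right scaleC_scaleC mult.commute)
 have Ualt: "U w = Q w + (- \<i>) *\<^sub>C R w" for w
  unfolding U_def by (subst (1) RQ(2)[of w, symmetric]) (simp add: scaleC.minus_left scaleC_add_left[of \<i> \<i>, simplified])
 have Unorm: "norm (U w) = norm w" for w
 proof -
  have "(norm (U w))\<^sup>2 = (norm w)\<^sup>2"
   unfolding Ualt using sa_norm[OF RQ(1), of "- \<i>" w] sa_norm[OF RQ(1), of \<i> w] RQ(2)[of w] by simp
  then show ?thesis by simp
 qed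
 interpret ell2_unitary U
 proof
  show "U (u + v) = U u + U v" for u v by (simp add: U_def Radd scaleC_add_right)
  show "U (c *\<^sub>C u) = c *\<^sub>C U u" for c u
   by (simp add: U_def Rscale scaleC.diff_right scaleC_scaleC mult_ac)
  show "norm (U u) = norm u" for u by (rule Unorm)
  show "\<exists>v. U v = w" for w
  proof -
   obtain u v where uv: "(u, v) \<in> G" "v + (- \<i>) *\<^sub>C u = w" using sa_range[of "- \<i>" w] by blast
   have "U (v + \<i> *\<^sub>C u) = w" unfolding Ualt using uniq[OF uv(1) refl] uv(2) by simp
   then show ?thesis by blast
  qed
  have "Domain G \<subseteq> range (%w. w - U w)"
  proof clarify
   fix u v assume "(u, v) \<in> G"
   then have r: "R (v + \<i> *\<^sub>C u) = u" by (rule uniq(1)) simp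
   have "R (inverse (2 * \<i>) *\<^sub>C (v + \<i> *\<^sub>C u)) = inverse (2 * \<i>) *\<^sub>C u" by (simp only: Rscale r)
   then have "u = inverse (2 * \<i>) *\<^sub>C (v + \<i> *\<^sub>C u) - U (inverse (2 * \<i>) *\<^sub>C (v + \<i> *\<^sub>C u))"
    by (simp add: U_def scaleC_scaleC)
   then show "u \<in> range (%w. w - U w)" by (rule range_eqI)
  qed
  then have "closure (Domain G) \<subseteq> closure (range (%w. w - U w))" by (rule closure_mono)
  then show "closure (range (%w. w - U w)) = UNIV"
   using sa unfolding self_adjoint_def by auto
 qed
 obtain E where E: "is_pvm E" "scalc E cay = U" using spectral_measure_of_unitary by blast
 interpret pvm E by (rule pvm.intro[OF E(1)])
 have r: "bborel (%x. 1 / (cor x + \<i>))"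
 proof (rule bborel_continuous[where B = 1])
  show "cmod (1 / (cor x + \<i>)) \<le> 1" for x
   using abs_Im_le_cmod[of "cor x + \<i>"] by (simp add: norm_divide divide_simps)
 qed (intro continuous_intros; simp)
 have xr: "bborel (%x. cor x * (1 / (cor x + \<i>)))"
 proof (rule bborel_continuous[where B = 1])
  show "cmod (cor x * (1 / (cor x + \<i>))) \<le> 1" for x
   using abs_Re_le_cmod[of "cor x + \<i>"] by (simp add: norm_mult norm_divide divide_simps)
 qed (intro continuous_intros; simp)
 have cr: "cay x = 1 - 2 * \<i> * (1 / (cor x + \<i>))" for x
  by (simp add: cay_def divide_simps)
 have xcr: "cor x * (1 / (cor x + \<i>)) = 1 - \<i> * (1 / (cor x + \<i>))" for x
  by (simp add: divide_simps)
 have Tr: "T (%x. 1 / (cor x + \<i>)) w = R w" for w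
 proof -
  have "T cay w = w - (2 * \<i>) *\<^sub>C T (%x. 1 / (cor x + \<i>)) w"
   unfolding cr[abs_def]
   by (simp only: T_diff_fun[OF bborel_const bborel_mult[OF bborel_const r]] T_scale_fun[OF r] T_one)
  then have "(2 * \<i>) *\<^sub>C T (%x. 1 / (cor x + \<i>)) w = (2 * \<i>) *\<^sub>C R w"
   unfolding E(2) U_def by simp
  from arg_cong[OF this, of "%x. inverse (2 * \<i>) *\<^sub>C x"] show ?thesis
   by (simp add: scaleC_scaleC)
 qed
 have Txr: "T (%x. cor x * (1 / (cor x + \<i>))) w = Q w" for w
 proof -
  have "T (%x. cor x * (1 / (cor x + \<i>))) w = w - \<i> *\<^sub>C R w"
   unfolding xcr
   by (simp only: T_diff_fun[OF bborel_const bborel_mult[OF bborel_const r]] T_scale_fun[OF r] T_one Tr)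
  then show ?thesis using RQ(2)[of w] by (metis add_diff_cancel_right')
 qed
 have sub: "G \<subseteq> spectral_integral E cor"
 proof clarify
  fix u v assume "(u, v) \<in> G"
  then have "R (v + \<i> *\<^sub>C u) = u" "Q (v + \<i> *\<^sub>C u) = v" by (auto intro: uniq)
  then show "(u, v) \<in> spectral_integral E cor"
   using spectral_integral_id_mem[OF r xr, of "v + \<i> *\<^sub>C u"] by (simp only: Tr Txr)
 qed
 \<comment> \<open>A self-adjoint operator has no proper symmetric extension.\<close>
 moreover have "spectral_integral E cor \<subseteq> G"
 proof clarify
  fix u v assume "(u, v) \<in> spectral_integral E cor"
  then show "(u, v) \<in> G"
   unfolding sa_adjoint using sub spectral_integral_id_sym by blast
 qed
 ultimately show ?thesis using E(1) by blast
qed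

lemma spectral_measure: "is_pvm (spectral_measure G)"
 "spectral_integral (spectral_measure G) cor = G"
 using someI_ex[OF self_adjoint_spectral] unfolding spectral_measure_def by auto

lemma pvm_spectral_measure: "pvm (spectral_measure G)"
 by (rule pvm.intro[OF spectral_measure(1)])

lemma resolvent_eq:
 assumes l: "Im l \<noteq> 0"
 shows "bborel (%x. 1 / (l - cor x))"
  "resolvent G l u = fun_calc G (%x. 1 / (l - cor x)) u"
proof -
 interpret pvm "spectral_measure G" by (rule pvm_spectral_measure)
 have nz: "l - cor x \<noteq> 0" for x using l by (auto simp: complex_eq_iff)
 show r: "bborel (%x. 1 / (l - cor x))"
 proof (rule bborel_continuous[where B = "1 / \<bar>Im l\<bar>"])
  show "cmod (1 / (l - cor x)) \<le> 1 / \<bar>Im l\<bar>" for x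
   using abs_Im_le_cmod[of "l - cor x"] l nz
   by (simp add: norm_divide frac_le)
 qed (intro continuous_intros; use nz in simp)
 have e: "cor x * (1 / (l - cor x)) = l * (1 / (l - cor x)) - 1" for x
  using nz[of x] by (simp add: divide_simps)
 have xr: "bborel (%x. cor x * (1 / (l - cor x)))"
  unfolding e by (intro bborel_diff bborel_mult r bborel_const)
 let ?v = "T (%x. 1 / (l - cor x)) u"
 have "T (%x. cor x * (1 / (l - cor x))) u = l *\<^sub>C ?v - u"
  unfolding e
  by (simp only: T_diff_fun[OF bborel_mult[OF bborel_const r] bborel_const] T_scale_fun[OF r] T_one)
 then have mem: "(?v, l *\<^sub>C ?v - u) \<in> G"
  using spectral_integral_id_mem[OF r xr, of u] by (simp add: spectral_measure(2))
 have "resolvent G l u = ?v"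
  unfolding resolvent_def
 proof (rule the_equality, rule mem)
  fix v assume "(v, l *\<^sub>C v - u) \<in> G"
  from sa_diff[OF this mem] have d: "(v - ?v, l *\<^sub>C (v - ?v)) \<in> G"
   by (simp add: scaleC.diff_right)
  have "l * cinner (v - ?v) (v - ?v) = cnj l * cinner (v - ?v) (v - ?v)"
   using sa_sym[OF d d] by (simp add: cinner_scaleC_left cinner_scaleC_right)
  moreover have "l \<noteq> cnj l" using l by (auto simp: complex_eq_iff)
  ultimately show "v = ?v" by (simp add: cinner_self_norm)
 qed
 then show "resolvent G l u = fun_calc G (%x. 1 / (l - cor x)) u"
  by (simp add: fun_calc_def scalc_def)
qed

end

lemma of_real_neq_ii [simp]: "cor x \<noteq> \<i>"
 by (simp add: complex_eq_iff)

section \<open>Strong resolvent convergence and the functional calculus\<close>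

text \<open>The uniform bound on the operators absorbs the change of the vector they act on.\<close>

lemma tendsto_op_compose:
 assumes lin: "!!N u v. A N (u + v) = A N u + A N (v :: 'x ell2)"
  and bound: "!!N u. norm (A N u) \<le> B * norm u"
  and v: "v \<longlonglongrightarrow> w" and A: "(%N. A N w) \<longlonglongrightarrow> (z :: 'x ell2)"
 shows "(%N. A N (v N)) \<longlonglongrightarrow> z"
proof -
 have "(%N. A N (v N - w)) \<longlonglongrightarrow> 0"
 proof (rule Lim_null_comparison[OF always_eventually])
  show "\<forall>N. norm (A N (v N - w)) \<le> B * norm (v N - w)" using bound by blast
  have "(%N. B * norm (v N - w)) \<longlonglongrightarrow> B * norm (w - w)" by (intro tendsto_intros v)
  then show "(%N. B * norm (v N - w)) \<longlonglongrightarrow> 0" by simp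
 qed
 from tendsto_add[OF this A] show ?thesis by (simp flip: lin)
qed

text \<open>The functions whose calculus converges strongly form an algebra that contains the
  resolvents, hence \<open>cay\<close> and its conjugate, and is closed under uniform limits. This
  reaches continuous functions of bounded support. A general \<open>f\<close> need not be a uniform
  limit of these, so it is compared with \<open>f\<close> times a cutoff, on a vector that the
  cutoff nearly fixes.\<close>

lemma strong_resolvent_fun_calc:
 fixes G :: "'x ell2_op"
 assumes G: "self_adjoint G" and GN: "!!N. self_adjoint (GN N)"
  and conv: "strong_resolvent_conv GN G"
  and f: "continuous_on UNIV f" and fB: "!!x. cmod (f x) \<le> B"
 shows "(%N. fun_calc (GN N) f u) \<longlonglongrightarrow> fun_calc G f u"
proof -
 interpret G: pvm "spectral_measure G" by (rule pvm_spectral_measure[OF G])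
 interpret GN: pvm "spectral_measure (GN N)" for N by (rule pvm_spectral_measure[OF GN])
 have fc: "fun_calc K g = scalc (spectral_measure K) g" for K :: "'x ell2_op" and g
  by (simp add: fun_calc_def scalc_def)
 define C where "C g \<longleftrightarrow> bborel g \<and> (\<forall>u. (%N. GN.T N g u) \<longlonglongrightarrow> G.T g u)" for g
 have add: "C (%x. g x + h x)" if "C g" "C h" for g h
  using that unfolding C_def by (auto simp: G.T_add_fun GN.T_add_fun intro: tendsto_add)
 have scale: "C (%x. c * g x)" if "C g" for c g
  using that unfolding C_def by (auto simp: G.T_scale_fun GN.T_scale_fun intro: scaleC.tendsto)
 have mult: "C (%x. g x * h x)" if "C g" "C h" for g h
 proof -
  have g: "bborel g" and h: "bborel h" using that by (simp_all add: C_def)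
  obtain A where A: "!!x. cmod (g x) \<le> A" using bborelE[OF g] by blast
  have "(%N. GN.T N g (GN.T N h u)) \<longlonglongrightarrow> G.T g (G.T h u)" for u
  proof (rule tendsto_op_compose[where B = A and w = "G.T h u" and A = "%N. GN.T N g" and v = "%N. GN.T N h u"])
   show "(%N. GN.T N h u) \<longlonglongrightarrow> G.T h u" "(%N. GN.T N g (G.T h u)) \<longlonglongrightarrow> G.T g (G.T h u)"
    using that by (simp_all add: C_def)
  qed (simp_all only: GN.T_add[OF g] GN.norm_T_le[OF g A])
  then show ?thesis using g h by (auto simp: C_def G.T_mult GN.T_mult)
 qed
 have one: "C (%_. 1)" by (simp add: C_def G.T_one GN.T_one)
 have pow: "C (%x. g x ^ n)" if "C g" for g n
  by (induction n) (simp_all add: one mult that)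
 have res: "C (%x. 1 / (l - cor x))" if "Im l \<noteq> 0" for l
  unfolding C_def
 proof (intro conjI allI resolvent_eq(1)[OF G that])
  fix u
  have "(%N. resolvent (GN N) l u) \<longlonglongrightarrow> resolvent G l u"
   using conv that unfolding strong_resolvent_conv_def by blast
  then show "(%N. GN.T N (%x. 1 / (l - cor x)) u) \<longlonglongrightarrow> G.T (%x. 1 / (l - cor x)) u"
   by (simp only: resolvent_eq(2)[OF G that] resolvent_eq(2)[OF GN that] fc)
 qed
 have cay: "C cay"
 proof -
  have "C (%x. 1 + (2 * \<i>) * (1 / (- \<i> - cor x)))"
   by (intro add one scale res) simp
  moreover have "1 + (2 * \<i>) * (1 / (- \<i> - cor x)) = cay x" for x
  proof -
   have "1 / (- \<i> - cor x) = - (1 / (cor x + \<i>))"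
    by (metis add_uminus_conv_diff minus_add minus_divide_right uminus_add_conv_diff)
   then show ?thesis by (simp only: cay_def) (simp add: divide_simps)
  qed
  ultimately show ?thesis by simp
 qed
 have cnj_cay: "C (%x. cnj (cay x))"
 proof -
  have "C (%x. 1 + (- 2 * \<i>) * (1 / (\<i> - cor x)))"
   by (intro add one scale res) simp
  moreover have "1 + (- 2 * \<i>) * (1 / (\<i> - cor x)) = cnj (cay x)" for x
  proof -
   have "1 / (\<i> - cor x) = - (1 / (cor x - \<i>))"
    by (metis minus_diff_eq minus_divide_right)
   then show ?thesis by (simp only: cay_def) (simp add: divide_simps)
  qed
  ultimately show ?thesis by simp
 qed
 have trig: "C p" if "trig p" for p
  using that
 proof induction
  case (trig_base a b)
  show ?case by (rule mult[OF pow[OF cay] pow[OF cnj_cay]])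
 qed (simp_all add: add scale)
 have approx: "C g" if g: "bborel g" and ap: "!!e. e > 0 ==> \<exists>p. C p \<and> (\<forall>x. cmod (g x - p x) \<le> e)" for g
  unfolding C_def
 proof (intro conjI g allI tendsto_approx)
  fix u :: "'x ell2" and e :: real assume e: "0 < e"
  define d where "d = e / (norm u + 1)"
  have d: "d > 0" "d * norm u \<le> e"
   using e norm_ge_zero[of u] by (simp_all add: d_def divide_le_eq add_nonneg_pos mult_left_mono)
  obtain p where p: "C p" "!!x. cmod (g x - p x) \<le> d" using ap[OF d(1)] by blast
  have pb: "bborel p" using p(1) by (simp add: C_def)
  have b: "bborel (%x. g x - p x)" by (intro bborel_diff g pb)
  have "norm (G.T g u - G.T p u) \<le> e" "norm (GN.T N g u - GN.T N p u) \<le> e" for N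
   using G.norm_T_le[OF b p(2), of u] GN.norm_T_le[OF b p(2), of N u] d(2) by (simp_all add: G.T_diff_fun GN.T_diff_fun g pb)
  then show "\<exists>s' l'. s' \<longlonglongrightarrow> l' \<and> (\<forall>\<^sub>F N in sequentially. dist (GN.T N g u) (s' N) \<le> e) \<and> dist (G.T g u) l' \<le> e"
   using p(1) unfolding C_def dist_norm by (intro exI[of _ "%N. GN.T N p u"] exI[of _ "G.T p u"]) auto
 qed
 have compact: "C (%x. cor (g x))"
  if g: "continuous_on UNIV g" "!!x. \<bar>x\<bar> > R ==> g x = 0" "!!x. \<bar>g x\<bar> \<le> D" for g R D
 proof (rule approx)
  show "bborel (%x. cor (g x))"
   by (rule bborel_continuous[of _ D]) (use g in \<open>auto intro!: continuous_on_of_real\<close>)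
  show "\<exists>p. C p \<and> (\<forall>x. cmod (cor (g x) - p x) \<le> e)" if "e > 0" for e
  proof -
   obtain p where "trig p" "!!x. cmod (cor (g x) - p x) < e"
    using trig_approx[OF g(1,2) \<open>e > 0\<close>] by auto
   then show ?thesis using trig less_imp_le by (intro exI[of _ p]) auto
  qed
 qed
 define chi where "chi m x = max 0 (min 1 (real m + 1 - \<bar>x\<bar>))" for m :: nat and x
 have chi01: "0 \<le> chi m x" "chi m x \<le> 1" for m x by (auto simp: chi_def)
 have chi_cont: "continuous_on UNIV (chi m)" for m unfolding chi_def by (intro continuous_intros)
 have chi_supp: "chi m x = 0" if "\<bar>x\<bar> > real m + 1" for m x using that by (auto simp: chi_def)
 have chi: "C (%x. cor (chi m x))" for m
  by (rule compact[where R = "real m + 1" and D = 1]) (use chi01 chi_cont chi_supp in auto)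
 have fchi: "C (%x. f x * cor (chi m x))" for m
 proof -
  have B0: "0 \<le> B" using order_trans[OF norm_ge_zero fB] .
  have bd: "\<bar>Re (f x) * chi m x\<bar> \<le> B" "\<bar>Im (f x) * chi m x\<bar> \<le> B" for x
   using mult_mono[OF order_trans[OF abs_Re_le_cmod fB] chi01(2)[of m x] B0 chi01(1), of x]
    mult_mono[OF order_trans[OF abs_Im_le_cmod fB] chi01(2)[of m x] B0 chi01(1), of x] chi01[of m x]
   by (simp_all add: abs_mult)
  have "C (%x. cor (Re (f x) * chi m x) + \<i> * cor (Im (f x) * chi m x))"
   by (intro add scale compact[where R = "real m + 1" and D = B] continuous_on_mult continuous_on_Re
     continuous_on_Im f chi_cont bd) (simp_all add: chi_supp)
  moreover have "cor (Re (f x) * chi m x) + \<i> * cor (Im (f x) * chi m x)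
    = f x * cor (chi m x)" for x
   by (simp add: complex_eq_iff)
  ultimately show ?thesis by simp
 qed
 have fb: "bborel f" by (rule bborel_continuous[OF f fB])
 have chib: "bborel (%x. cor (chi m x))" for m using chi by (simp add: C_def)
 have chilim: "(%m. G.T (%x. cor (chi m x)) u) \<longlonglongrightarrow> u"
 proof -
  have "(%m. G.T (%x. cor (chi m x)) u) \<longlonglongrightarrow> G.T (%_. 1) u"
  proof (rule G.T_strong_limit[where B = 1, OF chib])
   fix x
   obtain N :: nat where "\<bar>x\<bar> < real N" using reals_Archimedean2 by blast
   then have "\<forall>\<^sub>F m in sequentially. cor (chi m x) = 1"
    unfolding eventually_sequentially chi_def by (intro exI[of _ N]) (auto simp: min_def max_def)
   then show "(%m. cor (chi m x)) \<longlonglongrightarrow> 1" by (rule tendsto_eventually)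
  qed (use chi01 in auto)
  then show ?thesis by (simp add: G.T_one)
 qed
 have B0: "0 \<le> B" using order_trans[OF norm_ge_zero fB] .
 show ?thesis
  unfolding fc
 proof (rule tendsto_approx)
  fix e :: real assume e: "0 < e"
  \<comment> \<open>The 1 keeps the quotient meaningful when \<open>B\<close> is 0.\<close>
  define d where "d = e / (B + 1)"
  have d: "d > 0" "B * d \<le> e" using e B0 by (simp_all add: d_def field_simps)
  \<comment> \<open>The cutoff is chosen for \<open>G\<close> alone; convergence of its calculus
    transfers the property to \<open>GN N\<close> for large \<open>N\<close>.\<close>
  obtain m where m: "dist (G.T (%x. cor (chi m x)) u) u < d"
   using metric_LIMSEQ_D[OF chilim d(1)] by blast
  let ?c = "%x. cor (chi m x)"
  have split: "GN.T N f u - GN.T N (%x. f x * ?c x) u = GN.T N f (u - GN.T N ?c u)"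
   "G.T f u - G.T (%x. f x * ?c x) u = G.T f (u - G.T ?c u)" for N
   by (simp_all add: GN.T_mult G.T_mult fb chib linear_diff[OF bounded_linear.linear[OF G.T_bounded_linear[OF fb]]]
     linear_diff[OF bounded_linear.linear[OF GN.T_bounded_linear[OF fb]]])
  have lim: "(%N. GN.T N ?c u) \<longlonglongrightarrow> G.T ?c u" "(%N. GN.T N (%x. f x * ?c x) u) \<longlonglongrightarrow> G.T (%x. f x * ?c x) u"
   using chi fchi by (simp_all add: C_def)
  have "\<forall>\<^sub>F N in sequentially. dist (GN.T N ?c u) u < d"
   by (rule order_tendstoD(2)[OF tendsto_dist[OF lim(1) tendsto_const] m])
  then have "\<forall>\<^sub>F N in sequentially. dist (GN.T N f u) (GN.T N (%x. f x * ?c x) u) \<le> e"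
  proof eventually_elim
   case (elim N)
   have "norm (GN.T N f (u - GN.T N ?c u)) \<le> B * d"
    using elim by (intro order_trans[OF GN.norm_T_le[OF fb fB]] mult_left_mono B0) (simp add: dist_norm norm_minus_commute)
   then show ?case using d(2) by (simp add: dist_norm split)
  qed
  moreover have "norm (G.T f (u - G.T ?c u)) \<le> B * d"
   using m by (intro order_trans[OF G.norm_T_le[OF fb fB]] mult_left_mono B0) (simp add: dist_norm norm_minus_commute)
  then have "dist (G.T f u) (G.T (%x. f x * ?c x) u) \<le> e" using d(2) by (simp add: dist_norm split)
  ultimately show "\<exists>s' l'. s' \<longlonglongrightarrow> l' \<and> (\<forall>\<^sub>F N in sequentially. dist (GN.T N f u) (s' N) \<le> e) \<and> dist (G.T f u) l' \<le> e"
   using lim(2) by blast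
 qed
qed

section \<open>Positivity in C*-algebras\<close>

lemma adj_0 [simp]: "adj (0 :: 'a::cstar_algebra) = 0"
 using adj_scaleC[of 0 "0 :: 'a"] by simp

lemma adj_1 [simp]: "adj (1 :: 'a::cstar_algebra) = 1"
 by (metis adj_adj adj_mult mult_1_left mult_1_right)

lemma adj_minus: "adj (- x :: 'a::cstar_algebra) = - adj x"
 by (metis add_eq_0_iff adj_0 adj_add)

lemma adj_diff: "adj (x - y :: 'a::cstar_algebra) = adj x - adj y"
 by (metis adj_add adj_minus add_uminus_conv_diff)

lemma adj_sum: "adj (sum f I :: 'a::cstar_algebra) = (\<Sum>i\<in>I. adj (f i))"
 by (induction I rule: infinite_finite_induct) (simp_all add: adj_add)

lemma adj_scaleR: "adj (r *\<^sub>R x :: 'a::cstar_algebra) = r *\<^sub>R adj x"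
 by (simp add: adj_scaleC flip: scaleC_of_real)

lemma norm_adj [simp]: "norm (adj x :: 'a::cstar_algebra) = norm x"
proof -
 have *: "norm y \<le> norm (adj y)" for y :: 'a
 proof (cases "y = 0")
  case False
  have "(norm y)\<^sup>2 \<le> norm (adj y) * norm y"
   using norm_mult_ineq[of "adj y" y] by (simp add: cstar_identity)
  then show ?thesis using False by (simp add: power2_eq_square)
 qed simp
 show ?thesis using *[of x] *[of "adj x"] by (simp add: adj_adj)
qed

lemma bounded_linear_adj: "bounded_linear (adj :: 'a::cstar_algebra => 'a)"
 by (rule bounded_linear_intro[where K = 1]) (simp_all add: adj_add adj_scaleR)

lemmas tendsto_adj [tendsto_intros] = bounded_linear.tendsto[OF bounded_linear_adj]

lemma abs_half_gbinomial_le: "\<bar>(1/2 :: real) gchoose n\<bar> \<le> 1"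
proof (induction n)
 case (Suc n)
 have "(1/2 :: real) gchoose Suc n = (1/2 gchoose n) * ((1/2 - real n) / real (Suc n))"
  by (simp add: gbinomial_prod_rev prod.atLeast0_lessThan_Suc field_simps)
 moreover have "\<bar>(1/2 - real n) / real (Suc n)\<bar> \<le> 1"
  by (auto simp: abs_if field_simps)
 ultimately show ?case using Suc by (simp only: abs_mult) (rule mult_le_one, simp_all)
qed simp

text \<open>The binomial series of exponent 1/2. Its square is evaluated by Vandermonde's identity,
  which leaves the binomial coefficients of exponent 1.\<close>

lemma banach_sqrt_one_minus:
 fixes x :: "'a::{real_normed_algebra_1, banach}"
 assumes x: "norm x < 1"
 shows "\<exists>b. summable (%n. norm (b n *\<^sub>R x ^ n)) \<and> (\<Sum>n. b n *\<^sub>R x ^ n) * (\<Sum>n. b n *\<^sub>R x ^ n) = 1 - x"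
proof -
 define b where "b n = (1/2 gchoose n) * (-1 :: real) ^ n" for n
 have b1: "\<bar>b n\<bar> \<le> 1" for n
  unfolding b_def abs_mult power_abs by (simp add: abs_half_gbinomial_le)
 have s: "summable (%n. norm (b n *\<^sub>R x ^ n))"
 proof (rule summable_comparison_test')
  show "summable (%n. norm x ^ n)" using x by (simp add: summable_geometric)
  show "norm (norm (b n *\<^sub>R x ^ n)) \<le> norm x ^ n" for n
   using mult_mono[OF b1[of n] norm_power_ineq[of x n]] by simp
 qed
 have conv: "(\<Sum>i\<le>k. (b i *\<^sub>R x ^ i) * (b (k - i) *\<^sub>R x ^ (k - i))) = ((1 gchoose k) * (-1) ^ k) *\<^sub>R x ^ k" for k
 proof -
  have "(\<Sum>i\<le>k. (b i *\<^sub>R x ^ i) * (b (k - i) *\<^sub>R x ^ (k - i)))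
    = (\<Sum>i\<le>k. (((1/2 gchoose i) * (1/2 gchoose (k - i))) * (-1) ^ k) *\<^sub>R x ^ k)"
  proof (intro sum.cong refl)
   fix i assume "i \<in> {..k}"
   then have "x ^ i * x ^ (k - i) = x ^ k" "(-1 :: real) ^ i * (-1) ^ (k - i) = (-1) ^ k"
    by (simp_all flip: power_add)
   then show "(b i *\<^sub>R x ^ i) * (b (k - i) *\<^sub>R x ^ (k - i))
     = (((1/2 gchoose i) * (1/2 gchoose (k - i))) * (-1) ^ k) *\<^sub>R x ^ k"
    by (simp add: b_def mult_ac)
  qed
  also have "\<dots> = ((1 gchoose k) * (-1) ^ k) *\<^sub>R x ^ k"
   using gbinomial_Vandermonde[of "1/2 :: real" "1/2" k]
   by (simp add: atMost_atLeast0 flip: scaleR_sum_left sum_distrib_right)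
  finally show ?thesis .
 qed
 have "(%k. ((1 gchoose k) * (-1) ^ k) *\<^sub>R x ^ k) sums ((\<Sum>n. b n *\<^sub>R x ^ n) * (\<Sum>n. b n *\<^sub>R x ^ n))"
  using Cauchy_product_sums[OF s s] by (simp only: conv)
 moreover have "(%k. ((1 gchoose k) * (-1) ^ k) *\<^sub>R x ^ k) sums (\<Sum>k<2. ((1 gchoose k) * (-1) ^ k) *\<^sub>R x ^ k)"
 proof (rule sums_finite)
  fix k :: nat assume "k \<notin> {..<2}"
  then have "(1 :: real) gchoose k = 0"
   using binomial_gbinomial[of 1 k, where 'a = real] by (simp add: binomial_eq_0)
  then show "((1 gchoose k) * (-1) ^ k) *\<^sub>R x ^ k = 0" by simp
 qed simp
 ultimately have "(\<Sum>n. b n *\<^sub>R x ^ n) * (\<Sum>n. b n *\<^sub>R x ^ n) = 1 - x"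
  using sums_unique2 by (fastforce simp: eval_nat_numeral)
 then show ?thesis using s by blast
qed

lemma cstar_sqrt:
 fixes x :: "'a::cstar_algebra"
 assumes "adj x = x" "norm x < 1"
 obtains s where "adj s = s" "s * s = 1 - x" "!!y. x * y = y * x ==> s * y = y * s"
proof -
 from banach_sqrt_one_minus[OF assms(2)] obtain b where
  b: "summable (%n. norm (b n *\<^sub>R x ^ n))" "(\<Sum>n. b n *\<^sub>R x ^ n) * (\<Sum>n. b n *\<^sub>R x ^ n) = 1 - x" by blast
 define s where "s = (\<Sum>n. b n *\<^sub>R x ^ n)"
 have sm: "summable (%n. b n *\<^sub>R x ^ n)" using b(1) by (rule summable_norm_cancel)
 have ap: "adj (x ^ n) = x ^ n" for n
  by (induction n) (simp_all add: adj_mult assms(1) power_commutes)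
 have "adj s = s"
  unfolding s_def bounded_linear.suminf[OF bounded_linear_adj sm] by (simp add: adj_scaleR ap)
 moreover have "s * y = y * s" if "x * y = y * x" for y
 proof -
  have "x ^ n * y = y * x ^ n" for n
   by (induction n) (simp_all add: mult.assoc that, metis mult.assoc that)
  then show ?thesis
   unfolding s_def by (simp add: suminf_mult[OF sm, symmetric] suminf_mult2[OF sm])
 qed
 ultimately show ?thesis using b(2) that unfolding s_def by blast
qed

text \<open>\<open>u + \<i> *\<^sub>C s\<close> has norm 1 by the C*-identity, so its real and
  imaginary parts have norm at most 1. This takes the place of the continuous functional calculus: a
  norm bound is certified by a commuting square root.\<close>

lemma commuting_squares_bound:
 fixes u s :: "'a::cstar_algebra"
 assumes "adj u = u" "adj s = s" "u * s = s * u" "u * u + s * s = 1"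
 shows "norm u \<le> 1" "norm s \<le> 1"
proof -
 define w where "w = u + \<i> *\<^sub>C s"
 have aw: "adj w = u - \<i> *\<^sub>C s"
  by (simp add: w_def adj_add adj_scaleC assms scaleC.minus_left)
 have "adj w * w = 1"
  unfolding aw unfolding w_def
  by (simp add: algebra_simps scaleC_mult_left scaleC_mult_right scaleC_scaleC scaleC_minus_one assms(3,4)
    scaleC.diff_right scaleC_add_right assms(4)[unfolded add.commute[of "u * u"]])
 then have "(norm w)\<^sup>2 = 1" using cstar_identity[of w] by simp
 then have w1: "norm w = 1" by (simp add: power2_eq_1_iff) (smt (verit) norm_ge_zero)
 have "2 *\<^sub>R u = w + adj w" unfolding aw unfolding w_def by (simp add: scaleR_2)
 then have "norm (2 *\<^sub>R u) \<le> 1 + 1" using norm_triangle_ineq[of w "adj w"] w1 by simp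
 then show "norm u \<le> 1" by simp
 have "w - adj w = 2 *\<^sub>R \<i> *\<^sub>C s" unfolding aw unfolding w_def by (simp add: scaleR_2)
 then have "norm (2 *\<^sub>R \<i> *\<^sub>C s) \<le> 1 + 1" using norm_triangle_ineq4[of w "adj w"] w1 by (simp only: norm_adj)
 then show "norm s \<le> 1" by (simp add: norm_scaleC)
qed

text \<open>For self-adjoint elements the bound is certified by an identity
  \<open>v * v + s * s = 1\<close>, which a homomorphism preserves. The C*-identity reduces the
  general case to this one.\<close>

lemma star_hom_contractive:
 fixes \<pi> :: "'a::cstar_algebra => 'b::cstar_algebra"
 assumes add: "!!x y. \<pi> (x + y) = \<pi> x + \<pi> y" and scale: "!!c x. \<pi> (c *\<^sub>C x) = c *\<^sub>C \<pi> x"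
  and mult: "!!x y. \<pi> (x * y) = \<pi> x * \<pi> y" and adj: "!!x. \<pi> (adj x) = adj (\<pi> x)" and one: "\<pi> 1 = 1"
 shows "norm (\<pi> x) \<le> norm x"
proof -
 have minus: "\<pi> (x - y) = \<pi> x - \<pi> y" for x y
  using add[of x "(-1) *\<^sub>C y"] scale[of "-1" y] by (simp add: scaleC_minus_one)
 have sa: "norm (\<pi> u) \<le> norm u" if u: "adj u = u" for u
 proof (rule dense_ge)
  fix r assume r: "norm u < r"
  then have r0: "r > 0" using norm_ge_zero[of u] by linarith
  define v where "v = cor (inverse r) *\<^sub>C u"
  have v: "adj v = v" "norm v < 1"
   using r r0 by (simp_all add: v_def adj_scaleC u norm_scaleC norm_inverse norm_divide field_simps)
  have "norm v * norm v \<le> 1 * norm v" using v(2) by (intro mult_right_mono) auto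
  then have vv: "adj (v * v) = v * v" "norm (v * v) < 1"
   using v norm_mult_ineq[of v v] by (simp_all add: adj_mult)
  obtain s where s: "adj s = s" "s * s = 1 - v * v" "!!y. v * v * y = y * (v * v) ==> s * y = y * s"
   using cstar_sqrt[OF vv] by metis
  have "v * s = s * v" using s(3)[of v] by (simp add: mult.assoc)
  have "adj (\<pi> v) = \<pi> v" "adj (\<pi> s) = \<pi> s" by (simp_all only: adj[symmetric] v s)
  moreover have "\<pi> v * \<pi> s = \<pi> s * \<pi> v" by (simp only: mult[symmetric] \<open>v * s = s * v\<close>)
  moreover have "\<pi> v * \<pi> v + \<pi> s * \<pi> s = 1" by (simp only: mult[symmetric] s(2) minus one) simp
  ultimately have "norm (\<pi> v) \<le> 1" by (rule commuting_squares_bound(1))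
  then have "norm (inverse r *\<^sub>R \<pi> u) \<le> 1" unfolding v_def unfolding scale unfolding scaleC_of_real .
  then show "norm (\<pi> u) \<le> r" using r0 by (simp add: field_simps)
 qed
 have "(norm (\<pi> x))\<^sup>2 = norm (\<pi> (adj x * x))" by (simp add: mult adj cstar_identity)
 also have "\<dots> \<le> norm (adj x * x)" by (intro sa) (simp add: adj_mult adj_adj)
 finally have "(norm (\<pi> x))\<^sup>2 \<le> (norm x)\<^sup>2" by (simp only: cstar_identity)
 then show ?thesis by (rule power2_le_imp_le) simp
qed

section \<open>States: hermiticity and the norm bound\<close>

context
 fixes \<phi> :: "'a::cstar_algebra => complex" assumes st: "is_state \<phi>"
begin

lemma state_add: "\<phi> (x + y) = \<phi> x + \<phi> y" and state_scale: "\<phi> (c *\<^sub>C x) = c * \<phi> x"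
 and state_one: "\<phi> 1 = 1"
 using st unfolding is_state_def by auto

lemma state_pos: "Im (\<phi> (adj x * x)) = 0" "0 \<le> Re (\<phi> (adj x * x))"
proof -
 have "\<phi> (adj x * x) \<in> \<real>\<^sub>\<ge>\<^sub>0" using st unfolding is_state_def by blast
 then show "Im (\<phi> (adj x * x)) = 0" "0 \<le> Re (\<phi> (adj x * x))"
  by (simp_all add: complex_nonneg_Reals_iff)
qed

text \<open>Nonnegativity at \<open>1 + x\<close> and at \<open>1 + \<i> *\<^sub>C x\<close> yields
  the imaginary and the real part of the identity.\<close>

lemma state_adj: "\<phi> (adj x) = cnj (\<phi> x)"
proof -
 have "adj (1 + x) * (1 + x) = 1 + x + adj x + adj x * x"
  "adj (1 + \<i> *\<^sub>C x) * (1 + \<i> *\<^sub>C x) = 1 + \<i> *\<^sub>C x + (- \<i>) *\<^sub>C adj x + adj x * x"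
  by (simp_all add: adj_add adj_scaleC algebra_simps scaleC_mult_left scaleC_mult_right scaleC_scaleC scaleC_add_right)
 then have "Im (1 + \<phi> x + \<phi> (adj x) + \<phi> (adj x * x)) = 0"
  "Im (1 + \<i> * \<phi> x + (- \<i>) * \<phi> (adj x) + \<phi> (adj x * x)) = 0"
  using state_pos(1)[of "1 + x"] state_pos(1)[of "1 + \<i> *\<^sub>C x"]
  by (simp_all add: state_add state_scale state_one)
 then show ?thesis using state_pos(1)[of x] by (simp add: complex_eq_iff)
qed

text \<open>After scaling below norm 1, a square root of \<open>1 - adj v * v\<close> shows that
  \<open>\<phi> (adj v * v)\<close> is at most 1. Nonnegativity of the variance of \<open>v\<close>
  then bounds \<open>\<phi> v\<close>.\<close>

lemma state_bound: "cmod (\<phi> x) \<le> norm x"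
proof (rule dense_ge)
 fix r assume r: "norm x < r"
 then have r0: "r > 0" using norm_ge_zero[of x] by linarith
 define v where "v = cor (inverse r) *\<^sub>C x"
 have nv: "norm v < 1" using r r0 by (simp add: v_def norm_scaleC norm_inverse norm_divide field_simps)
 have "norm (adj v * v) < 1" using nv by (simp add: cstar_identity power_less_one_iff abs_square_less_1)
 then obtain s where s: "adj s = s" "s * s = 1 - adj v * v"
  using cstar_sqrt[of "adj v * v"] by (metis adj_adj adj_mult)
 define c where "c = \<phi> v"
 have "adj s * s + adj v * v = 1" using s by simp
 then have "\<phi> (adj s * s) + \<phi> (adj v * v) = 1" by (metis state_add state_one)
 then have 1: "Re (\<phi> (adj v * v)) \<le> 1" using state_pos(2)[of s] by (drule_tac arg_cong[of _ _ Re]) simp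
 have "adj (v - c *\<^sub>C 1) * (v - c *\<^sub>C 1) = adj v * v + (- cnj c) *\<^sub>C v + (- c) *\<^sub>C adj v + (c * cnj c) *\<^sub>C 1"
  by (simp add: adj_diff adj_scaleC algebra_simps scaleC_mult_left scaleC_mult_right scaleC_scaleC
    scaleC.minus_left scaleC.diff_right)
 then have "\<phi> (adj (v - c *\<^sub>C 1) * (v - c *\<^sub>C 1)) = \<phi> (adj v * v) - c * cnj c"
  by (simp add: state_add state_scale state_one state_adj c_def[symmetric] mult.commute)
 then have "0 \<le> Re (\<phi> (adj v * v) - c * cnj c)" using state_pos(2) by metis
 then have "(cmod c)\<^sup>2 \<le> 1" using 1 by (simp add: complex_norm_square[symmetric] flip: of_real_power)
 then have "cmod c \<le> 1" by (simp add: abs_square_le_1)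
 moreover have "\<phi> x = cor r * c"
  using r0 by (simp add: c_def v_def state_scale)
 ultimately show "cmod (\<phi> x) \<le> r" using r0 by (simp add: norm_mult)
qed

end

text \<open>
 The elementary substitute for positivity: for \<open>x\<close> self-adjoint the condition says that the
 spectrum is nonnegative. It holds for squares and is stable under sums, which is all that is
 needed to exclude negative multiples of projections.
\<close>

definition psd :: "'a::cstar_algebra => bool" where
 "psd x \<longleftrightarrow> (\<exists>T. \<forall>t\<ge>T. norm (t *\<^sub>R 1 - x) \<le> t)"

lemma psd_add: "psd x ==> psd y ==> psd (x + y)"
proof -
 assume "psd x" "psd y"
 then obtain A B where A: "!!t. t \<ge> A ==> norm (t *\<^sub>R 1 - x) \<le> t" and B: "!!t. t \<ge> B ==> norm (t *\<^sub>R 1 - y) \<le> t"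
  unfolding psd_def by blast
 have "norm (t *\<^sub>R 1 - (x + y)) \<le> t" if "t \<ge> 2 * max A B" for t
 proof -
  have "t *\<^sub>R 1 - (x + y) = ((t/2) *\<^sub>R 1 - x) + ((t/2) *\<^sub>R 1 - y)"
   by (simp add: algebra_simps flip: scaleR_add_left)
  also have "norm \<dots> \<le> t/2 + t/2" by (intro norm_triangle_le add_mono A B) (use that in auto)
  finally show ?thesis by simp
 qed
 then show ?thesis unfolding psd_def by blast
qed

text \<open>For \<open>t\<close> above the squared norm the rescaled \<open>1 - v * v\<close> is
  again a square, of an element whose norm \<open>commuting_squares_bound\<close> keeps below
  1.\<close>

lemma psd_square: "adj u = u ==> psd (u * u)"
 unfolding psd_def
proof (intro exI[of _ "(norm u)\<^sup>2 + 1"] allI impI)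
 fix t assume u: "adj u = u" and t: "(norm u)\<^sup>2 + 1 \<le> t"
 then have t0: "t > 0" "(norm u)\<^sup>2 < t" by (smt (verit) zero_le_power2)+
 define v where "v = inverse (sqrt t) *\<^sub>R u"
 have v: "adj v = v" by (simp add: v_def adj_scaleR u)
 have vv: "v * v = inverse t *\<^sub>R (u * u)" using t0 by (simp add: v_def flip: inverse_mult_distrib)
 have "norm (v * v) \<le> inverse t * (norm u)\<^sup>2"
  using norm_mult_ineq[of u u] t0 by (simp add: vv power2_eq_square)
 also have "\<dots> < 1" using t0 by (simp add: field_simps)
 finally have "norm (v * v) < 1" .
 then obtain s where s: "adj s = s" "s * s = 1 - v * v" "!!y. v * v * y = y * (v * v) ==> s * y = y * s"
  using cstar_sqrt[of "v * v"] v by (metis adj_mult)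
 have "v * s = s * v" using s(3)[of v] by (simp add: mult.assoc)
 then have "norm s \<le> 1" using commuting_squares_bound(2)[OF v s(1)] s(2) by simp
 then have "norm (1 - v * v) \<le> 1"
  using norm_mult_ineq[of s s] s(2) mult_mono[of "norm s" 1 "norm s" 1] by simp
 then have "t * norm (1 - v * v) \<le> t" using t0 by simp
 moreover have "t *\<^sub>R 1 - u * u = t *\<^sub>R (1 - v * v)" using t0 by (simp add: vv scaleR_diff_right)
 ultimately show "norm (t *\<^sub>R 1 - u * u) \<le> t" using t0 by simp
qed

lemma psd_scale: "psd x ==> r \<ge> 0 ==> psd (r *\<^sub>R x)"
proof (cases "r = 0")
 case True then show ?thesis using psd_square[of 0] by simp
next
 case False
 assume "psd x" "r \<ge> 0"
 then obtain A where A: "!!t. t \<ge> A ==> norm (t *\<^sub>R 1 - x) \<le> t" unfolding psd_def by blast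
 have r: "r > 0" using False \<open>r \<ge> 0\<close> by simp
 have "norm (t *\<^sub>R 1 - r *\<^sub>R x) \<le> t" if "t \<ge> r * A" for t
 proof -
  have "t *\<^sub>R 1 - r *\<^sub>R x = r *\<^sub>R ((t / r) *\<^sub>R 1 - x)" using r by (simp add: scaleR_diff_right)
  moreover have "norm ((t / r) *\<^sub>R 1 - x) \<le> t / r" using A[of "t / r"] that r by (simp add: field_simps)
  ultimately have "norm (t *\<^sub>R 1 - r *\<^sub>R x) \<le> r * (t / r)"
   using r by (simp only: norm_scaleR abs_of_pos) (rule mult_left_mono, simp_all)
  then show ?thesis using r by simp
 qed
 then show "psd (r *\<^sub>R x)" unfolding psd_def by blast
qed

lemma psd_projection:
 assumes p: "p * p = p" "p \<noteq> 0" and neg: "psd (- c *\<^sub>R p)" and "c \<ge> 0" shows "c = 0"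
proof (rule ccontr)
 assume "c \<noteq> 0" with \<open>c \<ge> 0\<close> have c: "c > 0" by simp
 from neg obtain T where T: "!!t. t \<ge> T ==> norm (t *\<^sub>R 1 - - c *\<^sub>R p) \<le> t" unfolding psd_def by blast
 define t where "t = max T 0"
 have "(t + c) * norm p = norm ((t *\<^sub>R 1 - - c *\<^sub>R p) * p)"
  using c by (simp add: algebra_simps p(1) t_def flip: scaleR_add_left)
 also have "\<dots> \<le> t * norm p"
  by (intro order_trans[OF norm_mult_ineq] mult_right_mono T) (auto simp: t_def)
 finally have "c * norm p \<le> 0" by (simp add: algebra_simps)
 then show False using c p(2) by (simp add: mult_le_0_iff)
qed

text \<open>If the scalar were negative, \<open>X * adj X\<close> would be the same negative
  multiple of a projection \<open>q\<close>, and a sum of squares of self-adjoint elements would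
  equal a negative multiple of \<open>p\<close>, which \<open>psd_projection\<close>
  forbids.\<close>

lemma positive_corner:
 fixes p X :: "'a::cstar_algebra"
 assumes p: "adj p = p" "p * p = p" "p \<noteq> 0" and X: "X * p = X" "adj X * X = g *\<^sub>C p"
 shows "g \<in> \<real>\<^sub>\<ge>\<^sub>0"
proof -
 have "adj X * X = cnj g *\<^sub>C p" using arg_cong[OF X(2), of adj] by (simp add: adj_mult adj_adj adj_scaleC p(1))
 then have "cnj g *\<^sub>C p = g *\<^sub>C p" using X(2) by simp
 then have "(cnj g - g) *\<^sub>C p = 0" by (simp add: scaleC.diff_left)
 then have "cnj g = g" using p(3) by simp
 then have im: "Im g = 0" by (simp add: complex_eq_iff)
 then have X': "adj X * X = Re g *\<^sub>R p" using X(2) by (metis complex_is_Real_iff of_real_Re scaleC_of_real)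
 have "Re g \<ge> 0"
 proof (rule ccontr)
  assume neg: "\<not> Re g \<ge> 0"
  define c where "c = - Re g"
  have c: "c > 0" using neg by (simp add: c_def)
  have XX: "adj X * X = - c *\<^sub>R p" using X' by (simp add: c_def)
  define q where "q = - inverse c *\<^sub>R (X * adj X)"
  have aq: "adj q = q" by (simp add: q_def adj_minus adj_scaleR adj_mult adj_adj)
  have "X * adj X * (X * adj X) = X * (adj X * X) * adj X" by (simp only: mult.assoc)
  also have "\<dots> = - c *\<^sub>R (X * adj X)" by (simp add: XX X(1))
  finally have qq: "q * q = q" using c by (simp add: q_def)
  have XXq: "X * adj X = - c *\<^sub>R q" using c by (simp add: q_def)
  define u where "u = X + adj X"
  define v where "v = \<i> *\<^sub>C (X - adj X)"
  have uv: "adj u = u" "adj v = v"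
   by (simp_all add: u_def v_def adj_add adj_diff adj_scaleC adj_adj add.commute scaleC.minus_left scaleC.diff_right)
  \<comment> \<open>The real and imaginary parts of \<open>X\<close> bring in
    \<open>adj X * X\<close> and \<open>X * adj X\<close> together; the latter is cancelled by
    adding a multiple of \<open>q * q\<close>.\<close>
  have "u * u + v * v = 2 *\<^sub>R (adj X * X) + 2 *\<^sub>R (X * adj X)"
   by (simp add: u_def v_def scaleC_mult_left scaleC_mult_right scaleC_scaleC scaleC_minus_one algebra_simps scaleR_2
     scaleC.diff_right)
  then have e: "u * u + v * v + (2 * c) *\<^sub>R (q * q) = - (2 * c) *\<^sub>R p"
   by (simp add: XX XXq qq)
  have "psd (- (2 * c) *\<^sub>R p)"
   unfolding e[symmetric] using c by (intro psd_add psd_scale psd_square uv aq) auto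
  from psd_projection[OF p(2,3) this] c show False by simp
 qed
 with im show ?thesis by (simp add: complex_nonneg_Reals_iff)
qed

lemma functional_extend:
 fixes \<phi> :: "'a::complex_banach => complex"
 assumes S: "csubspace S" "closure S = UNIV"
  and add: "!!x y. x \<in> S ==> y \<in> S ==> \<phi> (x + y) = \<phi> x + \<phi> y"
  and scale: "!!c x. x \<in> S ==> \<phi> (c *\<^sub>C x) = c * \<phi> x"
  and bound: "!!x. x \<in> S ==> cmod (\<phi> x) \<le> norm x"
 obtains \<psi> where "!!x y. \<psi> (x + y) = \<psi> x + \<psi> y" "!!c x. \<psi> (c *\<^sub>C x) = c * \<psi> x"
  "!!x. cmod (\<psi> x) \<le> norm x" "!!x. x \<in> S ==> \<psi> x = \<phi> x"
proof -
 have diff: "\<phi> (x - y) = \<phi> x - \<phi> y" if "x \<in> S" "y \<in> S" for x y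
  using add[of x "(-1) *\<^sub>C y"] scale[of y "-1"] that csubspaceD(3)[OF S(1), of y "-1"]
  by (simp add: scaleC_minus_one)
 have "uniformly_continuous_on S \<phi>"
  unfolding uniformly_continuous_on_def dist_norm
 proof (intro allI impI)
  fix e :: real assume e: "e > 0"
  have "norm (\<phi> x' - \<phi> x) < e" if "x \<in> S" "x' \<in> S" "norm (x' - x) < e" for x x'
   using bound[OF csubspace_diff[OF S(1) that(2,1)]] that by (simp add: diff)
  then show "\<exists>d>0. \<forall>x\<in>S. \<forall>x'\<in>S. norm (x' - x) < d \<longrightarrow> norm (\<phi> x' - \<phi> x) < e"
   using e by blast
 qed
 from uniformly_continuous_on_extension_on_closure[OF this] obtain \<psi> where
  \<psi>: "uniformly_continuous_on UNIV \<psi>" "!!x. x \<in> S ==> \<phi> x = \<psi> x"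
  unfolding S(2) by (metis (no_types))
 have cont: "(%n. \<psi> (f n)) \<longlonglongrightarrow> \<psi> l" if "f \<longlonglongrightarrow> l" for f l
  using uniformly_continuous_imp_continuous[OF \<psi>(1)] that
  by (auto simp: continuous_on_sequentially comp_def)
 have seq: "\<exists>f. (\<forall>n. f n \<in> S) \<and> f \<longlonglongrightarrow> x" for x
  using S(2) closure_sequential[of x S] by auto
 show ?thesis
 proof
  show "\<psi> x = \<phi> x" if "x \<in> S" for x using \<psi>(2) that by simp
  show "\<psi> (x + y) = \<psi> x + \<psi> y" for x y
  proof -
   obtain f g where f: "!!n. f n \<in> S" "f \<longlonglongrightarrow> x" and g: "!!n. g n \<in> S" "g \<longlonglongrightarrow> y" using seq by metis
   have "(%n. \<psi> (f n + g n)) \<longlonglongrightarrow> \<psi> (x + y)" by (intro cont tendsto_add f g)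
   moreover have "(%n. \<psi> (f n) + \<psi> (g n)) \<longlonglongrightarrow> \<psi> x + \<psi> y" by (intro cont tendsto_add f g)
   moreover have "\<psi> (f n + g n) = \<psi> (f n) + \<psi> (g n)" for n
    using f(1)[of n] g(1)[of n] csubspaceD(2)[OF S(1)] by (simp add: \<psi>(2)[symmetric] add)
   ultimately show ?thesis by (simp add: LIMSEQ_unique)
  qed
  show "\<psi> (c *\<^sub>C x) = c * \<psi> x" for c x
  proof -
   obtain f where f: "!!n. f n \<in> S" "f \<longlonglongrightarrow> x" using seq by metis
   have "(%n. \<psi> (c *\<^sub>C f n)) \<longlonglongrightarrow> \<psi> (c *\<^sub>C x)" by (intro cont scaleC.tendsto tendsto_const f)
   moreover have "(%n. c * \<psi> (f n)) \<longlonglongrightarrow> c * \<psi> x" by (intro tendsto_intros cont f)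
   moreover have "\<psi> (c *\<^sub>C f n) = c * \<psi> (f n)" for n
    using f(1)[of n] csubspaceD(3)[OF S(1)] by (simp add: \<psi>(2)[symmetric] scale)
   ultimately show ?thesis by (simp add: LIMSEQ_unique)
  qed
  show "cmod (\<psi> x) \<le> norm x" for x
  proof -
   obtain f where f: "!!n. f n \<in> S" "f \<longlonglongrightarrow> x" using seq by metis
   show ?thesis
   proof (rule LIMSEQ_le)
    show "(%n. cmod (\<psi> (f n))) \<longlonglongrightarrow> cmod (\<psi> x)" by (intro tendsto_norm cont f)
    show "(%n. norm (f n)) \<longlonglongrightarrow> norm x" by (intro tendsto_norm f)
    show "\<exists>N. \<forall>n\<ge>N. cmod (\<psi> (f n)) \<le> norm (f n)" using bound[OF f(1)] f(1) \<psi>(2) by auto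
   qed
  qed
 qed
qed

section \<open>Normal ordering in the CAR algebra\<close>

definition del :: "nat => 'b list => 'b list" where
 "del j xs = take j xs @ drop (Suc j) xs"

lemma del_Cons_0 [simp]: "del 0 (x # xs) = xs"
 and del_Cons_Suc [simp]: "del (Suc j) (x # xs) = x # del j xs"
 by (simp_all add: del_def)

lemma length_del [simp]: "j < length xs ==> length (del j xs) = length xs - 1"
 by (auto simp: del_def)

lemma nth_del: "j < length xs ==> i < length xs - 1 ==> del j xs ! i = xs ! (if i < j then i else Suc i)"
 by (auto simp: del_def nth_append min_def)

lemma set_del_subset: "set (del j xs) \<subseteq> set xs"
 by (auto simp: del_def dest: in_set_takeD in_set_dropD)

lemma del_map: "del j (map f xs) = map f (del j xs)"
 by (simp add: del_def take_map drop_map)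

text \<open>Entries are a function of the indices, so entrywise limits and the deletion of rows and
  columns involve no matrix carriers.\<close>

definition fdet :: "nat => (nat => nat => complex) => complex" where
 "fdet n F = Determinant.det (Matrix.mat n n (%(i, j). F i j))"

abbreviation "qfdet K hs ks \<equiv>
 if length hs = length ks then fdet (length hs) (%i j. cinner (K (hs ! i)) (ks ! j)) else 0"

lemma fdet_0 [simp]: "fdet 0 F = 1"
 by (simp add: fdet_def det_def)

lemma fdet_cong: "(!!i j. i < n ==> j < n ==> F i j = G i j) ==> fdet n F = fdet n G"
 unfolding fdet_def by (intro arg_cong[of _ _ Determinant.det] eq_matI) auto

lemma fdet_laplace:
 assumes r: "r < Suc n"
 shows "fdet (Suc n) F = (\<Sum>j<Suc n. (-1) ^ (r + j) * F r j *
   fdet n (%i j'. F (if i < r then i else Suc i) (if j' < j then j' else Suc j')))"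
proof -
 let ?A = "Matrix.mat (Suc n) (Suc n) (%(i, j). F i j)"
 have "fdet (Suc n) F = (\<Sum>j<Suc n. ?A $$ (r, j) * cofactor ?A r j)"
  unfolding fdet_def by (subst laplace_expansion_row[where i = r and n = "Suc n"]) (use r in auto)
 also have "\<dots> = (\<Sum>j<Suc n. (-1) ^ (r + j) * F r j *
   fdet n (%i j'. F (if i < r then i else Suc i) (if j' < j then j' else Suc j')))"
 proof (intro sum.cong refl)
  fix j assume "j \<in> {..<Suc n}"
  then have j: "j < Suc n" by simp
  have "mat_delete ?A r j = Matrix.mat n n (%(i, j'). F (if i < r then i else Suc i) (if j' < j then j' else Suc j'))"
   unfolding mat_delete_def by (intro eq_matI) auto
  then show "?A $$ (r, j) * cofactor ?A r j = (-1) ^ (r + j) * F r j *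
   fdet n (%i j'. F (if i < r then i else Suc i) (if j' < j then j' else Suc j'))"
   using r j by (simp add: cofactor_def fdet_def)
 qed
 finally show ?thesis .
qed

lemma tendsto_fdet:
 assumes "!!i j. i < n ==> j < n ==> ((%N. F N i j) \<longlongrightarrow> G i j) A"
 shows "((%N. fdet n (F N)) \<longlongrightarrow> fdet n G) A"
proof -
 have e: "fdet n H = (\<Sum>p\<in>{p. p permutes {0..<n}}. signof p * (\<Prod>i = 0..<n. H i (p i)))" for H
 proof -
  have "(\<Prod>i = 0..<n. Matrix.mat n n (%(i, j). H i j) $$ (i, p i)) = (\<Prod>i = 0..<n. H i (p i))"
   if "p permutes {0..<n}" for p
   using permutes_in_image[OF that] by (intro prod.cong) auto
  then show ?thesis unfolding fdet_def det_def by (auto intro!: sum.cong)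
 qed
 show ?thesis
  unfolding e
 proof (intro tendsto_sum tendsto_mult tendsto_const tendsto_prod assms)
  fix p i assume "p \<in> {p. p permutes {0..<n}}" "i \<in> {0..<n}"
  then show "i < n" "p i < n" using permutes_in_image[of p "{0..<n}" i] by auto
 qed
qed

section \<open>Anticommutation relations and normally ordered monomials\<close>

locale car =
 fixes a :: "'x ell2 => 'a::cstar_algebra"
 assumes car: "car_relations a"
begin

abbreviation c :: "'x ell2 => 'a" where "c h \<equiv> adj (a h)"

lemma c_add: "c (h + k) = c h + c k" and c_scale: "c (z *\<^sub>C h) = z *\<^sub>C c h"
 and a_anti: "a h * a k + a k * a h = 0"
 and c_a: "c h * a k + a k * c h = cinner h k *\<^sub>C 1"
 using car unfolding car_relations_def by auto

lemma a_add: "a (h + k) = a h + a k"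
 by (metis adj_add adj_adj c_add)

lemma a_scale: "a (z *\<^sub>C h) = cnj z *\<^sub>C a h"
 by (metis adj_scaleC adj_adj c_scale)

lemma a_0 [simp]: "a 0 = 0"
 using a_scale[of 0 0] by simp

lemma a_swap: "a h * a k = - (a k * a h)"
 using a_anti by (simp add: eq_neg_iff_add_eq_0)

lemma c_a_swap: "c h * a k = cinner h k *\<^sub>C 1 - a k * c h"
 using c_a by (simp add: eq_diff_eq)

lemma a_c_swap: "a k * c h = cinner h k *\<^sub>C 1 - c h * a k"
 using c_a[of h k] by (simp add: eq_diff_eq add.commute)

lemma a_square: "a h * a h = 0"
 using a_anti[of h h] by (simp flip: scaleR_2)

lemma c_square: "c h * c h = 0"
 using arg_cong[OF a_square[of h], of adj] by (simp add: adj_mult)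

text \<open>\<open>c h * a h\<close> squares to \<open>(norm h)\<^sup>2\<close> times itself; the
  C*-identity, used twice, then compares powers of \<open>norm (a h)\<close>.\<close>

lemma norm_a_le: "norm (a h) \<le> norm h"
proof -
 have "(c h * a h) * (c h * a h) = c h * (a h * c h) * a h" by (simp only: mult.assoc)
 also have "\<dots> = cor ((norm h)\<^sup>2) *\<^sub>C (c h * a h)"
  unfolding a_c_swap
  by (simp add: algebra_simps scaleC_mult_left scaleC_mult_right cinner_self_norm)
   (metis (no_types, lifting) a_square mult.assoc mult_zero_right)
 finally have sq: "(c h * a h) * (c h * a h) = cor ((norm h)\<^sup>2) *\<^sub>C (c h * a h)" .
 have "(norm (c h * a h))\<^sup>2 = norm (adj (c h * a h) * (c h * a h))" by (rule cstar_identity[symmetric])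
 also have "\<dots> = (norm h)\<^sup>2 * norm (c h * a h)"
  by (simp add: adj_mult adj_adj sq norm_scaleC norm_power)
 finally have "((norm (a h))\<^sup>2)\<^sup>2 = (norm h)\<^sup>2 * (norm (a h))\<^sup>2" by (simp add: cstar_identity)
 then have "(norm (a h))\<^sup>2 = (norm h)\<^sup>2 \<or> (norm (a h))\<^sup>2 = 0"
  by (auto simp: power2_eq_square)
 then show ?thesis
  by (metis norm_ge_zero order_refl power2_eq_imp_eq power_zero_numeral zero_eq_power2)
qed

lemma bounded_linear_a: "bounded_linear a"
 by (rule bounded_linear_intro[where K = 1])
  (simp_all add: a_add norm_a_le a_scale[of "cor _", unfolded scaleC_of_real, simplified] scaleC_of_real)

lemma bounded_linear_c: "bounded_linear c"
 by (rule bounded_linear_compose[OF bounded_linear_adj bounded_linear_a])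

lemmas tendsto_a = bounded_linear.tendsto[OF bounded_linear_a]
lemmas tendsto_c = bounded_linear.tendsto[OF bounded_linear_c]
lemmas a_sum = linear_sum[OF bounded_linear.linear[OF bounded_linear_a]]
definition ann :: "'x ell2 list => 'a" where "ann ks = prod_list (map a ks)"
definition cre :: "'x ell2 list => 'a" where "cre hs = prod_list (rev (map c hs))"
definition nmon :: "'x ell2 list => 'x ell2 list => 'a" where "nmon hs ks = cre hs * ann ks"

lemma ann_Nil [simp]: "ann [] = 1" and ann_Cons [simp]: "ann (k # ks) = a k * ann ks"
 and ann_append: "ann (ks @ ks') = ann ks * ann ks'"
 by (simp_all add: ann_def)

lemma cre_Nil [simp]: "cre [] = 1" and cre_Cons: "cre (h # hs) = cre hs * c h"
 and cre_snoc: "cre (hs @ [h]) = c h * cre hs"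
 by (simp_all add: cre_def)

lemma adj_ann: "adj (ann ks) = cre ks"
 by (induction ks) (simp_all add: cre_Cons adj_mult)

lemma adj_cre: "adj (cre hs) = ann hs"
 by (metis adj_ann adj_adj)

lemma adj_nmon: "adj (nmon hs ks) = nmon ks hs"
 by (simp add: nmon_def adj_mult adj_ann adj_cre)

lemma a_ann_commute: "a k * ann ks = (-1) ^ length ks *\<^sub>C (ann ks * a k)"
proof (induction ks)
 case (Cons l ks)
 have "a k * ann (l # ks) = - (a l * (a k * ann ks))"
  by (simp add: mult.assoc[symmetric] a_swap[of k l])
 then show ?case by (simp add: Cons scaleC_mult_right scaleC.minus_left mult.assoc)
qed simp

text \<open>The creator moves to the right past one annihilator after the other and leaves one
  contraction behind at each.\<close>

lemma c_ann:
 "c h * ann ks = (-1) ^ length ks *\<^sub>C (ann ks * c h)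
  + (\<Sum>j<length ks. ((-1) ^ j * cinner h (ks ! j)) *\<^sub>C ann (del j ks))"
proof (induction ks)
 case (Cons k ks)
 have "c h * ann (k # ks) = cinner h k *\<^sub>C ann ks - a k * (c h * ann ks)"
  by (simp add: mult.assoc[symmetric] c_a_swap left_diff_distrib scaleC_mult_left)
 also have "\<dots> = (-1) ^ length (k # ks) *\<^sub>C (ann (k # ks) * c h)
  + (\<Sum>j<length (k # ks). ((-1) ^ j * cinner h ((k # ks) ! j)) *\<^sub>C ann (del j (k # ks)))"
  unfolding Cons list.size(4) sum.lessThan_Suc_shift add.right_neutral add_Suc_right
  by (simp add: distrib_left sum_distrib_left scaleC_mult_right mult.assoc scaleC.minus_left sum_negf)
 finally show ?case .
qed simp

lemma a_cre:
 "a k * cre hs = (-1) ^ length hs *\<^sub>C (cre hs * a k)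
  + (\<Sum>j<length hs. ((-1) ^ (length hs + 1 + j) * cinner (hs ! j) k) *\<^sub>C cre (del j hs))"
proof -
 let ?s = "(-1 :: complex) ^ length hs"
 have "cre hs * a k = adj (c k * ann hs)" by (simp add: adj_mult adj_ann adj_adj)
 also have "\<dots> = ?s *\<^sub>C (a k * cre hs) + (\<Sum>j<length hs. ((-1) ^ j * cinner (hs ! j) k) *\<^sub>C cre (del j hs))"
  unfolding c_ann
  by (simp add: adj_add adj_sum adj_scaleC adj_mult adj_ann adj_adj cinner_commute[of _ k])
 finally have "?s *\<^sub>C (cre hs * a k) = a k * cre hs
  + (\<Sum>j<length hs. (?s * ((-1) ^ j * cinner (hs ! j) k)) *\<^sub>C cre (del j hs))"
  by (simp add: scaleC_add_right scaleC.sum_right scaleC_scaleC flip: power_add mult.assoc)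
 then show ?thesis
  by (simp add: power_add scaleC.minus_left sum_negf eq_diff_eq mult.assoc flip: scaleC.sum_right)
qed

text \<open>The span is already a star-algebra: restoring normal order by \<open>a_cre\<close> only
  deletes letters, so no vectors outside \<open>W\<close> appear.\<close>

definition calg :: "'x ell2 set => 'a set" where
 "calg W = cspan {nmon hs ks |hs ks. set hs \<subseteq> W \<and> set ks \<subseteq> W}"

lemma csubspace_calg: "csubspace (calg W)"
 by (simp add: calg_def csubspace_cspan)

lemma nmon_calg: "set hs \<subseteq> W ==> set ks \<subseteq> W ==> nmon hs ks \<in> calg W"
 unfolding calg_def by (rule cspan_base) blast

lemma calg_induct [consumes 1, case_names nmon zero add]:
 assumes "x \<in> calg W"
  and "!!hs ks. set hs \<subseteq> W ==> set ks \<subseteq> W ==> P (nmon hs ks)"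
  and "P 0" and "!!x y z. x \<in> calg W ==> y \<in> calg W ==> P x ==> P y ==> P (x + z *\<^sub>C y)"
 shows "P x"
 using assms(1) unfolding calg_def
proof induction
 case (cspan_add_scale x y z)
 then obtain hs ks where "y = nmon hs ks" "set hs \<subseteq> W" "set ks \<subseteq> W" by blast
 then show ?case
  using cspan_add_scale assms(2)[of hs ks] by (intro assms(4)) (auto simp: calg_def intro: cspan_base)
qed (rule assms(3))

lemma calg_1: "1 \<in> calg W"
 using nmon_calg[of "[]" W "[]"] by (simp add: nmon_def)

lemma calg_left_c: "x \<in> calg W ==> h \<in> W ==> c h * x \<in> calg W"
proof (induction rule: calg_induct)
 case (nmon hs ks)
 have "c h * nmon hs ks = nmon (hs @ [h]) ks" by (simp add: nmon_def cre_snoc mult.assoc)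
 then show ?case using nmon by (simp add: nmon_calg)
next
 case zero then show ?case using csubspaceD(1)[OF csubspace_calg] by simp
next
 case (add x y z)
 then show ?case using csubspaceD(2,3)[OF csubspace_calg] by (simp add: distrib_left scaleC_mult_right)
qed

lemma calg_left_a: "x \<in> calg W ==> k \<in> W ==> a k * x \<in> calg W"
proof (induction rule: calg_induct)
 case (nmon hs ks)
 have "a k * nmon hs ks = (-1) ^ length hs *\<^sub>C nmon hs (k # ks)
  + (\<Sum>j<length hs. ((-1) ^ (length hs + 1 + j) * cinner (hs ! j) k) *\<^sub>C nmon (del j hs) ks)"
  unfolding nmon_def mult.assoc[symmetric] a_cre
  by (simp add: distrib_right sum_distrib_right scaleC_mult_left mult.assoc)
 moreover have "nmon (del j hs) ks \<in> calg W" for j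
  using nmon set_del_subset[of j hs] by (intro nmon_calg) auto
 moreover have "nmon hs (k # ks) \<in> calg W" using nmon by (intro nmon_calg) auto
 ultimately show ?case
  by (simp only:) (intro csubspaceD(2,3)[OF csubspace_calg] csubspace_sum[OF csubspace_calg])
next
 case zero then show ?case using csubspaceD(1)[OF csubspace_calg] by simp
next
 case (add x y z)
 then show ?case using csubspaceD(2,3)[OF csubspace_calg] by (simp add: distrib_left scaleC_mult_right)
qed

lemma calg_mult: "x \<in> calg W ==> y \<in> calg W ==> x * y \<in> calg W"
proof (induction rule: calg_induct)
 case (nmon hs ks)
 have 1: "ann ks * y \<in> calg W" using nmon(2)
  by (induction ks) (use nmon(3) in \<open>auto simp: mult.assoc intro: calg_left_a\<close>)
 have "cre hs * z \<in> calg W" if "z \<in> calg W" for z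
  using nmon(1) that
  by (induction hs arbitrary: z rule: rev_induct) (auto simp: mult.assoc cre_snoc intro: calg_left_c)
 from this[OF 1] show ?case by (simp add: nmon_def mult.assoc)
next
 case zero then show ?case using csubspaceD(1)[OF csubspace_calg] by simp
next
 case (add x x' z)
 then show ?case using csubspaceD(2,3)[OF csubspace_calg] by (simp add: distrib_right scaleC_mult_left)
qed

lemma calg_adj: "x \<in> calg W ==> adj x \<in> calg W"
proof (induction rule: calg_induct)
 case (nmon hs ks) then show ?case by (simp add: adj_nmon nmon_calg)
next
 case zero then show ?case using csubspaceD(1)[OF csubspace_calg] by simp
next
 case (add x x' z)
 then show ?case using csubspaceD(2,3)[OF csubspace_calg] by (simp add: adj_add adj_scaleC)
qed

lemma calg_a: "h \<in> W ==> a h \<in> calg W" and calg_c: "h \<in> W ==> c h \<in> calg W"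
 using calg_left_a[OF calg_1, of h W] calg_left_c[OF calg_1, of h W] by simp_all

end

lemma cstar_generated_subset:
 assumes "S \<subseteq> closure B" "1 \<in> B" "csubspace B" "!!x y. x \<in> B ==> y \<in> B ==> x * y \<in> B"
  "!!x. x \<in> B ==> adj x \<in> B"
 shows "cstar_generated S \<subseteq> closure (B :: 'a::cstar_algebra set)"
 unfolding cstar_generated_def
proof (rule Inter_lower, intro CollectI conjI ballI allI)
 have sub: "csubspace (closure B)" by (rule csubspace_closure[OF assms(3)])
 show "S \<subseteq> closure B" "1 \<in> closure B" "closed (closure B)" using assms(1,2) closure_subset by auto
 fix x assume x: "x \<in> closure B"
 then obtain f where f: "!!n. f n \<in> B" "f \<longlonglongrightarrow> x" unfolding closure_sequential by blast
 show "adj x \<in> closure B"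
  unfolding closure_sequential using f
  by (intro exI[of _ "%n. adj (f n)"]) (auto intro: assms(5) tendsto_adj)
 show "z *\<^sub>C x \<in> closure B" for z using csubspaceD(3)[OF sub x] .
 fix y assume y: "y \<in> closure B"
 then obtain g where g: "!!n. g n \<in> B" "g \<longlonglongrightarrow> y" unfolding closure_sequential by blast
 show "x + y \<in> closure B" using csubspaceD(2)[OF sub x y] .
 show "x * y \<in> closure B"
  unfolding closure_sequential using f g
  by (intro exI[of _ "%n. f n * g n"]) (auto intro: assms(4) tendsto_mult)
qed

locale car_alg = car a for a :: "'x ell2 => 'a::cstar_algebra" +
 assumes generated: "cstar_generated (range a) = UNIV"
begin

lemma calg_dense:
 assumes "closure W = UNIV" shows "closure (calg W) = UNIV"
proof -
 have "range a \<subseteq> closure (calg W)"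
 proof clarify
  fix h
  obtain f where "!!n. f n \<in> W" "f \<longlonglongrightarrow> h"
   using assms closure_sequential[of h W] by auto
  then show "a h \<in> closure (calg W)"
   unfolding closure_sequential by (intro exI[of _ "%n. a (f n)"]) (auto intro: calg_a tendsto_a)
 qed
 from cstar_generated_subset[OF this calg_1 csubspace_calg calg_mult calg_adj] generated
 show ?thesis by auto
qed

text \<open>The function \<open>f\<close> covers both uses: multiplication of scalars for states and
  \<open>scaleC\<close> for endomorphisms.\<close>

lemma functional_unique:
 fixes \<phi> \<psi> :: "'a => 'b::real_normed_vector"
 assumes "bounded_linear \<phi>" "bounded_linear \<psi>" "closure W = UNIV"
  and "!!z x. \<phi> (z *\<^sub>C x) = f z (\<phi> x)" "!!z x. \<psi> (z *\<^sub>C x) = f z (\<psi> x)"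
  and "!!hs ks. set hs \<subseteq> W ==> set ks \<subseteq> W ==> \<phi> (nmon hs ks) = \<psi> (nmon hs ks)"
 shows "\<phi> = \<psi>"
proof
 fix x
 have eq: "\<phi> y = \<psi> y" if "y \<in> calg W" for y
  using that
  by (induction rule: calg_induct)
   (simp_all add: assms(4-6) linear_add[OF bounded_linear.linear[OF assms(1)]] linear_add[OF bounded_linear.linear[OF assms(2)]]
    linear_0[OF bounded_linear.linear[OF assms(1)]] linear_0[OF bounded_linear.linear[OF assms(2)]])
 have "closed {y. \<phi> y = \<psi> y}"
  by (intro closed_Collect_eq linear_continuous_on assms)
 then have "closure (calg W) \<subseteq> {y. \<phi> y = \<psi> y}" using eq by (intro closure_minimal) auto
 then show "\<phi> x = \<psi> x" using calg_dense[OF assms(3)] by auto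
qed

lemma state_bounded_linear: "is_state \<phi> ==> bounded_linear (\<phi> :: 'a => complex)"
proof (rule bounded_linear_intro[where K = 1])
 fix x y :: 'a and r :: real assume st: "is_state \<phi>"
 show "\<phi> (x + y) = \<phi> x + \<phi> y" by (rule state_add[OF st])
 show "\<phi> (r *\<^sub>R x) = r *\<^sub>R \<phi> x"
  using state_scale[OF st, of "cor r" x] by (simp add: scaleC_of_real scaleR_conv_of_real)
 show "norm (\<phi> x) \<le> norm x * 1" using state_bound[OF st, of x] by simp
qed

lemma is_quasifree_iff:
 "is_quasifree a K \<phi> \<longleftrightarrow> is_state \<phi> \<and> (\<forall>hs ks. \<phi> (nmon hs ks) =
  qfdet K hs ks)"
 unfolding is_quasifree_def nmon_def cre_def ann_def fdet_def by simp

lemma quasifree_unique: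
 assumes "is_quasifree a K \<phi>" "is_quasifree a K \<psi>" shows "\<phi> = \<psi>"
proof (rule functional_unique[where W = UNIV and f = "(*)"])
 show "bounded_linear \<phi>" "bounded_linear \<psi>"
  using assms by (auto simp: is_quasifree_iff intro: state_bounded_linear)
 show "\<phi> (z *\<^sub>C x) = z * \<phi> x" "\<psi> (z *\<^sub>C x) = z * \<psi> x" for z x
  using assms by (auto simp: is_quasifree_iff intro: state_scale)
qed (use assms in \<open>simp_all add: is_quasifree_iff\<close>)

lemma quasifree_state_eq: "is_quasifree a K \<phi> ==> quasifree_state a K = \<phi>"
 unfolding quasifree_state_def by (rule the_equality) (auto intro: quasifree_unique)

end

section \<open>Existence of quasi-free states\<close>

text \<open>Bordering the matrix by one row and one column separates the perturbation: column
  operations of determinant 1, collected in \<open>C\<close>, carry the rank-one term from the block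
  of \<open>N\<close> to the first row of \<open>M\<close>, and expansion along that row is affine
  in \<open>t\<close>.\<close>

lemma fdet_rank_one: "\<exists>b. \<forall>t. fdet n (%i j. F i j + t * u i * v j) = fdet n F + t * b"
proof -
 define M where "M t i j = (if i = 0 then (if j = 0 then 1 else - t * v (j - 1))
   else if j = 0 then u (i - 1) else F (i - 1) (j - 1))" for t i j
 define C where "C t i j = (if i = j then 1 else 0) + (if i = 0 then (if j = 0 then 0 else t * v (j - 1)) else 0)" for t i j
 define N where "N t i j = (if i = 0 then (if j = 0 then 1 else 0)
   else if j = 0 then u (i - 1) else F (i - 1) (j - 1) + t * u (i - 1) * v (j - 1))" for t i j
 define b where "b = (\<Sum>j<n. (-1) ^ j * v j * fdet n (%i j'. M 0 (Suc i) (if j' < Suc j then j' else Suc j')))"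
 have "fdet n (%i j. F i j + t * u i * v j) = fdet n F + t * b" for t
 proof -
  let ?C = "Matrix.mat (Suc n) (Suc n) (%(i, j). C t i j)"
  have "Matrix.mat (Suc n) (Suc n) (%(i, j). N t i j) = Matrix.mat (Suc n) (Suc n) (%(i, j). M t i j) * ?C"
  proof (intro eq_matI)
   fix i j assume "i < dim_row (Matrix.mat (Suc n) (Suc n) (%(i, j). M t i j) * ?C)"
    "j < dim_col (Matrix.mat (Suc n) (Suc n) (%(i, j). M t i j) * ?C)"
   then have ij: "i < Suc n" "j < Suc n" by auto
   have "(\<Sum>k = 0..<Suc n. M t i k * C t k j) = M t i j + (if j = 0 then 0 else M t i 0 * (t * v (j - 1)))"
    using ij by (simp add: C_def distrib_left sum.distrib if_distrib[of "%x. _ * x"] sum.delta cong: if_cong)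
   then show "Matrix.mat (Suc n) (Suc n) (%(i, j). N t i j) $$ (i, j)
    = (Matrix.mat (Suc n) (Suc n) (%(i, j). M t i j) * ?C) $$ (i, j)"
    using ij by (simp add: scalar_prod_def N_def M_def)
  qed auto
  moreover have "Determinant.det ?C = 1"
  proof (subst det_upper_triangular)
   show "upper_triangular ?C" by (auto simp: C_def)
   have "diag_mat ?C = replicate (Suc n) 1"
    by (intro nth_equalityI) (auto simp: diag_mat_def C_def simp del: upt_Suc)
   then show "prod_list (diag_mat ?C) = 1" by simp
  qed auto
  ultimately have "fdet (Suc n) (N t) = fdet (Suc n) (M t)"
   unfolding fdet_def by (simp add: det_mult[of _ "Suc n"])
  also have "\<dots> = fdet n F + t * b"
   unfolding fdet_laplace[OF zero_less_Suc] sum.lessThan_Suc_shift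
   by (simp add: M_def b_def sum_distrib_left mult_ac cong: if_cong)
  moreover have "fdet (Suc n) (N t) = fdet n (%i j. F i j + t * u i * v j)"
   unfolding fdet_laplace[OF zero_less_Suc] sum.lessThan_Suc_shift
   by (simp add: N_def)
  ultimately show ?thesis by simp
 qed
 then show ?thesis by blast
qed

section \<open>Diagonalization on finitely many vectors\<close>

definition orthonormal :: "'x ell2 set => bool" where
 "orthonormal B \<longleftrightarrow> (\<forall>e\<in>B. \<forall>f\<in>B. cinner e f = (if e = f then 1 else 0))"

text \<open>For a finite orthonormal \<open>B\<close> this is its linear span, encoded by the
  expansion that the proofs use.\<close>

definition spn :: "'x ell2 set => 'x ell2 set" where
 "spn B = {v. v = (\<Sum>e\<in>B. cinner v e *\<^sub>C e)}"

lemma csubspace_spn: "csubspace (spn B)"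
proof -
 have "u + v \<in> spn B" if "u \<in> spn B" "v \<in> spn B" for u v
 proof -
  have "(\<Sum>e\<in>B. cinner u e *\<^sub>C e) = u" "(\<Sum>e\<in>B. cinner v e *\<^sub>C e) = v"
   using that by (simp_all add: spn_def)
  then have "(\<Sum>e\<in>B. cinner (u + v) e *\<^sub>C e) = u + v"
   by (simp only: cinner_add_left scaleC_add_left sum.distrib)
  then show ?thesis by (simp add: spn_def)
 qed
 moreover have "z *\<^sub>C u \<in> spn B" if "u \<in> spn B" for z u
 proof -
  have "(\<Sum>e\<in>B. cinner u e *\<^sub>C e) = u" using that by (simp add: spn_def)
  then have "(\<Sum>e\<in>B. cinner (z *\<^sub>C u) e *\<^sub>C e) = z *\<^sub>C u"
   by (simp only: cinner_scaleC_left scaleC_scaleC[symmetric] scaleC.sum_right[symmetric])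
  then show ?thesis by (simp add: spn_def)
 qed
 moreover have "0 \<in> spn B" by (simp add: spn_def)
 ultimately show ?thesis by (simp add: csubspace_def)
qed

text \<open>Orthogonalization keeps eigenvectors: by symmetry of \<open>L\<close> an eigenvector has
  components only along eigenvectors with its own eigenvalue, so the residual belongs to that
  eigenvalue too.\<close>

lemma gram_schmidt_eigenvectors:
 fixes L :: "'x ell2 => 'x ell2"
 assumes add: "!!u v. L (u + v) = L u + L v" and scale: "!!z u. L (z *\<^sub>C u) = z *\<^sub>C L u"
  and sym: "!!u v. cinner (L u) v = cinner u (L v)"
  and V: "finite V" "!!v. v \<in> V ==> \<exists>k\<in>{0..1}. L v = cor k *\<^sub>C v"
 shows "\<exists>B. finite B \<and> orthonormal B \<and> (\<forall>e\<in>B. \<exists>k\<in>{0..1}. L e = cor k *\<^sub>C e) \<and> V \<subseteq> spn B"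
 using V
proof (induction V)
 case empty
 then show ?case by (intro exI[of _ "{}"]) (simp add: orthonormal_def)
next
 case (insert v V)
 then obtain B where B: "finite B" "orthonormal B" "!!e. e \<in> B ==> \<exists>k\<in>{0..1}. L e = cor k *\<^sub>C e" "V \<subseteq> spn B"
  by auto
 obtain k where k: "k \<in> {0..1}" "L v = cor k *\<^sub>C v" using insert.prems[of v] by auto
 have L0: "L 0 = 0" using scale[of 0 0] by simp
 have Lsum: "L (sum g I) = (\<Sum>i\<in>I. L (g i))" for g :: "'x ell2 => 'x ell2" and I
  by (induction I rule: infinite_finite_induct) (simp_all add: L0 add)
 define r where "r = v - (\<Sum>e\<in>B. cinner v e *\<^sub>C e)"
 show ?case
 proof (cases "r = 0")
  case True
  then have "v \<in> spn B" by (simp add: r_def spn_def)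
  then show ?thesis using B by blast
 next
  case False
  have r_orth: "cinner r e = 0" if "e \<in> B" for e
  proof -
   have "(\<Sum>f\<in>B. cinner v f * cinner f e) = (\<Sum>f\<in>B. if f = e then cinner v e else 0)"
    using B(2) that by (intro sum.cong) (auto simp: orthonormal_def)
   then show ?thesis
    using B(1) that by (simp add: r_def cinner.diff_left cinner.sum_left cinner_scaleC_left)
  qed
  have Lr: "L r = cor k *\<^sub>C r"
  proof -
   have "cinner v e *\<^sub>C L e = cor k *\<^sub>C cinner v e *\<^sub>C e" if e: "e \<in> B" for e
   proof -
    obtain k' where k': "L e = cor k' *\<^sub>C e" using B(3)[OF e] by blast
    have "cor k * cinner v e = cor k' * cinner v e"
     using sym[of v e] by (simp add: k(2) k' cinner_scaleC_left cinner_scaleC_right)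
    then show ?thesis by (auto simp add: k' scaleC_scaleC mult.commute)
   qed
   then have "L (\<Sum>e\<in>B. cinner v e *\<^sub>C e) = cor k *\<^sub>C (\<Sum>e\<in>B. cinner v e *\<^sub>C e)"
    by (simp add: Lsum scale scaleC.sum_right)
   moreover have "L v = L r + L (\<Sum>e\<in>B. cinner v e *\<^sub>C e)" by (simp add: r_def flip: add)
   ultimately show ?thesis by (simp add: k(2) r_def scaleC.diff_right eq_diff_eq)
  qed
  define e' where "e' = cor (inverse (norm r)) *\<^sub>C r"
  have ne': "cinner e' e' = 1"
   using False by (simp add: e'_def cinner_self_norm norm_scaleC norm_inverse)
  have e'_orth: "cinner e' e = 0" "cinner e e' = 0" if "e \<in> B" for e
   using r_orth[OF that] cinner_commute[of e r]
   by (simp_all add: e'_def cinner_scaleC_left cinner_scaleC_right)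
  have nB: "e' \<notin> B" using e'_orth ne' by force
  have spn_sub: "w \<in> spn (insert e' B)" if "w \<in> spn B" for w
  proof -
   have w: "(\<Sum>e\<in>B. cinner w e *\<^sub>C e) = w" using that by (simp add: spn_def)
   have "cinner (\<Sum>e\<in>B. cinner w e *\<^sub>C e) e' = 0"
    by (simp add: cinner.sum_left cinner_scaleC_left e'_orth)
   then have "cinner w e' = 0" by (simp only: w)
   then show ?thesis using w B(1) nB by (simp add: spn_def)
  qed
  have "v \<in> spn (insert e' B)"
  proof -
   have "cinner v e' = cinner (r + (\<Sum>e\<in>B. cinner v e *\<^sub>C e)) e'" by (simp add: r_def)
   also have "\<dots> = cinner r e'"
    by (simp only: cinner_add_left cinner.sum_left cinner_scaleC_left) (simp add: e'_orth)
   also have "\<dots> = cor (norm r)"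
    using False by (simp add: e'_def cinner_scaleC_right cinner_self_norm power2_eq_square)
   finally have "cinner v e' *\<^sub>C e' = r" using False by (simp add: e'_def scaleC_scaleC)
   then show ?thesis using B(1) nB by (simp add: spn_def r_def)
  qed
  moreover have "orthonormal (insert e' B)"
   unfolding orthonormal_def
  proof (intro ballI)
   fix e f assume ef: "e \<in> insert e' B" "f \<in> insert e' B"
   show "cinner e f = (if e = f then 1 else 0)"
   proof (cases "e = e' \<or> f = e'")
    case True
    then show ?thesis using ef ne' nB e'_orth[of e] e'_orth[of f] by fastforce
   next
    case False
    then show ?thesis using ef B(2) unfolding orthonormal_def by blast
   qed
  qed
  moreover have "L e' = cor k *\<^sub>C e'"
   by (simp add: e'_def scale Lr scaleC_scaleC mult.commute)
  ultimately show ?thesis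
   using B k(1) spn_sub by (intro exI[of _ "insert e' B"]) auto
 qed
qed

lemma (in pvm) T_sum_fun: "finite I ==> (!!i. i \<in> I ==> bborel (g i)) ==> T (%x. \<Sum>i\<in>I. g i x) u = (\<Sum>i\<in>I. T (g i) u)"
proof (induction I rule: finite_induct)
 case empty
 then show ?case using T_scale_fun[of "%_. 0" 0 u] by simp
next
 case (insert i I)
 then show ?case by (simp add: T_add_fun bborel_sum)
qed

text \<open>Rounding \<open>f\<close> down to multiples of \<open>1 / Suc m\<close> leaves finitely
  many values. The spectral projections of their level sets split each vector of \<open>F\<close>
  into finitely many eigenvectors, whose orthogonalization is \<open>B\<close>.\<close>

lemma (in pvm) step_approx:
 fixes f :: "real => real" and m :: nat
 assumes f: "f \<in> borel_measurable borel" "!!x. 0 \<le> f x" "!!x. f x \<le> 1" and F: "finite F"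
 defines "g \<equiv> %x. cor (of_int \<lfloor>real (Suc m) * f x\<rfloor> / real (Suc m))"
 shows "bborel g" "!!x. cmod (g x) \<le> 1" "!!x. cmod (cor (f x) - g x) \<le> 1 / real (Suc m)"
  "\<exists>B. finite B \<and> orthonormal B \<and> (\<forall>e\<in>B. \<exists>k\<in>{0..1}. T g e = cor k *\<^sub>C e) \<and> F \<subseteq> spn B"
proof -
 have fl: "0 \<le> \<lfloor>real (Suc m) * f x\<rfloor>" "\<lfloor>real (Suc m) * f x\<rfloor> \<le> int (Suc m)" for x
 proof -
  show "0 \<le> \<lfloor>real (Suc m) * f x\<rfloor>" using f(2)[of x] by simp
  have "real (Suc m) * f x \<le> real (Suc m)" using f(3)[of x] by (simp add: mult_left_le)
  then have "\<lfloor>real (Suc m) * f x\<rfloor> \<le> \<lfloor>real (Suc m)\<rfloor>" by (rule floor_mono)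
  then show "\<lfloor>real (Suc m) * f x\<rfloor> \<le> int (Suc m)" by (simp only: floor_of_nat)
 qed
 have gx: "cmod (g x) = of_int \<lfloor>real (Suc m) * f x\<rfloor> / real (Suc m)" for x
  using fl(1)[of x] by (simp add: g_def norm_divide del: of_nat_Suc)
 show g1: "cmod (g x) \<le> 1" for x
  using fl(2)[of x] unfolding gx by (simp add: divide_le_eq del: of_nat_Suc)
 have meas: "(%x. \<lfloor>real (Suc m) * f x\<rfloor>) \<in> measurable borel (count_space UNIV)"
  using f(1) by measurable
 show gb: "bborel g"
  by (rule bborelI[OF _ g1]) (unfold g_def, use f(1) in measurable)
 show "cmod (cor (f x) - g x) \<le> 1 / real (Suc m)" for x
 proof -
  have "\<bar>f x - of_int \<lfloor>real (Suc m) * f x\<rfloor> / real (Suc m)\<bar> = \<bar>real (Suc m) * f x - of_int \<lfloor>real (Suc m) * f x\<rfloor>\<bar> / real (Suc m)"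
   by (simp add: field_simps abs_if del: of_nat_Suc)
  also have "\<dots> \<le> 1 / real (Suc m)"
   by (intro divide_right_mono) linarith+
  finally show ?thesis by (simp only: g_def norm_of_real flip: of_real_diff)
 qed
 define S where "S j = {x. \<lfloor>real (Suc m) * f x\<rfloor> = int j}" for j
 have S: "S j \<in> sets borel" for j
  using measurable_sets[OF meas, of "{int j}"] by (simp add: S_def vimage_def)
 have eig: "T g (E (S j) u) = cor (real j / real (Suc m)) *\<^sub>C E (S j) u" for j u
 proof -
  have e: "(%x. g x * indicator (S j) x) = (%x. cor (real j / real (Suc m)) * indicator (S j) x)"
   by (auto simp: g_def S_def indicator_def fun_eq_iff simp del: of_nat_Suc)
  have "T g (E (S j) u) = T (%x. g x * indicator (S j) x) u"
   using T_mult[OF gb bborel_indicator[OF S[of j]], of u] by (simp add: T_indicator S)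
  then show ?thesis
   unfolding e by (simp only: T_scale_fun[OF bborel_indicator[OF S]] T_indicator[OF S])
 qed
 define V where "V = (%(j, v). E (S j) v) ` ({..Suc m} \<times> F)"
 have "\<exists>B. finite B \<and> orthonormal B \<and> (\<forall>e\<in>B. \<exists>k\<in>{0..1}. T g e = cor k *\<^sub>C e) \<and> V \<subseteq> spn B"
 proof (rule gram_schmidt_eigenvectors)
  show "cinner (T g u) v = cinner u (T g v)" for u v
   using T_cnj[OF gb, of u v] by (simp add: g_def)
  show "finite V" using F by (simp add: V_def)
  fix v assume "v \<in> V"
  then obtain j w where "j \<le> Suc m" "v = E (S j) w" by (auto simp: V_def)
  then show "\<exists>k\<in>{0..1}. T g v = cor k *\<^sub>C v"
   using eig[of j w] by (intro bexI[of _ "real j / real (Suc m)"]) (auto simp: divide_le_eq simp del: of_nat_Suc)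
 qed (simp_all add: T_add T_scale gb)
 then obtain B where B: "finite B" "orthonormal B" "\<forall>e\<in>B. \<exists>k\<in>{0..1}. T g e = cor k *\<^sub>C e" "V \<subseteq> spn B"
  by blast
 have "v \<in> spn B" if v: "v \<in> F" for v
 proof -
  have "(\<Sum>j\<le>Suc m. indicator (S j) x :: complex) = 1" for x
  proof -
   define i where "i = nat \<lfloor>real (Suc m) * f x\<rfloor>"
   have i: "\<lfloor>real (Suc m) * f x\<rfloor> = int i" "i \<le> Suc m"
    using fl[of x] unfolding i_def by auto
   have "(\<Sum>j\<le>Suc m. indicator (S j) x :: complex) = (\<Sum>j\<le>Suc m. if j = i then 1 else 0)"
    by (intro sum.cong refl) (simp add: S_def i(1) indicator_def del: of_nat_Suc)
   then show ?thesis using i(2) by (simp del: sum.atMost_Suc)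
  qed
  then have "v = T (%x. \<Sum>j\<le>Suc m. indicator (S j) x) v" by (simp only: T_one)
  also have "\<dots> = (\<Sum>j\<le>Suc m. E (S j) v)"
   by (subst T_sum_fun) (auto simp: S T_indicator simp del: sum.atMost_Suc)
  also have "\<dots> \<in> spn B"
   using B(4) v by (intro csubspace_sum[OF csubspace_spn]) (auto simp: V_def)
  finally show ?thesis .
 qed
 then show "\<exists>B. finite B \<and> orthonormal B \<and> (\<forall>e\<in>B. \<exists>k\<in>{0..1}. T g e = cor k *\<^sub>C e) \<and> F \<subseteq> spn B"
  using B by blast
qed

section \<open>Projections onto occupation patterns and states of finitely many modes\<close>

context car
begin

definition occp :: "'x ell2 => bool => 'a" where
 "occp e b = (if b then c e * a e else a e * c e)"

text \<open>The joint projection onto the occupation pattern \<open>w\<close> of the modes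
  \<open>es\<close>; the factors commute when the modes are orthogonal.\<close>

primrec corner :: "('x ell2 => bool) => 'x ell2 list => 'a" where
 "corner w [] = 1"
| "corner w (e # es) = occp e (w e) * corner w es"

lemma occp_adj: "adj (occp e b) = occp e b"
 by (simp add: occp_def adj_mult adj_adj)

lemma a_occp_commute: "cinner h e = 0 ==> a h * occp e b = occp e b * a h"
 unfolding occp_def
 by (simp add: mult.assoc[symmetric] a_c_swap[of h e] cinner_commute[of e h])
  (simp add: mult.assoc a_swap[of h e] a_c_swap[of h e] cinner_commute[of e h])

lemma c_occp_commute: "cinner h e = 0 ==> c h * occp e b = occp e b * c h"
 using arg_cong[OF a_occp_commute[of h e b], of adj] by (simp add: adj_mult occp_adj)

lemma occp_idem: "norm e = 1 ==> occp e b * occp e b = occp e b"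
proof -
 assume "norm e = 1"
 then have 1: "a e * c e = 1 - c e * a e" by (simp add: a_c_swap cinner_self_norm)
 have 2: "c e * (a e * (c e * a e)) = c e * a e"
  by (simp add: mult.assoc[symmetric] 1) (simp add: mult.assoc 1 right_diff_distrib,
    simp add: mult.assoc[symmetric] c_square)
 show ?thesis
  using 2 by (simp add: occp_def 1 algebra_simps mult.assoc)
qed

lemma commute_corner:
 assumes "!!e. e \<in> set es ==> y * occp e (w e) = occp e (w e) * y"
 shows "y * corner w es = corner w es * y"
 using assms
proof (induction es)
 case (Cons e es)
 have "y * corner w (e # es) = occp e (w e) * (y * corner w es)"
  using Cons.prems[of e] by (simp add: mult.assoc[symmetric])
 then show ?case using Cons by (simp add: mult.assoc)
qed simp

lemma a_corner_commute: "(!!e. e \<in> set es ==> cinner h e = 0) ==> a h * corner w es = corner w es * a h"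
 by (intro commute_corner a_occp_commute)

lemma c_corner_commute: "(!!e. e \<in> set es ==> cinner h e = 0) ==> c h * corner w es = corner w es * c h"
 by (intro commute_corner c_occp_commute)

lemma occp_corner_commute: "(!!e. e \<in> set es ==> cinner h e = 0) ==> occp h b * corner w es = corner w es * occp h b"
 unfolding occp_def
 by (simp add: mult.assoc a_corner_commute c_corner_commute)
  (simp add: mult.assoc[symmetric] a_corner_commute c_corner_commute)

lemma corner_facts:
 assumes "distinct es" "orthonormal (set es)"
 shows "adj (corner w es) = corner w es" "corner w es * corner w es = corner w es" "corner w es \<noteq> 0"
  "!!e. e \<in> set es ==> w e ==> c e * corner w es = 0"
  "!!e. e \<in> set es ==> \<not> w e ==> a e * corner w es = 0"
proof -
 have "adj (corner w es) = corner w es \<and> corner w es * corner w es = corner w es \<and> corner w es \<noteq> 0 \<and>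
  (\<forall>e\<in>set es. (w e \<longrightarrow> c e * corner w es = 0) \<and> (\<not> w e \<longrightarrow> a e * corner w es = 0))"
  using assms
 proof (induction es)
  case (Cons e es)
  define P where "P = corner w es"
  have e: "norm e = 1" "!!f. f \<in> set es ==> cinner e f = 0" "!!f. f \<in> set es ==> cinner f e = 0"
  proof -
   have "cinner e e = 1" using Cons.prems(2) by (simp add: orthonormal_def)
   then have "(norm e)\<^sup>2 = 1" unfolding cinner_self_norm by (metis of_real_eq_1_iff)
   then show "norm e = 1" by (simp add: power2_eq_1_iff) (smt (verit) norm_ge_zero)
   show "cinner e f = 0" "cinner f e = 0" if "f \<in> set es" for f
    using Cons.prems that by (auto simp: orthonormal_def)
  qed
  have IH: "adj P = P" "P * P = P" "P \<noteq> 0" "!!f. f \<in> set es ==> w f ==> c f * P = 0"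
   "!!f. f \<in> set es ==> \<not> w f ==> a f * P = 0"
   using Cons by (auto simp: P_def orthonormal_def)
  have com: "occp e b * P = P * occp e b" "a e * P = P * a e" "c e * P = P * c e" for b
   unfolding P_def by (intro occp_corner_commute a_corner_commute c_corner_commute e(2); assumption)+
  have one: "c e * a e + a e * c e = 1" using c_a[of e e] e(1) by (simp add: cinner_self_norm)
  \<comment> \<open>If one of the two complementary projections of the mode \<open>e\<close>
    annihilated \<open>P\<close>, one further factor \<open>a e\<close> or \<open>c e\<close> would
    show that the other half vanishes as well, and \<open>P\<close> with it.\<close>
  have "occp e (w e) * P \<noteq> 0"
  proof
   assume z: "occp e (w e) * P = 0"
   show False
   proof (cases "w e")
    case True
    then have z: "c e * a e * P = 0" using z by (simp add: occp_def)
    have "a e * P = a e * (c e * a e + a e * c e) * P" by (simp add: one)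
    also have "\<dots> = a e * (c e * a e * P) + (a e * a e) * c e * P" by (simp add: algebra_simps)
    finally have aP: "a e * P = 0" by (simp add: z a_square)
    have "P = (c e * a e + a e * c e) * P" by (simp add: one)
    also have "\<dots> = c e * (a e * P) + a e * (c e * P)" by (simp add: algebra_simps)
    also have "\<dots> = c e * (a e * P) + (a e * P) * c e" by (simp only: com(3) mult.assoc)
    finally show False using aP IH(3) by simp
   next
    case False
    then have z: "a e * c e * P = 0" using z by (simp add: occp_def)
    have "c e * P = c e * (c e * a e + a e * c e) * P" by (simp add: one)
    also have "\<dots> = c e * (a e * c e * P) + (c e * c e) * a e * P" by (simp add: algebra_simps)
    finally have cP: "c e * P = 0" by (simp add: z c_square)
    have "P = (c e * a e + a e * c e) * P" by (simp add: one)
    also have "\<dots> = a e * (c e * P) + c e * (a e * P)" by (simp add: algebra_simps)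
    also have "\<dots> = a e * (c e * P) + (c e * P) * a e" by (simp only: com(2) mult.assoc)
    finally show False using cP IH(3) by simp
   qed
  qed
  moreover have "adj (occp e (w e) * P) = occp e (w e) * P"
   by (simp add: adj_mult occp_adj IH com)
  moreover have "occp e (w e) * P * (occp e (w e) * P) = occp e (w e) * P"
  proof -
   have "occp e (w e) * P * (occp e (w e) * P) = occp e (w e) * (P * occp e (w e)) * P" by (simp only: mult.assoc)
   also have "\<dots> = (occp e (w e) * occp e (w e)) * (P * P)" by (simp only: com(1)[symmetric] mult.assoc)
   finally show ?thesis by (simp add: occp_idem e(1) IH)
  qed
  moreover have "w f \<longrightarrow> c f * (occp e (w e) * P) = 0" if "f \<in> set (e # es)" for f
  proof (cases "f = e")
   case True
   then show ?thesis by (simp add: occp_def mult.assoc[symmetric] c_square)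
  next
   case False
   then have f: "f \<in> set es" using that by simp
   have "c f * (occp e (w e) * P) = occp e (w e) * (c f * P)"
    using c_occp_commute[OF e(3)[OF f]] by (simp add: mult.assoc[symmetric])
   then show ?thesis using IH(4)[OF f] by simp
  qed
  moreover have "\<not> w f \<longrightarrow> a f * (occp e (w e) * P) = 0" if "f \<in> set (e # es)" for f
  proof (cases "f = e")
   case True
   then show ?thesis by (simp add: occp_def mult.assoc[symmetric] a_square)
  next
   case False
   then have f: "f \<in> set es" using that by simp
   have "a f * (occp e (w e) * P) = occp e (w e) * (a f * P)"
    using a_occp_commute[OF e(3)[OF f]] by (simp add: mult.assoc[symmetric])
   then show ?thesis using IH(5)[OF f] by simp
  qed
  ultimately show ?case unfolding corner.simps P_def by blast
 qed simp
 then show "adj (corner w es) = corner w es" "corner w es * corner w es = corner w es" "corner w es \<noteq> 0"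
  "!!e. e \<in> set es ==> w e ==> c e * corner w es = 0"
  "!!e. e \<in> set es ==> \<not> w e ==> a e * corner w es = 0" by blast+
qed

text \<open>Carrying the creator at the head of the list through the annihilators to
  \<open>p\<close> leaves only its contractions, and this is the expansion of the determinant along
  the first row.\<close>

lemma corner_nmon_annihilated:
 assumes p: "adj p = p" "p * p = p" and "!!h. h \<in> set hs ==> c h * p = 0" "!!k. k \<in> set ks ==> c k * p = 0"
 shows "p * nmon hs ks * p = (if length hs = length ks then fdet (length hs) (%i j. cinner (hs ! i) (ks ! j)) else 0) *\<^sub>C p"
 using assms(3,4)
proof (induction hs arbitrary: ks)
 case Nil
 show ?case
 proof (cases ks)
  case Nil then show ?thesis using p by (simp add: nmon_def)
 next
  case (Cons k ks')
  have "adj (c k * p) = 0" using Nil.prems(2) Cons by simp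
  then have "p * a k = 0" by (simp add: adj_mult p adj_adj)
  then show ?thesis by (simp add: nmon_def Cons mult.assoc[symmetric])
 qed
next
 case (Cons h hs)
 have ch: "c h * p = 0" using Cons.prems by simp
 have "p * nmon (h # hs) ks * p = p * cre hs * (c h * ann ks) * p"
  by (simp add: nmon_def cre_Cons mult.assoc)
 also have "\<dots> = (\<Sum>j<length ks. ((-1) ^ j * cinner h (ks ! j)) *\<^sub>C (p * nmon hs (del j ks) * p))"
  unfolding c_ann
  by (simp add: distrib_left distrib_right sum_distrib_left sum_distrib_right scaleC_mult_left scaleC_mult_right
    nmon_def mult.assoc ch)
 also have "\<dots> = (\<Sum>j<length ks. ((-1) ^ j * cinner h (ks ! j)) *\<^sub>C
   ((if length hs = length (del j ks) then fdet (length hs) (%i i'. cinner (hs ! i) (del j ks ! i')) else 0) *\<^sub>C p))"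
 proof (intro sum.cong refl arg_cong[of _ _ "%x. _ *\<^sub>C x"] Cons.IH)
  show "c h' * p = 0" if "h' \<in> set hs" for h' using Cons.prems(1) that by simp
  show "c k * p = 0" if "k \<in> set (del j ks)" for k j
   using Cons.prems(2) that set_del_subset[of j ks] by blast
 qed
 also have "\<dots> = (if length (h # hs) = length ks then fdet (length (h # hs)) (%i j. cinner ((h # hs) ! i) (ks ! j)) else 0) *\<^sub>C p"
 proof (cases "length ks = Suc (length hs)")
  case True
  have "fdet (length (h # hs)) (%i j. cinner ((h # hs) ! i) (ks ! j))
    = (\<Sum>j<length ks. (-1) ^ j * cinner h (ks ! j) * fdet (length hs) (%i i'. cinner (hs ! i) (del j ks ! i')))"
   unfolding True length_Cons fdet_laplace[OF zero_less_Suc]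
   using True by (intro sum.cong refl) (auto simp: nth_del intro!: fdet_cong)
  moreover have "(\<Sum>j<length ks. ((-1) ^ j * cinner h (ks ! j)) *\<^sub>C
    ((if length hs = length (del j ks) then fdet (length hs) (%i i'. cinner (hs ! i) (del j ks ! i')) else 0) *\<^sub>C p))
   = (\<Sum>j<length ks. (-1) ^ j * cinner h (ks ! j) * fdet (length hs) (%i i'. cinner (hs ! i) (del j ks ! i'))) *\<^sub>C p"
   unfolding scaleC.sum_left using True by (intro sum.cong refl) (simp add: scaleC_scaleC)
  ultimately show ?thesis using True by simp
 next
  case False
  have "length hs \<noteq> length (del j ks)" if "j < length ks" for j using False that by auto
  then show ?thesis using False by (auto intro!: sum.neutral)
 qed
 finally show ?case .
qed

definition dop :: "'x ell2 set => ('x ell2 => real) => 'x ell2 => 'x ell2" where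
 "dop B k h = (\<Sum>e\<in>B. (cor (k e) * cinner h e) *\<^sub>C e)"

text \<open>A quasi-free state on \<open>calg W\<close> only. The norm bound is listed because it
  has to survive the limit that extends the state.\<close>

definition partial_quasifree :: "'x ell2 set => ('x ell2 => 'x ell2) => ('a => complex) => bool" where
 "partial_quasifree W K \<phi> \<longleftrightarrow>
  (\<forall>x\<in>calg W. \<forall>y\<in>calg W. \<phi> (x + y) = \<phi> x + \<phi> y) \<and> (\<forall>z. \<forall>x\<in>calg W. \<phi> (z *\<^sub>C x) = z * \<phi> x) \<and>
  (\<forall>x\<in>calg W. cmod (\<phi> x) \<le> norm x) \<and> (\<forall>x\<in>calg W. \<phi> (adj x * x) \<in> \<real>\<^sub>\<ge>\<^sub>0) \<and>
  (\<forall>hs ks. set hs \<subseteq> W \<longrightarrow> set ks \<subseteq> W \<longrightarrow> \<phi> (nmon hs ks) =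
   qfdet K hs ks)"

text \<open>
 For the projection \<open>p\<close> onto one configuration of occupied sites, \<open>p x p\<close> is a scalar multiple
 of \<open>p\<close>, and this scalar is the value of the state.
\<close>

lemma partial_quasifree_pure:
 assumes B: "finite B" "orthonormal B"
 shows "\<exists>\<phi>. partial_quasifree (spn B) (dop B (%e. if w e then 1 else 0)) \<phi>"
proof -
 obtain es where es: "distinct es" "set es = B" using finite_distinct_list[OF B(1)] by blast
 define p where "p = corner w es"
 have p: "adj p = p" "p * p = p" "p \<noteq> 0" "!!e. e \<in> B ==> w e ==> c e * p = 0" "!!e. e \<in> B ==> \<not> w e ==> a e * p = 0"
  using corner_facts[where es = es and w = w] es B(2) by (auto simp: p_def)
 define P where "P = dop B (%e. if w e then 1 else 0)"
 have aP: "a v * p = a (P v) * p" if "v \<in> spn B" for v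
 proof -
  have "a v = a (\<Sum>e\<in>B. cinner v e *\<^sub>C e)" using that by (simp add: spn_def)
  then have "a v * p = (\<Sum>e\<in>B. cnj (cinner v e) *\<^sub>C (a e * p))"
   by (simp add: a_sum a_scale sum_distrib_right scaleC_mult_left)
  also have "\<dots> = (\<Sum>e\<in>B. cnj (cor (if w e then 1 else 0) * cinner v e) *\<^sub>C (a e * p))"
   by (intro sum.cong refl) (use p(5) in auto)
  also have "\<dots> = a (P v) * p"
   by (simp add: P_def dop_def a_sum a_scale sum_distrib_right scaleC_mult_left)
  finally show ?thesis .
 qed
 have cP: "c (P v) * p = 0" for v
 proof -
  have "c (P v) * p = (\<Sum>e\<in>B. (cor (if w e then 1 else 0) * cinner v e) *\<^sub>C (c e * p))"
   by (simp add: P_def dop_def a_sum a_scale adj_sum adj_scaleC sum_distrib_right scaleC_mult_left)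
  also have "\<dots> = 0" by (intro sum.neutral) (use p(4) in auto)
  finally show ?thesis .
 qed
 \<comment> \<open>\<open>aP\<close> replaces only the letter next to \<open>p\<close>, so each
   letter is carried there, replaced, and carried back with the same sign.\<close>
 have annP: "ann ks * p = ann (map P ks) * p" if "set ks \<subseteq> spn B" for ks
  using that
 proof (induction ks)
  case (Cons k ks)
  have "ann (k # ks) * p = a k * (ann (map P ks) * p)" using Cons by (simp add: mult.assoc)
  also have "\<dots> = (-1) ^ length ks *\<^sub>C (ann (map P ks) * (a k * p))"
   by (simp add: mult.assoc[symmetric] a_ann_commute scaleC_mult_left)
  also have "\<dots> = (-1) ^ length ks *\<^sub>C (ann (map P ks) * (a (P k) * p))" using Cons.prems aP[of k] by simp
  also have "\<dots> = a (P k) * (ann (map P ks) * p)"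
   by (simp add: mult.assoc[symmetric] a_ann_commute scaleC_mult_left)
  finally show ?case by (simp add: mult.assoc)
 qed simp
 have creP: "p * cre hs = p * cre (map P hs)" if "set hs \<subseteq> spn B" for hs
  using arg_cong[OF annP[OF that], of adj] by (simp add: adj_mult adj_ann p(1))
 have PP: "cinner (P h) (P k) = cinner (P h) k" for h k
 proof -
  have "cinner (P h) (P k) = (\<Sum>e\<in>B. \<Sum>f\<in>B. (cor (if w e then 1 else 0) * cinner h e) *
    (cnj (cor (if w f then 1 else 0) * cinner k f) * cinner e f))"
   unfolding P_def dop_def cinner.sum_left
   unfolding cinner.sum_right cinner_scaleC_left cinner_scaleC_right by (intro sum.cong refl) (simp only: mult_ac)
  also have "\<dots> = (\<Sum>e\<in>B. (cor (if w e then 1 else 0) * cinner h e) * cinner e k)"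
  proof (intro sum.cong refl)
   fix e assume e: "e \<in> B"
   have "(\<Sum>f\<in>B. (cor (if w e then 1 else 0) * cinner h e) *
    (cnj (cor (if w f then 1 else 0) * cinner k f) * cinner e f))
    = (\<Sum>f\<in>B. if e = f then (cor (if w e then 1 else 0) * cinner h e) * cnj (cinner k e) else 0)"
    using B(2) e by (intro sum.cong) (auto simp: orthonormal_def)
   then show "(\<Sum>f\<in>B. (cor (if w e then 1 else 0) * cinner h e) *
    (cnj (cor (if w f then 1 else 0) * cinner k f) * cinner e f))
    = (cor (if w e then 1 else 0) * cinner h e) * cinner e k"
    using e B(1) by (simp add: cinner_commute[of e k])
  qed
  also have "\<dots> = cinner (P h) k" by (simp add: P_def dop_def cinner.sum_left cinner_scaleC_left)
  finally show ?thesis .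
 qed
 have mon: "p * nmon hs ks * p = (qfdet P hs ks) *\<^sub>C p"
  if "set hs \<subseteq> spn B" "set ks \<subseteq> spn B" for hs ks
 proof -
  have "p * nmon hs ks * p = (p * cre hs) * (ann ks * p)" by (simp add: nmon_def mult.assoc)
  also have "\<dots> = p * nmon (map P hs) (map P ks) * p"
   by (simp only: creP[OF that(1)] annP[OF that(2)]) (simp add: nmon_def mult.assoc)
  also have "\<dots> = (if length (map P hs) = length (map P ks) then
    fdet (length (map P hs)) (%i j. cinner (map P hs ! i) (map P ks ! j)) else 0) *\<^sub>C p"
   by (rule corner_nmon_annihilated[OF p(1,2)]) (auto simp: cP)
  finally show ?thesis
   by (auto simp: PP intro!: arg_cong[of _ _ "%z. z *\<^sub>C p"] fdet_cong)
 qed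
 have ex: "\<exists>g. p * x * p = g *\<^sub>C p" if "x \<in> calg (spn B)" for x
  using that
 proof (induction rule: calg_induct)
  case (nmon hs ks) then show ?case using mon by blast
 next
  case zero then show ?case by (intro exI[of _ 0]) simp
 next
  case (add x y z)
  then obtain g g' where "p * x * p = g *\<^sub>C p" "p * y * p = g' *\<^sub>C p" by blast
  then have "p * (x + z *\<^sub>C y) * p = (g + z * g') *\<^sub>C p"
   by (simp add: distrib_left distrib_right scaleC_mult_left scaleC_mult_right scaleC_add_left scaleC_scaleC)
  then show ?case by blast
 qed
 define \<phi> where "\<phi> x = (SOME g. p * x * p = g *\<^sub>C p)" for x
 have \<phi>: "p * x * p = \<phi> x *\<^sub>C p" if "x \<in> calg (spn B)" for x
  unfolding \<phi>_def by (rule someI_ex[OF ex[OF that]])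
 have \<phi>I: "\<phi> x = g" if "x \<in> calg (spn B)" "p * x * p = g *\<^sub>C p" for x g
 proof -
  have "(\<phi> x - g) *\<^sub>C p = 0" using \<phi>[OF that(1)] that(2) by (simp add: scaleC.diff_left)
  then show ?thesis using p(3) by simp
 qed
 have sub: "csubspace (calg (spn B))" by (rule csubspace_calg)
 have np: "norm p = 1"
 proof -
  have "(norm p)\<^sup>2 = norm p" using cstar_identity[of p] by (simp add: p)
  then show ?thesis using p(3) by (simp add: power2_eq_square)
 qed
 have "partial_quasifree (spn B) P \<phi>"
  unfolding partial_quasifree_def
 proof (intro conjI ballI allI impI)
  fix x assume x: "x \<in> calg (spn B)"
  show "\<phi> (x + y) = \<phi> x + \<phi> y" if "y \<in> calg (spn B)" for y
   by (rule \<phi>I[OF csubspaceD(2)[OF sub x that]])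
    (simp add: distrib_left distrib_right scaleC_add_left \<phi> x that)
  show "\<phi> (z *\<^sub>C x) = z * \<phi> x" for z
   by (rule \<phi>I[OF csubspaceD(3)[OF sub x]])
    (simp add: scaleC_mult_left scaleC_mult_right scaleC_scaleC[symmetric] \<phi> x)
  have "cmod (\<phi> x) = norm (p * x * p)" by (simp add: \<phi> x norm_scaleC np)
  also have "\<dots> \<le> norm (p * x) * norm p" by (rule norm_mult_ineq)
  also have "\<dots> \<le> norm p * norm x * norm p" by (intro mult_right_mono norm_mult_ineq) simp
  finally show "cmod (\<phi> x) \<le> norm x" by (simp add: np)
  \<comment> \<open>Positivity of the value is thus \<open>positive_corner\<close> for the element
    \<open>x * p\<close>.\<close>
  have "adj (x * p) * (x * p) = \<phi> (adj x * x) *\<^sub>C p"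
   using \<phi>[OF calg_mult[OF calg_adj[OF x] x]] by (simp add: adj_mult p(1) mult.assoc)
  then show "\<phi> (adj x * x) \<in> \<real>\<^sub>\<ge>\<^sub>0"
   by (rule positive_corner[OF p(1-3), rotated]) (simp add: mult.assoc p(2))
 next
  fix hs ks assume "set hs \<subseteq> spn B" "set ks \<subseteq> spn B"
  then show "\<phi> (nmon hs ks) = qfdet P hs ks"
   by (intro \<phi>I nmon_calg mon)
 qed
 then show ?thesis unfolding P_def by blast
qed

text \<open>
 The determinants are affine in each single eigenvalue, by \<open>fdet_rank_one\<close>, so an eigenvalue
 \<open>t\<close> is reached as a mixture of the eigenvalues 0 and 1.
\<close>

lemma partial_quasifree_diagonal:
 assumes B: "finite B" "orthonormal B" and k: "!!e. e \<in> B ==> k e \<in> {0..1}"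
 shows "\<exists>\<phi>. partial_quasifree (spn B) (dop B k) \<phi>"
proof -
 \<comment> \<open>Induction over the set \<open>F\<close> of modes whose eigenvalue may lie
   strictly between 0 and 1.\<close>
 have "\<exists>\<phi>. partial_quasifree (spn B) (dop B k) \<phi>"
  if "F \<subseteq> B" "!!e. e \<in> B ==> k e \<in> {0..1}" "!!e. e \<in> B - F ==> k e \<in> {0, 1}" for F k
  using finite_subset[OF that(1) B(1)] that
 proof (induction F arbitrary: k)
  case empty
  have "dop B k = dop B (%e. if k e = 1 then 1 else 0)"
   unfolding dop_def
  proof (intro ext sum.cong refl)
   fix h e assume "e \<in> B"
   then have "k e = (if k e = 1 then 1 else 0)" using empty.prems(3)[of e] by auto
   then show "(cor (k e) * cinner h e) *\<^sub>C e
     = (cor (if k e = 1 then 1 else 0) * cinner h e) *\<^sub>C e" by simp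
  qed
  then show ?case using partial_quasifree_pure[OF B, of "%e. k e = 1"] by simp
 next
  case (insert e F)
  have e: "e \<in> B" using insert.prems by simp
  have "\<exists>\<phi>. partial_quasifree (spn B) (dop B (k(e := s))) \<phi>" if "s \<in> {0, 1}" for s
   using insert.prems that by (intro insert.IH) auto
  then obtain \<phi>0 \<phi>1 where \<phi>: "partial_quasifree (spn B) (dop B (k(e := 0))) \<phi>0"
   "partial_quasifree (spn B) (dop B (k(e := 1))) \<phi>1" by blast
  define t where "t = k e"
  have t: "0 \<le> t" "t \<le> 1" using insert.prems(2)[OF e] by (auto simp: t_def)
  define \<phi> where "\<phi> x = cor (1 - t) * \<phi>0 x + cor t * \<phi>1 x" for x
  have form: "cinner (dop B (k(e := s)) h) l = cinner (dop B (k(e := 0)) h) l + cor s * cinner h e * cinner e l" for s h l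
  proof -
   have "cinner (dop B (k(e := s)) h) l = (\<Sum>f\<in>B. cor ((k(e := s)) f) * cinner h f * cinner f l)" for s
    by (simp add: dop_def cinner.sum_left cinner_scaleC_left)
   moreover have "(\<Sum>f\<in>B. cor ((k(e := s)) f) * cinner h f * cinner f l)
    = cor s * cinner h e * cinner e l + (\<Sum>f\<in>B - {e}. cor (k f) * cinner h f * cinner f l)" for s
    by (subst sum.remove[OF B(1) e]) (auto intro!: sum.cong)
   ultimately show ?thesis by simp
  qed
  have det: "fdet n (%i j. cinner (dop B k (hs ! i)) (ks ! j))
    = cor (1 - t) * fdet n (%i j. cinner (dop B (k(e := 0)) (hs ! i)) (ks ! j))
     + cor t * fdet n (%i j. cinner (dop B (k(e := 1)) (hs ! i)) (ks ! j))" for n hs ks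
  proof -
   obtain b where b: "!!s. fdet n (%i j. cinner (dop B (k(e := 0)) (hs ! i)) (ks ! j) + s * cinner (hs ! i) e * cinner e (ks ! j))
     = fdet n (%i j. cinner (dop B (k(e := 0)) (hs ! i)) (ks ! j)) + s * b"
    using fdet_rank_one[of n "%i j. cinner (dop B (k(e := 0)) (hs ! i)) (ks ! j)" "%i. cinner (hs ! i) e" "%j. cinner e (ks ! j)"]
    by blast
   have ke: "k = k(e := t)" by (simp add: t_def)
   show ?thesis
    by (subst ke, subst (1 3) form) (simp only: b, simp add: algebra_simps)
  qed
  have "partial_quasifree (spn B) (dop B k) \<phi>"
   unfolding partial_quasifree_def
  proof (intro conjI ballI allI impI)
   fix x assume x: "x \<in> calg (spn B)"
   show "\<phi> (x + y) = \<phi> x + \<phi> y" if "y \<in> calg (spn B)" for y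
    using \<phi> x that unfolding partial_quasifree_def by (simp add: \<phi>_def algebra_simps)
   show "\<phi> (z *\<^sub>C x) = z * \<phi> x" for z
    using \<phi> x unfolding partial_quasifree_def by (simp add: \<phi>_def algebra_simps)
   have "cmod (\<phi> x) \<le> (1 - t) * cmod (\<phi>0 x) + t * cmod (\<phi>1 x)"
    unfolding \<phi>_def using t by (intro norm_triangle_le) (simp add: norm_mult del: of_real_diff)
   also have "\<dots> \<le> (1 - t) * norm x + t * norm x"
    using \<phi> x t unfolding partial_quasifree_def by (intro add_mono mult_left_mono) auto
   finally show "cmod (\<phi> x) \<le> norm x" by (simp add: algebra_simps)
   show "\<phi> (adj x * x) \<in> \<real>\<^sub>\<ge>\<^sub>0"
    using \<phi> x t unfolding partial_quasifree_def \<phi>_def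
    by (intro nonneg_Reals_add_I nonneg_Reals_mult_I) (auto simp del: of_real_diff)
  next
   fix hs ks assume "set hs \<subseteq> spn B" "set ks \<subseteq> spn B"
   then show "\<phi> (nmon hs ks) = qfdet (dop B k) hs ks"
    using \<phi> unfolding partial_quasifree_def by (simp add: \<phi>_def det)
  qed
  then show ?case by blast
 qed
 from this[of B k] k show ?thesis by blast
qed

end

section \<open>Passage to infinitely many modes\<close>

locale countable_car_alg = car_alg a for a :: "'x::countable ell2 => 'a::cstar_algebra"
begin

lemma closure_cspan_delta: "closure (cspan (range delta)) = (UNIV :: 'y ell2 set)"
proof (rule ell2_delta_dense)
 show "csubspace (closure (cspan (range delta)))" by (intro csubspace_closure csubspace_cspan)
 show "delta x \<in> closure (cspan (range delta))" for x
  using closure_subset cspan_base[of "delta x" "range delta"] by blast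
qed simp

lemma tendsto_ann: "length ks = n ==> (!!i. i < n ==> (%N. f N ! i) \<longlonglongrightarrow> ks ! i) ==>
  (!!N. length (f N) = n) ==> (%N. ann (f N)) \<longlonglongrightarrow> ann ks"
proof (induction n arbitrary: ks f)
 case (Suc n)
 obtain k ks' where ks: "ks = k # ks'" "length ks' = n" using Suc.prems(1) by (cases ks) auto
 have f: "f N = hd (f N) # tl (f N)" for N using Suc.prems(3)[of N] by (cases "f N") auto
 have "(%N. a (hd (f N))) \<longlonglongrightarrow> a k"
 proof (intro tendsto_a)
  have "hd (f N) = f N ! 0" for N using Suc.prems(3)[of N] by (intro hd_conv_nth) auto
  then show "(%N. hd (f N)) \<longlonglongrightarrow> k" using Suc.prems(2)[of 0] by (simp add: ks)
 qed
 moreover have "(%N. ann (tl (f N))) \<longlonglongrightarrow> ann ks'"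
 proof (rule Suc.IH[OF ks(2)])
  show "(%N. tl (f N) ! i) \<longlonglongrightarrow> ks' ! i" if "i < n" for i
   using Suc.prems(2)[of "Suc i"] that by (simp add: ks nth_tl Suc.prems(3))
  show "length (tl (f N)) = n" for N using Suc.prems(3)[of N] by simp
 qed
 ultimately have "(%N. a (hd (f N)) * ann (tl (f N))) \<longlonglongrightarrow> a k * ann ks'" by (rule tendsto_mult)
 moreover have "ann (f N) = a (hd (f N)) * ann (tl (f N))" for N by (subst f) simp
 ultimately show ?case by (simp add: ks)
qed simp

text \<open>The approximating states live on different finite mode spaces and share a domain only
  eventually: each combination of basis vectors lies in \<open>spn (B m)\<close> for all large
  \<open>m\<close>. There the determinants converge; the norm bound extends the limit to the whole
  algebra, and positivity persists.\<close>

theorem quasifree_exists: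
 assumes E: "is_pvm E" and f: "f \<in> borel_measurable borel" "!!x. 0 \<le> f x" "!!x. f x \<le> 1"
 shows "\<exists>\<phi>. is_quasifree a (scalc E (%x. cor (f x))) \<phi>"
proof -
 interpret pvm E by (rule pvm.intro[OF E])
 \<comment> \<open>Basis vectors enter in the order in which the countable index type is
   enumerated.\<close>
 define F where "F m = delta ` {x :: 'x. to_nat x \<le> m}" for m
 have F: "finite (F m)" for m
 proof -
  have "finite {x :: 'x. to_nat x \<le> m}"
   by (rule inj_on_finite[of to_nat _ "{..m}"]) auto
  then show ?thesis by (simp add: F_def)
 qed
 define K where "K = T (%x. cor (f x))"
 define g where "g m x = cor (of_int \<lfloor>real (Suc m) * f x\<rfloor> / real (Suc m))" for m x
 have g: "bborel (g m)" "cmod (cor (f x) - g m x) \<le> 1 / real (Suc m)"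
  "\<exists>B. finite B \<and> orthonormal B \<and> (\<forall>e\<in>B. \<exists>k\<in>{0..1}. T (g m) e = cor k *\<^sub>C e) \<and> F m \<subseteq> spn B" for m x
  using step_approx[OF f F, where m = m] unfolding g_def by blast+
 have fb: "bborel (%x. cor (f x))"
  by (rule bborelI[where B = 1]) (use f in auto)
 have K_lim: "(%m. T (g m) u) \<longlonglongrightarrow> K u" for u
  unfolding K_def
 proof (rule LIM_zero_cancel, rule Lim_null_comparison[OF always_eventually])
  show "\<forall>m. norm (T (g m) u - T (%x. cor (f x)) u) \<le> 1 / real (Suc m) * norm u"
  proof
   fix m
   have "bborel (%x. g m x - cor (f x))" by (intro bborel_diff g fb)
   from norm_T_le[OF this, of "1 / real (Suc m)" u] g(2)[of _ m]
   show "norm (T (g m) u - T (%x. cor (f x)) u) \<le> 1 / real (Suc m) * norm u"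
    by (simp add: norm_minus_commute T_diff_fun[OF g(1) fb])
  qed
  show "(%m. 1 / real (Suc m) * norm u) \<longlonglongrightarrow> 0"
   using tendsto_mult_left_zero[OF LIMSEQ_inverse_real_of_nat, of "norm u"] by (simp add: inverse_eq_divide)
 qed
 have "\<exists>B \<phi>. F m \<subseteq> spn B \<and> partial_quasifree (spn B) (T (g m)) \<phi>" for m
 proof -
  obtain B where B: "finite B" "orthonormal B" "F m \<subseteq> spn B"
   and ev: "\<forall>e\<in>B. \<exists>k\<in>{0..1}. T (g m) e = cor k *\<^sub>C e" using g(3) by blast
  then obtain k where k: "!!e. e \<in> B ==> k e \<in> {0..1}" "!!e. e \<in> B ==> T (g m) e = cor (k e) *\<^sub>C e"
   by metis
  obtain \<phi> where \<phi>: "partial_quasifree (spn B) (dop B k) \<phi>"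
   using partial_quasifree_diagonal[OF B(1,2), of k] k(1) by blast
  have "dop B k h = T (g m) h" if "h \<in> spn B" for h
  proof -
   have lin: "linear (T (g m))" by (rule bounded_linear.linear[OF T_bounded_linear[OF g(1)]])
   have "T (g m) (\<Sum>e\<in>B. cinner h e *\<^sub>C e) = dop B k h"
    by (simp add: linear_sum[OF lin] T_scale g(1) k(2) dop_def scaleC_scaleC mult.commute)
   then show ?thesis using that by (simp add: spn_def)
  qed
  then have "fdet n (%i j. cinner (dop B k (hs ! i)) (ks ! j)) = fdet n (%i j. cinner (T (g m) (hs ! i)) (ks ! j))"
   if "set hs \<subseteq> spn B" "n \<le> length hs" for n hs ks
   using that by (intro fdet_cong) (auto simp: subset_iff)
  then have "partial_quasifree (spn B) (T (g m)) \<phi>"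
   using \<phi> unfolding partial_quasifree_def by simp
  then show ?thesis using B(3) by blast
 qed
 then obtain B \<phi> where B: "!!m. F m \<subseteq> spn (B m)" and \<phi>: "!!m. partial_quasifree (spn (B m)) (T (g m)) (\<phi> m)"
  by metis
 define W where "W = cspan (range (delta :: 'x => 'x ell2))"
 have Wev: "\<forall>\<^sub>F m in sequentially. h \<in> spn (B m)" if "h \<in> W" for h
  using that unfolding W_def
 proof induction
  case cspan_zero
  show ?case by (intro always_eventually allI csubspaceD(1)[OF csubspace_spn])
 next
  case (cspan_add_scale u d z)
  then obtain x where d: "d = delta x" by blast
  have "\<forall>\<^sub>F m in sequentially. d \<in> spn (B m)"
   using eventually_ge_at_top[of "to_nat x"]
  proof eventually_elim
   case (elim m)
   then have "d \<in> F m" by (simp add: F_def d)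
   then show ?case using B by blast
  qed
  with cspan_add_scale.IH show ?case
   by eventually_elim (intro csubspaceD(2,3)[OF csubspace_spn])
 qed
 have Wset: "\<forall>\<^sub>F m in sequentially. set hs \<subseteq> spn (B m)" if "set hs \<subseteq> W" for hs
  using that by (induction hs) (auto intro: eventually_conj Wev)
 have Aev: "\<forall>\<^sub>F m in sequentially. x \<in> calg (spn (B m))" if "x \<in> calg W" for x
  using that
 proof (induction rule: calg_induct)
  case (nmon hs ks)
  have "\<forall>\<^sub>F m in sequentially. set hs \<subseteq> spn (B m) \<and> set ks \<subseteq> spn (B m)"
   by (intro eventually_conj Wset nmon)
  then show ?case by eventually_elim (simp add: nmon_calg)
 next
  case zero
  show ?case by (intro always_eventually allI csubspaceD(1)[OF csubspace_calg])
 next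
  case (add x y z)
  from add(3,4) show ?case
   by eventually_elim (intro csubspaceD(2,3)[OF csubspace_calg])
 qed
 have mono_lim: "(%m. \<phi> m (nmon hs ks)) \<longlonglongrightarrow>
   qfdet K hs ks"
  if "set hs \<subseteq> W" "set ks \<subseteq> W" for hs ks
 proof (rule Lim_transform_eventually)
  show "(%m. qfdet (T (g m)) hs ks)
   \<longlonglongrightarrow> qfdet K hs ks"
   by (auto intro!: tendsto_fdet cinner.tendsto K_lim)
  have "\<forall>\<^sub>F m in sequentially. set hs \<subseteq> spn (B m) \<and> set ks \<subseteq> spn (B m)"
   by (intro eventually_conj Wset that)
  then show "\<forall>\<^sub>F m in sequentially. qfdet (T (g m)) hs ks
    = \<phi> m (nmon hs ks)"
   by eventually_elim (use \<phi> in \<open>simp add: partial_quasifree_def\<close>)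
 qed
 have "\<exists>l. (%m. \<phi> m x) \<longlonglongrightarrow> l" if "x \<in> calg W" for x
  using that
 proof (induction rule: calg_induct)
  case (nmon hs ks) then show ?case using mono_lim by blast
 next
  case zero
  have "\<phi> m (0 *\<^sub>C 0) = 0 * \<phi> m 0" for m
   using \<phi>[of m] csubspaceD(1)[OF csubspace_calg] unfolding partial_quasifree_def by blast
  then have "(%m. \<phi> m 0) \<longlonglongrightarrow> 0" by simp
  then show ?case by blast
 next
  case (add x y z)
  then obtain l l' where l: "(%m. \<phi> m x) \<longlonglongrightarrow> l" "(%m. \<phi> m y) \<longlonglongrightarrow> l'" by blast
  have "(%m. \<phi> m (x + z *\<^sub>C y)) \<longlonglongrightarrow> l + z * l'"
  proof (rule Lim_transform_eventually)
   show "(%m. \<phi> m x + z * \<phi> m y) \<longlonglongrightarrow> l + z * l'" by (intro tendsto_intros l)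
   show "\<forall>\<^sub>F m in sequentially. \<phi> m x + z * \<phi> m y = \<phi> m (x + z *\<^sub>C y)"
    using Aev[OF add(1)] Aev[OF add(2)]
   proof eventually_elim
    case (elim m)
    then show ?case using \<phi>[of m] csubspaceD(3)[OF csubspace_calg elim(2)] by (simp add: partial_quasifree_def)
   qed
  qed
  then show ?case by blast
 qed
 then obtain \<phi>0 where \<phi>0: "!!x. x \<in> calg W ==> (%m. \<phi> m x) \<longlonglongrightarrow> \<phi>0 x" by metis
 have sub: "csubspace (calg W)" by (rule csubspace_calg)
 have dense: "closure (calg W) = UNIV" unfolding W_def by (rule calg_dense[OF closure_cspan_delta])
 obtain \<psi> where \<psi>: "!!x y. \<psi> (x + y) = \<psi> x + \<psi> y" "!!z x. \<psi> (z *\<^sub>C x) = z * \<psi> x"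
  "!!x. cmod (\<psi> x) \<le> norm x" "!!x. x \<in> calg W ==> \<psi> x = \<phi>0 x"
 proof (rule functional_extend[OF sub dense, of \<phi>0])
  fix x y assume xy: "x \<in> calg W" "y \<in> calg W"
  show "\<phi>0 (x + y) = \<phi>0 x + \<phi>0 y"
  proof (rule LIMSEQ_unique[OF \<phi>0])
   show "x + y \<in> calg W" by (rule csubspaceD(2)[OF sub xy])
   show "(%m. \<phi> m (x + y)) \<longlonglongrightarrow> \<phi>0 x + \<phi>0 y"
   proof (rule Lim_transform_eventually)
    show "(%m. \<phi> m x + \<phi> m y) \<longlonglongrightarrow> \<phi>0 x + \<phi>0 y" by (intro tendsto_intros \<phi>0 xy)
    show "\<forall>\<^sub>F m in sequentially. \<phi> m x + \<phi> m y = \<phi> m (x + y)"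
     using Aev[OF xy(1)] Aev[OF xy(2)] by eventually_elim (use \<phi> in \<open>simp add: partial_quasifree_def\<close>)
   qed
  qed
 next
  fix z x assume x: "x \<in> calg W"
  show "\<phi>0 (z *\<^sub>C x) = z * \<phi>0 x"
  proof (rule LIMSEQ_unique[OF \<phi>0])
   show "z *\<^sub>C x \<in> calg W" by (rule csubspaceD(3)[OF sub x])
   show "(%m. \<phi> m (z *\<^sub>C x)) \<longlonglongrightarrow> z * \<phi>0 x"
   proof (rule Lim_transform_eventually)
    show "(%m. z * \<phi> m x) \<longlonglongrightarrow> z * \<phi>0 x" by (intro tendsto_intros \<phi>0 x)
    show "\<forall>\<^sub>F m in sequentially. z * \<phi> m x = \<phi> m (z *\<^sub>C x)"
     using Aev[OF x] by eventually_elim (use \<phi> in \<open>simp add: partial_quasifree_def\<close>)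
   qed
  qed
 next
  fix x assume x: "x \<in> calg W"
  show "cmod (\<phi>0 x) \<le> norm x"
  proof (rule tendsto_upperbound)
   show "(%m. cmod (\<phi> m x)) \<longlonglongrightarrow> cmod (\<phi>0 x)" by (intro tendsto_intros \<phi>0 x)
   show "\<forall>\<^sub>F m in sequentially. cmod (\<phi> m x) \<le> norm x"
    using Aev[OF x] by eventually_elim (use \<phi> in \<open>simp add: partial_quasifree_def\<close>)
  qed simp
 qed (rule that)
 have bl: "bounded_linear \<psi>"
 proof (rule bounded_linear_intro[where K = 1])
  show "\<psi> (r *\<^sub>R x) = r *\<^sub>R \<psi> x" for r x
   using \<psi>(2)[of "cor r" x] by (simp add: scaleC_of_real scaleR_conv_of_real)
 qed (simp_all add: \<psi>)
 have Wdense: "\<exists>s. (\<forall>n. s n \<in> W) \<and> s \<longlonglongrightarrow> h" for h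
  using closure_cspan_delta closure_sequential[of h W] unfolding W_def by auto
 have nm: "\<psi> (nmon hs ks) = qfdet K hs ks" for hs ks
 proof -
  obtain s where s: "!!h n. s h n \<in> W" "!!h. (%n. s h n) \<longlonglongrightarrow> h" using Wdense by metis
  define H where "H n = map (%h. s h n) hs" for n
  define L where "L n = map (%h. s h n) ks" for n
  have "(%n. ann (H n)) \<longlonglongrightarrow> ann hs" "(%n. ann (L n)) \<longlonglongrightarrow> ann ks"
   by (rule tendsto_ann[OF refl]; simp add: H_def L_def s)+
  then have "(%n. adj (ann (H n)) * ann (L n)) \<longlonglongrightarrow> adj (ann hs) * ann ks"
   by (intro tendsto_mult tendsto_adj)
  then have "(%n. nmon (H n) (L n)) \<longlonglongrightarrow> nmon hs ks" by (simp add: nmon_def adj_ann)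
  then have 1: "(%n. \<psi> (nmon (H n) (L n))) \<longlonglongrightarrow> \<psi> (nmon hs ks)" by (rule bounded_linear.tendsto[OF bl])
  have sub: "set (H n) \<subseteq> W" "set (L n) \<subseteq> W" for n by (auto simp: H_def L_def s)
  have "\<psi> (nmon (H n) (L n)) = (if length hs = length ks then fdet (length hs) (%i j. cinner (K (H n ! i)) (L n ! j)) else 0)" for n
   using LIMSEQ_unique[OF \<phi>0[OF nmon_calg[OF sub[of n]]] mono_lim[OF sub[of n]]] \<psi>(4)[OF nmon_calg[OF sub[of n]]]
   by (simp add: H_def L_def)
  moreover have "(%n. if length hs = length ks then fdet (length hs) (%i j. cinner (K (H n ! i)) (L n ! j)) else 0)
   \<longlonglongrightarrow> qfdet K hs ks"
  proof -
   have "(%n. K (s h n)) \<longlonglongrightarrow> K h" for h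
    unfolding K_def by (rule bounded_linear.tendsto[OF T_bounded_linear[OF fb] s(2)])
   then show ?thesis by (auto intro!: tendsto_fdet cinner.tendsto s simp: H_def L_def)
  qed
  ultimately show ?thesis using LIMSEQ_unique[OF 1] by (simp only:)
 qed
 have "is_state \<psi>"
  unfolding is_state_def
 proof (intro conjI allI \<psi>(1,2))
  show "\<psi> 1 = 1" using nm[of "[]" "[]"] by (simp add: nmon_def)
  fix x
  obtain s where s: "!!n. s n \<in> calg W" "s \<longlonglongrightarrow> x" using dense closure_sequential[of x "calg W"] by auto
  have "(%n. \<psi> (adj (s n) * s n)) \<longlonglongrightarrow> \<psi> (adj x * x)"
   by (intro bounded_linear.tendsto[OF bl] tendsto_mult tendsto_adj s)
  moreover have "\<psi> (adj (s n) * s n) \<in> \<real>\<^sub>\<ge>\<^sub>0" for n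
  proof -
   have m: "adj (s n) * s n \<in> calg W" by (intro calg_mult calg_adj s)
   have "\<phi>0 (adj (s n) * s n) \<in> \<real>\<^sub>\<ge>\<^sub>0"
   proof (rule Lim_in_closed_set[OF closed_nonneg_Reals_complex _ _ \<phi>0[OF m]])
    show "\<forall>\<^sub>F m in sequentially. \<phi> m (adj (s n) * s n) \<in> \<real>\<^sub>\<ge>\<^sub>0"
     using Aev[OF s(1)[of n]] by eventually_elim (use \<phi> in \<open>simp add: partial_quasifree_def\<close>)
   qed simp
   then show ?thesis by (simp add: \<psi>(4)[OF m])
  qed
  ultimately show "\<psi> (adj x * x) \<in> \<real>\<^sub>\<ge>\<^sub>0"
   by (intro Lim_in_closed_set[OF closed_nonneg_Reals_complex]) auto
 qed
 then have "is_quasifree a K \<psi>" unfolding is_quasifree_iff using nm by blast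
 then show ?thesis unfolding K_def by blast
qed

end

section \<open>Entire functions and the maximum principle in a strip\<close>

definition cderiv :: "(complex => 'a::complex_banach) => 'a => complex => bool" where
 "cderiv F D z \<longleftrightarrow> ((%w. inverse (w - z) *\<^sub>C (F w - F z)) \<longlongrightarrow> D) (at z)"

lemma entire_fun_iff: "entire_fun F \<longleftrightarrow> (\<forall>z. \<exists>D. cderiv F D z)"
 by (simp add: entire_fun_def cderiv_def)

lemma cderiv_continuous: "cderiv F D z ==> (F \<longlongrightarrow> F z) (at z)"
proof -
 assume D: "cderiv F D z"
 have "((%w. (w - z) *\<^sub>C (inverse (w - z) *\<^sub>C (F w - F z)) + F z) \<longlongrightarrow> (z - z) *\<^sub>C D + F z) (at z)"
  by (intro tendsto_add scaleC.tendsto tendsto_diff tendsto_ident_at tendsto_const D[unfolded cderiv_def])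
 moreover have "\<forall>\<^sub>F w in at z. (w - z) *\<^sub>C (inverse (w - z) *\<^sub>C (F w - F z)) + F z = F w"
  by (auto simp: eventually_at_filter scaleC_scaleC)
 ultimately show ?thesis by (auto dest: Lim_transform_eventually)
qed

lemma entire_fun_continuous: "entire_fun F ==> isCont F z"
 unfolding entire_fun_iff isCont_def using cderiv_continuous by blast

lemma entire_fun_const: "entire_fun (%_. x)"
 by (auto simp: entire_fun_def)

lemma cderiv_add: "cderiv F D z ==> cderiv G D' z ==> cderiv (%z. F z + G z) (D + D') z"
 unfolding cderiv_def by (drule (1) tendsto_add) (simp add: algebra_simps flip: scaleC_add_right)

lemma entire_fun_add: "entire_fun F ==> entire_fun G ==> entire_fun (%z. F z + G z)"
 unfolding entire_fun_iff using cderiv_add by metis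

lemma entire_fun_bounded_linear:
 assumes F: "entire_fun F" and L: "bounded_linear L" "!!z x. L (z *\<^sub>C x) = z *\<^sub>C L x"
 shows "entire_fun (%z. L (F z))"
proof -
 have "cderiv (%z. L (F z)) (L D) z" if "cderiv F D z" for D z
  using bounded_linear.tendsto[OF L(1) that[unfolded cderiv_def]]
  by (simp add: cderiv_def L(2) linear_diff[OF bounded_linear.linear[OF L(1)]])
 then show ?thesis using F unfolding entire_fun_iff by metis
qed

lemma cderiv_mult:
 fixes F G :: "complex => 'a::cstar_algebra"
 assumes "cderiv F D z" "cderiv G D' z" shows "cderiv (%z. F z * G z) (D * G z + F z * D') z"
proof -
 have "((%w. (inverse (w - z) *\<^sub>C (F w - F z)) * G w + F z * (inverse (w - z) *\<^sub>C (G w - G z))) \<longlongrightarrow> D * G z + F z * D') (at z)"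
  by (intro tendsto_intros assms[unfolded cderiv_def] cderiv_continuous[OF assms(2)])
 then show ?thesis
  by (simp add: cderiv_def scaleC_mult_left scaleC_mult_right algebra_simps flip: scaleC_add_right)
qed

lemma entire_fun_mult:
 "entire_fun F ==> entire_fun G ==> entire_fun (%z. F z * G z :: 'a::cstar_algebra)"
 unfolding entire_fun_iff using cderiv_mult by metis

lemma entire_fun_shift: "entire_fun F ==> entire_fun (%z. F (z + s))"
proof -
 have "cderiv (%z. F (z + s)) D z" if "cderiv F D (z + s)" for D z
  using that unfolding cderiv_def
  by (subst (asm) LIM_offset_zero_iff, simp, subst LIM_offset_zero_iff) (auto simp: add_ac)
 then show "entire_fun F ==> ?thesis" unfolding entire_fun_iff by metis
qed

lemma entire_fun_scale_arg:
 assumes F: "entire_fun F" and c: "c \<noteq> 0" shows "entire_fun (%z. F (c * z))"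
proof -
 have "cderiv (%z. F (c * z)) (c *\<^sub>C D) z" if D: "cderiv F D (c * z)" for D z
 proof -
  have "filterlim (%w. c * w) (at (c * z)) (at z)"
   unfolding filterlim_at using c by (auto simp: eventually_at_filter intro!: tendsto_intros)
  from scaleC.tendsto[OF tendsto_const[of c] filterlim_compose[OF D[unfolded cderiv_def] this]]
  show ?thesis using c by (simp add: cderiv_def scaleC_scaleC flip: right_diff_distrib mult.assoc)
 qed
 then show ?thesis using F unfolding entire_fun_iff by metis
qed

lemma entire_fun_adj:
 assumes F: "entire_fun (F :: complex => 'a::cstar_algebra)" shows "entire_fun (%z. adj (F (cnj z)))"
proof -
 have "cderiv (%z. adj (F (cnj z))) (adj D) z" if D: "cderiv F D (cnj z)" for D z
 proof -
  have "filterlim cnj (at (cnj z)) (at z)"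
   unfolding filterlim_at by (auto simp: eventually_at_filter intro!: tendsto_intros)
  from tendsto_adj[OF filterlim_compose[OF D[unfolded cderiv_def] this]]
  show ?thesis by (simp add: cderiv_def adj_scaleC adj_diff)
 qed
 then show ?thesis using F unfolding entire_fun_iff by metis
qed

lemma entire_fun_holomorphic:
 assumes F: "entire_fun F" and L: "bounded_linear L" "!!z x. L (z *\<^sub>C x) = z * L x"
 shows "(%z. L (F z) :: complex) holomorphic_on A"
 unfolding holomorphic_on_def field_differentiable_def
proof (intro ballI)
 fix z
 obtain D where "((%w. inverse (w - z) *\<^sub>C (F w - F z)) \<longlongrightarrow> D) (at z)" using F unfolding entire_fun_def by blast
 from bounded_linear.tendsto[OF L(1) this]
 have "((%w. (L (F w) - L (F z)) / (w - z)) \<longlongrightarrow> L D) (at z)"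
  by (simp add: L(2) linear_diff[OF bounded_linear.linear[OF L(1)]] divide_inverse mult.commute)
 then have "((%z. L (F z)) has_field_derivative L D) (at z)"
  by (simp add: has_field_derivative_iff)
 then show "\<exists>D. ((%z. L (F z)) has_field_derivative D) (at z within A)"
  using has_field_derivative_at_within by blast
qed

lemma entire_eq_on_reals:
 assumes "f holomorphic_on UNIV" "g holomorphic_on UNIV" "!!t. f (cor t) = g (cor t)"
 shows "f z = g z"
proof -
 have "f z - g z = 0"
 proof (rule analytic_continuation[where f = "%z. f z - g z" and w = z and S = UNIV and U = "range cor" and \<xi> = 0])
  show "(%z. f z - g z) holomorphic_on UNIV" by (intro holomorphic_intros assms)
  show "0 islimpt range cor"
   unfolding islimpt_sequential
  proof (intro exI[of _ "%n. cor (inverse (real (Suc n)))"] conjI allI)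
   show "(%n. cor (inverse (real (Suc n)))) \<longlonglongrightarrow> 0"
    using tendsto_of_real[OF LIMSEQ_inverse_real_of_nat, where 'a = complex] by simp
   show "cor (inverse (real (Suc n))) \<in> range cor - {0}" for n
    by (intro DiffI rangeI) (simp del: of_nat_Suc)
  qed
 qed (use assms(3) in auto)
 then show ?thesis by simp
qed

text \<open>On an unbounded strip the maximum principle needs decay at the ends. A Gaussian factor
  provides it at the price of constants that disappear as \<open>e\<close> tends to 0; the surplus
  in \<open>M + e\<close> takes care of the vertical sides of a long rectangle.\<close>

lemma strip_maximum:
 fixes f :: "complex => complex"
 assumes f: "f holomorphic_on UNIV" and z0: "l \<le> Im z0" "Im z0 \<le> u"
  and C: "!!z. l \<le> Im z ==> Im z \<le> u ==> cmod (f z) \<le> C"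
  and M: "!!s. cmod (f (Complex s l)) \<le> M" "!!s. cmod (f (Complex s u)) \<le> M"
 shows "cmod (f z0) \<le> M"
proof -
 have M0: "0 \<le> M" using M(1)[of 0] norm_ge_zero order_trans by blast
 have C0: "0 \<le> C" using C[OF z0] norm_ge_zero order_trans by blast
 define Y where "Y = max \<bar>l\<bar> \<bar>u\<bar>"
 have bound: "cmod (f z0) \<le> (M + e) * exp (e * (Y\<^sup>2 + (Re z0)\<^sup>2))" if e: "e > 0" for e
 proof -
  define g where "g z = f z * exp (- cor e * z\<^sup>2)" for z
  have gn: "cmod (g z) = cmod (f z) * exp (- e * ((Re z)\<^sup>2 - (Im z)\<^sup>2))" for z
   by (simp add: g_def norm_mult norm_exp_eq_Re power2_eq_square)
  have "\<exists>R0. \<forall>R\<ge>R0. C * exp (- e * R\<^sup>2) \<le> M + e"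
  proof -
   have "((%R. C * exp (- e * R\<^sup>2)) \<longlongrightarrow> 0) at_top" using e by real_asymp
   then have "\<forall>\<^sub>F R in at_top. C * exp (- e * R\<^sup>2) < M + e" by (rule order_tendstoD(2)) (use e M0 in simp)
   then show ?thesis unfolding eventually_at_top_linorder by (meson less_imp_le)
  qed
  then obtain R0 where R0: "!!R. R \<ge> R0 ==> C * exp (- e * R\<^sup>2) \<le> M + e" by blast
  define R where "R = max R0 (\<bar>Re z0\<bar>)"
  have R: "R \<ge> R0" "\<bar>Re z0\<bar> \<le> R" by (auto simp: R_def)
  define S where "S = cbox (Complex (- R) l) (Complex R u)"
  have "cmod (g z0) \<le> (M + e) * exp (e * Y\<^sup>2)"
  proof (rule maximum_modulus_frontier[where f = g and S = S and \<xi> = z0])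
   have hol: "g holomorphic_on UNIV" unfolding g_def by (intro holomorphic_intros f)
   then show "g holomorphic_on interior S" by (rule holomorphic_on_subset) simp
   show "continuous_on (closure S) g"
    using holomorphic_on_imp_continuous_on[OF hol] continuous_on_subset by blast
   show "bounded S" by (simp add: S_def)
   show "z0 \<in> S" using z0 R by (auto simp: S_def in_cbox_complex_iff)
   fix z assume "z \<in> frontier S"
   then have z: "z \<in> cbox (Complex (- R) l) (Complex R u)" "z \<notin> box (Complex (- R) l) (Complex R u)"
    by (auto simp: S_def frontier_cbox)
   then have Im: "l \<le> Im z" "Im z \<le> u" by (auto simp: in_cbox_complex_iff)
   have "\<bar>Im z\<bar> \<le> Y" using Im by (auto simp: Y_def)
   then have Y2: "(Im z)\<^sup>2 \<le> Y\<^sup>2" by (metis abs_ge_zero power2_abs power_mono)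
   have split: "exp (- e * ((Re z)\<^sup>2 - (Im z)\<^sup>2)) \<le> exp (- e * (Re z)\<^sup>2) * exp (e * Y\<^sup>2)"
    using Y2 e by (simp add: algebra_simps flip: exp_add)
   have "cmod (f z) * exp (- e * (Re z)\<^sup>2) \<le> M + e"
   proof (cases "Im z = l \<or> Im z = u")
    case True
    then have "cmod (f z) \<le> M" using M[of "Re z"] by (metis complex_surj)
    moreover have "exp (- e * (Re z)\<^sup>2) \<le> 1" using e by simp
    ultimately have "cmod (f z) * exp (- e * (Re z)\<^sup>2) \<le> M * 1" using M0 by (intro mult_mono) auto
    then show ?thesis using e by simp
   next
    case False
    then have "Re z = R \<or> Re z = - R" using z by (auto simp: in_cbox_complex_iff in_box_complex_iff)
    then have "(Re z)\<^sup>2 = R\<^sup>2" by auto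
    then have "cmod (f z) * exp (- e * (Re z)\<^sup>2) \<le> C * exp (- e * R\<^sup>2)"
     using C[OF Im] by (simp add: mult_right_mono)
    then show ?thesis using R0[OF R(1)] by linarith
   qed
   then have "cmod (f z) * exp (- e * (Re z)\<^sup>2) * exp (e * Y\<^sup>2) \<le> (M + e) * exp (e * Y\<^sup>2)"
    by (intro mult_right_mono) auto
   moreover have "cmod (g z) \<le> cmod (f z) * exp (- e * (Re z)\<^sup>2) * exp (e * Y\<^sup>2)"
    unfolding gn mult.assoc[of "cmod (f z)"] by (intro mult_left_mono split) auto
   ultimately show "cmod (g z) \<le> (M + e) * exp (e * Y\<^sup>2)" by linarith
  qed
  moreover have "cmod (f z0) * exp (- e * (Re z0)\<^sup>2) \<le> cmod (g z0)"
   unfolding gn using e by (intro mult_left_mono) (auto simp: algebra_simps)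
  ultimately have "cmod (f z0) * exp (- e * (Re z0)\<^sup>2) \<le> (M + e) * exp (e * Y\<^sup>2)" by linarith
  then have "cmod (f z0) * exp (- e * (Re z0)\<^sup>2) * exp (e * (Re z0)\<^sup>2) \<le> (M + e) * exp (e * Y\<^sup>2) * exp (e * (Re z0)\<^sup>2)"
   by (intro mult_right_mono) auto
  then show ?thesis by (simp add: mult.assoc distrib_left flip: exp_add)
 qed
 have lim: "((%e. (M + e) * exp (e * (Y\<^sup>2 + (Re z0)\<^sup>2))) \<longlongrightarrow> (M + 0) * exp (0 * (Y\<^sup>2 + (Re z0)\<^sup>2))) (at_right 0)"
  by (intro tendsto_intros)
 have "cmod (f z0) \<le> (M + 0) * exp (0 * (Y\<^sup>2 + (Re z0)\<^sup>2))"
  by (rule tendsto_lowerbound[OF lim]) (auto simp: eventually_at_right_less intro!: eventually_at_rightI[of 0 1] bound)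
 then show ?thesis by simp
qed

lemma bborel_exp_cut: "bborel (%x. exp (w * cor x) * indicator {- real m..real m} x)"
proof (rule bborelI[where B = "exp (cmod w * real m)"])
 show "(%x. exp (w * cor x) * indicator {- real m..real m} x) \<in> borel_measurable borel" by measurable
 show "cmod (exp (w * cor x) * indicator {- real m..real m} x) \<le> exp (cmod w * real m)" for x
 proof (cases "x \<in> {- real m..real m}")
  case True
  have "Re (w * cor x) \<le> cmod (w * cor x)" by (rule complex_Re_le_cmod)
  also have "\<dots> \<le> cmod w * real m" using True by (auto simp: norm_mult intro: mult_left_mono)
  finally show ?thesis using True by (simp add: norm_exp_eq_Re)
 qed simp
qed

text \<open>A bounded spectral window makes the difference quotients of the exponential uniformly
  bounded, so \<open>T_strong_limit\<close> permits differentiation under the calculus.\<close>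

lemma (in pvm) entire_fun_exp:
 "entire_fun (%z. T (%x. exp (z * cor x) * indicator {- real m..real m} x) h)"
 unfolding entire_fun_def
proof
 fix z
 let ?i = "indicator {- real m..real m} :: real => complex"
 define e where "e w x = exp (w * cor x) * ?i x" for w x
 have eb: "bborel (e w)" for w unfolding e_def by (rule bborel_exp_cut)
 define D where "D x = cor x * e z x" for x
 have Db: "bborel D"
 proof -
  have "D = (%x. trunc m x * e z x)" by (auto simp: D_def trunc_def e_def indicator_def fun_eq_iff)
  then show ?thesis using bborel_mult[OF bborel_trunc eb] by simp
 qed
 have "((%w. inverse (w - z) *\<^sub>C (T (e w) h - T (e z) h)) \<longlongrightarrow> T D h) (at z)"
  unfolding tendsto_at_iff_sequentially comp_def
 proof (intro allI impI)
  fix X :: "nat => complex" assume X: "\<forall>i. X i \<in> UNIV - {z}" "X \<longlonglongrightarrow> z"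
  have Xz: "X i - z \<noteq> 0" for i using X(1) by auto
  have "bounded (range X)" using X(2) by (intro convergent_imp_bounded) (auto simp: convergent_def)
  then obtain C where C: "!!i. cmod (X i) \<le> C" by (auto simp: bounded_iff)
  define s where "s i x = inverse (X i - z) * (e (X i) x - e z x)" for i x
  have sb: "bborel (s i)" for i unfolding s_def by (intro bborel_mult bborel_const bborel_diff eb)
  have "(%i. T (s i) h) \<longlonglongrightarrow> T D h"
  proof (rule T_strong_limit[OF sb _ _ Db])
   fix x
   have "((%w. exp (w * cor x)) has_field_derivative cor x * exp (z * cor x)) (at z)"
    by (auto intro!: derivative_eq_intros)
   then have "((%w. (exp (w * cor x) - exp (z * cor x)) / (w - z)) \<longlongrightarrow> cor x * exp (z * cor x)) (at z)"
    by (simp add: has_field_derivative_iff)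
   then have "(%i. (exp (X i * cor x) - exp (z * cor x)) / (X i - z)) \<longlonglongrightarrow> cor x * exp (z * cor x)"
    unfolding tendsto_at_iff_sequentially comp_def using X by blast
   then have "(%i. (exp (X i * cor x) - exp (z * cor x)) / (X i - z) * ?i x) \<longlonglongrightarrow> cor x * exp (z * cor x) * ?i x"
    by (intro tendsto_mult tendsto_const)
   then show "(%i. s i x) \<longlonglongrightarrow> D x"
    by (simp add: s_def D_def e_def divide_inverse algebra_simps)
  next
   fix i x
   show "cmod (s i x) \<le> exp (cmod z * real m) * (exp ((C + cmod z) * real m) * real m)"
   proof (cases "x \<in> {- real m..real m}")
    case True
    define d where "d = X i - z"
    have d: "d \<noteq> 0" "cmod d \<le> C + cmod z" using Xz[of i] norm_triangle_ineq4[of "X i" z] C[of i] by (auto simp: d_def)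
    have dx: "cmod (d * cor x) \<le> (C + cmod z) * real m"
     unfolding norm_mult using True d order_trans[OF norm_ge_zero d(2)] by (intro mult_mono) auto
    have "cmod (exp (d * cor x) - 1) \<le> exp \<bar>Re (d * cor x)\<bar> * cmod (d * cor x)"
     using Taylor_exp[of "d * cor x" 0] by simp
    also have "\<dots> \<le> exp ((C + cmod z) * real m) * (cmod d * real m)"
    proof (intro mult_mono)
     show "exp \<bar>Re (d * cor x)\<bar> \<le> exp ((C + cmod z) * real m)"
      using abs_Re_le_cmod[of "d * cor x"] dx by simp
     show "cmod (d * cor x) \<le> cmod d * real m"
      unfolding norm_mult using True by (intro mult_left_mono) auto
    qed auto
    finally have 1: "cmod (exp (d * cor x) - 1) \<le> cmod d * (exp ((C + cmod z) * real m) * real m)"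
     by (simp add: mult_ac)
    have "s i x = e z x * ((exp (d * cor x) - 1) / d)"
     using True by (simp add: s_def e_def d_def divide_inverse algebra_simps flip: exp_add)
    then have "cmod (s i x) = cmod (e z x) * (cmod (exp (d * cor x) - 1) / cmod d)"
     by (simp add: norm_mult norm_divide)
    also have "\<dots> \<le> exp (cmod z * real m) * (exp ((C + cmod z) * real m) * real m)"
    proof (intro mult_mono)
     have "Re (z * cor x) \<le> cmod (z * cor x)" by (rule complex_Re_le_cmod)
     also have "\<dots> \<le> cmod z * real m" using True by (auto simp: norm_mult intro: mult_left_mono)
     finally show "cmod (e z x) \<le> exp (cmod z * real m)" using True by (simp add: e_def norm_exp_eq_Re)
     show "cmod (exp (d * cor x) - 1) / cmod d \<le> exp ((C + cmod z) * real m) * real m"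
      using 1 d(1) by (simp add: divide_le_eq mult.commute)
    qed auto
    finally show ?thesis .
   qed (simp add: s_def e_def)
  qed
  moreover have "T (s i) h = inverse (X i - z) *\<^sub>C (T (e (X i)) h - T (e z) h)" for i
   unfolding s_def by (simp add: T_scale_fun bborel_diff eb T_diff_fun)
  ultimately show "(%i. inverse (X i - z) *\<^sub>C (T (e (X i)) h - T (e z) h)) \<longlonglongrightarrow> T D h" by simp
 qed
 then show "\<exists>D. ((%w. inverse (w - z) *\<^sub>C (T (%x. exp (w * cor x) * ?i x) h -
   T (%x. exp (z * cor x) * ?i x) h)) \<longlongrightarrow> D) (at z)"
  unfolding e_def by blast
qed

section \<open>Wick's theorem for words in creators and annihilators\<close>

text \<open>
 A letter \<open>(True, l)\<close> is a creator and \<open>(False, l)\<close> an annihilator. In a row \<open>(l, q)\<close> of the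
 matrix, \<open>q\<close> counts the annihilators to the left of the creator \<open>l\<close>.
\<close>

fun rows :: "nat => (bool \<times> 'l) list => ('l \<times> nat) list" where
 "rows q [] = []"
| "rows q ((b, l) # w) = (if b then (l, q) # rows q w else rows (Suc q) w)"

definition cols :: "(bool \<times> 'l) list => 'l list" where
 "cols w = map snd (filter (%p. \<not> fst p) w)"

text \<open>The sign of normal ordering: a creator brought to the front passes every letter to its
  left, so the parity of its position is what counts.\<close>

fun sg :: "nat => (bool \<times> 'l) list => complex" where
 "sg s [] = 1"
| "sg s ((b, l) # w) = (if b then (-1) ^ s else 1) * sg (Suc s) w"

text \<open>The flag given to \<open>e\<close> says that the annihilator of the column stands to the
  left of the creator of the row, so that the two contract in the opposite order.\<close>

definition wick :: "(bool => 'l => 'l => complex) => ('l \<times> nat) list => 'l list => complex" where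
 "wick e R C = (if length R = length C
  then fdet (length R) (%i j. e (j < snd (R ! i)) (fst (R ! i)) (C ! j)) else 0)"

lemma rows_Suc: "rows (Suc q) w = map (%(l, q). (l, Suc q)) (rows q w)"
 by (induction q w rule: rows.induct) auto

lemma sg_parity: "sg (Suc (Suc s)) w = sg s w"
 by (induction s w rule: sg.induct) auto

text \<open>Deleting column \<open>j\<close> takes one annihilator away from the left of every later
  creator, so the counts above \<open>j\<close> drop by one.\<close>

lemma wick_laplace:
 assumes m: "m < length R" and l: "length R = length C"
 shows "wick e R C = (\<Sum>j<length C. (-1) ^ (m + j) * e (j < snd (R ! m)) (fst (R ! m)) (C ! j) *
  wick e (map (%(l, q). (l, if j < q then q - 1 else q)) (del m R)) (del j C))"
proof -
 obtain n where n: "length C = Suc n" using assms by (cases "length C") auto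
 have "wick e (map (%(l, q). (l, if j < q then q - 1 else q)) (del m R)) (del j C) =
  fdet n (%i j'. e ((if j' < j then j' else Suc j') < snd (R ! (if i < m then i else Suc i)))
   (fst (R ! (if i < m then i else Suc i))) (C ! (if j' < j then j' else Suc j')))" if "j < Suc n" for j
 proof -
  have "fdet n (%i j'. e (j' < snd (map (%(l, q). (l, if j < q then q - 1 else q)) (del m R) ! i))
     (fst (map (%(l, q). (l, if j < q then q - 1 else q)) (del m R) ! i)) (del j C ! j')) =
  fdet n (%i j'. e ((if j' < j then j' else Suc j') < snd (R ! (if i < m then i else Suc i)))
   (fst (R ! (if i < m then i else Suc i))) (C ! (if j' < j then j' else Suc j')))"
  proof (rule fdet_cong)
   fix i j' assume ij: "i < n" "j' < n"
   define r where "r = R ! (if i < m then i else Suc i)"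
   have r: "del m R ! i = r" using ij assms n unfolding r_def by (intro nth_del) auto
   have C: "del j C ! j' = C ! (if j' < j then j' else Suc j')" using ij n that by (intro nth_del) auto
   have q: "(j' < (if j < q then q - 1 else q)) = ((if j' < j then j' else Suc j') < q)" for q by auto
   have "i < length (del m R)" using assms ij n by simp
   then show "e (j' < snd (map (%(l, q). (l, if j < q then q - 1 else q)) (del m R) ! i))
     (fst (map (%(l, q). (l, if j < q then q - 1 else q)) (del m R) ! i)) (del j C ! j') =
     e ((if j' < j then j' else Suc j') < snd (R ! (if i < m then i else Suc i)))
   (fst (R ! (if i < m then i else Suc i))) (C ! (if j' < j then j' else Suc j'))"
    unfolding r_def[symmetric] by (simp only: nth_map r C split_beta fst_conv snd_conv q)
  qed
  then show ?thesis using assms n that by (simp add: wick_def)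
 qed
 then show ?thesis using assms n by (simp add: wick_def fdet_laplace)
qed

context car
begin

definition op :: "('l => 'x ell2) => ('l => 'x ell2) => bool \<times> 'l => 'a" where
 "op hv kv p = (if fst p then c (hv (snd p)) else a (kv (snd p)))"

lemma c_cre_commute: "c h * cre hs = (-1) ^ length hs *\<^sub>C (cre hs * c h)"
 using arg_cong[OF a_ann_commute[of h hs], of adj]
 by (simp add: adj_mult adj_ann adj_scaleC scaleC_scaleC flip: power_mult_distrib)

text \<open>Induction on the unprocessed word \<open>w\<close> behind a normally ordered prefix.
  Pulling a creator through the annihilators of the prefix produces contraction terms, and these are
  exactly the change of the determinant when the first \<open>n\<close> flags in the row of that
  creator are switched on.\<close>

lemma wick_words_aux:
 fixes hv kv :: "'l => 'x ell2"
 assumes add: "!!x y. \<phi> (x + y) = \<phi> x + \<phi> y" and scale: "!!z x. \<phi> (z *\<^sub>C x) = z * \<phi> x"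
  and nm: "!!hs ks. \<phi> (nmon hs ks) =
   qfdet K hs ks"
 defines "e \<equiv> %f l l'. cinner (K (hv l)) (kv l') - (if f then cinner (hv l) (kv l') else 0)"
 shows "\<phi> (nmon (map hv hs) (map kv ks) * prod_list (map (op hv kv) w)) =
  sg (length hs + length ks) w * wick e (map (%l. (l, 0)) hs @ rows (length ks) w) (ks @ cols w)"
proof (induction w arbitrary: hs ks)
 case Nil
 show ?case by (auto simp: nm wick_def cols_def e_def intro!: fdet_cong)
next
 case (Cons p w)
 obtain b l where p: "p = (b, l)" by (cases p)
 have zero: "\<phi> 0 = 0" using scale[of 0 0] by simp
 have sum: "\<phi> (sum F I) = (\<Sum>i\<in>I. \<phi> (F i))" if "finite I" for F :: "nat => 'a" and I
  using that by induction (simp_all add: zero add)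
 let ?W = "prod_list (map (op hv kv) w)"
 show ?case
 proof (cases b)
  case False
  have "nmon (map hv hs) (map kv ks) * prod_list (map (op hv kv) (p # w)) = nmon (map hv hs) (map kv (ks @ [l])) * ?W"
   using False by (simp add: p op_def nmon_def ann_append mult.assoc)
  then show ?thesis using Cons.IH[of hs "ks @ [l]"] False by (simp add: p cols_def)
 next
  case True
  define m n where "m = length hs" and "n = length ks"
  have "c (hv l) * ann (map kv ks) = (-1) ^ n *\<^sub>C (ann (map kv ks) * c (hv l))
   + (\<Sum>j<n. ((-1) ^ j * cinner (hv l) (kv (ks ! j))) *\<^sub>C ann (map kv (del j ks)))"
   using c_ann[of "hv l" "map kv ks"] by (simp add: n_def del_map)
  from arg_cong[OF this, of "scaleC ((-1) ^ n)"]
  have 1: "ann (map kv ks) * c (hv l) = (-1) ^ n *\<^sub>C (c (hv l) * ann (map kv ks))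
   - (\<Sum>j<n. ((-1) ^ (n + j) * cinner (hv l) (kv (ks ! j))) *\<^sub>C ann (map kv (del j ks)))"
   by (simp add: scaleC_add_right scaleC_scaleC scaleC.sum_right power_add mult.assoc flip: power_mult_distrib)
  have 2: "cre (map hv hs) * c (hv l) = (-1) ^ m *\<^sub>C cre (map hv (hs @ [l]))"
   using arg_cong[OF c_cre_commute[of "hv l" "map hv hs"], of "scaleC ((-1) ^ m)"]
   by (simp add: cre_snoc scaleC_scaleC m_def flip: power_mult_distrib)
  have "nmon (map hv hs) (map kv ks) * prod_list (map (op hv kv) (p # w)) =
    cre (map hv hs) * (ann (map kv ks) * c (hv l)) * ?W"
   using True by (simp add: p op_def nmon_def mult.assoc)
  also have "\<dots> = (-1) ^ n *\<^sub>C ((cre (map hv hs) * c (hv l)) * ann (map kv ks) * ?W)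
   - (\<Sum>j<n. ((-1) ^ (n + j) * cinner (hv l) (kv (ks ! j))) *\<^sub>C (nmon (map hv hs) (map kv (del j ks)) * ?W))"
   unfolding 1 by (simp add: nmon_def right_diff_distrib left_diff_distrib scaleC_mult_left scaleC_mult_right
     sum_distrib_left sum_distrib_right mult.assoc)
  also have "\<dots> = (-1) ^ (m + n) *\<^sub>C (nmon (map hv (hs @ [l])) (map kv ks) * ?W)
   + (- 1) *\<^sub>C (\<Sum>j<n. ((-1) ^ (n + j) * cinner (hv l) (kv (ks ! j))) *\<^sub>C (nmon (map hv hs) (map kv (del j ks)) * ?W))"
   unfolding 2 by (simp add: nmon_def scaleC_mult_left scaleC_scaleC power_add mult.commute scaleC_minus_one)
  finally have L: "\<phi> (nmon (map hv hs) (map kv ks) * prod_list (map (op hv kv) (p # w))) =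
   (-1) ^ (m + n) * (sg (m + 1 + n) w * wick e (map (%l. (l, 0)) (hs @ [l]) @ rows n w) (ks @ cols w))
   - (\<Sum>j<n. (-1) ^ (n + j) * cinner (hv l) (kv (ks ! j)) *
     (sg (m + length (del j ks)) w * wick e (map (%l. (l, 0)) hs @ rows (length (del j ks)) w) (del j ks @ cols w)))"
   by (simp add: add scale sum Cons.IH Cons.IH[of "hs @ [l]", simplified] m_def n_def del: length_del)
  let ?R = "%q. map (%l. (l, 0)) hs @ (l, q) # rows n w"
  let ?minor = "%j. wick e (map (%l. (l, 0)) hs @ rows (n - 1) w) (del j ks @ cols w)"
  \<comment> \<open>Both determinants are expanded along row \<open>m\<close>, the only one in which
    they differ, so they share their cofactors.\<close>
  have diff: "wick e (?R n) (ks @ cols w) = wick e (?R 0) (ks @ cols w)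
   - (\<Sum>j<n. (-1) ^ (m + j) * cinner (hv l) (kv (ks ! j)) * ?minor j)"
  proof (cases "length (?R 0) = length (ks @ cols w)")
   case False
   then have "?minor j = 0" if "j < n" for j
    using that by (cases n) (auto simp: wick_def n_def rows_Suc)
   with False show ?thesis by (simp add: wick_def)
  next
   case True
   let ?N = "length (ks @ cols w)"
   let ?M = "%j. wick e (map (%(l, q). (l, if j < q then q - 1 else q)) (map (%l. (l, 0)) hs @ rows n w)) (del j (ks @ cols w))"
   have nth: "?R q ! m = (l, q)" for q by (simp add: m_def nth_append)
   have dl: "del m (?R q) = map (%l. (l, 0)) hs @ rows n w" for q by (simp add: m_def del_def)
   have lap: "wick e (?R q) (ks @ cols w) = (\<Sum>j<?N. (-1) ^ (m + j) * e (j < q) l ((ks @ cols w) ! j) * ?M j)" for q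
    using wick_laplace[of m "?R q" "ks @ cols w" e] True unfolding nth dl by (simp add: m_def)
   have "wick e (?R 0) (ks @ cols w) - wick e (?R n) (ks @ cols w) =
     (\<Sum>j<?N. (-1) ^ (m + j) * (e False l ((ks @ cols w) ! j) - e (j < n) l ((ks @ cols w) ! j)) * ?M j)"
    unfolding lap by (simp add: algebra_simps flip: sum_subtractf)
   also have "\<dots> = (\<Sum>j<n. (-1) ^ (m + j) * (e False l ((ks @ cols w) ! j) - e (j < n) l ((ks @ cols w) ! j)) * ?M j)"
    by (rule sum.mono_neutral_right) (auto simp: n_def)
   also have "\<dots> = (\<Sum>j<n. (-1) ^ (m + j) * cinner (hv l) (kv (ks ! j)) * ?minor j)"
   proof (intro sum.cong refl)
    fix j assume "j \<in> {..<n}"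
    then have j: "j < n" by simp
    then obtain n' where n': "n = Suc n'" by (cases n) auto
    have "map (%(l, q). (l, if j < q then q - 1 else q)) (rows n w) = rows (n - 1) w"
    proof -
     have "q \<ge> n'" if "(l, q) \<in> set (rows n' w)" for l q
      using that by (induction n' w rule: rows.induct) (auto split: if_splits)
     then have "j \<le> q" if "(l, q) \<in> set (rows n' w)" for l q
      using that j by (fastforce simp: n')
     then show ?thesis by (auto simp: n' rows_Suc less_Suc_eq_le intro!: map_idI)
    qed
    moreover have "del j (ks @ cols w) = del j ks @ cols w" using j by (simp add: del_def n_def)
    ultimately show "(-1) ^ (m + j) * (e False l ((ks @ cols w) ! j) - e (j < n) l ((ks @ cols w) ! j)) * ?M j =
      (-1) ^ (m + j) * cinner (hv l) (kv (ks ! j)) * ?minor j"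
     using j by (simp add: e_def nth_append n_def comp_def)
   qed
   finally show ?thesis by (simp add: algebra_simps)
  qed
  have "(-1) ^ (n + j) * cinner (hv l) (kv (ks ! j)) *
    (sg (m + length (del j ks)) w * wick e (map (%l. (l, 0)) hs @ rows (length (del j ks)) w) (del j ks @ cols w)) =
   (-1) ^ (m + n) * sg (m + 1 + n) w * ((-1) ^ (m + j) * cinner (hv l) (kv (ks ! j)) * ?minor j)" if "j < n" for j
  proof -
   \<comment> \<open>A contraction removes two letters, which leaves all later signs
     unchanged.\<close>
   have "Suc (Suc (m + length (del j ks))) = m + 1 + n" using that by (simp add: n_def)
   then have 1: "sg (m + length (del j ks)) w = sg (m + 1 + n) w" by (metis sg_parity)
   have 2: "length (del j ks) = n - 1" using that by (simp add: n_def)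
   have 3: "(-1 :: complex) ^ (n + j) = (-1) ^ (m + n) * (-1) ^ (m + j)"
    by (simp add: power_add mult_ac flip: power_mult_distrib)
   show ?thesis unfolding 1 unfolding 2 3 by (simp only: ac_simps)
  qed
  then have "(\<Sum>j<n. (-1) ^ (n + j) * cinner (hv l) (kv (ks ! j)) *
    (sg (m + length (del j ks)) w * wick e (map (%l. (l, 0)) hs @ rows (length (del j ks)) w) (del j ks @ cols w))) =
   (-1) ^ (m + n) * sg (m + 1 + n) w * (\<Sum>j<n. (-1) ^ (m + j) * cinner (hv l) (kv (ks ! j)) * ?minor j)"
   unfolding sum_distrib_left by (intro sum.cong) auto
  with L have "\<phi> (nmon (map hv hs) (map kv ks) * prod_list (map (op hv kv) (p # w))) =
   (-1) ^ (m + n) * sg (m + 1 + n) w * wick e (?R n) (ks @ cols w)"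
   unfolding diff by (simp add: algebra_simps)
  then show ?thesis using True by (simp add: p m_def n_def cols_def)
 qed
qed

end

lemma (in car_alg) wick_words:
 assumes "is_quasifree a K \<phi>"
 shows "\<phi> (prod_list (map (op hv kv) w)) = sg 0 w *
  wick (%f l l'. cinner (K (hv l)) (kv l') - (if f then cinner (hv l) (kv l') else 0)) (rows 0 w) (cols w)"
proof -
 have q: "is_state \<phi>" "!!hs ks. \<phi> (nmon hs ks) = qfdet K hs ks"
  using assms unfolding is_quasifree_iff by auto
 from wick_words_aux[of \<phi> K hv "[]" kv "[]" w, OF state_add[OF q(1)] state_scale[OF q(1)] q(2)]
 show ?thesis by (simp add: nmon_def)
qed


section \<open>The flow\<close>

text \<open>The algebra itself as a record: the universal property is applied with this algebra as
  the target.\<close>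

definition cstar_of :: "'a::cstar_algebra itself => 'a cstar" where
 "cstar_of _ = \<lparr>carrier = UNIV, monoid.mult = (*), one = 1, ring.zero = 0, add = (+),
  cs_scale = scaleC, cs_star = adj, cs_norm = norm\<rparr>"

lemma cstar_of_simps [simp]:
 "carrier (cstar_of T) = UNIV" "x \<otimes>\<^bsub>cstar_of T\<^esub> y = x * y" "x \<oplus>\<^bsub>cstar_of T\<^esub> y = x + y"
 "\<one>\<^bsub>cstar_of T\<^esub> = 1" "\<zero>\<^bsub>cstar_of T\<^esub> = 0" "cs_scale (cstar_of T) = scaleC"
 "cs_star (cstar_of T) = adj" "cs_norm (cstar_of T) = norm"
 by (simp_all add: cstar_of_def)

lemma cstar_structure_cstar_of: "cstar_structure (cstar_of TYPE('a::cstar_algebra))"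
proof -
 let ?B = "cstar_of TYPE('a)"
 have ab: "abelian_group ?B"
  by (rule abelian_groupI) (auto simp: add_ac intro: exI[of _ "- _"])
 interpret R: Ring.ring ?B
  by (rule ringI[OF ab]) (auto intro!: monoidI simp: mult.assoc algebra_simps)
 have neg: "\<ominus>\<^bsub>?B\<^esub> y = - y" for y
  by (rule R.minus_equality) auto
 have minus: "x \<ominus>\<^bsub>?B\<^esub> y = x - y" for x y
  by (simp add: a_minus_def neg)
 show ?thesis
 proof
  fix s :: "nat => 'a"
  assume "\<forall>e>0. \<exists>k. \<forall>m\<ge>k. \<forall>n\<ge>k. cs_norm ?B (s m \<ominus>\<^bsub>?B\<^esub> s n) < e"
  then have "Cauchy s" by (simp add: minus Cauchy_def dist_norm)
  then obtain l where "s \<longlonglongrightarrow> l" using Cauchy_convergent convergent_def by blast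
  then show "\<exists>l\<in>carrier ?B. (%n. cs_norm ?B (s n \<ominus>\<^bsub>?B\<^esub> l)) \<longlonglongrightarrow> 0"
   by (auto simp: minus LIM_zero_iff tendsto_norm_zero_iff)
 qed (auto simp: scaleC_add_right scaleC_add_left scaleC_scaleC scaleC_one scaleC_mult_left scaleC_mult_right
   adj_adj adj_add adj_scaleC adj_mult norm_triangle_ineq norm_scaleC norm_mult_ineq cstar_identity)
qed

locale universal_car =
 fixes a :: "'x::countable ell2 => 'a::cstar_algebra"
 assumes car_algebra: "is_car_algebra a"

sublocale universal_car \<subseteq> countable_car_alg a
 using car_algebra by unfold_locales (auto simp: is_car_algebra_def)

locale star_hom =
 fixes \<pi> :: "'a::cstar_algebra => 'a"
 assumes hom_add: "\<pi> (x + y) = \<pi> x + \<pi> y" and hom_scale: "\<pi> (z *\<^sub>C x) = z *\<^sub>C \<pi> x"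
  and hom_mult: "\<pi> (x * y) = \<pi> x * \<pi> y" and hom_adj: "\<pi> (adj x) = adj (\<pi> x)"
  and hom_one: "\<pi> 1 = 1"
begin

lemma hom_norm: "norm (\<pi> x) \<le> norm x"
 by (rule star_hom_contractive) (rule hom_add hom_scale hom_mult hom_adj hom_one)+

lemma hom_bounded_linear: "bounded_linear \<pi>"
proof (rule bounded_linear_intro[where K = 1])
 show "\<pi> (r *\<^sub>R x) = r *\<^sub>R \<pi> x" for r x
  using hom_scale[of "cor r" x] by (simp add: scaleC_of_real)
qed (simp_all add: hom_add hom_norm)

lemma hom_diff: "\<pi> (x - y) = \<pi> x - \<pi> y"
 by (rule linear_diff[OF bounded_linear.linear[OF hom_bounded_linear]])

end

context universal_car
begin

text \<open>The elements \<open>a (V h)\<close> satisfy the relations again, so universality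
  supplies the homomorphism.\<close>

lemma bogoliubov:
 assumes "!!h k. V (h + k) = V h + V k" "!!z h. V (z *\<^sub>C h) = z *\<^sub>C V h"
  "!!h k. cinner (V h) (V k) = cinner h k"
 obtains \<pi> where "star_hom \<pi>" "!!h. \<pi> (a h) = a (V h)"
proof -
 have "car_relations_in (cstar_of TYPE('a)) (%h. a (V h))"
  unfolding car_relations_in_def by (simp add: assms c_add c_scale a_anti c_a)
 then have "\<exists>\<pi>. star_hom_into (cstar_of TYPE('a)) \<pi> \<and> (\<forall>h. \<pi> (a h) = a (V h))"
  using car_algebra cstar_structure_cstar_of unfolding is_car_algebra_def by blast
 then obtain \<pi> where "star_hom_into (cstar_of TYPE('a)) \<pi>" "\<forall>h. \<pi> (a h) = a (V h)" by blast
 then show ?thesis by (intro that[of \<pi>]) (auto simp: star_hom_into_def star_hom_def)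
qed

lemma hom_unique:
 assumes \<pi>: "star_hom \<pi>" "star_hom \<pi>'" and "!!h. \<pi> (a h) = \<pi>' (a h)"
 shows "\<pi> = \<pi>'"
proof (rule functional_unique[where W = UNIV and f = scaleC])
 note h = star_hom.hom_mult[OF \<pi>(1)] star_hom.hom_mult[OF \<pi>(2)] star_hom.hom_one[OF \<pi>(1)]
  star_hom.hom_one[OF \<pi>(2)] star_hom.hom_adj[OF \<pi>(1)] star_hom.hom_adj[OF \<pi>(2)] assms(3)
 have "\<pi> (ann ks) = \<pi>' (ann ks)" for ks by (induction ks) (simp_all add: h)
 moreover have "\<pi> (cre hs) = \<pi>' (cre hs)" for hs by (induction hs) (simp_all add: cre_Cons h)
 ultimately show "\<pi> (nmon hs ks) = \<pi>' (nmon hs ks)" for hs ks by (simp add: nmon_def h)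
qed (use assms star_hom.hom_bounded_linear star_hom.hom_scale in auto)

lemma star_hom_comp: "star_hom \<pi> ==> star_hom \<pi>' ==> star_hom (%x. \<pi> (\<pi>' x) :: 'b::cstar_algebra)"
 by (simp add: star_hom_def)

lemma star_hom_id: "star_hom (%x. x :: 'b::cstar_algebra)"
 by (simp add: star_hom_def)

end

locale car_flow = universal_car a for a :: "'x::countable ell2 => 'a::cstar_algebra" +
 fixes G :: "'x ell2_op"
 assumes self_adjoint: "self_adjoint G"

sublocale car_flow \<subseteq> sp: pvm "spectral_measure G"
 by (rule pvm_spectral_measure[OF self_adjoint])

context car_flow
begin

abbreviation \<alpha> :: "real => 'a => 'a" where "\<alpha> \<equiv> quasifree_flow a G"

definition u :: "real => 'x ell2 => 'x ell2" where
 "u t = sp.T (%x. exp (\<i> * cor (t * x)))"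

lemma fun_calc_T: "fun_calc G f = sp.T f"
 by (simp add: fun_calc_def scalc_def fun_eq_iff)

lemma bborel_exp: "bborel (%x. exp (\<i> * cor (t * x)))"
 by (rule bborel_continuous[where B = 1]) (auto intro!: continuous_intros)

lemma u_add: "u t (h + k) = u t h + u t k" and u_scale: "u t (z *\<^sub>C h) = z *\<^sub>C u t h"
 unfolding u_def by (rule sp.T_add[OF bborel_exp] sp.T_scale[OF bborel_exp])+

lemma u_u: "u s (u t h) = u (s + t) h"
proof -
 have "(%x. exp (\<i> * cor (s * x)) * exp (\<i> * cor (t * x)))
   = (%x. exp (\<i> * cor ((s + t) * x)))"
  by (simp add: fun_eq_iff algebra_simps flip: exp_add)
 then show ?thesis
  using sp.T_mult[OF bborel_exp bborel_exp, of s t h] by (simp add: u_def)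
qed

lemma u_0: "u 0 h = h"
 by (simp add: u_def sp.T_one)

lemma u_cinner: "cinner (u t h) (u t k) = cinner h k"
proof -
 have "cinner (u t h) (u t k) = cinner h (u (- t) (u t k))"
  using sp.T_cnj[OF bborel_exp, of t] by (simp add: u_def exp_cnj)
 then show ?thesis by (simp add: u_u u_0)
qed

lemma flow: "star_hom (\<alpha> t)" "\<alpha> t (a h) = a (u t h)"
proof -
 have ex: "\<exists>\<pi>. star_hom \<pi> \<and> (\<forall>h. \<pi> (a h) = a (u t h))" for t
  by (rule bogoliubov[of "u t", OF u_add u_scale u_cinner]) blast
 obtain \<pi> where \<pi>: "star_hom \<pi>" "!!h. \<pi> (a h) = a (u t h)" using ex by blast
 obtain \<pi>' where \<pi>': "star_hom \<pi>'" "!!h. \<pi>' (a h) = a (u (- t) h)" using ex by blast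
 \<comment> \<open>The homomorphism for time \<open>- t\<close> is a two-sided inverse, by
   uniqueness on the generators.\<close>
 have "(%x. \<pi> (\<pi>' x)) = (%x. x)" "(%x. \<pi>' (\<pi> x)) = (%x. x)"
  by (rule hom_unique; simp add: star_hom_comp star_hom_id \<pi> \<pi>' u_u u_0)+
 then have "bij \<pi>" by (intro o_bij[of \<pi>']) (auto simp: fun_eq_iff)
 then have aut: "is_star_automorphism \<pi>"
  using \<pi>(1) by (auto simp: is_star_automorphism_def star_hom_def)
 \<comment> \<open>\<open>is_star_automorphism\<close> does not list preservation of 1 while
   \<open>star_hom\<close> does; surjectivity provides it.\<close>
 have one: "\<rho> 1 = 1" if "is_star_automorphism \<rho>" for \<rho> :: "'a => 'a"
 proof -
  have "surj \<rho>" and m: "\<rho> (1 * y) = \<rho> 1 * \<rho> y" for y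
   using that unfolding is_star_automorphism_def bij_def by blast+
  then obtain y where "\<rho> y = 1" by (metis surjD)
  then show ?thesis using m[of y] by simp
 qed
 have "\<alpha> t = \<pi>"
  unfolding quasifree_flow_def
 proof (rule the_equality)
  show "is_star_automorphism \<pi> \<and> (\<forall>h. \<pi> (a h) = a (fun_calc G (%x. exp (\<i> * cor (t * x))) h))"
   using aut \<pi>(2) by (simp add: fun_calc_T u_def)
  fix \<rho> assume \<rho>: "is_star_automorphism \<rho> \<and> (\<forall>h. \<rho> (a h) = a (fun_calc G (%x. exp (\<i> * cor (t * x))) h))"
  then have "star_hom \<rho>" using one[of \<rho>] by (auto simp: is_star_automorphism_def star_hom_def)
  then show "\<rho> = \<pi>" using \<pi> \<rho> by (intro hom_unique) (auto simp: fun_calc_T u_def)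
 qed
 then show "star_hom (\<alpha> t)" "\<alpha> t (a h) = a (u t h)" using \<pi> by auto
qed

lemmas flow_add = star_hom.hom_add[OF flow(1)] and flow_scale = star_hom.hom_scale[OF flow(1)]
 and flow_mult = star_hom.hom_mult[OF flow(1)] and flow_adj = star_hom.hom_adj[OF flow(1)]
 and flow_one = star_hom.hom_one[OF flow(1)] and flow_norm = star_hom.hom_norm[OF flow(1)]
 and flow_diff = star_hom.hom_diff[OF flow(1)]

lemma flow_flow: "\<alpha> s (\<alpha> t x) = \<alpha> (s + t) x"
proof -
 have "(%x. \<alpha> s (\<alpha> t x)) = \<alpha> (s + t)"
  by (rule hom_unique) (simp_all add: star_hom_comp flow u_u)
 then show ?thesis by (rule fun_cong)
qed

end

section \<open>Multilinear forms\<close>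

text \<open>The part of \<open>is_time_ordered_form\<close> that involves neither the state nor the
  flow, and is therefore stable under pointwise limits of forms.\<close>

definition mform :: "nat => ('a::complex_banach list => complex) => bool" where
 "mform n S \<longleftrightarrow> (\<forall>As. length As = n \<longrightarrow>
  (\<forall>i<n. \<forall>B C. S (As[i := B + C]) = S (As[i := B]) + S (As[i := C])) \<and>
  (\<forall>i<n. \<forall>z B. S (As[i := z *\<^sub>C B]) = z * S (As[i := B])) \<and>
  cmod (S As) \<le> prod_list (map norm As))"

lemma mformD:
 assumes "mform n S" "length As = n"
 shows "i < n ==> S (As[i := B + C]) = S (As[i := B]) + S (As[i := C])"
  "i < n ==> S (As[i := z *\<^sub>C B]) = z * S (As[i := B])"
  "cmod (S As) \<le> prod_list (map norm As)"
 using assms unfolding mform_def by blast+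

lemma mform_diff:
 assumes "mform n S" "length As = n" "i < n"
 shows "S (As[i := B - C]) = S (As[i := B]) - S (As[i := C])"
 using mformD(1)[OF assms, of B "(-1) *\<^sub>C C"] mformD(2)[OF assms, of "-1" C]
 by (simp add: scaleC_minus_one)

lemma tendsto_prod_list:
 fixes F :: "nat => 'b => 'a::real_normed_algebra_1"
 assumes "!!x. x \<in> set xs ==> (%k. F k x) \<longlonglongrightarrow> G x"
 shows "(%k. prod_list (map (F k) xs)) \<longlonglongrightarrow> prod_list (map G xs)"
 using assms by (induction xs) (auto intro!: tendsto_mult)

text \<open>Joint continuity, by exchanging one entry at a time:
  \<open>take m (B k) @ drop m A\<close> interpolates between the two arguments.\<close>

lemma mform_tendsto:
 fixes S :: "'a::complex_banach list => complex"
 assumes S: "mform n S" and len: "length A = n" "!!k. length (B k) = n"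
  and lim: "!!i. i < n ==> (%k. B k ! i) \<longlonglongrightarrow> A ! i"
 shows "(%k. S (B k)) \<longlonglongrightarrow> S A"
proof -
 have "(%k. S (take m (B k) @ drop m A)) \<longlonglongrightarrow> S A" if "m \<le> n" for m
  using that
 proof (induction m)
  case (Suc m)
  define L where "L k = take m (B k) @ drop m A" for k
  have L: "length (L k) = n" for k using Suc.prems len by (simp add: L_def)
  have up: "take (Suc m) (B k) @ drop (Suc m) A = (L k)[m := B k ! m]" "L k = (L k)[m := A ! m]" for k
   using Suc.prems len by (auto simp: L_def list_eq_iff_nth_eq nth_append nth_list_update min_def)
  have d: "S (take (Suc m) (B k) @ drop (Suc m) A) = S ((L k)[m := B k ! m - A ! m]) + S (L k)" for k
   using mform_diff[OF S L, of m k "B k ! m" "A ! m"] Suc.prems up[of k] by simp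
  have "(%k. prod_list (map norm ((L k)[m := B k ! m - A ! m]))) \<longlonglongrightarrow> 0"
  proof -
   have e: "prod_list (map norm ((L k)[m := B k ! m - A ! m])) =
    (\<Prod>i<n. if i = m then norm (B k ! m - A ! m) else if i < m then norm (B k ! i) else norm (A ! i))" for k
    unfolding prod.list_conv_set_nth using L[of k] Suc.prems len
    by (auto simp: nth_list_update L_def nth_append min_def lessThan_atLeast0 intro!: prod.cong)
   have "(%k. \<Prod>i<n. if i = m then norm (B k ! m - A ! m) else if i < m then norm (B k ! i) else norm (A ! i))
    \<longlonglongrightarrow> (\<Prod>i<n. if i = m then norm (A ! m - A ! m) else if i < m then norm (A ! i) else norm (A ! i))"
   proof (rule tendsto_prod)
    fix i assume i: "i \<in> {..<n}"
    then have l: "(%k. B k ! i) \<longlonglongrightarrow> A ! i" using lim by simp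
    have "(%k. B k ! i - A ! i) \<longlonglongrightarrow> A ! i - A ! i" "(%k. norm (B k ! i)) \<longlonglongrightarrow> norm (A ! i)"
     by (rule tendsto_diff[OF l tendsto_const] tendsto_norm[OF l])+
    then show "(%k. if i = m then norm (B k ! m - A ! m) else if i < m then norm (B k ! i) else norm (A ! i))
     \<longlonglongrightarrow> (if i = m then norm (A ! m - A ! m) else if i < m then norm (A ! i) else norm (A ! i))"
     using tendsto_norm by (cases "i = m"; cases "i < m") (auto dest: tendsto_norm)
   qed
   also have "(\<Prod>i<n. if i = m then norm (A ! m - A ! m) else if i < m then norm (A ! i) else norm (A ! i)) = 0"
    using Suc.prems by (intro prod_zero) auto
   finally show ?thesis unfolding e .
  qed
  then have "(%k. S ((L k)[m := B k ! m - A ! m])) \<longlonglongrightarrow> 0"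
   by (rule Lim_null_comparison[rotated]) (auto intro!: always_eventually mformD(3)[OF S] simp: L)
  from tendsto_add[OF this Suc.IH] Suc.prems show ?case unfolding d by (simp add: L_def)
 qed simp
 from this[of n] show ?thesis using len by simp
qed

text \<open>Density is used one entry at a time; \<open>m\<close> counts the leading entries already
  freed from \<open>Q\<close>.\<close>

lemma multi_induct:
 assumes Q: "closure (cspan Q) = UNIV"
  and base: "!!As. length As = n ==> set As \<subseteq> Q ==> P As"
  and sub: "!!As i. length As = n ==> i < n ==> csubspace {B. P (As[i := B])}"
  and cl: "!!As i. length As = n ==> i < n ==> closed {B. P (As[i := B])}"
  and len: "length As = n"
 shows "P As"
proof -
 have "P As" if "m \<le> n" "length As = n" "!!i. m \<le> i ==> i < n ==> As ! i \<in> Q" for m As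
  using that
 proof (induction m arbitrary: As)
  case 0
  then show ?case by (intro base) (auto simp: in_set_conv_nth)
 next
  case (Suc m)
  have "Q \<subseteq> {B. P (As[m := B])}"
   using Suc.prems by (auto intro!: Suc.IH simp: nth_list_update)
  then have "closure (cspan Q) \<subseteq> {B. P (As[m := B])}"
   using Suc.prems by (intro closure_minimal cl cspan_minimal sub) auto
  then have "As ! m \<in> {B. P (As[m := B])}" using Q by blast
  then show ?case by simp
 qed
 from this[of n As] show ?thesis using len by simp
qed


section \<open>Time-ordered forms on words\<close>

definition flat :: "(bool \<times> 'v) list list => real list => (bool \<times> 'v \<times> real) list" where
 "flat ws ts = concat (map2 (%w t. map (%(b, h). (b, h, t)) w) ws ts)"

definition wickval :: "(bool => 'v \<times> real => 'v \<times> real => complex) =>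
  (bool \<times> 'v) list list => real list => complex" where
 "wickval e ws ts = sg 0 (flat ws ts) * wick e (rows 0 (flat ws ts)) (cols (flat ws ts))"

lemma rows_set: "(l, r) \<in> set (rows q w) ==> q \<le> r \<and> l \<in> snd ` set w"
 by (induction q w rule: rows.induct) (auto split: if_splits)

lemma cols_set: "set (cols w) \<subseteq> snd ` set w"
 by (auto simp: cols_def)

text \<open>For sorted times the flag of an entry, which compares positions, also orders the two
  times. This is why only bounded kernels occur.\<close>

lemma rows_cols_order:
 assumes "sorted (map (%p. \<tau> (snd p)) w)" "i < length (rows q w)" "j < length (cols w)"
 shows "(q + j < snd (rows q w ! i) \<longrightarrow> \<tau> (cols w ! j) \<le> (\<tau> (fst (rows q w ! i)) :: real)) \<and>
  (snd (rows q w ! i) \<le> q + j \<longrightarrow> \<tau> (fst (rows q w ! i)) \<le> \<tau> (cols w ! j))"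
 using assms
proof (induction q w arbitrary: i j rule: rows.induct)
 case (2 q b l w)
 have le: "\<tau> l \<le> \<tau> l'" if "l' \<in> snd ` set w" for l' using 2(3) that by auto
 have s: "sorted (map (%p. \<tau> (snd p)) w)" using 2(3) by simp
 show ?case
 proof (cases b)
  case True
  have C: "cols ((b, l) # w) = cols w" using True by (simp add: cols_def)
  show ?thesis
  proof (cases i)
   case 0
   have "cols w ! j \<in> snd ` set w" using 2(5) cols_set[of w] C by (metis nth_mem subsetD)
   then show ?thesis using True 0 C le by simp
  next
   case (Suc i')
   then show ?thesis using 2(1)[OF True s, of i' j] 2(4,5) C True by simp
  qed
 next
  case False
  have C: "cols ((b, l) # w) = l # cols w" using False by (simp add: cols_def)
  have i: "i < length (rows (Suc q) w)" using 2(4) False by simp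
  then have "rows (Suc q) w ! i \<in> set (rows (Suc q) w)" by simp
  then have r: "Suc q \<le> snd (rows (Suc q) w ! i)" "fst (rows (Suc q) w ! i) \<in> snd ` set w"
   using rows_set by (metis prod.collapse)+
  show ?thesis
  proof (cases j)
   case 0
   then show ?thesis using r le False C by simp
  next
   case (Suc j')
   then show ?thesis using 2(2)[OF False s i, of j'] 2(5) C False by simp
  qed
 qed
qed simp

lemma flat_Cons: "flat (w # ws) (t # ts) = map (%(b, h). (b, h, t)) w @ flat ws ts"
 by (simp add: flat_def)

lemma flat_Nil: "flat [] ts = []"
 by (simp add: flat_def)

lemma flat_times: "length ws = length ts ==> p \<in> set (flat ws ts) ==> snd (snd p) \<in> set ts"
 by (induction ws ts rule: list_induct2) (auto simp: flat_Cons flat_Nil)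

lemma sorted_flat: "length ws = length ts ==> sorted ts ==> sorted (map (%p. snd (snd p)) (flat ws ts))"
 by (induction ws ts rule: list_induct2)
  (auto simp: flat_Cons flat_Nil sorted_append comp_def split_beta map_replicate_const dest: flat_times)

text \<open>Convergence of entries is required only for pairs of times that can occur: ordered as
  the flag says and at distance at most \<beta>.\<close>

lemma wickval_tendsto:
 assumes ts: "ordered_times \<beta> ts" and len: "length ws = length ts"
  and e: "!!f h t k s. (f ==> s \<le> t \<and> t - s \<le> \<beta>) ==> (\<not> f ==> t \<le> s \<and> s - t \<le> \<beta>) ==>
   (%N. e N f (h, t) (k, s)) \<longlonglongrightarrow> e' f (h, t) (k, s)"
 shows "(%N. wickval (e N) ws ts) \<longlonglongrightarrow> wickval e' ws ts"
proof -
 let ?w = "flat ws ts"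
 have s: "sorted (map (%p. snd (snd p)) ?w)"
  using sorted_flat[OF len] ts by (simp add: ordered_times_def)
 have "(%N. fdet (length (rows 0 ?w)) (%i j. e N (j < snd (rows 0 ?w ! i)) (fst (rows 0 ?w ! i)) (cols ?w ! j)))
  \<longlonglongrightarrow> fdet (length (rows 0 ?w)) (%i j. e' (j < snd (rows 0 ?w ! i)) (fst (rows 0 ?w ! i)) (cols ?w ! j))"
  if l: "length (rows 0 ?w) = length (cols ?w)"
 proof (rule tendsto_fdet)
  fix i j assume i: "i < length (rows 0 ?w)" and "j < length (rows 0 ?w)"
  then have j: "j < length (cols ?w)" using l by simp
  obtain h t where ht: "fst (rows 0 ?w ! i) = (h, t)" by fastforce
  obtain k s where ks: "cols ?w ! j = (k, s)" by fastforce
  have "rows 0 ?w ! i \<in> set (rows 0 ?w)" using i by simp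
  then have "fst (rows 0 ?w ! i) \<in> snd ` set ?w" using rows_set by (metis prod.collapse)
  then have t: "t \<in> set ts" using flat_times[OF len] ht by force
  have "cols ?w ! j \<in> snd ` set ?w" using cols_set[of ?w] j by (metis nth_mem subsetD)
  then have "s \<in> set ts" using flat_times[OF len] ks by force
  with t have "t \<in> {- \<beta> / 2 .. \<beta> / 2}" "s \<in> {- \<beta> / 2 .. \<beta> / 2}" using ts by (auto simp: ordered_times_def)
  then have "t - s \<le> \<beta>" "s - t \<le> \<beta>" by auto
  then show "(%N. e N (j < snd (rows 0 ?w ! i)) (fst (rows 0 ?w ! i)) (cols ?w ! j))
    \<longlonglongrightarrow> e' (j < snd (rows 0 ?w ! i)) (fst (rows 0 ?w ! i)) (cols ?w ! j)"
   using rows_cols_order[where \<tau> = snd, OF s i j] unfolding ht ks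
   by (intro e) (auto simp: not_less)
 qed
 then show ?thesis unfolding wickval_def wick_def by (auto intro!: tendsto_mult)
qed

text \<open>The two-point functions in both orders. With \<kappa> the Fermi function they are
  \<open>exp ((s - t) * x)\<close> times \<kappa> when the annihilator stands to the right of the
  creator, and times \<kappa> minus 1 when it stands to the left; a single exponential in the
  numerator makes the bound visible.\<close>

definition ker :: "real => bool => real => real => real => real" where
 "ker \<beta> f t s x = (if f then - (exp (- (t - s) * x) * inverse (1 + exp (- \<beta> * x)))
  else exp (- (\<beta> - s + t) * x) * inverse (1 + exp (- \<beta> * x)))"

definition entry :: "'x ell2_op => real => bool => 'x ell2 \<times> real => 'x ell2 \<times> real => complex" where
 "entry G \<beta> f l l' = cinner (fun_calc G (%x. cor (ker \<beta> f (snd l) (snd l') x)) (fst l)) (fst l')"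

text \<open>The exponent \<open>r\<close> lies between 0 and \<beta>, so
  \<open>exp (- r * x)\<close> is at most the larger of its values at the two ends, and the
  denominator dominates both.\<close>

lemma ker_bound:
 assumes "f ==> s \<le> t \<and> t - s \<le> \<beta>" "\<not> f ==> t \<le> s \<and> s - t \<le> \<beta>"
 shows "\<bar>ker \<beta> f t s x\<bar> \<le> 1"
proof -
 have b: "exp (- r * x) * inverse (1 + exp (- \<beta> * x)) \<le> 1" if "0 \<le> r" "r \<le> \<beta>" for r
 proof -
  have "exp (- r * x) \<le> max 1 (exp (- \<beta> * x))"
  proof (cases "x \<ge> 0")
   case True
   then have "exp (- r * x) \<le> 1" using that by simp
   then show ?thesis by (rule max.coboundedI1)
  next
   case False
   then have "- r * x \<le> - \<beta> * x" using that by (simp add: mult_right_mono_neg)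
   then show ?thesis by (metis exp_le_cancel_iff max.coboundedI2)
  qed
  also have "\<dots> \<le> 1 + exp (- \<beta> * x)" using exp_ge_zero[of "- \<beta> * x"] by linarith
  finally show ?thesis by (simp add: divide_inverse[symmetric] add_pos_pos)
 qed
 have p: "0 \<le> inverse (1 + exp (- \<beta> * x))" by (simp add: add_pos_pos less_imp_le)
 show ?thesis
 proof (cases f)
  case True
  then show ?thesis using b[of "t - s"] assms p by (simp add: ker_def abs_mult)
 next
  case False
  then show ?thesis using b[of "\<beta> - s + t"] assms p by (simp add: ker_def abs_mult)
 qed
qed

lemma continuous_ker: "continuous_on UNIV (ker \<beta> f t s)"
proof -
 have "1 + exp y \<noteq> (0 :: real)" for y using exp_gt_zero[of y] by linarith
 then show ?thesis unfolding ker_def by (cases f) (auto intro!: continuous_intros)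
qed

section \<open>The Gibbs state on analytic words\<close>

locale gibbs = car_flow +
 fixes \<beta> :: real
begin

abbreviation \<phi> :: "'b => complex" where "\<phi> \<equiv> gibbs_state a G \<beta>"

abbreviation (input) \<kappa> :: "real => complex" where
 "\<kappa> \<equiv> %x. cor (exp (- \<beta> * x) * inverse (1 + exp (- \<beta> * x)))"

lemma quasifree: "is_quasifree a (sp.T \<kappa>) \<phi>"
proof -
 have "\<exists>\<phi>. is_quasifree a (scalc (spectral_measure G) \<kappa>) \<phi>"
 proof (rule quasifree_exists)
  show "is_pvm (spectral_measure G)" by (rule sp.pvm_axioms[unfolded pvm_def])
  show "(%x. exp (- \<beta> * x) * inverse (1 + exp (- \<beta> * x))) \<in> borel_measurable borel" by measurable
  show "0 \<le> exp (- \<beta> * x) * inverse (1 + exp (- \<beta> * x))" for x :: real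
   by (simp add: add_pos_pos less_imp_le)
  show "exp (- \<beta> * x) * inverse (1 + exp (- \<beta> * x)) \<le> 1" for x :: real
   by (simp add: divide_inverse[symmetric] add_pos_pos)
 qed
 then show ?thesis
  by (auto simp: gibbs_state_def fermi_op_def fun_calc_T quasifree_state_eq)
qed

lemma state: "is_state \<phi>"
 using quasifree is_quasifree_iff by blast

lemmas state_lin = state_add[OF state] state_scale[OF state]

text \<open>The exponential of \<open>z\<close> times \<open>G\<close> on the spectral window from
  \<open>- m\<close> to \<open>m\<close>, where it is bounded for every complex
  \<open>z\<close>.\<close>

definition cut :: "nat => complex => 'a ell2 => 'a ell2" where
 "cut m z = sp.T (%x. exp (z * cor x) * indicator {- real m..real m} x)"

text \<open>Creators depend linearly and annihilators antilinearly on their vector. The conjugate in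
  the second family makes both kinds of letter holomorphic in \<open>z\<close>.\<close>

definition Fword :: "nat => (bool \<times> 'a ell2) list => complex => 'b" where
 "Fword m w z = prod_list (map (op (cut m (\<i> * z)) (cut m (\<i> * cnj z))) w)"

definition word :: "(bool \<times> 'a ell2) list => 'b" where
 "word w = prod_list (map (op (%h. h) (%h. h)) w)"

lemma entire_Fword: "entire_fun (Fword m w)"
proof (induction w)
 case Nil
 then show ?case by (simp add: Fword_def[abs_def] entire_fun_const)
next
 case (Cons p w)
 have c: "entire_fun (%z. c (cut m (\<i> * z) h))" for h
 proof -
  have "entire_fun (%z. cut m z h)" unfolding cut_def by (rule sp.entire_fun_exp)
  from entire_fun_bounded_linear[OF this bounded_linear_c c_scale]
  show ?thesis by (rule entire_fun_scale_arg) simp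
 qed
 have "entire_fun (%z. op (cut m (\<i> * z)) (cut m (\<i> * cnj z)) p)"
 proof (cases "fst p")
  case False
  then show ?thesis using entire_fun_adj[OF c] by (simp add: op_def adj_adj)
 qed (simp add: op_def c)
 from entire_fun_mult[OF this Cons] show ?case by (simp add: Fword_def[abs_def])
qed

lemma u_cut: "u s (cut m z h) = cut m (z + \<i> * cor s) h"
proof -
 have "(%x. exp (\<i> * cor (s * x)) * (exp (z * cor x) * indicator {- real m..real m} x))
   = (%x. exp ((z + \<i> * cor s) * cor x) * indicator {- real m..real m} x)"
  by (simp add: fun_eq_iff algebra_simps exp_add)
 then show ?thesis
  using sp.T_mult[OF bborel_exp bborel_exp_cut, of s z m h] by (simp add: u_def cut_def)
qed

lemma flow_Fword: "\<alpha> s (Fword m w z) = Fword m w (z + cor s)"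
 by (induction w)
  (auto simp: Fword_def flow_one flow_mult flow op_def flow_adj u_cut algebra_simps)

lemma extension_Fword: "entire_extension \<alpha> (Fword m w 0) (Fword m w)"
 unfolding entire_extension_def by (simp add: entire_Fword flow_Fword)

lemma state_Fwords:
 assumes "length ws = length ts"
 shows "\<phi> (prod_list (map2 (%F t. F (\<i> * cor t)) (map (Fword m) ws) ts)) =
  wickval (%f l l'. cinner (sp.T (%x. cor (ker \<beta> f (snd l) (snd l') x) * indicator {- real m..real m} x) (fst l)) (fst l')) ws ts"
proof -
 \<comment> \<open>At \<open>\<i> * t\<close> the creators carry the exponential of
   \<open>- t * G\<close> and the annihilators that of \<open>t * G\<close>. Moved to one side of
   the inner product, these factors combine with the Fermi function into \<open>ker\<close>.\<close>
 define hv kv where "hv = (%(h, t). cut m (- cor t) h)" and "kv = (%(h, t). cut m (cor t) h)"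
 have 1: "prod_list (map2 (%F t. F (\<i> * cor t)) (map (Fword m) ws) ts) = prod_list (map (op hv kv) (flat ws ts))"
  using assms
 proof (induction ws ts rule: list_induct2)
  case (Cons w ws t ts)
  have "Fword m w (\<i> * cor t) = prod_list (map (op hv kv) (map (%(b, h). (b, h, t)) w))"
   by (induction w) (auto simp: Fword_def op_def hv_def kv_def mult.assoc[symmetric])
  then show ?case using Cons by (simp add: flat_Cons)
 qed (simp add: flat_Nil)
 define i where "i = (indicator {- real m..real m} :: real => complex)"
 have \<kappa>: "bborel \<kappa>"
 proof (rule bborel_continuous[where B = 1])
  have "1 + exp y \<noteq> (0 :: real)" for y using exp_gt_zero[of y] by linarith
  then have "continuous_on UNIV (%x. exp (- \<beta> * x) * inverse (1 + exp (- \<beta> * x)))"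
   by (auto intro!: continuous_intros)
  then show "continuous_on UNIV \<kappa>" by (rule continuous_on_of_real)
  show "cmod (\<kappa> x) \<le> 1" for x
   by (simp add: norm_mult divide_inverse[symmetric] norm_divide del: of_real_mult of_real_inverse of_real_add)
    (simp add: add_pos_pos divide_inverse[symmetric])
 qed
 have "cinner (sp.T \<kappa> (hv l)) (kv l') - (if f then cinner (hv l) (kv l') else 0) =
  cinner (sp.T (%x. cor (ker \<beta> f (snd l) (snd l') x) * i x) (fst l)) (fst l')" for f l l'
 proof -
  obtain h t where l: "l = (h, t)" by fastforce
  obtain k s where l': "l' = (k, s)" by fastforce
  let ?e = "%r x. exp (cor r * cor x) * i x"
  have eb: "bborel (?e r)" for r unfolding i_def by (rule bborel_exp_cut)
  have cn: "(%x. cnj (?e s x)) = ?e s" by (simp add: fun_eq_iff i_def exp_cnj indicator_def)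
  have move: "cinner v (kv l') = cinner (sp.T (?e s) v) k" for v
   unfolding sp.T_cnj[OF eb] cn by (simp add: kv_def l' cut_def i_def)
  have h: "hv l = sp.T (?e (- t)) h" by (simp add: hv_def l cut_def i_def)
  have "cinner (sp.T \<kappa> (hv l)) (kv l') = cinner (sp.T (%x. ?e s x * (\<kappa> x * ?e (- t) x)) h) k"
   unfolding move h
   by (simp only: sp.T_mult[OF eb bborel_mult[OF \<kappa> eb]] sp.T_mult[OF \<kappa> eb])
  moreover have "cinner (hv l) (kv l') = cinner (sp.T (%x. ?e s x * ?e (- t) x) h) k"
   unfolding move h by (simp only: sp.T_mult[OF eb eb])
  moreover have "(%x. ?e s x * (\<kappa> x * ?e (- t) x)) = (%x. cor (ker \<beta> False t s x) * i x)"
  proof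
   fix x
   have "exp (s * x) * (exp (- \<beta> * x) * exp (- t * x)) = exp (- (\<beta> - s + t) * x)"
    by (simp add: algebra_simps flip: exp_add)
   from arg_cong[OF this, of cor]
   show "?e s x * (\<kappa> x * ?e (- t) x) = cor (ker \<beta> False t s x) * i x"
    by (simp add: ker_def i_def indicator_def exp_of_real[symmetric] mult_ac)
  qed
  moreover have "sp.T (%x. ?e s x * (\<kappa> x * ?e (- t) x)) h - sp.T (%x. ?e s x * ?e (- t) x) h
   = sp.T (%x. cor (ker \<beta> True t s x) * i x) h"
  proof -
   have "?e s x * (\<kappa> x * ?e (- t) x) - ?e s x * ?e (- t) x = cor (ker \<beta> True t s x) * i x" for x
   proof -
    have "exp (s * x) * exp (- t * x) = exp (- (t - s) * x)"
     by (simp add: algebra_simps flip: exp_add)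
    moreover have "exp (- \<beta> * x) * inverse (1 + exp (- \<beta> * x)) - 1 = - inverse (1 + exp (- \<beta> * x))"
    proof -
     have "y * inverse (1 + y) - 1 = - inverse (1 + y)" if "y > 0" for y :: real
      using that by (simp add: field_simps)
     then show ?thesis by simp
    qed
    ultimately have "exp (s * x) * ((exp (- \<beta> * x) * inverse (1 + exp (- \<beta> * x)) - 1) * exp (- t * x))
     = ker \<beta> True t s x" by (simp add: ker_def)
    from arg_cong[OF this, of cor]
    show ?thesis by (simp add: i_def indicator_def exp_of_real[symmetric] algebra_simps)
   qed
   then show ?thesis
    by (simp only: sp.T_diff_fun[OF bborel_mult[OF eb bborel_mult[OF \<kappa> eb]] bborel_mult[OF eb eb], symmetric])
  qed
  then have "cinner (sp.T (%x. ?e s x * (\<kappa> x * ?e (- t) x)) h) k - cinner (sp.T (%x. ?e s x * ?e (- t) x) h) k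
   = cinner (sp.T (%x. cor (ker \<beta> True t s x) * i x) h) k"
   by (metis cinner.diff_left)
  ultimately show ?thesis by (auto simp: l l')
 qed
 then show ?thesis
  unfolding 1 wick_words[OF quasifree] wickval_def i_def by simp
qed

lemma Fword_tendsto: "(%m. Fword m w 0) \<longlonglongrightarrow> word w"
 unfolding Fword_def word_def
proof (rule tendsto_prod_list)
 fix p
 have "(%m. cut m 0 h) \<longlonglongrightarrow> sp.T (%_. 1) h" for h
  unfolding cut_def
 proof (rule sp.T_strong_limit[where B = 1])
  fix x
  have "\<forall>\<^sub>F m in sequentially. exp (0 * cor x) * indicator {- real m..real m} x = (1 :: complex)"
   using eventually_ge_at_top[of "nat \<lceil>\<bar>x\<bar>\<rceil>"] by eventually_elim (auto simp: indicator_def)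
  then show "(%m. exp (0 * cor x) * indicator {- real m..real m} x) \<longlonglongrightarrow> (1 :: complex)"
   by (rule tendsto_eventually)
  show "cmod (exp (0 * cor x) * indicator {- real m..real m} x) \<le> 1" for m x
   by (simp add: indicator_def)
 qed (rule bborel_exp_cut bborel_const)+
 then have "(%m. cut m 0 h) \<longlonglongrightarrow> h" for h by (simp add: sp.T_one)
 then show "(%m. op (cut m (\<i> * 0)) (cut m (\<i> * cnj 0)) p) \<longlonglongrightarrow> op (%h. h) (%h. h) p"
  by (auto simp: op_def intro!: tendsto_c tendsto_a)
qed

abbreviation cut_entry :: "nat => bool => 'a ell2 \<times> real => 'a ell2 \<times> real => complex" where
 "cut_entry m f l l' \<equiv> cinner (sp.T (%x. cor (ker \<beta> f (snd l) (snd l') x) * indicator {- real m..real m} x) (fst l)) (fst l')"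

lemma cut_entry_tendsto:
 assumes ts: "ordered_times \<beta> ts" and len: "length ws = length ts"
 shows "(%m. wickval (cut_entry m) ws ts) \<longlonglongrightarrow> wickval (entry G \<beta>) ws ts"
proof (rule wickval_tendsto[OF ts len])
 fix f h t k s assume fts: "f ==> s \<le> t \<and> t - s \<le> \<beta>" "\<not> f ==> t \<le> s \<and> s - t \<le> \<beta>"
 have kb: "bborel (%x. cor (ker \<beta> f t s x))"
  using ker_bound[of f, OF fts]
  by (intro bborel_continuous[where B = 1] continuous_intros continuous_ker) auto
 have ib: "bborel (indicator {- real m..real m})" for m by (rule bborel_indicator) simp
 have "(%m. sp.T (%x. cor (ker \<beta> f t s x) * indicator {- real m..real m} x) h)
  \<longlonglongrightarrow> sp.T (%x. cor (ker \<beta> f t s x)) h"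
 proof (rule sp.T_strong_limit[where B = 1, OF _ _ _ kb])
  fix x
  have "\<forall>\<^sub>F m in sequentially. cor (ker \<beta> f t s x) * indicator {- real m..real m} x = cor (ker \<beta> f t s x)"
   using eventually_ge_at_top[of "nat \<lceil>\<bar>x\<bar>\<rceil>"] by eventually_elim (auto simp: indicator_def)
  then show "(%m. cor (ker \<beta> f t s x) * indicator {- real m..real m} x) \<longlonglongrightarrow> cor (ker \<beta> f t s x)"
   by (rule tendsto_eventually)
  show "cmod (cor (ker \<beta> f t s x) * indicator {- real m..real m} x) \<le> 1" for m x
   using ker_bound[of f, OF fts] by (simp add: indicator_def)
 qed (rule bborel_mult[OF kb ib])
 then show "(%m. cut_entry m f (h, t) (k, s)) \<longlonglongrightarrow> entry G \<beta> f (h, t) (k, s)"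
  by (simp add: entry_def fun_calc_T cinner.tendsto)
qed

text \<open>A word need not be entire analytic, but its spectrally cut version is, and it tends to
  the word in norm. Both sides are continuous along this approximation.\<close>

lemma form_words:
 assumes S: "is_time_ordered_form \<phi> \<alpha> ts S" and ts: "ordered_times \<beta> ts" and len: "length ws = length ts"
 shows "S (map word ws) = wickval (entry G \<beta>) ws ts"
proof (rule LIMSEQ_unique)
 have "S (map (%w. Fword m w 0) ws) = \<phi> (prod_list (map2 (%F t. F (\<i> * cor t)) (map (Fword m) ws) ts))" for m
  using S len unfolding is_time_ordered_form_def by (simp add: extension_Fword)
 then show "(%m. S (map (%w. Fword m w 0) ws)) \<longlonglongrightarrow> wickval (entry G \<beta>) ws ts"
  using cut_entry_tendsto[OF ts len] by (simp add: state_Fwords len)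
 show "(%m. S (map (%w. Fword m w 0) ws)) \<longlonglongrightarrow> S (map word ws)"
  by (rule mform_tendsto[where n = "length ts"])
   (use S len Fword_tendsto in \<open>auto simp: is_time_ordered_form_def mform_def\<close>)
qed

end

section \<open>Time-ordered forms are determined by their values on words\<close>

text \<open>On the upper line only mutual closeness of the \<open>f k\<close> is known. It gives a
  Cauchy condition in the strip, and below the upper line the limit must be \<open>g\<close>, since
  smallness on the real line propagates into the interior. Letting \<open>v\<close> rise to
  \<open>y\<close> identifies the limit on the upper line as well.\<close>

lemma strip_limit_pos:
 fixes f :: "nat => complex => complex" and e :: "nat => real"
 assumes hol: "!!k. f k holomorphic_on UNIV" "g holomorphic_on UNIV" and y: "y > 0"
  and bd: "!!k Y. \<exists>C. \<forall>z. \<bar>Im z\<bar> \<le> Y \<longrightarrow> cmod (f k z) \<le> C" "!!Y. \<exists>C. \<forall>z. \<bar>Im z\<bar> \<le> Y \<longrightarrow> cmod (g z) \<le> C"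
  and e: "e \<longlonglongrightarrow> 0"
  and low: "!!k s. cmod (f k (Complex s 0) - g (Complex s 0)) \<le> e k"
  and up: "!!k l s. cmod (f k (Complex s y) - f l (Complex s y)) \<le> e k + e l"
 shows "(%k. f k (Complex 0 y)) \<longlonglongrightarrow> g (Complex 0 y)"
proof -
 have e0: "0 \<le> e k" for k using low[of k 0] norm_ge_zero order_trans by blast
 have bdiff: "\<exists>C. \<forall>z. 0 \<le> Im z \<and> Im z \<le> y \<longrightarrow> cmod (F z - F' z) \<le> C"
  if b: "\<exists>C. \<forall>z. \<bar>Im z\<bar> \<le> y \<longrightarrow> cmod (F z) \<le> C" "\<exists>C. \<forall>z. \<bar>Im z\<bar> \<le> y \<longrightarrow> cmod (F' z) \<le> C" for F F' :: "complex => complex"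
 proof -
  obtain C where C: "\<forall>z. \<bar>Im z\<bar> \<le> y \<longrightarrow> cmod (F z) \<le> C" using b(1) by blast
  obtain C' where C': "\<forall>z. \<bar>Im z\<bar> \<le> y \<longrightarrow> cmod (F' z) \<le> C'" using b(2) by blast
  have "cmod (F z - F' z) \<le> C + C'" if "0 \<le> Im z" "Im z \<le> y" for z
   using norm_triangle_ineq4[of "F z" "F' z"] C C' that by (smt (verit) abs_of_nonneg)
  then show ?thesis by blast
 qed
 have A: "cmod (f k (Complex 0 v) - f l (Complex 0 v)) \<le> e k + e l" if v: "0 \<le> v" "v \<le> y" for k l v
 proof -
  obtain C where C: "!!z. 0 \<le> Im z ==> Im z \<le> y ==> cmod (f k z - f l z) \<le> C"
   using bdiff[OF bd(1) bd(1)] by metis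
  show ?thesis
  proof (rule strip_maximum[where f = "%z. f k z - f l z" and l = 0 and u = y and C = C])
   show "cmod (f k (Complex s 0) - f l (Complex s 0)) \<le> e k + e l" for s
    using norm_triangle_ineq4[of "f k (Complex s 0) - g (Complex s 0)" "f l (Complex s 0) - g (Complex s 0)"]
     low[of k s] low[of l s] by simp
  qed (use v C up in \<open>auto intro!: holomorphic_intros hol\<close>)
 qed
 have B: "(%k. f k (Complex 0 v)) \<longlonglongrightarrow> g (Complex 0 v)" if v: "0 \<le> v" "v < y" for v
 proof -
  obtain E where E: "!!k. e k \<le> E"
   using convergent_imp_bounded[OF e] unfolding bounded_iff by (metis abs_le_D1 rangeI real_norm_def)
  obtain C0 where C0: "!!z. 0 \<le> Im z ==> Im z \<le> y ==> cmod (f 0 z - g z) \<le> C0"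
   using bdiff[OF bd(1) bd(2)] by metis
  \<comment> \<open>A bound for \<open>f k - g\<close> on the upper line that does not depend on
    \<open>k\<close>, obtained by passing through \<open>f 0\<close>.\<close>
  define M where "M = C0 + E + E"
  have M: "cmod (f k (Complex s y) - g (Complex s y)) \<le> M" for k s
   using norm_triangle_ineq[of "f k (Complex s y) - f 0 (Complex s y)" "f 0 (Complex s y) - g (Complex s y)"]
    up[of k s 0] C0[of "Complex s y"] y E[of k] E[of 0] by (simp add: M_def)
  have M0: "0 \<le> M" using M[of 0 0] norm_ge_zero order_trans by blast
  \<comment> \<open>The exponential factor is the device of the three lines theorem: a large
    \<open>L\<close> suppresses the uncontrolled upper line, and for fixed \<open>L\<close> the
    contribution of the lower line tends to 0 in \<open>k\<close>.\<close>
  have bound: "cmod (f k (Complex 0 v) - g (Complex 0 v)) \<le> exp (L * v) * e k + M * exp (- L * (y - v))" if L: "L \<ge> 0" for L k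
  proof -
   obtain C where C: "!!z. 0 \<le> Im z ==> Im z \<le> y ==> cmod (f k z - g z) \<le> C"
    using bdiff[OF bd(1) bd(2)] by metis
   have "cmod (f k 0 - g 0) \<le> C" using C[of 0] y by simp
   then have C': "0 \<le> C" using norm_ge_zero[of "f k 0 - g 0"] by linarith
   let ?h = "%z. (f k z - g z) * exp (\<i> * cor L * z)"
   have h: "cmod (?h z) = cmod (f k z - g z) * exp (- L * Im z)" for z
    by (simp add: norm_mult norm_exp_eq_Re)
   have "cmod (?h (Complex 0 v)) \<le> e k + M * exp (- L * y)"
   proof (rule strip_maximum[where f = ?h and l = 0 and u = y and C = C])
    fix z assume z: "0 \<le> Im z" "Im z \<le> y"
    have "exp (- L * Im z) \<le> 1" using z L by simp
    from mult_mono[OF C[OF z] this C'] show "cmod (?h z) \<le> C" unfolding h by simp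
   next
    fix s
    show "cmod (?h (Complex s 0)) \<le> e k + M * exp (- L * y)"
     unfolding h using low[of k s] M0 by (simp add: add_increasing2)
    have "cmod (?h (Complex s y)) \<le> M * exp (- L * y)"
     unfolding h using M[of k s] by (simp add: mult_right_mono)
    then show "cmod (?h (Complex s y)) \<le> e k + M * exp (- L * y)" using e0[of k] by linarith
   qed (use v in \<open>auto intro!: holomorphic_intros hol\<close>)
   then have "exp (L * v) * (cmod (f k (Complex 0 v) - g (Complex 0 v)) * exp (- L * v)) \<le> exp (L * v) * (e k + M * exp (- L * y))"
    unfolding h by (intro mult_left_mono) auto
   also have "\<dots> = exp (L * v) * e k + M * (exp (L * v) * exp (- L * y))"
    unfolding distrib_left mult.left_commute[of M] ..
   also have "exp (L * v) * exp (- L * y) = exp (- L * (y - v))" by (simp add: algebra_simps flip: exp_add)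
   also have "exp (L * v) * (cmod (f k (Complex 0 v) - g (Complex 0 v)) * exp (- L * v)) = cmod (f k (Complex 0 v) - g (Complex 0 v))"
    unfolding mult.left_commute[of _ "cmod _"] by (simp flip: exp_add)
   finally show ?thesis .
  qed
  show ?thesis
  proof (rule LIMSEQ_I)
   fix r :: real assume r: "r > 0"
   have "((%L. M * exp (- L * (y - v))) \<longlongrightarrow> 0) at_top" using v by real_asymp
   then have "\<forall>\<^sub>F L in at_top. M * exp (- L * (y - v)) < r / 2" by (rule order_tendstoD(2)) (use r in simp)
   with eventually_ge_at_top[of 0] have "\<forall>\<^sub>F L in at_top. L \<ge> 0 \<and> M * exp (- L * (y - v)) < r / 2"
    by eventually_elim simp
   then obtain L where L: "L \<ge> 0" "M * exp (- L * (y - v)) < r / 2"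
    using eventually_happens'[OF trivial_limit_at_top_linorder] by blast
   have "(%k. exp (L * v) * e k) \<longlonglongrightarrow> exp (L * v) * 0" by (intro tendsto_intros e)
   then have "\<forall>\<^sub>F k in sequentially. exp (L * v) * e k < r / 2" by (rule order_tendstoD(2)) (use r in simp)
   then obtain k0 where "!!k. k \<ge> k0 ==> exp (L * v) * e k < r / 2" by (auto simp: eventually_sequentially)
   then show "\<exists>k0. \<forall>k\<ge>k0. norm (f k (Complex 0 v) - g (Complex 0 v)) < r"
    by (intro exI[of _ k0] allI impI) (use bound[OF L(1)] L(2) in \<open>fastforce intro: le_less_trans\<close>)
  qed
 qed
 have lim: "((%v. F (Complex 0 v)) \<longlongrightarrow> F (Complex 0 y)) (at_left y)"
  if "F holomorphic_on UNIV" for F :: "complex => complex"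
 proof -
  have "continuous_on UNIV F" by (rule holomorphic_on_imp_continuous_on[OF that])
  then have "isCont F (Complex 0 y)" by (simp add: continuous_on_eq_continuous_at)
  then show ?thesis
   by (rule isCont_tendsto_compose) (intro tendsto_intros)
 qed
 \<comment> \<open>First \<open>l\<close> tends to infinity at a height \<open>v\<close> below
   \<open>y\<close>, then \<open>v\<close> tends to \<open>y\<close>; in this order the bound
   \<open>e k\<close> survives.\<close>
 have "cmod (f k (Complex 0 y) - g (Complex 0 y)) \<le> e k" for k
 proof (rule tendsto_upperbound)
  show "((%v. cmod (f k (Complex 0 v) - g (Complex 0 v))) \<longlongrightarrow> cmod (f k (Complex 0 y) - g (Complex 0 y))) (at_left y)"
   by (intro tendsto_intros lim hol)
  have "cmod (f k (Complex 0 v) - g (Complex 0 v)) \<le> e k" if v: "0 < v" "v < y" for v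
  proof (rule tendsto_le[OF sequentially_bot])
   show "(%l. e k + e l) \<longlonglongrightarrow> e k" using tendsto_add[OF tendsto_const e] by simp
   show "(%l. cmod (f k (Complex 0 v) - f l (Complex 0 v))) \<longlonglongrightarrow> cmod (f k (Complex 0 v) - g (Complex 0 v))"
    by (intro tendsto_intros B) (use v in auto)
   show "\<forall>\<^sub>F l in sequentially. cmod (f k (Complex 0 v) - f l (Complex 0 v)) \<le> e k + e l"
    using A[of v k] v by auto
  qed
  then show "\<forall>\<^sub>F v in at_left y. cmod (f k (Complex 0 v) - g (Complex 0 v)) \<le> e k"
   using y unfolding eventually_at_left_field by blast
 qed simp
 then have "(%k. f k (Complex 0 y) - g (Complex 0 y)) \<longlonglongrightarrow> 0"
  by (intro Lim_null_comparison[OF _ e] always_eventually) simp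
 then show ?thesis by (simp add: LIM_zero_iff)
qed

text \<open>Times of either sign occur; a negative height is reflected at the origin.\<close>

lemma strip_limit:
 fixes f :: "nat => complex => complex" and e :: "nat => real"
 assumes hol: "!!k. f k holomorphic_on UNIV" "g holomorphic_on UNIV"
  and bd: "!!k Y. \<exists>C. \<forall>z. \<bar>Im z\<bar> \<le> Y \<longrightarrow> cmod (f k z) \<le> C" "!!Y. \<exists>C. \<forall>z. \<bar>Im z\<bar> \<le> Y \<longrightarrow> cmod (g z) \<le> C"
  and e: "e \<longlonglongrightarrow> 0"
  and low: "!!k s. cmod (f k (Complex s 0) - g (Complex s 0)) \<le> e k"
  and up: "!!k l s. cmod (f k (Complex s y) - f l (Complex s y)) \<le> e k + e l"
 shows "(%k. f k (Complex 0 y)) \<longlonglongrightarrow> g (Complex 0 y)"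
proof -
 consider "y > 0" | "y = 0" | "y < 0" by linarith
 then show ?thesis
 proof cases
  case 1 then show ?thesis by (rule strip_limit_pos[OF hol _ bd e low up])
 next
  case 2
  have "(%k. f k (Complex 0 0) - g (Complex 0 0)) \<longlonglongrightarrow> 0"
   using low[of _ 0] by (intro Lim_null_comparison[OF _ e] always_eventually) simp
  then show ?thesis using 2 by (simp add: LIM_zero_iff)
 next
  case 3
  have n: "- Complex s v = Complex (- s) (- v)" for s v by (simp add: complex_eq_iff)
  have h: "(%z. F (- z)) holomorphic_on UNIV" if "F holomorphic_on UNIV" for F :: "complex => complex"
   using holomorphic_on_compose[OF holomorphic_on_minus[OF holomorphic_on_ident] holomorphic_on_subset[OF that subset_UNIV]]
   by (simp add: comp_def)
  have b: "\<exists>C. \<forall>z. \<bar>Im z\<bar> \<le> Y \<longrightarrow> cmod (F (- z)) \<le> C" if "\<exists>C. \<forall>z. \<bar>Im z\<bar> \<le> Y \<longrightarrow> cmod (F z) \<le> C" for F :: "complex => complex" and Y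
   using that by (metis abs_minus_cancel uminus_complex.sel(2))
  have "(%k. f k (- Complex 0 (- y))) \<longlonglongrightarrow> g (- Complex 0 (- y))"
  proof (rule strip_limit_pos[where f = "%k z. f k (- z)" and g = "%z. g (- z)" and e = e])
   show "cmod (f k (- Complex s 0) - g (- Complex s 0)) \<le> e k" for k s
    unfolding n using low[of k "- s"] by simp
   show "cmod (f k (- Complex s (- y)) - f l (- Complex s (- y))) \<le> e k + e l" for k l s
    unfolding n using up[of k "- s" l] by simp
  qed (use 3 in \<open>auto intro: h hol e b bd\<close>)
  then show ?thesis by (simp add: n)
 qed
qed

lemma prod_list_update_norm:
 assumes "i < length As"
 shows "prod_list (map norm (As[i := B])) = prod_list (map norm (As[i := 1])) * norm (B :: 'a::real_normed_algebra_1)"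
 using assms
proof (induction As arbitrary: i)
 case (Cons A As)
 then show ?case by (cases i) (auto simp: mult.assoc mult.commute)
qed simp

lemma map2_update_split:
 assumes "length Fs = length ts" "m < length ts"
 shows "prod_list (map2 g (Fs[m := F]) ts) = prod_list (map2 g (take m Fs) (take m ts)) * g F (ts ! m) *
  (prod_list (map2 g (drop (Suc m) Fs) (drop (Suc m) ts)) :: 'a::monoid_mult)"
proof -
 have "ts = take m ts @ ts ! m # drop (Suc m) ts" by (rule id_take_nth_drop[OF assms(2)])
 then have "map2 g (Fs[m := F]) ts = map2 g (take m Fs @ F # drop (Suc m) Fs) (take m ts @ ts ! m # drop (Suc m) ts)"
  using assms by (simp add: upd_conv_take_nth_drop)
 also have "\<dots> = map2 g (take m Fs) (take m ts) @ g F (ts ! m) # map2 g (drop (Suc m) Fs) (drop (Suc m) ts)"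
  using assms by (subst zip_append) auto
 finally show ?thesis by (simp add: mult.assoc)
qed

lemma norm_mult3: "norm (x * y * z) \<le> norm x * norm y * norm (z :: 'a::real_normed_algebra)"
 by (rule order_trans[OF norm_mult_ineq mult_right_mono[OF norm_mult_ineq norm_ge_zero]])

context car_alg
begin

lemma word_dense: "closure (cspan {prod_list (map (op (%h. h) (%h. h)) w) |w. True}) = UNIV"
proof -
 have "prod_list (map c hs) = prod_list (map (op (%h. h) (%h. h)) (map (Pair True) hs))"
  "prod_list (map a ks) = prod_list (map (op (%h. h) (%h. h)) (map (Pair False) ks))" for hs ks
  by (simp_all add: op_def comp_def)
 then have "nmon hs ks = prod_list (map (op (%h. h) (%h. h)) (map (Pair True) (rev hs) @ map (Pair False) ks))" for hs ks
  by (simp add: nmon_def cre_def ann_def rev_map)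
 then have "calg UNIV \<subseteq> cspan {prod_list (map (op (%h. h) (%h. h)) w) |w. True}"
  unfolding calg_def by (intro cspan_minimal csubspace_cspan) (blast intro: cspan_base)
 from closure_mono[OF this] show ?thesis using calg_dense[of UNIV] by auto
qed

end

context gibbs
begin

lemma flow_0: "\<alpha> 0 x = x"
proof -
 have "\<alpha> 0 = (%x. x)" by (rule hom_unique) (simp_all add: flow star_hom_id u_0)
 then show ?thesis by simp
qed

definition entire_flow :: "(complex => 'b) => bool" where
 "entire_flow F \<longleftrightarrow> entire_fun F \<and> (\<forall>t. F (cor t) = \<alpha> t (F 0))"

lemma entire_flow_iff: "entire_extension \<alpha> A F \<longleftrightarrow> entire_flow F \<and> F 0 = A"
 unfolding entire_extension_def entire_flow_def using flow_0 by (metis of_real_0)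

lemma entire_flow_shift: "entire_flow F ==> entire_flow (%z. F (z + cor s))"
 unfolding entire_flow_def by (auto simp: entire_fun_shift flow_flow add.commute simp flip: of_real_add)

lemma entire_flow_add: "entire_flow F ==> entire_flow F' ==> entire_flow (%z. F z + F' z)"
 unfolding entire_flow_def by (auto simp: entire_fun_add flow_add)

lemma bounded_linear_scaleC: "bounded_linear (%x :: 'b. r *\<^sub>C x)"
 by (rule scaleC.bounded_linear_right)

lemma entire_flow_scale: "entire_flow F ==> entire_flow (%z. r *\<^sub>C F z)"
 unfolding entire_flow_def
 by (auto simp: flow_scale scaleC_scaleC mult.commute intro!: entire_fun_bounded_linear[OF _ bounded_linear_scaleC])

lemma entire_flow_Fword: "entire_flow (Fword m w)"
 unfolding entire_flow_def by (simp add: entire_Fword flow_Fword)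

text \<open>By the identity theorem \<open>F (z + s)\<close> and \<open>\<alpha> s (F z)\<close>
  have the same expectations. The flow is contractive, so a bound over a compact segment of the
  imaginary axis holds on the whole strip, as \<open>strip_maximum\<close> requires.\<close>

lemma entire_flow_sandwich:
 assumes "entire_flow F"
 shows "(%z. \<phi> (X * F z * Y)) holomorphic_on UNIV"
  "\<exists>C. \<forall>z. \<bar>Im z\<bar> \<le> R \<longrightarrow> cmod (\<phi> (X * F z * Y)) \<le> C"
proof -
 have hol: "(%z. \<phi> (X * F z * Y)) holomorphic_on UNIV" if "entire_fun F" for F
 proof -
  have "entire_fun (%z. X * F z * Y)" by (intro entire_fun_mult that entire_fun_const)
  from entire_fun_holomorphic[OF this state_bounded_linear[OF state] state_lin(2)] show ?thesis .
 qed
 then show "(%z. \<phi> (X * F z * Y)) holomorphic_on UNIV" using assms by (simp add: entire_flow_def)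
 have ent: "entire_fun F" using assms by (simp add: entire_flow_def)
 have shift: "\<phi> (X * F (z + cor s) * Y) = \<phi> (X * \<alpha> s (F z) * Y)" for z s
 proof (rule entire_eq_on_reals[of _ _ z])
  show "(%z. \<phi> (X * F (z + cor s) * Y)) holomorphic_on UNIV"
   by (intro hol entire_fun_shift ent)
  show "(%z. \<phi> (X * \<alpha> s (F z) * Y)) holomorphic_on UNIV"
   using entire_fun_bounded_linear[OF ent star_hom.hom_bounded_linear[OF flow(1)] flow_scale] by (rule hol)
  show "\<phi> (X * F (cor t + cor s) * Y) = \<phi> (X * \<alpha> s (F (cor t)) * Y)" for t
   using assms unfolding entire_flow_def by (metis add.commute flow_flow of_real_add)
 qed
 have "compact ((%v. F (Complex 0 v)) ` {-R..R})"
 proof (rule compact_continuous_image)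
  have "isCont F z" for z using ent by (rule entire_fun_continuous)
  moreover have "((%v. Complex 0 v) \<longlongrightarrow> Complex 0 v) (at v within {-R..R})" for v
   by (intro tendsto_intros)
  ultimately show "continuous_on {-R..R} (%v. F (Complex 0 v))"
   unfolding continuous_on_def using isCont_tendsto_compose by blast
 qed simp
 from compact_imp_bounded[OF this]
 obtain C where "\<forall>x\<in>(%v. F (Complex 0 v)) ` {-R..R}. norm x \<le> C" unfolding bounded_iff by blast
 then have C: "norm (F (Complex 0 v)) \<le> C" if "v \<in> {-R..R}" for v using that by blast
 have "cmod (\<phi> (X * F z * Y)) \<le> norm X * C * norm Y" if "\<bar>Im z\<bar> \<le> R" for z
 proof -
  have z: "z = Complex 0 (Im z) + cor (Re z)" by (simp add: complex_eq_iff)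
  have "\<phi> (X * F z * Y) = \<phi> (X * \<alpha> (Re z) (F (Complex 0 (Im z))) * Y)"
   by (subst z) (rule shift)
  also have "cmod \<dots> \<le> norm (X * \<alpha> (Re z) (F (Complex 0 (Im z))) * Y)" by (rule state_bound[OF state])
  also have "\<dots> \<le> norm X * norm (\<alpha> (Re z) (F (Complex 0 (Im z)))) * norm Y"
   by (rule norm_mult3)
  also have "\<dots> \<le> norm X * C * norm Y"
  proof (intro mult_right_mono mult_left_mono norm_ge_zero)
   show "norm (\<alpha> (Re z) (F (Complex 0 (Im z)))) \<le> C"
    by (rule order_trans[OF flow_norm C]) (use that in auto)
  qed
  finally show ?thesis .
 qed
 then show "\<exists>C. \<forall>z. \<bar>Im z\<bar> \<le> R \<longrightarrow> cmod (\<phi> (X * F z * Y)) \<le> C" by blast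
qed

text \<open>
 Replacing one entry at a time, an arbitrary entire analytic element is approximated by
 combinations of words. This gives convergence on the real axis and, since \<open>S\<close> is bounded, a
 uniform Cauchy condition on the line \<open>Im z = t\<^sub>m\<close>, so that the maximum principle in the strip
 between the two lines applies.
\<close>

lemma form_from_words:
 assumes S: "mform (length ts) S" and ts: "ordered_times \<beta> ts"
  and words: "!!ws. length ws = length ts ==> S (map word ws) = wickval (entry G \<beta>) ws ts"
 shows "is_time_ordered_form \<phi> \<alpha> ts S"
proof -
 define n where "n = length ts"
 define ev where "ev Fs = \<phi> (prod_list (map2 (%F t. F (\<i> * cor t)) Fs ts))" for Fs :: "(complex => 'b) list"
 define V where "V Fs \<longleftrightarrow> S (map (%F. F 0) Fs) = ev Fs" for Fs
 \<comment> \<open>Cut words at all real time shifts: the estimate on the upper line needs every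
   real translate of an approximant, so the family is made invariant under translation.\<close>
 define FQ where "FQ p z = Fword (fst p) (fst (snd p)) (z + cor (snd (snd p)))"
  for p :: "nat \<times> (bool \<times> 'a ell2) list \<times> real" and z
 define Q where "Q = range FQ"
 have Qflow: "entire_flow F" if "F \<in> Q" for F
  using that entire_flow_shift[OF entire_flow_Fword] by (auto simp: Q_def FQ_def[abs_def])
 have Qshift: "(%z. F (z + cor s)) \<in> Q" if "F \<in> Q" for F s
 proof -
  from that obtain m w r where "F = FQ (m, w, r)" by (auto simp: Q_def)
  then have "(%z. F (z + cor s)) = FQ (m, w, s + r)" by (simp add: FQ_def fun_eq_iff add.assoc)
  then show ?thesis by (simp add: Q_def)
 qed
 have Qdense: "closure (cspan {F 0 |F. F \<in> Q}) = UNIV"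
 proof -
  have "{prod_list (map (op (%h. h) (%h. h)) w) |w. True} \<subseteq> closure (cspan {F 0 |F. F \<in> Q})"
  proof clarify
   fix w
   have "FQ (m, w, 0) 0 = Fword m w 0" for m by (simp add: FQ_def)
   then have "Fword m w 0 \<in> cspan {F 0 |F. F \<in> Q}" for m by (metis (mono_tags, lifting) Q_def cspan_base mem_Collect_eq rangeI)
   then show "prod_list (map (op (%h. h) (%h. h)) w) \<in> closure (cspan {F 0 |F. F \<in> Q})"
    using Fword_tendsto[of w] unfolding word_def closure_sequential
    by (intro exI[of _ "%m. Fword m w 0"] conjI allI) auto
  qed
  then have "closure (cspan {prod_list (map (op (%h. h) (%h. h)) w) |w. True}) \<subseteq> closure (cspan {F 0 |F. F \<in> Q})"
   by (intro closure_minimal cspan_minimal csubspace_closure csubspace_cspan) auto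
  then show ?thesis using word_dense by auto
 qed
 have base: "V Fs" if "length Fs = n" "set Fs \<subseteq> Q" for Fs
 proof -
  obtain ps where ps: "Fs = map FQ ps" using \<open>set Fs \<subseteq> Q\<close> unfolding Q_def by (metis subset_code(1) ex_map_conv rangeE)
  define w' where "w' p = map (%(b, h). (b, cut (fst p) (\<i> * cor (snd (snd p))) h)) (fst (snd p))"
   for p :: "nat \<times> (bool \<times> 'a ell2) list \<times> real"
  \<comment> \<open>Different entries come with different cutoffs. A smaller window absorbs a larger
    one, so all entries can be written with one common cutoff \<open>M\<close>, which may then tend
    to infinity.\<close>
  have cutcut: "cut M z (cut m z' h) = cut m (z + z') h" if "m \<le> M" for m M z z' h
  proof -
   have "(%x. exp (z * cor x) * indicator {- real M..real M} x * (exp (z' * cor x) * indicator {- real m..real m} x))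
    = (%x. exp ((z + z') * cor x) * indicator {- real m..real m} x)"
    using that by (auto simp: fun_eq_iff indicator_def algebra_simps exp_add)
   then show ?thesis
    using sp.T_mult[OF bborel_exp_cut bborel_exp_cut, of z M z' m h] by (simp add: cut_def)
  qed
  have FQ: "FQ p z = Fword M (w' p) z" if "fst p \<le> M" for p M z
  proof -
   have "op (cut (fst p) (\<i> * (z + cor s))) (cut (fst p) (\<i> * cnj (z + cor s))) (b, h) =
    op (cut M (\<i> * z)) (cut M (\<i> * cnj z)) (b, cut (fst p) (\<i> * cor s) h)" for b h s
    using that by (simp add: op_def cutcut algebra_simps)
   then show ?thesis by (auto simp: FQ_def Fword_def w'_def comp_def split_beta intro!: arg_cong[of _ _ prod_list])
  qed
  have FQ0: "FQ p 0 = word (w' p)" for p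
   by (auto simp: FQ_def Fword_def w'_def word_def op_def intro!: arg_cong[of _ _ prod_list])
  have len: "length (map w' ps) = length ts" using that ps by (simp add: n_def)
  obtain M0 where M0: "!!p. p \<in> set ps ==> fst p \<le> M0"
   using finite_nat_set_iff_bounded_le[of "fst ` set ps"] by auto
  have "ev Fs = wickval (cut_entry M) (map w' ps) ts" if "M \<ge> M0" for M
  proof -
   have "FQ p = Fword M (w' p)" if "p \<in> set ps" for p
    using FQ[of p M] M0[OF that] \<open>M0 \<le> M\<close> by (auto simp: fun_eq_iff)
   then have "Fs = map (Fword M) (map w' ps)" unfolding ps by simp
   then show ?thesis using state_Fwords[OF len, of M] by (simp add: ev_def)
  qed
  then have "\<forall>\<^sub>F M in sequentially. wickval (cut_entry M) (map w' ps) ts = ev Fs"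
   unfolding eventually_sequentially by (intro exI[of _ M0]) simp
  then have "wickval (entry G \<beta>) (map w' ps) ts = ev Fs"
   by (intro LIMSEQ_unique[OF cut_entry_tendsto[OF ts len]] tendsto_eventually)
  then show ?thesis using words[OF len] by (simp add: V_def ps FQ0 comp_def)
 qed
 \<comment> \<open>\<open>m\<close> is the number of leading entries that are arbitrary; the others
   still belong to \<open>Q\<close>.\<close>
 have "V Fs" if "m \<le> n" "length Fs = n" "!!i. i < n ==> entire_flow (Fs ! i)" "!!i. m \<le> i ==> i < n ==> Fs ! i \<in> Q" for m Fs
  using that
 proof (induction m arbitrary: Fs)
  case 0
  then show ?case by (intro base) (auto simp: in_set_conv_nth)
 next
  case (Suc m)
  then have m: "m < n" "m < length Fs" "length Fs = length ts" "m < length ts" by (auto simp: n_def)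
  define F where "F = Fs ! m"
  have F: "entire_flow F" using Suc.prems m by (simp add: F_def)
  define X Y where "X = prod_list (map2 (%F t. F (\<i> * cor t)) (take m Fs) (take m ts))"
   and "Y = prod_list (map2 (%F t. F (\<i> * cor t)) (drop (Suc m) Fs) (drop (Suc m) ts))"
  define As where "As = map (%F. F 0) Fs"
  have As: "length As = length ts" "m < length ts" using m by (simp_all add: As_def)
  have ev: "ev (Fs[m := H]) = \<phi> (X * H (\<i> * cor (ts ! m)) * Y)" for H
   unfolding ev_def X_def Y_def using m by (subst map2_update_split) auto
  have V: "V (Fs[m := H]) \<longleftrightarrow> S (As[m := H 0]) = \<phi> (X * H (\<i> * cor (ts ! m)) * Y)" for H
   unfolding V_def ev by (simp add: As_def map_update)
  define P where "P = prod_list (map norm (As[m := 1]))"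
  have P: "cmod (S (As[m := B]) - S (As[m := C])) \<le> P * norm (B - C)" for B C
   using mformD(3)[OF S, of "As[m := B - C]"] As
   by (simp add: mform_diff[OF S As] prod_list_update_norm[of m As "B - C"] P_def)
  \<comment> \<open>The replacements for entry \<open>m\<close> that are admissible together with
    all their real translates. Their values at 0 form a subspace, dense because it contains those
    coming from \<open>Q\<close>.\<close>
  define N where "N = {H. entire_flow H \<and> (\<forall>s. V (Fs[m := (%z. H (z + cor s))]))}"
  have N0: "{F 0 |F. F \<in> Q} \<subseteq> {H 0 |H. H \<in> N}"
  proof -
   have "F' \<in> N" if "F' \<in> Q" for F'
   proof -
    have "V (Fs[m := F''])" if F'': "F'' \<in> Q" for F''
    proof (rule Suc.IH)
     show "entire_flow (Fs[m := F''] ! i)" if "i < n" for i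
      using Suc.prems(3)[OF that] Qflow[OF F''] m by (cases "i = m") auto
     show "Fs[m := F''] ! i \<in> Q" if "m \<le> i" "i < n" for i
      using Suc.prems(4)[of i] F'' m that by (cases "i = m") auto
    qed (use m Suc.prems in auto)
    then show ?thesis using that Qflow Qshift by (simp add: N_def)
   qed
   then show ?thesis by blast
  qed
  have "csubspace {H 0 |H. H \<in> N}"
  proof (unfold csubspace_def, safe)
   have "(%_. 0) \<in> N"
    using mformD(2)[OF S As, of 0 0] by (simp add: N_def V entire_flow_def entire_fun_const flow_scale[of _ 0 0, simplified] state_lin(2)[of 0 0, simplified])
   then show "\<exists>H. 0 = H 0 \<and> H \<in> N" by (intro exI[of _ "%_. 0"]) simp
   fix H H' assume H: "H \<in> N" "H' \<in> N"
   then have "(%z. H z + H' z) \<in> N"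
    by (simp add: N_def V entire_flow_add mformD(1)[OF S As] distrib_left distrib_right state_lin)
   then show "\<exists>H''. H 0 + H' 0 = H'' 0 \<and> H'' \<in> N" by (intro exI[of _ "%z. H z + H' z"]) simp
   fix r
   have "(%z. r *\<^sub>C H z) \<in> N" using H(1)
    by (simp add: N_def V entire_flow_scale mformD(2)[OF S As] scaleC_mult_left scaleC_mult_right state_lin)
   then show "\<exists>H'. r *\<^sub>C H 0 = H' 0 \<and> H' \<in> N" by (intro exI[of _ "%z. r *\<^sub>C H z"]) simp
  qed
  then have "closure {H 0 |H. H \<in> N} = UNIV"
   using closure_mono[OF cspan_minimal[OF N0]] Qdense by blast
  then have "F 0 \<in> closure {H 0 |H. H \<in> N}" by simp
  then obtain A where A: "\<forall>k. A k \<in> {H 0 |H. H \<in> N}" "A \<longlonglongrightarrow> F 0"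
   unfolding closure_sequential by blast
  have "\<forall>k. \<exists>H. H \<in> N \<and> H 0 = A k"
  proof
   fix k
   have "A k \<in> {H 0 |H. H \<in> N}" using A(1) ..
   then show "\<exists>H. H \<in> N \<and> H 0 = A k"
    by (elim CollectE exE conjE) (rule exI, rule conjI, assumption, rule sym)
  qed
  from choice[OF this] obtain H where "\<forall>k. H k \<in> N \<and> H k 0 = A k" ..
  then have H: "H k \<in> N" "H k 0 = A k" for k by simp_all
  define D where "D k = norm (A k - F 0)" for k
  have D: "D \<longlonglongrightarrow> 0" unfolding D_def using A(2) by (simp add: LIM_zero_iff tendsto_norm_zero_iff)
  have P0: "P \<ge> 0" unfolding P_def by (rule prod_list_nonneg) auto
  \<comment> \<open>On the upper line the expectation of an approximant is a value of
    \<open>S\<close>, so the bound of \<open>S\<close> applies there.\<close>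
  have val: "\<phi> (X * H k (\<i> * cor (ts ! m) + cor s) * Y) = S (As[m := \<alpha> s (A k)])" for k s
  proof -
   have "entire_flow (H k)" "S (As[m := H k (cor s)])
     = \<phi> (X * H k (\<i> * cor (ts ! m) + cor s) * Y)"
    using H(1)[of k] unfolding N_def V by simp_all
   moreover have "H k (cor s) = \<alpha> s (A k)"
    using calculation(1) unfolding entire_flow_def H(2) by blast
   ultimately show ?thesis by simp
  qed
  have "(%k. \<phi> (X * H k (Complex 0 (ts ! m)) * Y)) \<longlonglongrightarrow> \<phi> (X * F (Complex 0 (ts ! m)) * Y)"
  proof (rule strip_limit[where f = "%k z. \<phi> (X * H k z * Y)" and g = "%z. \<phi> (X * F z * Y)"
     and e = "%k. (norm X * norm Y + P) * D k"])
   have Hf: "entire_flow (H k)" for k using H(1)[of k] by (simp add: N_def)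
   show "(%z. \<phi> (X * H k z * Y)) holomorphic_on UNIV" "(%z. \<phi> (X * F z * Y)) holomorphic_on UNIV"
    "\<exists>C. \<forall>z. \<bar>Im z\<bar> \<le> R \<longrightarrow> cmod (\<phi> (X * H k z * Y)) \<le> C"
    "\<exists>C. \<forall>z. \<bar>Im z\<bar> \<le> R \<longrightarrow> cmod (\<phi> (X * F z * Y)) \<le> C" for k R
    by (intro entire_flow_sandwich Hf F)+
   show "(%k. (norm X * norm Y + P) * D k) \<longlonglongrightarrow> 0"
    using tendsto_mult[OF tendsto_const D] by simp
   show "cmod (\<phi> (X * H k (Complex s 0) * Y) - \<phi> (X * F (Complex s 0) * Y)) \<le> (norm X * norm Y + P) * D k" for k s
   proof -
    have "Complex s 0 = cor s" by (simp add: complex_eq_iff)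
    then have "H k (Complex s 0) - F (Complex s 0) = \<alpha> s (A k - F 0)"
     using Hf[of k] F H(2)[of k] by (simp add: entire_flow_def flow_diff)
    then have "\<phi> (X * H k (Complex s 0) * Y) - \<phi> (X * F (Complex s 0) * Y) = \<phi> (X * \<alpha> s (A k - F 0) * Y)"
     by (metis linear_diff[OF bounded_linear.linear[OF state_bounded_linear[OF state]]] left_diff_distrib right_diff_distrib)
    also have "cmod \<dots> \<le> norm (X * \<alpha> s (A k - F 0) * Y)" by (rule state_bound[OF state])
    also have "\<dots> \<le> norm X * norm (\<alpha> s (A k - F 0)) * norm Y"
     by (rule norm_mult3)
    also have "\<dots> \<le> norm X * D k * norm Y"
     unfolding D_def by (intro mult_right_mono mult_left_mono flow_norm norm_ge_zero)
    also have "\<dots> \<le> (norm X * norm Y + P) * D k"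
     using mult_nonneg_nonneg[OF P0, of "D k"] by (simp add: algebra_simps D_def)
    finally show ?thesis .
   qed
   show "cmod (\<phi> (X * H k (Complex s (ts ! m)) * Y) - \<phi> (X * H l (Complex s (ts ! m)) * Y))
     \<le> (norm X * norm Y + P) * D k + (norm X * norm Y + P) * D l" for k l s
   proof -
    have z: "Complex s (ts ! m) = \<i> * cor (ts ! m) + cor s" by (simp add: complex_eq_iff)
    have "cmod (\<phi> (X * H k (Complex s (ts ! m)) * Y) - \<phi> (X * H l (Complex s (ts ! m)) * Y))
     \<le> P * norm (\<alpha> s (A k) - \<alpha> s (A l))" unfolding z val by (rule P)
    also have "\<dots> \<le> P * (D k + D l)"
    proof (intro mult_left_mono P0)
     have "norm (\<alpha> s (A k) - \<alpha> s (A l)) \<le> norm (A k - A l)"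
      using flow_norm[of s "A k - A l"] by (simp add: flow_diff)
     also have "\<dots> \<le> D k + D l"
      using norm_triangle_ineq4[of "A k - F 0" "A l - F 0"] by (simp add: D_def)
     finally show "norm (\<alpha> s (A k) - \<alpha> s (A l)) \<le> D k + D l" .
    qed
    also have "\<dots> \<le> (norm X * norm Y + P) * (D k + D l)"
     by (intro mult_right_mono) (auto simp: D_def)
    finally show ?thesis by (simp add: distrib_left)
   qed
  qed
  moreover have "\<phi> (X * H k (Complex 0 (ts ! m)) * Y) = S (As[m := A k])" for k
   using val[of k 0] by (simp add: flow_0 complex_eq_iff[of "Complex 0 _"] Complex_eq)
  moreover have "(%k. S (As[m := A k])) \<longlonglongrightarrow> S (As[m := F 0])"
  proof (rule LIM_zero_cancel, rule Lim_null_comparison)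
   show "(%k. P * D k) \<longlonglongrightarrow> 0" using tendsto_mult[OF tendsto_const D] by simp
   show "\<forall>\<^sub>F k in sequentially. norm (S (As[m := A k]) - S (As[m := F 0])) \<le> P * D k"
    using P by (simp add: D_def)
  qed
  ultimately have "S (As[m := F 0]) = \<phi> (X * F (Complex 0 (ts ! m)) * Y)"
   using LIMSEQ_unique by auto
  then have "V (Fs[m := F])" by (simp add: V Complex_eq)
  then show ?case by (simp add: F_def)
 qed
 from this[of n] have V: "V Fs" if "length Fs = n" "!!i. i < n ==> entire_flow (Fs ! i)" for Fs
  using that by simp
 show ?thesis
  unfolding is_time_ordered_form_def
 proof (intro allI impI conjI)
  fix As Fs assume len: "length As = length ts"
   and Fs: "length Fs = length ts \<and> (\<forall>i<length ts. entire_extension \<alpha> (As ! i) (Fs ! i))"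
  then have "map (%F. F 0) Fs = As" by (auto simp: list_eq_iff_nth_eq entire_flow_iff)
  then show "S As = \<phi> (prod_list (map2 (%F t. F (\<i> * cor t)) Fs ts))"
   using V[of Fs] Fs by (auto simp: V_def ev_def n_def entire_flow_iff)
 qed (use mformD[OF S] in auto)
qed

lemma form_unique:
 assumes S: "is_time_ordered_form \<phi> \<alpha> ts S" "is_time_ordered_form \<phi> \<alpha> ts S'"
  and ts: "ordered_times \<beta> ts" and len: "length As = length ts"
 shows "S As = S' As"
proof -
 have mf: "mform (length ts) S" "mform (length ts) S'"
  using S unfolding is_time_ordered_form_def mform_def by blast+
 show ?thesis
 proof (rule multi_induct[OF word_dense _ _ _ len])
  fix As :: "'b list" assume "length As = length ts" "set As \<subseteq> {prod_list (map (op (%h. h) (%h. h)) w) |w. True}"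
  then have "\<forall>A\<in>set As. \<exists>w. A = word w" by (auto simp: word_def)
  then obtain ws where "As = map word ws" using ex_map_conv[of As word] by blast
  then show "S As = S' As"
   using form_words[OF S(1) ts, of ws] form_words[OF S(2) ts, of ws] \<open>length As = length ts\<close> by simp
 next
  fix As :: "'b list" and i assume As: "length As = length ts" "i < length ts"
  show "csubspace {B. S (As[i := B]) = S' (As[i := B])}"
   using mformD(1,2)[OF mf(1) As] mformD(1,2)[OF mf(2) As] mformD(2)[OF mf(1) As, of 0 0] mformD(2)[OF mf(2) As, of 0 0]
   by (simp add: csubspace_def)
  show "closed {B. S (As[i := B]) = S' (As[i := B])}"
   unfolding closed_sequential_limits
  proof safe
   fix B l assume B: "\<forall>k. B k \<in> {B. S (As[i := B]) = S' (As[i := B])}" "B \<longlonglongrightarrow> l"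
   have "(%k. T (As[i := B k])) \<longlonglongrightarrow> T (As[i := l])" if "mform (length ts) T" for T :: "'b list => complex"
    by (rule mform_tendsto[OF that]) (use As B(2) in \<open>auto simp: nth_list_update\<close>)
   from this[OF mf(1)] this[OF mf(2)] B(1) show "S (As[i := l]) = S' (As[i := l])"
    using LIMSEQ_unique by fastforce
  qed
 qed
qed

end

section \<open>Convergence of the time-ordered forms\<close>

text \<open>Existence of the form of \<open>H\<close> is among the conclusions: the limit itself is
  the witness for the choice made in \<open>time_ordered_form\<close>.\<close>

lemma (in universal_car) form_limit:
 assumes sa: "self_adjoint H" "!!N. self_adjoint (HN N)" and conv: "strong_resolvent_conv HN H"
  and ts: "ordered_times \<beta> ts"
  and S: "!!N. is_time_ordered_form (gibbs_state a (HN N) \<beta>) (quasifree_flow a (HN N)) ts (S N)"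
 shows "is_time_ordered_form (gibbs_state a H \<beta>) (quasifree_flow a H) ts
   (time_ordered_form (gibbs_state a H \<beta>) (quasifree_flow a H) ts)"
  and "!!As. length As = length ts ==> (%N. S N As) \<longlonglongrightarrow>
   time_ordered_form (gibbs_state a H \<beta>) (quasifree_flow a H) ts As"
proof -
 interpret g: gibbs a H \<beta> by unfold_locales (rule sa)
 have gN: "gibbs a (HN N)" for N by unfold_locales (rule sa)
 have mf: "mform (length ts) (S N)" for N
  using S[of N] unfolding is_time_ordered_form_def mform_def by blast
 have words: "(%N. S N (map g.word ws)) \<longlonglongrightarrow> wickval (entry H \<beta>) ws ts" if len: "length ws = length ts" for ws
 proof -
  have "S N (map g.word ws) = wickval (entry (HN N) \<beta>) ws ts" for N
   by (rule gibbs.form_words[OF gN S ts len])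
  moreover have "(%N. wickval (entry (HN N) \<beta>) ws ts) \<longlonglongrightarrow> wickval (entry H \<beta>) ws ts"
  proof (rule wickval_tendsto[OF ts len])
   fix f h t k s assume "f ==> s \<le> t \<and> t - s \<le> \<beta>" "\<not> f ==> t \<le> s \<and> s - t \<le> \<beta>"
   then have "(%N. fun_calc (HN N) (%x. cor (ker \<beta> f t s x)) h) \<longlonglongrightarrow> fun_calc H (%x. cor (ker \<beta> f t s x)) h"
    using ker_bound[of f s t \<beta>]
    by (intro strong_resolvent_fun_calc[where B = 1] sa conv continuous_on_of_real continuous_ker) simp
   then show "(%N. entry (HN N) \<beta> f (h, t) (k, s)) \<longlonglongrightarrow> entry H \<beta> f (h, t) (k, s)"
    by (simp add: entry_def cinner.tendsto)
  qed
  ultimately show ?thesis by simp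
 qed
 have cv: "convergent (%N. S N As)" if len: "length As = length ts" for As
 proof (rule multi_induct[OF word_dense _ _ _ len])
  fix As :: "'a list" assume As: "length As = length ts" "set As \<subseteq> {prod_list (map (op (%h. h) (%h. h)) w) |w. True}"
  then have "\<forall>A\<in>set As. \<exists>w. A = g.word w" by (auto simp: g.word_def)
  then obtain ws where "As = map g.word ws" using ex_map_conv[of As g.word] by blast
  then show "convergent (%N. S N As)" using words[of ws] As by (auto simp: convergent_def)
 next
  fix As :: "'a list" and i assume As: "length As = length ts" "i < length ts"
  note add = mformD(1)[OF mf As] and scale = mformD(2)[OF mf As]
  have "(%N. S N (As[i := 0])) = (%_. 0)" using scale[of _ 0 0] by simp
  then show "csubspace {B. convergent (%N. S N (As[i := B]))}"
   by (auto simp: csubspace_def add scale convergent_const intro: convergent_add convergent_mult)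
  define P where "P = prod_list (map norm (As[i := 1]))"
  have P: "cmod (S N (As[i := B]) - S N (As[i := C])) \<le> P * norm (B - C)" for B C N
   using mformD(3)[OF mf, of "As[i := B - C]"] As
   by (simp add: mform_diff[OF mf As] prod_list_update_norm[of i As "B - C"] P_def)
  \<comment> \<open>The estimate with \<open>P\<close> does not depend on \<open>N\<close>, so
    convergence survives norm limits of the argument.\<close>
  show "closed {B. convergent (%N. S N (As[i := B]))}"
   unfolding closed_sequential_limits
  proof safe
   fix B l assume B: "\<forall>k. B k \<in> {B. convergent (%N. S N (As[i := B]))}" "B \<longlonglongrightarrow> l"
   show "convergent (%N. S N (As[i := l]))"
   proof (rule Cauchy_convergent, rule CauchyI)
    fix e :: real assume e: "e > 0"
    have "(%k. P * norm (B k - l)) \<longlonglongrightarrow> P * norm (l - l)" by (intro tendsto_intros B(2))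
    then have "\<forall>\<^sub>F k in sequentially. P * norm (B k - l) < e / 3" by (rule order_tendstoD(2)) (use e in simp)
    then obtain k where k: "P * norm (B k - l) < e / 3" unfolding eventually_sequentially by blast
    have "Cauchy (%N. S N (As[i := B k]))" using B(1) by (auto intro: convergent_Cauchy)
    then obtain M where M: "!!m n. m \<ge> M ==> n \<ge> M ==> norm (S m (As[i := B k]) - S n (As[i := B k])) < e / 3"
     using CauchyD[of _ "e / 3"] e by (metis divide_pos_pos zero_less_numeral)
    have "norm (S m (As[i := l]) - S n (As[i := l])) < e" if mn: "m \<ge> M" "n \<ge> M" for m n
    proof -
     let ?d = "%N. S N (As[i := B k]) - S N (As[i := l])"
     have d: "norm (?d N) < e / 3" for N using P[of N "B k" l] k by linarith
     have "S m (As[i := l]) - S n (As[i := l]) = (S m (As[i := B k]) - S n (As[i := B k])) - ?d m + ?d n" by simp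
     also have "norm \<dots> \<le> norm (S m (As[i := B k]) - S n (As[i := B k])) + norm (?d m) + norm (?d n)"
      by (intro order_trans[OF norm_triangle_ineq] add_mono norm_triangle_ineq4 order_refl)
     also have "\<dots> < e" using M[OF mn] d[of m] d[of n] by linarith
     finally show ?thesis .
    qed
    then show "\<exists>M. \<forall>m\<ge>M. \<forall>n\<ge>M. norm (S m (As[i := l]) - S n (As[i := l])) < e" by blast
   qed
  qed
 qed
 define L where "L As = lim (%N. S N As)" for As
 have L: "(%N. S N As) \<longlonglongrightarrow> L As" if "length As = length ts" for As
  using cv[OF that] by (simp add: L_def convergent_LIMSEQ_iff)
 have "mform (length ts) L"
  unfolding mform_def
 proof (intro allI impI conjI)
  fix As :: "'a list" assume As: "length As = length ts"
  show "cmod (L As) \<le> prod_list (map norm As)"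
   by (rule tendsto_upperbound[OF tendsto_norm[OF L[OF As]]]) (use mformD(3)[OF mf As] in auto)
  fix i B assume i: "i < length ts"
  have lu: "(%N. S N (As[i := C])) \<longlonglongrightarrow> L (As[i := C])" for C
   by (rule L) (simp add: As)
  show "L (As[i := B + C]) = L (As[i := B]) + L (As[i := C])" for C
   using LIMSEQ_unique[OF lu[of "B + C"]] tendsto_add[OF lu lu, of B C] by (simp add: mformD(1)[OF mf As i])
  show "L (As[i := z *\<^sub>C B]) = z * L (As[i := B])" for z
   using LIMSEQ_unique[OF lu[of "z *\<^sub>C B"]] tendsto_mult[OF tendsto_const lu, of z B] by (simp add: mformD(2)[OF mf As i])
 qed
 moreover have "L (map g.word ws) = wickval (entry H \<beta>) ws ts" if "length ws = length ts" for ws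
  using words[OF that] L[of "map g.word ws"] that LIMSEQ_unique by auto
 ultimately have form: "is_time_ordered_form (gibbs_state a H \<beta>) (quasifree_flow a H) ts L"
  by (intro g.form_from_words ts)
 then show tof: "is_time_ordered_form (gibbs_state a H \<beta>) (quasifree_flow a H) ts
   (time_ordered_form (gibbs_state a H \<beta>) (quasifree_flow a H) ts)"
  unfolding time_ordered_form_def
  by (rule someI[of "is_time_ordered_form (gibbs_state a H \<beta>) (quasifree_flow a H) ts"])
 show "(%N. S N As) \<longlonglongrightarrow> time_ordered_form (gibbs_state a H \<beta>) (quasifree_flow a H) ts As"
  if "length As = length ts" for As
  using L[OF that] g.form_unique[OF form tof ts that] by simp
qed

section \<open>Continuous functions on the configuration space and the diagonal algebra\<close>

lemma compact_config: "compact (UNIV :: ('y => bool) set)"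
proof -
 have "compact_space (product_topology (%_::'y. euclidean :: bool topology) UNIV)"
  unfolding compact_space_product_topology by (simp add: compact_space_def finite_imp_compact)
 then show ?thesis by (simp add: euclidean_product_topology compact_space_def)
qed

lemma continuous_coordinate: "continuous_on UNIV (%v :: 'y => bool. g (v x))"
 by (rule continuous_on_compose2[OF Topological_Spaces.continuous_on_discrete[of UNIV g] continuous_on_product_coordinates]) simp

text \<open>By compactness finitely many basic open sets, each restricting finitely many
  coordinates, cover the space; together these coordinates determine \<open>f\<close> up to
  \<open>e\<close>.\<close>

lemma continuous_depends_finite:
 fixes f :: "('y => bool) => 'b::metric_space"
 assumes f: "continuous_on UNIV f" and e: "e > 0"
 obtains F where "finite F" "!!v v'. (!!x. x \<in> F ==> v x = v' x) ==> dist (f v) (f v') < e"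
proof -
 define R where "R v F U \<longleftrightarrow> finite F \<and> open U \<and> v \<in> U \<and> (\<forall>v'\<in>U. dist (f v') (f v) < e / 2) \<and>
   (\<forall>v1 v2. (\<forall>x\<in>F. v1 x = v2 x) \<longrightarrow> v1 \<in> U \<longrightarrow> v2 \<in> U)" for v F U
 have "\<exists>F U. R v F U" for v
 proof -
  have "open (f -` ball (f v) (e / 2))" using f by (simp add: continuous_on_open_vimage)
  then have "openin (product_topology (%_. euclidean) UNIV) (f -` ball (f v) (e / 2))"
   by (simp add: euclidean_product_topology)
  moreover have "v \<in> f -` ball (f v) (e / 2)" using e by simp
  ultimately obtain X where X: "v \<in> (\<Pi>\<^sub>E i\<in>UNIV. X i)" "!!i. open (X i)"
    "finite {i. X i \<noteq> UNIV}" "(\<Pi>\<^sub>E i\<in>UNIV. X i) \<subseteq> f -` ball (f v) (e / 2)"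
   using product_topology_open_contains_basis[of "%_. euclidean" UNIV "f -` ball (f v) (e / 2)" v] by auto
  have "v2 \<in> (\<Pi>\<^sub>E i\<in>UNIV. X i)" if "\<forall>x\<in>{i. X i \<noteq> UNIV}. v1 x = v2 x" "v1 \<in> (\<Pi>\<^sub>E i\<in>UNIV. X i)" for v1 v2
  proof -
   have X: "v1 i \<in> X i" "X i = UNIV \<or> v1 i = v2 i" for i using that by (auto simp: PiE_iff)
   have "v2 i \<in> X i" for i using X[of i] by auto
   then show ?thesis by auto
  qed
  moreover have "open (\<Pi>\<^sub>E i\<in>UNIV. X i)" by (intro open_PiE X)
  moreover have "\<forall>v'\<in>(\<Pi>\<^sub>E i\<in>UNIV. X i). dist (f v') (f v) < e / 2"
   using X(4) by (auto simp: dist_commute)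
  ultimately have "R v {i. X i \<noteq> UNIV} (\<Pi>\<^sub>E i\<in>UNIV. X i)" using X unfolding R_def by blast
  then show ?thesis by blast
 qed
 then obtain N U where NU: "!!v. R v (N v) (U v)" by metis
 have p: "finite (N v)" "open (U v)" "v \<in> U v" "v' \<in> U v ==> dist (f v') (f v) < e / 2"
   "(!!x. x \<in> N v ==> v1 x = v2 x) ==> v1 \<in> U v ==> v2 \<in> U v" for v v' v1 v2
  using NU[of v] unfolding R_def by blast+
 obtain C where C: "finite C" "UNIV \<subseteq> (\<Union>v\<in>C. U v)"
  by (rule compactE_image[OF compact_config, of UNIV "%v. U v"]) (use p in auto)
 show ?thesis
 proof (rule that[of "\<Union>v\<in>C. N v"])
  show "finite (\<Union>v\<in>C. N v)" using C p by auto
  fix v v' :: "'y => bool" assume eq: "!!x. x \<in> (\<Union>v\<in>C. N v) ==> v x = v' x"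
  obtain \<eta> where \<eta>: "\<eta> \<in> C" "v \<in> U \<eta>" using C by blast
  then have "v' \<in> U \<eta>" using p(5)[of \<eta> v v'] eq by blast
  then show "dist (f v) (f v') < e"
   using p(4)[OF \<eta>(2)] p(4)[of v' \<eta>] dist_triangle2[of "f v" "f v'" "f \<eta>"] by simp
 qed
qed

context countable_car_alg
begin

abbreviation rho :: "'x => bool => 'a" where "rho x \<equiv> occp (delta x)"

text \<open>Unfolded, a sum over all configurations of the sites \<open>xs\<close> of the values of
  \<open>f\<close>, weighted by the projections onto these configurations; the remaining sites are
  read from \<open>v\<close>.\<close>

primrec Jr :: "'x list => (('x => bool) => complex) => ('x => bool) => 'a" where
 "Jr [] f v = f v *\<^sub>C 1"
| "Jr (x # xs) f v = rho x True * Jr xs f (fun_upd v x True) + rho x False * Jr xs f (fun_upd v x False)"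

lemma rho_sum: "rho x True + rho x False = 1"
 using c_a[of "delta x" "delta x"] by (simp add: occp_def cinner_delta scaleC_one)

lemma rho_sum_mult: "rho x True * y + rho x False * y = y"
 using distrib_right[of "rho x True" "rho x False" y] by (simp add: rho_sum)

lemma rho_idem: "rho x b * rho x b = rho x b"
 by (rule occp_idem) (simp add: norm_delta)

lemma rho_disjoint: "rho x True * rho x False = 0" "rho x False * rho x True = 0"
proof -
 have "rho x False = 1 - rho x True" using rho_sum[of x] by (simp add: eq_diff_eq add.commute)
 then show "rho x True * rho x False = 0" "rho x False * rho x True = 0"
  using rho_idem[of x True] by (simp_all add: right_diff_distrib left_diff_distrib)
qed

lemma rho_commute: "x \<noteq> y ==> rho x b * rho y b' = rho y b' * rho x b"
 using a_occp_commute[of "delta x" "delta y" b'] c_occp_commute[of "delta x" "delta y" b']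
 by (cases b) (simp_all add: occp_def[of "delta x"] cinner_delta mult.assoc, simp_all add: mult.assoc[symmetric])

lemma Jr_commute:
 assumes "x \<notin> set xs" shows "rho x b * Jr xs f v = Jr xs f v * rho x b"
 using assms
proof (induction xs arbitrary: v)
 case (Cons y ys)
 have "rho x b * (rho y b' * Jr ys f v') = rho y b' * Jr ys f v' * rho x b" for b' v'
 proof -
  have 1: "rho x b * rho y b' = rho y b' * rho x b" and 2: "rho x b * Jr ys f v' = Jr ys f v' * rho x b"
   using Cons by (auto intro: rho_commute)
  have "rho x b * (rho y b' * Jr ys f v') = rho y b' * (rho x b * Jr ys f v')"
   by (simp only: mult.assoc[symmetric] 1)
  also have "\<dots> = rho y b' * Jr ys f v' * rho x b"
   by (simp only: 2 mult.assoc)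
  finally show ?thesis .
 qed
 then show ?case by (simp add: distrib_left distrib_right)
qed (simp add: scaleC_mult_left scaleC_mult_right)

lemma Jr_add: "Jr xs (%v. f v + g v) v = Jr xs f v + Jr xs g v"
 by (induction xs arbitrary: v) (simp_all add: scaleC_add_left algebra_simps)

lemma Jr_scale: "Jr xs (%v. z * f v) v = z *\<^sub>C Jr xs f v"
 by (induction xs arbitrary: v) (simp_all add: scaleC_scaleC scaleC_mult_right scaleC_add_right)

lemma Jr_adj: "distinct xs ==> Jr xs (%v. cnj (f v)) v = adj (Jr xs f v)"
proof (induction xs arbitrary: v)
 case (Cons x xs)
 then show ?case by (simp add: adj_add adj_mult occp_adj Jr_commute)
qed (simp add: adj_scaleC)

lemma Jr_mult: "distinct xs ==> Jr xs (%v. f v * g v) v = Jr xs f v * Jr xs g v"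
proof (induction xs arbitrary: v)
 case (Cons x xs)
 let ?f = "%b. Jr xs f (fun_upd v x b)" and ?g = "%b. Jr xs g (fun_upd v x b)"
 have "(rho x b * ?f b) * (rho x b' * ?g b') = (rho x b * rho x b') * (?f b * ?g b')" for b b'
  using Cons.prems Jr_commute[of x xs b' f "fun_upd v x b"] by (simp add: mult.assoc) (simp add: mult.assoc[symmetric])
 then show ?case using Cons
  by (simp add: distrib_left distrib_right rho_idem rho_disjoint)
qed (simp add: scaleC_mult_left scaleC_mult_right scaleC_scaleC mult.commute)

text \<open>Sites that \<open>f\<close> does not see may be dropped, since the two projections of a
  site sum to 1.\<close>

lemma Jr_local:
 assumes "!!v v'. (!!y. y \<notin> set ys ==> v y = v' y) ==> f v = f v'"
 shows "Jr (xs @ ys) f v = Jr xs f v"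
proof (induction xs arbitrary: v)
 case Nil
 show ?case using assms
 proof (induction ys arbitrary: v)
  case (Cons y ys)
  have "Jr ([] @ ys) f v' = Jr [] f v'" for v'
   by (rule Cons.IH, rule Cons.prems) simp
  moreover have "f (fun_upd v y b) = f v" for b by (rule Cons.prems) auto
  ultimately show ?case by (simp add: rho_sum_mult)
 qed (simp only: append_Nil)
qed simp

lemma Jr_coordinate:
 assumes "distinct xs" "x \<in> set xs" shows "Jr xs (%v. of_bool (v x = b)) v = rho x b"
 using assms
proof (induction xs arbitrary: v)
 case (Cons y ys)
 show ?case
 proof (cases "x = y")
  case True
  have "Jr ([] @ ys) (%v. of_bool (v x = b)) v' = Jr [] (%v. of_bool (v x = b)) v'" for v'
  proof (rule Jr_local)
   fix v v' :: "'x => bool" assume "!!y. y \<notin> set ys ==> v y = v' y"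
   then have "v x = v' x" using Cons.prems True by simp
   then show "of_bool (v x = b) = (of_bool (v' x = b) :: complex)" by simp
  qed
  then show ?thesis using True by (cases b) (simp_all add: scaleC_one)
 next
  case False
  then show ?thesis using Cons by (simp add: rho_sum_mult)
 qed
qed simp

lemma Jr_one: "Jr xs (%_. 1) v = 1"
 using Jr_local[of xs "%_. 1" "[]" v] by (simp add: scaleC_one)

text \<open>For real values \<open>g\<close> and \<open>C\<close> above the bound, the commuting
  element built from \<open>sqrt (1 - (g v / C)\<^sup>2)\<close> certifies the norm. Splitting into
  real and imaginary parts costs the factor 2, which is harmless in limit arguments.\<close>

lemma Jr_bound:
 assumes d: "distinct xs" and B: "!!v. cmod (f v) \<le> B"
 shows "norm (Jr xs f v) \<le> 2 * B"
proof -
 have B0: "0 \<le> B" using B norm_ge_zero order_trans by blast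
 have real: "norm (Jr xs (%v. cor (g v)) v) \<le> B" if g: "!!v. \<bar>g v\<bar> \<le> B" for g
 proof (rule field_le_epsilon)
  fix e :: real assume e: "e > 0"
  define C where "C = B + e"
  have C: "C > 0" using e B0 by (simp add: C_def)
  have gC: "\<bar>g v / C\<bar> \<le> 1" for v using g[of v] C e by (simp add: C_def)
  define u s where "u = Jr xs (%v. cor (g v / C)) v"
   and "s = Jr xs (%v. cor (sqrt (1 - (g v / C)\<^sup>2))) v"
  have "norm u \<le> 1"
  proof (rule commuting_squares_bound(1))
   show "adj u = u" "adj s = s"
    using Jr_adj[OF d, of "%v. cor (g v / C)" v]
     Jr_adj[OF d, of "%v. cor (sqrt (1 - (g v / C)\<^sup>2))" v] by (simp_all add: u_def s_def)
   show "u * s = s * u" unfolding u_def s_def by (simp only: Jr_mult[OF d, symmetric] mult.commute)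
   have "cor (g v / C) * cor (g v / C) +
     cor (sqrt (1 - (g v / C)\<^sup>2)) * cor (sqrt (1 - (g v / C)\<^sup>2)) = 1" for v
   proof -
    have "(g v / C)\<^sup>2 \<le> 1" using gC[of v] by (simp add: abs_square_le_1)
    then have "g v / C * (g v / C) + sqrt (1 - (g v / C)\<^sup>2) * sqrt (1 - (g v / C)\<^sup>2) = 1"
     by (simp add: power2_eq_square flip: real_sqrt_mult)
    from arg_cong[OF this, of cor] show ?thesis by (simp only: of_real_mult of_real_add of_real_1)
   qed
   then show "u * u + s * s = 1"
    unfolding u_def s_def by (simp only: Jr_mult[OF d, symmetric] Jr_add[symmetric] Jr_one)
  qed
  moreover have "Jr xs (%v. cor (g v)) v = cor C *\<^sub>C u"
   unfolding u_def Jr_scale[symmetric] using C by simp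
  ultimately have "norm (Jr xs (%v. cor (g v)) v) \<le> C"
   using C by (simp add: norm_scaleC mult_left_le)
  then show "norm (Jr xs (%v. cor (g v)) v) \<le> B + e" by (simp add: C_def)
 qed
 have "Jr xs f v = Jr xs (%v. cor (Re (f v))) v + \<i> *\<^sub>C Jr xs (%v. cor (Im (f v))) v"
  by (simp only: Jr_scale[symmetric] Jr_add[symmetric] complex_eq[symmetric])
 also have "norm \<dots> \<le> B + B"
 proof (rule norm_triangle_mono)
  show "norm (Jr xs (%v. cor (Re (f v))) v) \<le> B"
   by (rule real) (use B abs_Re_le_cmod order_trans in blast)
  show "norm (\<i> *\<^sub>C Jr xs (%v. cor (Im (f v))) v) \<le> B"
   using real[of "%v. Im (f v)"] B abs_Im_le_cmod order_trans by (simp add: norm_scaleC) blast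
 qed
 finally show ?thesis by simp
qed

definition sites :: "nat => 'x list" where
 "sites n = map from_nat (filter (%i. i \<in> range (to_nat :: 'x => nat)) [0..<n])"

lemma sites: "distinct (sites n)" "set (sites n) = {x. to_nat x < n}"
 and sites_add: "n \<le> m ==> \<exists>ys. sites m = sites n @ ys"
proof -
 show "distinct (sites n)"
  unfolding sites_def distinct_map by (auto intro!: inj_onI)
 show "set (sites n) = {x. to_nat x < n}" by (force simp: sites_def)
 assume "n \<le> m"
 then have "[0..<m] = [0..<n] @ [n..<m]" using upt_add_eq_append[of 0 n "m - n"] by simp
 then show "\<exists>ys. sites m = sites n @ ys" by (simp add: sites_def)
qed

text \<open>Sites not yet enumerated are read as \<open>False\<close>; for continuous functions
  their influence vanishes in the limit.\<close>

definition J :: "(('x => bool) => complex) => 'a" where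
 "J f = lim (%n. Jr (sites n) f (%_. False))"

abbreviation "cfun \<equiv> {f :: ('x => bool) => complex. continuous_on UNIV f}"

lemma J_tendsto:
 assumes f: "continuous_on UNIV f" shows "(%n. Jr (sites n) f (%_. False)) \<longlonglongrightarrow> J f"
proof -
 have "Cauchy (%n. Jr (sites n) f (%_. False))"
 proof (rule CauchyI)
  fix e :: real assume e: "e > 0"
  then have "e / 5 > 0" by simp
  from continuous_depends_finite[OF f this] obtain F where
   F: "finite F" "!!v v'. (!!x. x \<in> F ==> v x = v' x) ==> dist (f v) (f v') < e / 5" by blast
  obtain n0 where n0: "!!x. x \<in> F ==> to_nat x < n0"
   using finite_nat_set_iff_bounded[of "to_nat ` F"] F(1) by auto
  define g where "g v = f (%x. x \<in> F \<and> v x)" for v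
  have "norm (Jr (sites n) f v - Jr (sites n) g v) \<le> 2 * (e / 5)" for n v
  proof -
   have "Jr (sites n) f v - Jr (sites n) g v = Jr (sites n) (%v. f v + (-1) * g v) v"
    unfolding Jr_add Jr_scale by (simp add: scaleC_minus_one)
   also have "norm \<dots> \<le> 2 * (e / 5)"
    using F(2)[of _ "%x. x \<in> F \<and> _ x"] by (intro Jr_bound sites) (simp add: g_def dist_norm less_imp_le)
   finally show ?thesis .
  qed
  note fg = this
  have "norm (Jr (sites m) f (%_. False) - Jr (sites n) f (%_. False)) < e" if mn: "m \<ge> n0" "n \<ge> n0" for m n
  proof -
   have "Jr (sites m) g v = Jr (sites n0) g v" if m: "m \<ge> n0" for m v
   proof -
    obtain ys where ys: "sites m = sites n0 @ ys" using sites_add[OF m] by blast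
    then have disj: "x \<notin> set ys" if "x \<in> F" for x
     using sites(1)[of m] sites(2)[of n0] n0[OF that] by auto
    show ?thesis unfolding ys
    proof (rule Jr_local)
     fix v v' :: "'x => bool" assume "!!y. y \<notin> set ys ==> v y = v' y"
     then have "(%x. x \<in> F \<and> v x) = (%x. x \<in> F \<and> v' x)" using disj by blast
     then show "g v = g v'" by (simp add: g_def)
    qed
   qed
   from this[OF mn(1)] this[OF mn(2)]
   have "Jr (sites m) f (%_. False) - Jr (sites n) f (%_. False) =
    (Jr (sites m) f (%_. False) - Jr (sites m) g (%_. False)) - (Jr (sites n) f (%_. False) - Jr (sites n) g (%_. False))"
    by simp
   also have "norm \<dots> \<le> 2 * (e / 5) + 2 * (e / 5)"
    by (rule order_trans[OF norm_triangle_ineq4 add_mono[OF fg fg]])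
   also have "\<dots> < e" using e by simp
   finally show ?thesis .
  qed
  then show "\<exists>M. \<forall>m\<ge>M. \<forall>n\<ge>M. norm (Jr (sites m) f (%_. False) - Jr (sites n) f (%_. False)) < e" by blast
 qed
 then show ?thesis unfolding J_def using Cauchy_convergent convergent_LIMSEQ_iff by blast
qed

lemma J_add: "f \<in> cfun ==> g \<in> cfun ==> J (%v. f v + g v) = J f + J g"
 by (rule LIMSEQ_unique[OF J_tendsto])
  (auto intro!: continuous_on_add tendsto_add J_tendsto simp: Jr_add)

lemma J_mult: "f \<in> cfun ==> g \<in> cfun ==> J (%v. f v * g v) = J f * J g"
 by (rule LIMSEQ_unique[OF J_tendsto])
  (auto intro!: continuous_on_mult tendsto_mult J_tendsto simp: Jr_mult sites)

lemma J_scale: "f \<in> cfun ==> J (%v. z * f v) = z *\<^sub>C J f"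
 by (rule LIMSEQ_unique[OF J_tendsto])
  (auto intro!: continuous_on_mult scaleC.tendsto tendsto_const continuous_on_const J_tendsto simp: Jr_scale)

lemma J_adj: "f \<in> cfun ==> J (%v. cnj (f v)) = adj (J f)"
 by (rule LIMSEQ_unique[OF J_tendsto])
  (auto intro!: continuous_on_cnj tendsto_adj J_tendsto simp: Jr_adj sites)

lemma J_one: "J (%_. 1) = 1"
 using J_tendsto[of "%_. 1"] by (simp add: Jr_one LIMSEQ_const_iff)

lemma J_coordinate: "J (%v. of_bool (v x = b)) = rho x b"
proof -
 have "continuous_on UNIV (%v :: 'x => bool. of_bool (v x = b) :: complex)"
  by (rule continuous_coordinate)
 from J_tendsto[OF this] have "(%n. Jr (sites n) (%v. of_bool (v x = b)) (%_. False)) \<longlonglongrightarrow> J (%v. of_bool (v x = b))" .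
 moreover have "\<forall>\<^sub>F n in sequentially. Jr (sites n) (%v. of_bool (v x = b)) (%_. False) = rho x b"
  unfolding eventually_sequentially
  by (intro exI[of _ "Suc (to_nat x)"] allI impI Jr_coordinate) (simp_all add: sites)
 then have "(%n. Jr (sites n) (%v. of_bool (v x = b)) (%_. False)) \<longlonglongrightarrow> rho x b"
  by (rule tendsto_eventually)
 ultimately show ?thesis by (rule LIMSEQ_unique)
qed

lemma J_bound:
 assumes "f \<in> cfun" "!!v. cmod (f v) \<le> B" shows "norm (J f) \<le> 2 * B"
 by (rule tendsto_upperbound[OF tendsto_norm[OF J_tendsto]]) (use assms in \<open>auto intro!: always_eventually Jr_bound sites\<close>)

lemma J_diff: "f \<in> cfun ==> g \<in> cfun ==> J (%v. f v - g v) = J f - J g"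
 using J_add[of f "%v. (-1) * g v"] J_scale[of g "-1"]
 by (simp add: scaleC_minus_one continuous_on_minus)

text \<open>The corner of a small cylinder around a point is a nonzero projection, on which \<open>J f\<close> is almost the scalar \<open>f v\<close>.\<close>

lemma J_lower:
 assumes f: "f \<in> cfun" shows "cmod (f v) \<le> norm (J f)"
proof (rule field_le_epsilon)
 fix e :: real assume e: "e > 0"
 have "continuous_on UNIV f" "e / 2 > 0" using f e by auto
 from continuous_depends_finite[OF this] obtain F where
  F: "finite F" "!!v v'. (!!x. x \<in> F ==> v x = v' x) ==> dist (f v) (f v') < e / 2" by blast
 obtain xs where xs: "set xs = F" "distinct xs" using finite_distinct_list[OF F(1)] by blast
 define Z where "Z = (%v'. prod_list (map (%x. of_bool (v' x = v x) :: complex) xs))"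
 have inj: "delta x = delta y ==> x = y" for x y :: 'x
  using cinner_delta[of x y] cinner_delta[of y y] by (auto split: if_splits)
 have "continuous_on UNIV (%v'. prod_list (map (%x. of_bool (v' x = v x) :: complex) ys)) \<and>
  J (%v'. prod_list (map (%x. of_bool (v' x = v x)) ys)) = corner (%h. v (inv_into UNIV delta h)) (map delta ys)" for ys
 proof (induction ys)
  case (Cons y ys)
  have "inv_into UNIV delta (delta y) = y" using inj by (intro inv_f_f injI)
  moreover have "continuous_on UNIV (%v' :: 'x => bool. of_bool (v' y = v y) :: complex)" by (rule continuous_coordinate)
  ultimately show ?case using Cons J_coordinate[of y "v y"]
   by (simp add: J_mult continuous_on_mult)
 qed (simp add: J_one)
 then have Zc: "Z \<in> cfun" and p: "J Z = corner (%h. v (inv_into UNIV delta h)) (map delta xs)"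
  unfolding Z_def by auto
 have on: "distinct (map delta xs :: 'x ell2 list)" "orthonormal (set (map delta xs) :: 'x ell2 set)"
  using xs inj by (auto simp: distinct_map inj_on_def orthonormal_def cinner_delta)
 have pp: "adj (J Z) = J Z" "J Z * J Z = J Z" "J Z \<noteq> 0" unfolding p using corner_facts[OF on] by auto
 have "(norm (J Z))\<^sup>2 = norm (J Z)" using cstar_identity[of "J Z"] pp by simp
 then have n1: "norm (J Z) = 1" using pp(3) by (simp add: power2_eq_square)
 have fin: "Z v' = (if \<forall>x\<in>F. v' x = v x then 1 else 0)" for v'
  unfolding Z_def xs(1)[symmetric] by (induction xs) auto
 have "norm (J (%v'. (f v' - f v) * Z v')) \<le> 2 * (e / 2)"
  by (rule J_bound) (use f Zc F(2)[of _ v] e in \<open>auto simp: fin dist_norm less_imp_le intro!: continuous_intros\<close>)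
 moreover have "J (%v'. (f v' - f v) * Z v') = J f * J Z - f v *\<^sub>C J Z"
 proof -
  have "(%v'. f v' * Z v') \<in> cfun" "(%v'. f v * Z v') \<in> cfun" using f Zc by (auto intro!: continuous_intros)
  from J_diff[OF this] show ?thesis
   unfolding J_mult[OF f Zc] J_scale[OF Zc] by (simp add: left_diff_distrib)
 qed
 ultimately have 1: "norm (J f * J Z - f v *\<^sub>C J Z) \<le> e" by simp
 have "cmod (f v) = norm (f v *\<^sub>C J Z)" by (simp add: norm_scaleC n1)
 also have "\<dots> \<le> norm (J f * J Z) + norm (J f * J Z - f v *\<^sub>C J Z)"
  using norm_triangle_ineq4[of "J f * J Z" "J f * J Z - f v *\<^sub>C J Z"] by simp
 also have "\<dots> \<le> norm (J f) * 1 + e" using norm_mult_ineq[of "J f" "J Z"] 1 n1 by simp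
 finally show "cmod (f v) \<le> norm (J f) + e" by simp
qed

end

lemma cstar_generated_closed:
 fixes S :: "'a::cstar_algebra set"
 shows "closed (cstar_generated S)" "S \<subseteq> cstar_generated S" "1 \<in> cstar_generated S"
  "x \<in> cstar_generated S ==> y \<in> cstar_generated S ==> x + y \<in> cstar_generated S"
  "x \<in> cstar_generated S ==> y \<in> cstar_generated S ==> x * y \<in> cstar_generated S"
  "x \<in> cstar_generated S ==> z *\<^sub>C x \<in> cstar_generated S"
  "x \<in> cstar_generated S ==> adj x \<in> cstar_generated S"
proof -
 show "closed (cstar_generated S)" unfolding cstar_generated_def by (rule closed_Inter) blast
qed (unfold cstar_generated_def, blast+)

context countable_car_alg
begin

lemma J_diag: "f \<in> cfun ==> J f \<in> diag_algebra a"
proof -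
 assume f: "f \<in> cfun"
 note D = cstar_generated_closed[where S = "range (occupation a)", folded diag_algebra_def]
 have occ: "rho x True = occupation a x" for x by (simp add: occp_def occupation_def)
 have "rho x False = 1 + (-1) *\<^sub>C rho x True" for x
  using rho_sum[of x] by (simp add: scaleC_minus_one eq_diff_eq add.commute)
 moreover have "rho x True \<in> diag_algebra a" for x using D(2) by (auto simp: occ)
 ultimately have "rho x b \<in> diag_algebra a" for x b
  using D(4)[OF D(3) D(6)] by (cases b) simp_all
 then have "Jr xs f v \<in> diag_algebra a" for xs v
  by (induction xs arbitrary: v) (auto intro!: D(3) D(4) D(5) D(6))
 then show ?thesis
  using f by (intro closed_sequentially[OF D(1) _ J_tendsto]) auto
qed

text \<open>\<open>J_lower\<close> turns a convergent sequence in the image into a uniformly Cauchy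
  sequence of functions, and \<open>J_bound\<close> carries the uniform limit back.\<close>

lemma J_closed: "closed (J ` cfun)"
 unfolding closed_sequential_limits
proof safe
 fix s l assume s: "\<forall>n. s n \<in> J ` cfun" "s \<longlonglongrightarrow> l"
 have "\<forall>n. \<exists>f. f \<in> cfun \<and> s n = J f" using s(1) by blast
 from choice[OF this] obtain f where "\<forall>n. f n \<in> cfun \<and> s n = J (f n)" ..
 then have f: "f n \<in> cfun" "s n = J (f n)" for n by auto
 have "uniformly_Cauchy_on UNIV f"
 proof (rule uniformly_Cauchy_onI)
  fix e :: real assume "e > 0"
  from CauchyD[OF LIMSEQ_imp_Cauchy[OF s(2)] this]
  obtain M where M: "!!m n. m \<ge> M ==> n \<ge> M ==> norm (s m - s n) < e" by blast
  have "dist (f m v) (f n v) < e" if "m \<ge> M" "n \<ge> M" for m n v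
  proof -
   have "(%v. f m v - f n v) \<in> cfun" using f(1) by (auto intro: continuous_on_diff)
   from J_lower[OF this, of v] M[OF that] show ?thesis unfolding J_diff[OF f(1) f(1)] by (simp add: f(2)[symmetric] dist_norm)
  qed
  then show "\<exists>M. \<forall>v\<in>UNIV. \<forall>m\<ge>M. \<forall>n\<ge>M. dist (f m v) (f n v) < e" by blast
 qed
 then have "uniformly_convergent_on UNIV f" by (rule Cauchy_uniformly_convergent)
 then obtain g where g: "uniform_limit UNIV f g sequentially" by (auto simp: uniformly_convergent_on_def)
 have gc: "g \<in> cfun"
  using uniform_limit_theorem[OF _ g] f(1) by auto
 have "s \<longlonglongrightarrow> J g"
 proof (rule LIMSEQ_I)
  fix e :: real assume e: "e > 0"
  then have "\<forall>\<^sub>F n in sequentially. \<forall>v\<in>UNIV. dist (f n v) (g v) < e / 3"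
   using g unfolding uniform_limit_iff by (auto dest: spec[of _ "e / 3"])
  then obtain M where M: "!!n v. n \<ge> M ==> cmod (f n v - g v) < e / 3"
   unfolding eventually_sequentially dist_norm by blast
  have "norm (s n - J g) < e" if "n \<ge> M" for n
  proof -
   have "s n - J g = J (%v. f n v - g v)" by (simp only: J_diff f gc)
   also have "norm \<dots> \<le> 2 * (e / 3)"
    using f(1)[of n] gc M[OF that] by (intro J_bound) (auto intro: continuous_on_diff less_imp_le)
   finally show ?thesis using e by simp
  qed
  then show "\<exists>M. \<forall>n\<ge>M. norm (s n - J g) < e" by blast
 qed
 then have "l = J g" using s(2) LIMSEQ_unique by blast
 then show "l \<in> J ` cfun" using gc by blast
qed

lemma J_identification: "is_diag_identification a J"
proof -
 have ind: "indicator {v :: 'x => bool. v x} = (%v. of_bool (v x = True) :: complex)" for x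
  by (simp add: fun_eq_iff indicator_def)
 have occ: "J (indicator {v. v x}) = occupation a x" for x
  unfolding ind J_coordinate by (simp add: occp_def occupation_def)
 have indc: "indicator {v :: 'x => bool. v x} \<in> cfun" for x
  unfolding ind using continuous_coordinate[of "%b. of_bool (b = True)" x] by simp
 have "inj_on J cfun"
 proof (rule inj_onI)
  fix f g assume fg: "f \<in> cfun" "g \<in> cfun" "J f = J g"
  have "(%v. f v - g v) \<in> cfun" using fg by (auto intro: continuous_on_diff)
  from J_lower[OF this] have "cmod (f v - g v) \<le> 0" for v
   unfolding J_diff[OF fg(1,2)] fg(3) by simp
  then show "f = g" by (auto simp: fun_eq_iff)
 qed
 \<comment> \<open>The image is a closed star-subalgebra containing the occupation numbers, hence it
   contains the algebra that they generate.\<close>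
 moreover have "J ` cfun = diag_algebra a"
 proof
  show "J ` cfun \<subseteq> diag_algebra a" using J_diag by blast
  have cl: "J f + J g \<in> J ` cfun" "J f * J g \<in> J ` cfun" "z *\<^sub>C J f \<in> J ` cfun" "adj (J f) \<in> J ` cfun"
   if "f \<in> cfun" "g \<in> cfun" for f g z
   unfolding J_add[OF that, symmetric] J_mult[OF that, symmetric] J_scale[OF that(1), symmetric] J_adj[OF that(1), symmetric]
   using that by (auto intro!: imageI continuous_intros)
  have "1 \<in> J ` cfun" by (rule image_eqI[of _ _ "%_. 1"]) (auto simp: J_one)
  moreover have "range (occupation a) \<subseteq> J ` cfun" using occ indc by (metis image_subsetI imageI)
  ultimately show "diag_algebra a \<subseteq> J ` cfun"
   unfolding diag_algebra_def cstar_generated_def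
   by (intro Inter_lower) (auto simp: J_closed intro: cl[simplified])
 qed
 ultimately show ?thesis
  unfolding is_diag_identification_def Let_def bij_betw_def
  by (intro conjI ballI allI J_add J_mult J_scale J_adj J_one occ)
qed

lemma diag_of_fun: "is_diag_identification a (diag_of_fun a)"
 unfolding diag_of_fun_def by (rule someI[of "is_diag_identification a", OF J_identification])

end

section \<open>The determinant formula\<close>

context gibbs
begin

definition pairw :: "'a => (bool \<times> 'a ell2) list" where
 "pairw x = [(True, delta x), (False, delta x)]"

lemma word_pairw: "word (pairw x) = occupation a x"
 by (simp add: word_def pairw_def op_def occupation_def)

text \<open>Creators and annihilators alternate, so the creator with index \<open>i\<close> receives
  the count \<open>q + i\<close> and stands at an even position, which makes the sign
  trivial.\<close>

lemma flat_pairw: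
 assumes "length xs = length ts"
 shows "rows q (flat (map pairw xs) ts) = zip (zip (map delta xs) ts) [q..<q + length ts]"
  "cols (flat (map pairw xs) ts) = zip (map delta xs) ts" "sg 0 (flat (map pairw xs) ts) = 1"
proof -
 have 1: "cols (p # w) = (if fst p then cols w else snd p # cols w)" for p :: "bool \<times> 'a ell2 \<times> real" and w
  by (simp add: cols_def)
 have 2: "cols [] = ([] :: ('a ell2 \<times> real) list)" by (simp add: cols_def)
 have 3: "[q..<Suc (q + n)] = q # [Suc q..<Suc q + n]" for q n by (simp add: upt_conv_Cons)
 have "rows q (flat (map pairw xs) ts) = zip (zip (map delta xs) ts) [q..<q + length ts] \<and>
  cols (flat (map pairw xs) ts) = zip (map delta xs) ts \<and> sg 0 (flat (map pairw xs) ts) = 1" for q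
  using assms
 proof (induction xs ts arbitrary: q rule: list_induct2)
  case (Cons x xs t ts)
  then show ?case by (simp add: flat_Cons pairw_def 1 3 sg_parity del: upt_Suc)
 qed (simp add: flat_Nil 2)
 then show "rows q (flat (map pairw xs) ts) = zip (zip (map delta xs) ts) [q..<q + length ts]"
  "cols (flat (map pairw xs) ts) = zip (map delta xs) ts" "sg 0 (flat (map pairw xs) ts) = 1" by auto
qed

lemma bborel_ker:
 assumes "f ==> s \<le> t \<and> t - s \<le> \<beta>" "\<not> f ==> t \<le> s \<and> s - t \<le> \<beta>"
 shows "bborel (%x. cor (ker \<beta> f t s x))"
 using ker_bound[of f, OF assms]
 by (intro bborel_continuous[where B = 1] continuous_on_of_real continuous_ker) auto

text \<open>At equal times \<open>R_kernel\<close> takes its first branch while Wick's theorem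
  yields the second. They differ by the anticommutator \<open>cinner (delta x) (delta y)\<close>,
  which vanishes for distinct sites.\<close>

lemma entry_True:
 assumes "\<beta> \<ge> 0" "s \<le> t" "t - s \<le> \<beta>" "s = t ==> x \<noteq> y"
 shows "entry G \<beta> True (delta x, t) (delta y, s) = R_kernel G \<beta> x t y s"
proof (cases "s = t")
 case True
 have b: "bborel (%x. cor (ker \<beta> f t t x))" for f by (rule bborel_ker) (use assms in auto)
 have "y * inverse (1 + y) + inverse (1 + y) = 1" if "y > 0" for y :: real using that by (simp add: field_simps)
 then have "ker \<beta> False t t x - ker \<beta> True t t x = 1" for x by (simp add: ker_def)
 then have "cor (ker \<beta> False t t x) - cor (ker \<beta> True t t x) = 1" for x
  by (metis of_real_1 of_real_diff)
 then have "sp.T (%x. cor (ker \<beta> False t t x)) (delta x) - sp.T (%x. cor (ker \<beta> True t t x)) (delta x) = delta x"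
  using sp.T_diff_fun[OF b b, of False True "delta x"] by (simp add: sp.T_one)
 then have "entry G \<beta> False (delta x, t) (delta y, t) - entry G \<beta> True (delta x, t) (delta y, t) = cinner (delta x) (delta y)"
  unfolding entry_def fun_calc_T by (simp flip: cinner.diff_left)
 then show ?thesis using True assms(4) by (simp add: cinner_delta R_kernel_def entry_def ker_def)
next
 case False
 then have "R_kernel G \<beta> x t y s = - cinner (sp.T (%l. cor (exp (- (t - s) * l) * inverse (1 + exp (- \<beta> * l)))) (delta x)) (delta y)"
  using assms(2) by (simp add: R_kernel_def fun_calc_T)
 moreover have "(%l. cor (exp (- (t - s) * l) * inverse (1 + exp (- \<beta> * l)))) = (%l. (-1) * cor (ker \<beta> True t s l))"
  by (simp add: ker_def)
 moreover have "bborel (%x. cor (ker \<beta> True t s x))" by (rule bborel_ker) (use assms in auto)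
 ultimately show ?thesis
  by (simp only: sp.T_scale_fun cinner_scaleC_left) (simp add: entry_def fun_calc_T)
qed

text \<open>Distinctness of the pairs of site and time enters through \<open>entry_True\<close>. A
  repeated pair would give the kernel matrix two equal rows, whereas occupation numbers are
  idempotent.\<close>

lemma form_occupation:
 assumes S: "is_time_ordered_form \<phi> \<alpha> ts S" and ts: "ordered_times \<beta> ts" and len: "length xs = length ts"
  and d: "distinct (zip xs ts)"
 shows "S (map (occupation a) xs) = Determinant.det (Matrix.mat (length ts) (length ts)
  (%(i, j). R_kernel G \<beta> (xs ! i) (ts ! i) (xs ! j) (ts ! j)))"
proof -
 have "S (map (occupation a) xs) = wickval (entry G \<beta>) (map pairw xs) ts"
  using form_words[OF S ts, of "map pairw xs"] len by (simp add: word_pairw comp_def)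
 also have "\<dots> = fdet (length ts) (%i j. entry G \<beta> (j < i) (delta (xs ! i), ts ! i) (delta (xs ! j), ts ! j))"
  unfolding wickval_def flat_pairw[OF len] wick_def using len by (auto intro!: fdet_cong)
 also have "\<dots> = fdet (length ts) (%i j. R_kernel G \<beta> (xs ! i) (ts ! i) (xs ! j) (ts ! j))"
 proof (rule fdet_cong)
  fix i j assume ij: "i < length ts" "j < length ts"
  have sorted: "sorted ts" and rng: "ts ! i \<in> {- \<beta> / 2..\<beta> / 2}" "ts ! j \<in> {- \<beta> / 2..\<beta> / 2}"
   using ts nth_mem[OF ij(1)] nth_mem[OF ij(2)] by (auto simp only: ordered_times_def)
  show "entry G \<beta> (j < i) (delta (xs ! i), ts ! i) (delta (xs ! j), ts ! j) = R_kernel G \<beta> (xs ! i) (ts ! i) (xs ! j) (ts ! j)"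
  proof (cases "j < i")
   case True
   have "ts ! j = ts ! i ==> xs ! i \<noteq> xs ! j"
    using nth_eq_iff_index_eq[OF d, of i j] ij len True by auto
   moreover have "ts ! j \<le> ts ! i" using sorted True ij by (auto simp: sorted_iff_nth_mono)
   ultimately show ?thesis using True rng by (auto intro!: entry_True)
  next
   case False
   then have "ts ! i \<le> ts ! j" using sorted ij by (auto simp: sorted_iff_nth_mono)
   then show ?thesis using False by (simp add: R_kernel_def entry_def ker_def)
  qed
 qed
 finally show ?thesis by (simp add: fdet_def)
qed

end

section \<open>Processes with values in the configuration space\<close>

definition cyl :: "('y => bool) => 'y set => 'y set => complex" where
 "cyl \<eta> F A = (\<Prod>p\<in>F. of_bool (\<eta> p = (p \<in> A)))"

lemma cyl_eq: "finite F ==> cyl \<eta> F A = of_bool ({p \<in> F. \<eta> p} = A \<inter> F)"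
 unfolding cyl_def by (induction F rule: finite_induct) (auto simp: set_eq_iff)

lemma cyl_expansion:
 assumes "finite F"
 shows "g (%p. p \<in> F \<and> \<eta> p) = (\<Sum>A\<in>Pow F. g (%p. p \<in> A) * cyl \<eta> F A)"
proof -
 have "(\<Sum>A\<in>Pow F. g (%p. p \<in> A) * cyl \<eta> F A) = (\<Sum>A\<in>Pow F. if A = {p \<in> F. \<eta> p} then g (%p. p \<in> A) else 0)"
  by (rule sum.cong) (auto simp: cyl_eq[OF assms] Int_absorb2)
 then show ?thesis using assms by (simp add: sum.delta')
qed

lemma measurable_cyl:
 assumes "!!p. p \<in> F ==> (%v. \<eta> v p) \<in> measurable M (count_space UNIV)"
 shows "(%v. cyl (\<eta> v) F A) \<in> borel_measurable M"
 unfolding cyl_def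
proof (rule borel_measurable_prod)
 fix p assume "p \<in> F"
 have "(%b. of_bool (b = (p \<in> A))) \<in> measurable (count_space UNIV) (borel :: complex measure)" by simp
 from measurable_compose[OF assms[OF \<open>p \<in> F\<close>] this]
 show "(%v. of_bool (\<eta> v p = (p \<in> A)) :: complex) \<in> borel_measurable M" .
qed

text \<open>The index set becomes uncountable once times are included, so Borel measurability cannot
  be read off coordinatewise. Continuous functions are still measurable, as limits of functions of
  finitely many coordinates.\<close>

lemma measurable_config:
 fixes g :: "('y => bool) => complex"
 assumes g: "continuous_on UNIV g" and \<eta>: "!!p. (%v. \<eta> v p) \<in> measurable M (count_space UNIV)"
 shows "(%v. g (\<eta> v)) \<in> borel_measurable M"
proof -
 have "\<exists>F. finite F \<and> (\<forall>v v'. (\<forall>x\<in>F. v x = v' x) \<longrightarrow> dist (g v) (g v') < inverse (real (Suc k)))" for k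
  using continuous_depends_finite[OF g, of "inverse (real (Suc k))"] by (metis inverse_positive_iff_positive of_nat_0_less_iff zero_less_Suc)
 then obtain F where F: "!!k. finite (F k)"
  "!!k v v'. (!!x. x \<in> F k ==> v x = v' x) ==> dist (g v) (g v') < inverse (real (Suc k))" by metis
 show ?thesis
 proof (rule borel_measurable_LIMSEQ_metric)
  show "(%v. g (%p. p \<in> F k \<and> \<eta> v p)) \<in> borel_measurable M" for k
   unfolding cyl_expansion[OF F(1)] by (intro borel_measurable_sum borel_measurable_times borel_measurable_const measurable_cyl \<eta>)
  show "(%k. g (%p. p \<in> F k \<and> \<eta> v p)) \<longlonglongrightarrow> g (\<eta> v)" for v
  proof (rule metric_LIMSEQ_I)
   fix r :: real assume "r > 0"
   then obtain K where K: "inverse (real (Suc K)) < r" using reals_Archimedean by blast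
   have "dist (g (%p. p \<in> F k \<and> \<eta> v p)) (g (\<eta> v)) < r" if "k \<ge> K" for k
   proof -
    have "dist (g (%p. p \<in> F k \<and> \<eta> v p)) (g (\<eta> v)) < inverse (real (Suc k))" by (rule F(2)) simp
    also have "\<dots> \<le> inverse (real (Suc K))" using that by (intro le_imp_inverse_le) auto
    finally show ?thesis using K by simp
   qed
   then show "\<exists>K. \<forall>k\<ge>K. dist (g (%p. p \<in> F k \<and> \<eta> v p)) (g (\<eta> v)) < r" by blast
  qed
 qed
qed

lemma integral_cyl_approx:
 fixes g :: "('y => bool) => complex"
 assumes M: "prob_space M" and g: "continuous_on UNIV g" and \<eta>: "!!p. (%v. \<eta> v p) \<in> measurable M (count_space UNIV)"
  and F: "finite F" "!!v v'. (!!x. x \<in> F ==> v x = v' x) ==> dist (g v) (g v') < e"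
 shows "cmod ((LINT v|M. g (\<eta> v)) - (\<Sum>A\<in>Pow F. g (%p. p \<in> A) * (LINT v|M. cyl (\<eta> v) F A))) \<le> e"
proof -
 interpret prob_space M by (rule M)
 have "bounded (g ` UNIV)" by (intro compact_imp_bounded compact_continuous_image g compact_config)
 then obtain B where B: "!!v. cmod (g v) \<le> B" by (auto simp: bounded_iff)
 have ig: "integrable M (%v. g (\<eta> v))"
  by (rule integrable_const_bound[where B = B]) (auto simp: B measurable_config[OF g \<eta>])
 have ic: "integrable M (%v. cyl (\<eta> v) F A)" for A
  by (rule integrable_const_bound[where B = 1, OF _ measurable_cyl[OF \<eta>]]) (simp add: cyl_eq[OF F(1)])
 let ?gF = "%v. g (%p. p \<in> F \<and> \<eta> v p)"
 have igF: "integrable M ?gF" unfolding cyl_expansion[OF F(1)] by (intro Bochner_Integration.integrable_sum integrable_mult_right ic)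
 have "(\<Sum>A\<in>Pow F. g (%p. p \<in> A) * (LINT v|M. cyl (\<eta> v) F A)) = (LINT v|M. ?gF v)"
  unfolding cyl_expansion[OF F(1)] by (simp add: ic)
 then have "(LINT v|M. g (\<eta> v)) - (\<Sum>A\<in>Pow F. g (%p. p \<in> A) * (LINT v|M. cyl (\<eta> v) F A)) = (LINT v|M. g (\<eta> v) - ?gF v)"
  by (simp add: ig igF)
 also have "cmod \<dots> \<le> (LINT v|M. cmod (g (\<eta> v) - ?gF v))" by (rule integral_norm_bound)
 also have "\<dots> \<le> e"
  by (rule integral_le_const) (use F(2)[of "\<eta> _" "%p. p \<in> F \<and> \<eta> _ p"] ig igF in \<open>auto simp: dist_norm less_imp_le\<close>)
 finally show ?thesis .
qed

text \<open>The cylinder approximation of \<open>g\<close> is uniform, so its error does not depend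
  on \<open>N\<close>.\<close>

lemma cyl_convergence:
 fixes g :: "('y => bool) => complex"
 assumes M: "!!N. prob_space (MN N)" "prob_space M" and g: "continuous_on UNIV g"
  and \<eta>: "!!N p. (%v. \<eta>N N v p) \<in> measurable (MN N) (count_space UNIV)" "!!p. (%v. \<eta> v p) \<in> measurable M (count_space UNIV)"
  and conv: "!!F A. finite F ==> (%N. LINT v|MN N. cyl (\<eta>N N v) F A) \<longlonglongrightarrow> (LINT v|M. cyl (\<eta> v) F A)"
 shows "(%N. LINT v|MN N. g (\<eta>N N v)) \<longlonglongrightarrow> (LINT v|M. g (\<eta> v))"
proof (rule LIMSEQ_I)
 fix e :: real assume e: "e > 0"
 then have "e / 3 > 0" by simp
 from continuous_depends_finite[OF g this] obtain F where
  F: "finite F" "!!v v'. (!!x. x \<in> F ==> v x = v' x) ==> dist (g v) (g v') < e / 3" by blast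
 let ?sN = "%N. \<Sum>A\<in>Pow F. g (%p. p \<in> A) * (LINT v|MN N. cyl (\<eta>N N v) F A)"
 let ?s = "\<Sum>A\<in>Pow F. g (%p. p \<in> A) * (LINT v|M. cyl (\<eta> v) F A)"
 have "?sN \<longlonglongrightarrow> ?s" by (intro tendsto_intros conv F)
 from LIMSEQ_D[OF this \<open>e / 3 > 0\<close>] obtain K where K: "!!N. N \<ge> K ==> cmod (?sN N - ?s) < e / 3" by blast
 have "cmod ((LINT v|MN N. g (\<eta>N N v)) - (LINT v|M. g (\<eta> v))) < e" if "N \<ge> K" for N
 proof -
  have 1: "cmod ((LINT v|MN N. g (\<eta>N N v)) - ?sN N) \<le> e / 3" by (rule integral_cyl_approx[OF M(1) g \<eta>(1) F])
  have 2: "cmod ((LINT v|M. g (\<eta> v)) - ?s) \<le> e / 3" by (rule integral_cyl_approx[OF M(2) g \<eta>(2) F])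
  have "cmod (x - y) \<le> cmod (x - sx) + cmod (sx - s) + cmod (y - s)" for x y sx s
   using norm_triangle_ineq4[of "x - s" "y - s"] norm_triangle_ineq[of "x - sx" "sx - s"] by simp
  from this[of _ _ "?sN N" ?s] show ?thesis by (rule le_less_trans) (use 1 2 K[OF that] in linarith)
 qed
 then show "\<exists>K. \<forall>N\<ge>K. norm ((LINT v|MN N. g (\<eta>N N v)) - (LINT v|M. g (\<eta> v))) < e" by blast
qed

text \<open>Kolmogorov's theorem is applied to real valued coordinates, \<open>1\<close> standing for \<open>True\<close>, because \<open>bool\<close> carries no metric in the library.\<close>

lemma limit_process:
 fixes \<eta>N :: "nat => 'w => 'y => bool"
 assumes M: "!!N. prob_space (MN N)" and \<eta>: "!!N p. (%v. \<eta>N N v p) \<in> measurable (MN N) (count_space UNIV)"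
  and conv: "!!F A. finite F ==> convergent (%N. LINT v|MN N. cyl (\<eta>N N v) F A)"
 obtains L :: "('y => real) measure" where "prob_space L" "sets L = sets (PiM UNIV (%_. borel))"
  "!!F A. finite F ==> (%N. LINT v|MN N. cyl (\<eta>N N v) F A) \<longlonglongrightarrow> (LINT v|L. cyl (%p. v p = 1) F A)"
proof -
 define w where "w F A = lim (%N. measure (MN N) {v \<in> space (MN N). {p \<in> F. \<eta>N N v p} = A})" for F A
 have set: "{v \<in> space (MN N). {p \<in> F. \<eta>N N v p} = A} \<in> sets (MN N)" if F: "finite F" for N F A
 proof -
  have "{v \<in> space (MN N). \<eta>N N v p = b} \<in> sets (MN N)" for p b
   using measurable_sets[OF \<eta>, of "{b}" N p] by (simp add: vimage_def Int_def conj_commute)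
  then have "{v \<in> space (MN N). \<forall>p\<in>F. \<eta>N N v p = (p \<in> A)} \<in> sets (MN N)" using F by measurable
  moreover have "{v \<in> space (MN N). {p \<in> F. \<eta>N N v p} = A} = (if A \<subseteq> F then {v \<in> space (MN N). \<forall>p\<in>F. \<eta>N N v p = (p \<in> A)} else {})"
   by auto
  ultimately show ?thesis by simp
 qed
 have cylm: "(LINT v|MN N. cyl (\<eta>N N v) F A) = cor (measure (MN N) {v \<in> space (MN N). {p \<in> F. \<eta>N N v p} = A \<inter> F})"
  if "finite F" for F A N
 proof -
  have "(LINT v|MN N. cyl (\<eta>N N v) F A) = (LINT v|MN N. cor (indicator {v \<in> space (MN N). {p \<in> F. \<eta>N N v p} = A \<inter> F} v))"
   by (intro Bochner_Integration.integral_cong) (auto simp: cyl_eq[OF that] indicator_def)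
  then show ?thesis using set[OF that] by (simp add: Int_absorb2 sets.sets_into_space)
 qed
 have w: "(%N. measure (MN N) {v \<in> space (MN N). {p \<in> F. \<eta>N N v p} = A}) \<longlonglongrightarrow> w F A" if F: "finite F" for F A
 proof (cases "A \<subseteq> F")
  case True
  then have "convergent (%N. cor (measure (MN N) {v \<in> space (MN N). {p \<in> F. \<eta>N N v p} = A}))"
   using conv[OF F, of A] by (simp add: cylm F Int_absorb2)
  then have "convergent (%N. measure (MN N) {v \<in> space (MN N). {p \<in> F. \<eta>N N v p} = A})"
   using tendsto_Re unfolding convergent_def by fastforce
  then show ?thesis unfolding w_def by (simp add: convergent_LIMSEQ_iff)
 next
  case False
  then have "{v \<in> space (MN N). {p \<in> F. \<eta>N N v p} = A} = {}" for N by auto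
  then show ?thesis by (simp only: w_def) simp
 qed
 \<comment> \<open>Consistency of the marginals is a finite sum for each \<open>N\<close> and so
   passes to the limit.\<close>
 have w_res: "w F B = (\<Sum>A\<in>{A. A \<subseteq> H \<and> A \<inter> F = B}. w H A)" if FH: "F \<subseteq> H" "finite H" for F H B
 proof (rule LIMSEQ_unique[OF w])
  show "finite F" using FH finite_subset by blast
  have "measure (MN N) {v \<in> space (MN N). {p \<in> F. \<eta>N N v p} = B} =
   (\<Sum>A\<in>{A. A \<subseteq> H \<and> A \<inter> F = B}. measure (MN N) {v \<in> space (MN N). {p \<in> H. \<eta>N N v p} = A})" for N
  proof -
   interpret prob_space "MN N" by (rule M)
   have "{v \<in> space (MN N). {p \<in> F. \<eta>N N v p} = B} = (\<Union>A\<in>{A. A \<subseteq> H \<and> A \<inter> F = B}. {v \<in> space (MN N). {p \<in> H. \<eta>N N v p} = A})"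
    using FH(1) by auto
   then show ?thesis
    using FH(2) set[OF FH(2)] by (simp only:) (intro finite_measure_finite_Union, auto simp: disjoint_family_on_def)
  qed
  then show "(%N. measure (MN N) {v \<in> space (MN N). {p \<in> F. \<eta>N N v p} = B}) \<longlonglongrightarrow> (\<Sum>A\<in>{A. A \<subseteq> H \<and> A \<inter> F = B}. w H A)"
   by (simp add: tendsto_sum w[OF FH(2)])
 qed
 have w_empty: "w {} {} = 1"
 proof -
  have "{v \<in> space (MN N). {p \<in> {}. \<eta>N N v p} = {}} = space (MN N)" for N by auto
  then show ?thesis unfolding w_def using prob_space.prob_space[OF M] by simp
 qed
 \<comment> \<open>A finite-dimensional law is a probability mass function on the subsets of
   \<open>F\<close>; it is carried to real coordinates only in \<open>P\<close>.\<close>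
 define q where "q F = embed_pmf (%A. if A \<subseteq> F then w F A else 0)" for F
 have q: "pmf (q F) A = (if A \<subseteq> F then w F A else 0)" if F: "finite F" for F A
  unfolding q_def
 proof (rule pmf_embed_pmf)
  have pos: "0 \<le> w F A" for A by (rule tendsto_lowerbound[OF w[OF F]]) auto
  then show "0 \<le> (if A \<subseteq> F then w F A else 0)" for A by simp
  have "(\<Sum>A\<in>Pow F. w F A) = 1" using w_res[of "{}" F "{}"] F w_empty by (simp add: Pow_def)
  moreover have "(\<integral>\<^sup>+ A. ennreal (if A \<subseteq> F then w F A else 0) \<partial>count_space UNIV) = (\<Sum>A\<in>Pow F. ennreal (w F A))"
   by (subst nn_integral_count_space'[of "Pow F"]) (use F in \<open>auto intro!: sum.cong\<close>)
  ultimately show "(\<integral>\<^sup>+ A. ennreal (if A \<subseteq> F then w F A else 0) \<partial>count_space UNIV) = 1"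
   by (simp add: pos sum_ennreal)
 qed
 have q_res: "map_pmf (%A. A \<inter> F) (q H) = q F" if FH: "F \<subseteq> H" "finite H" for F H
 proof (rule pmf_eqI)
  fix B
  have F: "finite F" using FH finite_subset by blast
  have "pmf (map_pmf (%A. A \<inter> F) (q H)) B = measure (q H) ({A. A \<subseteq> H \<and> A \<inter> F = B} \<inter> set_pmf (q H))"
   unfolding pmf_map by (rule measure_pmf.finite_measure_eq_AE) (auto simp: AE_measure_pmf_iff set_pmf_iff q[OF FH(2)] split: if_splits)
  also have "\<dots> = measure (q H) {A. A \<subseteq> H \<and> A \<inter> F = B}" by (rule measure_Int_set_pmf)
  also have "\<dots> = (\<Sum>A\<in>{A. A \<subseteq> H \<and> A \<inter> F = B}. w H A)"
   using FH(2) by (subst measure_measure_pmf_finite) (auto simp: q intro!: sum.cong)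
  also have "\<dots> = pmf (q F) B"
  proof (cases "B \<subseteq> F")
   case False
   then have "{A. A \<subseteq> H \<and> A \<inter> F = B} = {}" by auto
   then show ?thesis using False by (simp only: q[OF F]) simp
  qed (simp add: q[OF F] w_res[OF FH])
  finally show "pmf (map_pmf (%A. A \<inter> F) (q H)) B = pmf (q F) B" .
 qed
 define P where "P F = distr (q F) (PiM F (%_. borel)) (%A. \<lambda>p\<in>F. of_bool (p \<in> A) :: real)" for F
 have meas: "(%A. \<lambda>p\<in>F. of_bool (p \<in> A) :: real) \<in> measurable (q H) (PiM F (%_. borel))" for F H
  by (auto simp: space_PiM)
 interpret polish_projective UNIV P
 proof (unfold polish_projective_def projective_family_def, intro conjI allI impI)
  fix F H :: "'y set" assume FH: "F \<subseteq> H" "finite H"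
  have "distr (P H) (PiM F (%_. borel)) (%f. restrict f F) = distr (q H) (PiM F (%_. borel)) (%A. \<lambda>p\<in>F. of_bool (p \<in> A))"
   unfolding P_def using FH(1) by (subst distr_distr) (auto intro!: distr_cong meas measurable_restrict_subset simp: comp_def fun_eq_iff space_PiM)
  also have "\<dots> = distr (distr (q H) (count_space UNIV) (%A. A \<inter> F)) (PiM F (%_. borel)) (%A. \<lambda>p\<in>F. of_bool (p \<in> A))"
   by (subst distr_distr) (auto intro!: distr_cong measurable_restrict simp: comp_def fun_eq_iff space_PiM)
  also have "\<dots> = P F" unfolding P_def q_res[OF FH, symmetric] map_pmf_rep_eq ..
  finally show "P F = distr (P H) (PiM F (%_. borel)) (%f. restrict f F)" ..
 next
  show "prob_space (P F)" for F unfolding P_def by (intro prob_space.prob_space_distr measure_pmf.prob_space_axioms meas)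
 qed
 show ?thesis
 proof (rule that[of lim])
  show "prob_space lim" by (rule P.prob_space_axioms)
  show "sets lim = sets (PiM UNIV (%_. borel))" by simp
  fix F A assume F: "finite (F :: 'y set)"
  define X where "X = (\<Pi>\<^sub>E p\<in>F. if p \<in> A then {1} else - {1 :: real})"
  have X: "X \<in> sets (PiM F (%_. borel))" unfolding X_def using F by (intro sets_PiM_I_finite) auto
  have e: "prod_emb UNIV (%_. borel) F X = {v. {p \<in> F. v p = 1} = A \<inter> F}"
   by (auto simp: prod_emb_def X_def PiE_iff restrict_def extensional_def split: if_splits)
  have se: "{v. {p \<in> F. v p = 1} = A \<inter> F} \<in> sets lim"
   unfolding e[symmetric] sets_lim by (rule measurable_prod_emb[OF subset_UNIV X])
  have "measure lim {v. {p \<in> F. v p = 1} = A \<inter> F} = measure (P F) X"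
   using measure_lim_emb[OF subset_UNIV F X] e by simp
  also have "\<dots> = measure (q F) {B. B \<inter> F = A \<inter> F}"
   unfolding P_def by (subst measure_distr[OF meas X])
    (auto intro!: arg_cong[of _ _ "measure (q F)"] simp: X_def PiE_iff split: if_splits)
  also have "\<dots> = pmf (map_pmf (%B. B \<inter> F) (q F)) (A \<inter> F)" by (simp add: pmf_map vimage_def)
  also have "\<dots> = w F (A \<inter> F)" using q_res[OF order_refl F] by (simp add: q[OF F])
  finally have "measure lim {v. {p \<in> F. v p = 1} = A \<inter> F} = w F (A \<inter> F)" .
  moreover have "(LINT v|lim. cyl (%p. v p = 1) F A) = cor (measure lim {v. {p \<in> F. v p = 1} = A \<inter> F})"
  proof -
   have c: "(%v. cyl (%p. v p = 1) F A) = (%v. cor (indicator {v. {p \<in> F. v p = 1} = A \<inter> F} v))"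
    by (auto simp: cyl_eq[OF F] indicator_def)
   show ?thesis unfolding c using se by (simp add: space_PiM)
  qed
  ultimately show "(%N. LINT v|MN N. cyl (\<eta>N N v) F A) \<longlonglongrightarrow> (LINT v|lim. cyl (%p. v p = 1) F A)"
   unfolding cylm[OF F] using w[OF F, of "A \<inter> F"] by (simp add: tendsto_of_real)
 qed
qed

text \<open>Times outside the interval are moved to its nearest end, so that the processes can be
  indexed by all real numbers.\<close>

definition clip :: "real => real => real" where
 "clip \<beta> t = max (- \<beta> / 2) (min (\<beta> / 2) t)"

lemma clip: "\<beta> > 0 ==> clip \<beta> t \<in> {- \<beta> / 2..\<beta> / 2}" "t \<in> {- \<beta> / 2..\<beta> / 2} ==> clip \<beta> t = t"
 by (auto simp: clip_def)

lemma continuous_prod_coordinates: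
 "continuous_on UNIV (%v :: 'x => bool. \<Prod>p\<in>F. of_bool (v (h p) = b p) :: complex)"
 by (intro continuous_on_prod continuous_coordinate[of "%c. of_bool (c = b _)"])

text \<open>A cylinder condition may use one time at several sites. Conditions with the same clipped
  time are gathered into one continuous function, which leaves a sorted list of times, the shape in
  which \<open>associated_process\<close> gives expectations.\<close>

lemma cyl_as_product:
 fixes F :: "(real \<times> 'x) set"
 assumes \<beta>: "\<beta> > 0" and F: "finite F"
 obtains ts fs where "ordered_times \<beta> ts" "length fs = length ts" "\<forall>f\<in>set fs. continuous_on UNIV f"
  "!!Y. (\<Prod>i<length ts. (fs ! i) (Y (ts ! i))) = cyl (%p. Y (clip \<beta> (fst p)) (snd p)) F A"
proof -
 define T where "T = (%p. clip \<beta> (fst p)) ` F"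
 define ts where "ts = sorted_list_of_set T"
 define h where "h t v = (\<Prod>p\<in>{p \<in> F. clip \<beta> (fst p) = t}. of_bool (v (snd p) = (p \<in> A)) :: complex)" for t and v :: "'x => bool"
 have T: "finite T" using F by (simp add: T_def)
 show ?thesis
 proof (rule that[of ts "map h ts"])
  show "ordered_times \<beta> ts" using T clip(1)[OF \<beta>] by (auto simp: ts_def ordered_times_def T_def)
  show "\<forall>f\<in>set (map h ts). continuous_on UNIV f" by (auto simp: h_def continuous_prod_coordinates)
  fix Y :: "real => 'x => bool"
  have "(\<Prod>i<length ts. (map h ts ! i) (Y (ts ! i))) = prod_list (map (%t. h t (Y t)) ts)"
   by (simp add: prod.list_conv_set_nth lessThan_atLeast0)
  also have "\<dots> = (\<Prod>t\<in>T. h t (Y t))"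
   using prod.distinct_set_conv_list[of ts "%t. h t (Y t)"] T by (simp add: ts_def)
  also have "\<dots> = (\<Prod>t\<in>T. \<Prod>p\<in>{p \<in> F. clip \<beta> (fst p) = t}. of_bool (Y (clip \<beta> (fst p)) (snd p) = (p \<in> A)))"
   by (auto simp: h_def intro!: prod.cong)
  also have "\<dots> = cyl (%p. Y (clip \<beta> (fst p)) (snd p)) F A"
   unfolding T_def cyl_def by (rule prod.image_gen[OF F, symmetric])
  finally show "(\<Prod>i<length ts. (map h ts ! i) (Y (ts ! i))) = cyl (%p. Y (clip \<beta> (fst p)) (snd p)) F A" .
 qed simp
qed

lemma measurable_bool: "f \<in> borel_measurable M \<longleftrightarrow> f \<in> measurable M (count_space (UNIV :: bool set))"
proof -
 have "sets (borel :: bool measure) = sets (count_space UNIV)" by (auto intro!: borel_open Topological_Spaces.open_discrete)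
 then show ?thesis using measurable_cong_sets[OF refl] by blast
qed

lemma measurable_coordinate: "f \<in> borel_measurable M ==> (%v. f v (x :: 'x) :: bool) \<in> measurable M (count_space UNIV)"
 unfolding measurable_bool[symmetric] by (rule measurable_compose[OF _ measurable_product_coordinates])

text \<open>Compactness makes the image of a closed set under the embedding \<open>e\<close> closed,
  so \<open>S\<close> is the preimage under \<open>e\<close> of an open set. The composition with
  \<open>e\<close> is measurable because there are only countably many coordinates.\<close>

lemma measurable_configI:
 fixes f :: "'w => 'x::countable => bool"
 assumes "!!x. (%v. f v x) \<in> measurable M (count_space UNIV)"
 shows "f \<in> borel_measurable M"
proof (rule borel_measurableI)
 fix S :: "('x => bool) set" assume "open S"
 define e where "e v x = (of_bool (v x) :: real)" for v :: "'x => bool" and x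
 have "continuous_on UNIV e"
  unfolding e_def by (rule continuous_on_coordinatewise_then_product) (rule continuous_coordinate)
 moreover have "compact (- S)" using compact_Int_closed[OF compact_config closed_Compl[OF \<open>open S\<close>]] by simp
 ultimately have "closed (e ` (- S))"
  by (intro compact_imp_closed compact_continuous_image) (auto intro: continuous_on_subset)
 moreover have "(%v. e (f v)) \<in> borel_measurable M"
  by (rule measurable_coordinatewise_then_product) (auto simp: e_def intro: measurable_compose[OF assms])
 ultimately have "(%v. e (f v)) -` (- (e ` (- S))) \<inter> space M \<in> sets M"
  by (intro measurable_sets[where A = borel]) auto
 moreover have "inj e" by (auto simp: inj_on_def e_def fun_eq_iff)
 then have "(%v. e (f v)) -` (- (e ` (- S))) = f -` S" by (auto dest: injD)
 ultimately show "f -` S \<inter> space M \<in> sets M" by simp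
qed

lemma continuous_config_power:
 fixes g :: "(nat => 'x => bool) => real" and \<tau> :: "nat => 't"
 assumes "continuous_map (config_power n) euclidean g"
 shows "continuous_on UNIV (%\<eta>. cor (g (\<lambda>i\<in>{..<n}. %x. \<eta> (\<tau> i, x))))"
proof -
 have "continuous_on UNIV (%\<eta> :: 't \<times> 'x => bool. %x. \<eta> (\<tau> i, x))" for i
  by (rule continuous_on_coordinatewise_then_product) (rule continuous_on_product_coordinates)
 then have "continuous_map euclidean (config_power n) (%\<eta> :: 't \<times> 'x => bool. \<lambda>i\<in>{..<n}. %x. \<eta> (\<tau> i, x))"
  by (auto simp: continuous_map_componentwise)
 from continuous_map_compose[OF this assms] show ?thesis by (intro continuous_on_of_real) (simp add: comp_def)
qed

lemma integral_joint_law: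
 fixes g :: "(nat => 'x => bool) => real"
 assumes g: "continuous_map (config_power (length ts)) euclidean g" and X: "!!t. t \<in> set ts ==> X t \<in> borel_measurable M"
 shows "cor (LINT s|joint_law M X ts. g s) = (LINT v|M. cor (g (\<lambda>i\<in>{..<length ts}. X (ts ! i) v)))"
proof -
 let ?n = "length ts" and ?N = "PiM {..<length ts} (%_. borel) :: (nat => 'x => bool) measure"
 define \<eta> :: "(nat => 'x => bool) => nat \<times> 'x => bool" where "\<eta> s p = (if fst p < ?n then s (fst p) (snd p) else False)" for s p
 have "(%s. \<eta> s p) \<in> measurable ?N (count_space UNIV)" for p
  unfolding \<eta>_def by (cases "fst p < ?n") (auto intro: measurable_coordinate measurable_component_singleton)
 from measurable_config[OF continuous_config_power[OF g, of "%i. i"] this]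
 have "(%s. cor (g (\<lambda>i\<in>{..<?n}. %x. \<eta> s (i, x)))) \<in> borel_measurable ?N" .
 from measurable_compose[OF this borel_measurable_Re] have "(%s. g (\<lambda>i\<in>{..<?n}. %x. \<eta> s (i, x))) \<in> borel_measurable ?N" by simp
 moreover have "g (\<lambda>i\<in>{..<?n}. %x. \<eta> s (i, x)) = g s" if "s \<in> space ?N" for s
 proof (rule arg_cong[of _ _ g], rule ext)
  show "(\<lambda>i\<in>{..<?n}. %x. \<eta> s (i, x)) i = s i" for i
   using PiE_arb[of s "{..<?n}" "%_. UNIV" i] that by (cases "i < ?n") (simp_all add: \<eta>_def space_PiM)
 qed
 ultimately have "g \<in> borel_measurable ?N" by (simp cong: measurable_cong)
 moreover have "(%v. \<lambda>i\<in>{..<?n}. X (ts ! i) v) \<in> measurable M ?N"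
  by (rule measurable_restrict) (simp add: X)
 ultimately show ?thesis unfolding joint_law_def by (simp add: integral_distr)
qed

text \<open>A continuous function of the configurations at the times \<open>ts\<close> is a
  continuous function of the whole field over times and sites, so convergence of cylinder
  probabilities covers it.\<close>

lemma process_convergence:
 fixes YN :: "nat => real => 'w => 'x => bool" and Y :: "real => 'v => 'x => bool"
 assumes \<beta>: "\<beta> > 0" and M: "!!N. prob_space (MN N)" "prob_space M"
  and Y: "!!N t. t \<in> {- \<beta> / 2..\<beta> / 2} ==> YN N t \<in> borel_measurable (MN N)" "!!t. t \<in> {- \<beta> / 2..\<beta> / 2} ==> Y t \<in> borel_measurable M"
  and conv: "!!ts (fs :: (('x => bool) => complex) list). ordered_times \<beta> ts ==> length fs = length ts ==> \<forall>f\<in>set fs. continuous_on UNIV f ==>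
   (%N. LINT v|MN N. (\<Prod>i<length ts. (fs ! i) (YN N (ts ! i) v))) \<longlonglongrightarrow> (LINT v|M. (\<Prod>i<length ts. (fs ! i) (Y (ts ! i) v)))"
  and ts: "ordered_times \<beta> ts"
 shows "weakly_converges (config_power (length ts)) (%N. joint_law (MN N) (YN N) ts) (joint_law M Y ts)"
 unfolding weakly_converges_def
proof (intro allI impI, elim conjE)
 fix g :: "(nat => 'x => bool) => real" assume g: "continuous_map (config_power (length ts)) euclidean g"
 have rng: "ts ! i \<in> {- \<beta> / 2..\<beta> / 2}" if "i < length ts" for i using ts that unfolding ordered_times_def by (metis nth_mem subsetD)
 let ?g = "%\<eta> :: real \<times> 'x => bool. cor (g (\<lambda>i\<in>{..<length ts}. %x. \<eta> (ts ! i, x)))"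
 have "(%N. LINT v|MN N. ?g (%p. YN N (clip \<beta> (fst p)) v (snd p))) \<longlonglongrightarrow> (LINT v|M. ?g (%p. Y (clip \<beta> (fst p)) v (snd p)))"
 proof (rule cyl_convergence[OF M continuous_config_power[OF g]])
  fix F A assume F: "finite (F :: (real \<times> 'x) set)"
  obtain ts fs where "ordered_times \<beta> ts" "length fs = length ts" "\<forall>f\<in>set fs. continuous_on UNIV f"
   "!!Y. (\<Prod>i<length ts. (fs ! i) (Y (ts ! i))) = cyl (%p. Y (clip \<beta> (fst p)) (snd p)) F A"
   by (rule cyl_as_product[OF \<beta> F, where A = A]) (rule that)
  from conv[OF this(1-3)] this(4)[of "%t. YN _ t _"] this(4)[of "%t. Y t _"]
  show "(%N. LINT v|MN N. cyl (%p. YN N (clip \<beta> (fst p)) v (snd p)) F A) \<longlonglongrightarrow> (LINT v|M. cyl (%p. Y (clip \<beta> (fst p)) v (snd p)) F A)"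
   by simp
 qed (auto intro!: measurable_coordinate Y clip(1)[OF \<beta>] simp del: atLeastAtMost_iff)
 moreover have "(\<lambda>i\<in>{..<length ts}. %x. YN N (clip \<beta> (ts ! i)) v x) = (\<lambda>i\<in>{..<length ts}. YN N (ts ! i) v)"
  "(\<lambda>i\<in>{..<length ts}. %x. Y (clip \<beta> (ts ! i)) v' x) = (\<lambda>i\<in>{..<length ts}. Y (ts ! i) v')" for N v v'
  using clip(2)[OF rng] by (auto simp: restrict_def)
 ultimately have "(%N. LINT v|MN N. cor (g (\<lambda>i\<in>{..<length ts}. YN N (ts ! i) v)))
   \<longlonglongrightarrow> (LINT v|M. cor (g (\<lambda>i\<in>{..<length ts}. Y (ts ! i) v)))" by simp
 moreover have "t \<in> set ts ==> t \<in> {- \<beta> / 2..\<beta> / 2}" for t using ts by (auto simp: ordered_times_def)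
 ultimately have "(%N. cor (LINT s|joint_law (MN N) (YN N) ts. g s)) \<longlonglongrightarrow> cor (LINT s|joint_law M Y ts. g s)"
  using integral_joint_law[OF g Y(1)] integral_joint_law[OF g Y(2)] by simp
 then show "(%N. LINT s|joint_law (MN N) (YN N) ts. g s) \<longlonglongrightarrow> (LINT s|joint_law M Y ts. g s)"
  by (simp add: tendsto_of_real_iff)
qed

lemma process_exists:
 fixes YN :: "nat => real => 'w => 'x::countable => bool"
 assumes \<beta>: "\<beta> > 0" and M: "!!N. prob_space (MN N)"
  and Y: "!!N t. t \<in> {- \<beta> / 2..\<beta> / 2} ==> YN N t \<in> borel_measurable (MN N)"
  and conv: "!!ts (fs :: (('x => bool) => complex) list). ordered_times \<beta> ts ==> length fs = length ts ==> \<forall>f\<in>set fs. continuous_on UNIV f ==>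
   (%N. LINT v|MN N. (\<Prod>i<length ts. (fs ! i) (YN N (ts ! i) v))) \<longlonglongrightarrow> (E ts fs :: complex)"
 obtains M :: "(real => 'x => bool) measure" where "prob_space M" "!!t. (%v. v t) \<in> borel_measurable M"
  "!!ts fs. ordered_times \<beta> ts ==> length fs = length ts ==> \<forall>f\<in>set fs. continuous_on UNIV f ==>
   (LINT v|M. (\<Prod>i<length ts. (fs ! i) (v (ts ! i)))) = E ts fs"
proof -
 let ?\<eta> = "%N v p. YN N (clip \<beta> (fst p)) v (snd p)"
 have m: "(%v. ?\<eta> N v p) \<in> measurable (MN N) (count_space UNIV)" for N p
  by (intro measurable_coordinate Y clip(1)[OF \<beta>])
 have "convergent (%N. LINT v|MN N. cyl (?\<eta> N v) F A)" if F: "finite F" for F A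
 proof -
  obtain ts fs where "ordered_times \<beta> ts" "length fs = length ts" "\<forall>f\<in>set fs. continuous_on UNIV f"
   "!!Y. (\<Prod>i<length ts. (fs ! i) (Y (ts ! i))) = cyl (%p. Y (clip \<beta> (fst p)) (snd p)) F A"
   by (rule cyl_as_product[OF \<beta> F, where A = A]) (rule that)
  from conv[OF this(1-3)] this(4)[of "%t. YN _ t _"] show ?thesis by (auto simp: convergent_def)
 qed
 from limit_process[OF M m this] obtain L :: "(real \<times> 'x => real) measure" where
  L: "prob_space L" "sets L = sets (PiM UNIV (%_. borel))"
  "!!F A. finite F ==> (%N. LINT v|MN N. cyl (?\<eta> N v) F A) \<longlonglongrightarrow> (LINT v|L. cyl (%p. v p = 1) F A)" by blast
 have coord: "(%y. y p = 1) \<in> measurable L (count_space UNIV)" for p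
 proof -
  have "(%y. y p) \<in> borel_measurable L" unfolding measurable_cong_sets[OF L(2) refl] by simp
  then show ?thesis by simp
 qed
 define \<theta> :: "(real \<times> 'x => real) => real => 'x => bool" where "\<theta> = (%y t x. y (t, x) = 1)"
 let ?P = "PiM UNIV (%_. borel) :: (real => 'x => bool) measure"
 have \<theta>: "\<theta> \<in> measurable L ?P"
  unfolding \<theta>_def
 proof (rule measurable_PiM_single')
  show "(%y x. y (t, x) = 1) \<in> borel_measurable L" for t
   by (rule measurable_configI) (rule coord)
 qed (simp add: space_PiM)
 show ?thesis
 proof (rule that[of "distr L ?P \<theta>"])
  show "prob_space (distr L ?P \<theta>)" by (rule prob_space.prob_space_distr[OF L(1) \<theta>])
  show X: "(%v. v t) \<in> borel_measurable (distr L ?P \<theta>)" for t by simp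
  fix ts and fs :: "(('x => bool) => complex) list"
  assume ts: "ordered_times \<beta> ts" and fs: "length fs = length ts" "\<forall>f\<in>set fs. continuous_on UNIV f"
  have rng: "ts ! i \<in> {- \<beta> / 2..\<beta> / 2}" if "i < length ts" for i using ts that unfolding ordered_times_def by (metis nth_mem subsetD)
  let ?g = "%\<eta>. \<Prod>i<length ts. (fs ! i) (%x. \<eta> (ts ! i, x))"
  have fc: "continuous_on UNIV (fs ! i)" if "i < length ts" for i using fs that by simp
  have "continuous_on UNIV ?g"
   by (intro continuous_on_prod continuous_on_compose2[OF fc] continuous_on_coordinatewise_then_product)
    (auto intro: continuous_on_product_coordinates)
  from cyl_convergence[OF M L(1) this m coord L(3)]
  have "(%N. LINT v|MN N. ?g (?\<eta> N v)) \<longlonglongrightarrow> (LINT y|L. ?g (%p. y p = 1))" .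
  moreover have "?g (?\<eta> N v) = (\<Prod>i<length ts. (fs ! i) (YN N (ts ! i) v))" for N v
   using clip(2)[OF rng] by simp
  ultimately have "(LINT y|L. ?g (%p. y p = 1)) = E ts fs"
   using conv[OF ts fs] LIMSEQ_unique by auto
  moreover have "(LINT v|distr L ?P \<theta>. (\<Prod>i<length ts. (fs ! i) (v (ts ! i)))) = (LINT y|L. (\<Prod>i<length ts. (fs ! i) (\<theta> y (ts ! i))))"
  proof (rule integral_distr[OF \<theta>])
   have "(%v :: real => 'x => bool. (fs ! i) (v (ts ! i))) \<in> borel_measurable ?P" if "i < length ts" for i
    by (rule measurable_compose[OF _ borel_measurable_continuous_onI[OF fc[OF that]]]) simp
   then show "(%v. \<Prod>i<length ts. (fs ! i) (v (ts ! i))) \<in> borel_measurable ?P" by (intro borel_measurable_prod) simp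
  qed
  ultimately show "(LINT v|distr L ?P \<theta>. (\<Prod>i<length ts. (fs ! i) (v (ts ! i)))) = E ts fs"
   by (simp add: \<theta>_def)
 qed
qed

theorem proposition5p2:
  fixes a :: "'x::countable ell2 \<Rightarrow> 'a::cstar_algebra"
    and \<beta> :: real
    and H :: "'x ell2_op" and HN :: "nat \<Rightarrow> 'x ell2_op"
    and MN :: "nat \<Rightarrow> 'w measure" and XN :: "nat \<Rightarrow> real \<Rightarrow> 'w \<Rightarrow> 'x \<Rightarrow> bool"
  assumes "is_car_algebra a"
    and "\<beta> > 0"
    and "self_adjoint H"
    and "\<And>N. N \<ge> 1 \<Longrightarrow> self_adjoint (HN N)"
    and "\<And>N. N \<ge> 1 \<Longrightarrow> stochastically_positive
           (gibbs_state a (HN N) \<beta>) (quasifree_flow a (HN N)) \<beta> (diag_algebra a)"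
    and "strong_resolvent_conv HN H"
    and "\<And>N. N \<ge> 1 \<Longrightarrow> associated_process a (HN N) \<beta> (MN N) (XN N)"
  shows "stochastically_positive (gibbs_state a H \<beta>) (quasifree_flow a H) \<beta> (diag_algebra a) \<and>
    (\<exists>(M :: (real \<Rightarrow> 'x \<Rightarrow> bool) measure) X. associated_process a H \<beta> M X) \<and>
    (\<forall>(M :: 'v measure) X. associated_process a H \<beta> M X \<longrightarrow>
       (\<forall>ts. ts \<noteq> [] \<and> ordered_times \<beta> ts \<longrightarrow>
          weakly_converges (config_power (length ts))
            (\<lambda>N. joint_law (MN N) (XN N) ts) (joint_law M X ts)) \<and>
       (\<forall>ts xs. ts \<noteq> [] \<and> ordered_times \<beta> ts \<and> length xs = length ts \<and> distinct (zip xs ts) \<longrightarrow>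
          complex_of_real (\<P>(\<omega> in M. \<forall>i<length ts. X (ts ! i) \<omega> (xs ! i))) =
          Determinant.det (Matrix.mat (length ts) (length ts)
            (\<lambda>(i, j). R_kernel H \<beta> (xs ! i) (ts ! i) (xs ! j) (ts ! j)))))"
proof -
 interpret universal_car a by unfold_locales (rule assms(1))
 interpret g: gibbs a H \<beta> by unfold_locales (rule assms(3))
 define S where "S ts = time_ordered_form (gibbs_state a H \<beta>) (quasifree_flow a H) ts" for ts
 \<comment> \<open>The hypotheses start at \<open>N = 1\<close>, so every sequence is shifted by
   one; the shift is undone for the weak convergence at the end.\<close>
 define SN where "SN N ts = time_ordered_form (gibbs_state a (HN (Suc N)) \<beta>) (quasifree_flow a (HN (Suc N))) ts" for N ts
 have sp: "stochastically_positive (gibbs_state a (HN (Suc N)) \<beta>) (quasifree_flow a (HN (Suc N))) \<beta> (diag_algebra a)" for N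
  by (rule assms(5)) simp
 have ap: "associated_process a (HN (Suc N)) \<beta> (MN (Suc N)) (XN (Suc N))" for N
  by (rule assms(7)) simp
 have "strong_resolvent_conv (%N. HN (Suc N)) H"
  using assms(6) unfolding strong_resolvent_conv_def by (auto intro: LIMSEQ_Suc)
 note lim = form_limit[where HN = "%N. HN (Suc N)" and \<beta> = \<beta>, OF assms(3) assms(4) this]
 have form: "is_time_ordered_form (gibbs_state a H \<beta>) (quasifree_flow a H) ts (S ts)"
  and S: "length As = length ts ==> (%N. SN N ts As) \<longlonglongrightarrow> S ts As" if "ordered_times \<beta> ts" for ts As
  using lim[OF _ that, of "%N. SN N ts"] sp that unfolding stochastically_positive_def S_def SN_def by auto
 have "S ts As \<in> \<real>\<^sub>\<ge>\<^sub>0" if "ordered_times \<beta> ts" "length As = length ts \<and> set As \<subseteq> positive_part (diag_algebra a)" for ts As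
 proof (rule closed_sequentially[OF closed_nonneg_Reals_complex _ S[OF that(1)]])
  show "SN N ts As \<in> \<real>\<^sub>\<ge>\<^sub>0" for N
   using sp[of N] that unfolding stochastically_positive_def SN_def by blast
 qed (use that in simp)
 with form have "stochastically_positive (gibbs_state a H \<beta>) (quasifree_flow a H) \<beta> (diag_algebra a)"
  unfolding stochastically_positive_def S_def by blast
 moreover have conv: "(%N. LINT v|MN (Suc N). (\<Prod>i<length ts. (fs ! i) (XN (Suc N) (ts ! i) v))) \<longlonglongrightarrow> S ts (map (diag_of_fun a) fs)"
  if "ordered_times \<beta> ts" "length fs = length ts" "\<forall>f\<in>set fs. continuous_on UNIV f" for ts and fs :: "(('x => bool) => complex) list"
  using S[OF that(1), of "map (diag_of_fun a) fs"] ap that unfolding associated_process_def SN_def by simp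
 moreover have apm: "prob_space (MN (Suc N))" "t \<in> {- \<beta> / 2..\<beta> / 2} ==> XN (Suc N) t \<in> borel_measurable (MN (Suc N))" for N t
  using ap[of N] unfolding associated_process_def by blast+
 have "\<exists>(M :: (real => 'x => bool) measure) X. associated_process a H \<beta> M X"
 proof -
  obtain M :: "(real => 'x => bool) measure" where "prob_space M" "!!t. (%v. v t) \<in> borel_measurable M"
   "!!ts fs. ordered_times \<beta> ts ==> length fs = length ts ==> \<forall>f\<in>set fs. continuous_on UNIV f ==>
    (LINT v|M. (\<Prod>i<length ts. (fs ! i) (v (ts ! i)))) = S ts (map (diag_of_fun a) fs)"
   using process_exists[where MN = "%N. MN (Suc N)" and YN = "%N. XN (Suc N)", OF assms(2) apm conv] by blast
  then have "associated_process a H \<beta> M (%t v. v t)" unfolding associated_process_def S_def by simp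
  then show ?thesis by blast
 qed
 moreover have "weakly_converges (config_power (length ts)) (%N. joint_law (MN N) (XN N) ts) (joint_law M X ts)"
  if X: "associated_process a H \<beta> M X" and ts: "ordered_times \<beta> ts" for M :: "'v measure" and X ts
 proof -
  have "weakly_converges (config_power (length ts)) (%N. joint_law (MN (Suc N)) (XN (Suc N)) ts) (joint_law M X ts)"
  proof (rule process_convergence[OF assms(2) apm(1) _ apm(2) _ _ ts])
   show "prob_space M" "t \<in> {- \<beta> / 2..\<beta> / 2} ==> X t \<in> borel_measurable M" for t
    using X unfolding associated_process_def by blast+
   show "(%N. LINT v|MN (Suc N). (\<Prod>i<length ts. (fs ! i) (XN (Suc N) (ts ! i) v))) \<longlonglongrightarrow> (LINT v|M. (\<Prod>i<length ts. (fs ! i) (X (ts ! i) v)))"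
    if "ordered_times \<beta> ts" "length fs = length ts" "\<forall>f\<in>set fs. continuous_on UNIV f" for ts and fs :: "(('x => bool) => complex) list"
    using conv[OF that] X that unfolding associated_process_def S_def by simp
  qed
  then show ?thesis unfolding weakly_converges_def by (subst (asm) filterlim_sequentially_Suc)
 qed
 moreover have "cor (\<P>(v in M. \<forall>i<length ts. X (ts ! i) v (xs ! i))) =
   Determinant.det (Matrix.mat (length ts) (length ts) (%(i, j). R_kernel H \<beta> (xs ! i) (ts ! i) (xs ! j) (ts ! j)))"
  if X: "associated_process a H \<beta> M X" and ts: "ordered_times \<beta> ts" "length xs = length ts" "distinct (zip xs ts)"
  for M :: "'v measure" and X ts xs
 proof -
  let ?A = "{v \<in> space M. \<forall>i<length ts. X (ts ! i) v (xs ! i)}"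
  \<comment> \<open>With indicators of single sites the product under the expectation is the
    indicator of the event, and \<open>diag_of_fun\<close> sends the factors to occupation
    numbers.\<close>
  define fs where "fs = map (%x. indicator {v :: 'x => bool. v x} :: _ => complex) xs"
  have fs: "length fs = length ts" "\<forall>f\<in>set fs. continuous_on UNIV f"
   using continuous_coordinate[where g = of_bool] ts(2) by (auto simp: fs_def indicator_def)
  have "{v \<in> space M. X (ts ! i) v (xs ! i)} \<in> sets M" if "i < length ts" for i
  proof -
   have "ts ! i \<in> {- \<beta> / 2..\<beta> / 2}" using ts(1) that unfolding ordered_times_def by (metis nth_mem subsetD)
   then have "X (ts ! i) \<in> borel_measurable M" using X unfolding associated_process_def by blast
   from measurable_sets[OF measurable_coordinate[OF this], of "{True}" "xs ! i"]
   show ?thesis by (simp add: vimage_def Int_def conj_commute)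
  qed
  then have A: "?A \<in> sets M" by measurable
  have "cor (measure M ?A) = (LINT v|M. cor (indicator ?A v))"
  proof -
   have "?A \<inter> space M = ?A" by blast
   then show ?thesis by (simp only: integral_complex_of_real Bochner_Integration.integral_indicator)
  qed
  also have "\<dots> = (LINT v|M. (\<Prod>i<length ts. (fs ! i) (X (ts ! i) v)))"
  proof (rule Bochner_Integration.integral_cong[OF refl])
   fix v assume "v \<in> space M"
   then show "cor (indicator ?A v) = (\<Prod>i<length ts. (fs ! i) (X (ts ! i) v))"
    using ts(2) by (auto simp: fs_def indicator_def)
  qed
  also have "\<dots> = S ts (map (diag_of_fun a) fs)"
   using X ts fs unfolding associated_process_def S_def by blast
  also have "map (diag_of_fun a) fs = map (occupation a) xs"
   using diag_of_fun unfolding is_diag_identification_def Let_def by (simp add: fs_def)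
  also have "S ts (map (occupation a) xs) = Determinant.det (Matrix.mat (length ts) (length ts)
    (%(i, j). R_kernel H \<beta> (xs ! i) (ts ! i) (xs ! j) (ts ! j)))"
   by (rule g.form_occupation[OF form[OF ts(1)] ts])
  finally show ?thesis .
 qed
 ultimately show ?thesis by blast
qed

end
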